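(* Assume that $n=p^st$ is even. Then $$\left\{\begin{array}{c} V_{r,0},\ V_{r,0}',\ V_{r,\frac t2},\ V_{r,\frac t2}',\ W_{2r,i},\\ D(V_{r,0}),\ D(V_{r,0}'),\ D(V_{r,\frac t2}),\ D(V_{r,\frac t2}'),\\ D(W_{2r,i}),\ D(V_m),\ D(U_m),\ D(Q_{r,j}^l)\end{array}\ \left|\ \begin{array}{l}1\leqslant r\leqslant p^s,\ 1\leqslant i\leqslant\frac t2-1,\\ 0\leqslant j\leqslant t-1,\ 1\leqslant m\leqslant 4,\\ 1\leqslant l\leqslant\frac n2-1\end{array}\right.\right\}$$ is a complete set of (finite dimensional) indecomposable Yetter-Drinfeld $kD_n$-modules up to isomorphism; that is, the listed Yetter-Drinfeld modules are indecomposable and pairwise non-isomorphic, and every finite dimensional indecomposable Yetter-Drinfeld $kD_n$-module is isomorphic to one of them.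
   Context: $k$ is an algebraically closed field of odd characteristic $p$; $n=p^st$ with $s\geqslant1$ and $p\nmid t$ (so $t$ is even when $n$ is even); $\xi\in k$ is a primitive $t$-th root of unity. $D_n=\langle a,b\mid a^n=1,\ b^2=1,\ (ab)^2=1\rangle$ is the dihedral group of order $2n$, and $C_n=\langle a\rangle$. All modules are finite dimensional. Yetter-Drinfeld modules. For a finite group $G$, a Yetter-Drinfeld $kG$-module is a left $kG$-module $M$ with a right $kG$-comodule structure $\varphi:M\to M\otimes kG$, $m\mapsto\sum m_0\otimes m_1$, such that $\sum (g\cdot m)_0\otimes(g\cdot m)_1=\sum g\cdot m_0\otimes g m_1g^{-1}$ for all $g\in G$, $m\in M$. (Yetter-Drinfeld $kG$-modules are identified with left modules over the quantum double $D(kG)$.) Matrices. $A_{r,i}$ is the $r\times r$ upper triangular Jordan block with $\xi^i$ on the diagonal, $1$ on the superdiagonal, $0$ elsewhere. $T=(t_{ij})\in M_r(k)$ is the upper triangular matrix defined by $t_{rr}=1$, $t_{ii}=-t_{i+1,i+1}$ for $i<r$, and $t_{ij}=-t_{i+1,j}-t_{i+1,j+1}$ for $1\leqslant i<j\leqslant r$; $T_1=(t_{ij})\in M_r(k)$ is the upper triangular matrix defined by $t_{rr}=1$, $t_{ii}=-t_{i+1,i+1}$ for $i<r$, and $t_{ij}=-\xi^{t/2}t_{i+1,j}-t_{i+1,j+1}$ for $1\leqslant i<j\leqslant r$; in both cases $t_{i,r+1}:=0$. $kD_n$-modules. $V_{r,0},V_{r,0}',V_{r,\frac t2},V_{r,\frac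 t2}',W_{2r,i}$ are the $kD_n$-modules given respectively by the matrix representations $\Phi_{r,0}$: $a\mapsto A_{r,0},\ b\mapsto T$; $\Phi_{r,0}'$: $a\mapsto A_{r,0},\ b\mapsto-T$; $\Phi_{r,\frac t2}$: $a\mapsto A_{r,\frac t2},\ b\mapsto T_1$; $\Phi_{r,\frac t2}'$: $a\mapsto A_{r,\frac t2},\ b\mapsto -T_1$; and $\Omega_{2r,i}$: $a\mapsto\begin{pmatrix}A_{r,i}&0\\ 0&A_{r,i}^{-1}\end{pmatrix}$, $b\mapsto\begin{pmatrix}0&I_r\\ I_r&0\end{pmatrix}$. Written without $D(\cdot)$, each of these denotes the Yetter-Drinfeld module with coaction $\varphi(v)=v\otimes 1$. For $V$ any of these modules, $D(V)$ denotes the Yetter-Drinfeld module with $D(V)=V$ as a $kD_n$-module and coaction $\varphi(v)=v\otimes a^{n/2}$. Modules $D(V_m)$. $\langle b,a^{n/2}\rangle$ is the centralizer of $b$, a Klein four group; $V_1,V_2,V_3,V_4$ are its 1-dimensional modules on which $(a^{n/2},b)$ acts by the scalars $(1,1),(1,-1),(-1,1),(-1,-1)$, respectively. $D(V_m)=kD_n\otimes_{k\langle b,a^{n/2}\rangle}V_m$ as a $kD_n$-module, with coaction $\varphi(a^j\otimes v)=(a^j\otimes v)\otimes a^{2j}b$, $0\leqslant j\leqslant\frac n2-1$. Modules $D(U_m)$. $\langle ab,a^{n/2}\rangle$ is the centralizer of $ab$, a Klein four group; $U_1,U_2,U_3,U_4$ are its 1-dimensional modules on which $(a^{n/2},ab)$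 acts by $(1,1),(1,-1),(-1,1),(-1,-1)$, respectively. $D(U_m)=kD_n\otimes_{k\langle ab,a^{n/2}\rangle}U_m$ as a $kD_n$-module, with coaction $\varphi(a^j\otimes u)=(a^j\otimes u)\otimes a^{2j+1}b$, $0\leqslant j\leqslant\frac n2-1$. Modules $D(Q^l_{r,j})$. $Q_{r,j}$ is the $kC_n$-module given by the matrix representation $\rho_{r,j}$: $a\mapsto A_{r,j}$, and $Q_{r,j}^l=Q_{r,j}$ as a $kC_n$-module for each $l$. $D(Q_{r,j}^l)=kD_n\otimes_{kC_n}Q_{r,j}^l$ as a $kD_n$-module, with coaction $\varphi(1\otimes q)=(1\otimes q)\otimes a^l$ and $\varphi(b\otimes q)=(b\otimes q)\otimes a^{n-l}$ for $q\in Q_{r,j}^l$. *)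

theory Defs
  imports
    "HOL-Algebra.AbelCoset"
    "HOL-Algebra.Generated_Groups"
    "Jordan_Normal_Form.VS_Connect"
    "Jordan_Normal_Form.Gauss_Jordan_Elimination"
    "Jordan_Normal_Form.Jordan_Normal_Form"
begin

hide_const (open) Multiset.mult Polynomial.smult Modules.module
  Real_Vector_Spaces.subspace Real_Vector_Spaces.span

section \<open>The dihedral group\<close>

text \<open>
  \<^term>\<open>(i, e) :: nat \<times> bool\<close> with \<^prop>\<open>i < n\<close> is the normal form \<open>a\<^sup>i b\<^sup>e\<close>; so \<open>a = (1, False)\<close>
  (for \<open>n > 1\<close>), \<open>b = (0, True)\<close>, \<open>a b = (1, True)\<close>, and \<open>b a\<^sup>j = a\<^sup>-\<^sup>j b\<close> gives the product.
\<close>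

type_synonym dih = "nat \<times> bool"

definition dihedral :: "nat \<Rightarrow> dih monoid" where
  "dihedral n = \<lparr>carrier = {..<n} \<times> UNIV,
     mult = (\<lambda>(i, e) (j, f). ((if e then i + (n - j) else i + j) mod n, e \<noteq> f)),
     one = (0, False)\<rparr>"

lemma dihedral_group:
  assumes "n > 0"
  shows "group (dihedral n)"
proof (rule groupI)
  fix x y assume "x \<in> carrier (dihedral n)" "y \<in> carrier (dihedral n)"
  then show "x \<otimes>\<^bsub>dihedral n\<^esub> y \<in> carrier (dihedral n)"
    using assms by (auto simp: dihedral_def)
next
  show "\<one>\<^bsub>dihedral n\<^esub> \<in> carrier (dihedral n)"
    using assms by (auto simp: dihedral_def)
next
  fix x y z
  assume *: "x \<in> carrier (dihedral n)" "y \<in> carrier (dihedral n)" "z \<in> carrier (dihedral n)"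
  obtain i e j f k g where [simp]: "x = (i, e)" "y = (j, f)" "z = (k, g)"
    by (metis surj_pair)
  have lt: "i < n" "j < n" "k < n" using * by (auto simp: dihedral_def)
  define m where "m e i j = (if e then i + (n - j) else i + j) mod n" for e i j
  have m_lt: "m e i j < n" for e i j using assms by (simp add: m_def)
  have m_int: "int (m e i j) = (if e then int i - int j else int i + int j) mod int n" if "j < n" for e i j
  proof -
    have "(int i + int n - int j) mod int n = (int i - int j) mod int n"
      by (metis add.commute add_diff_eq mod_add_self1)
    then show ?thesis using that by (simp add: m_def zmod_int of_nat_diff)
  qed
  have "int (m e i (m f j k)) = int (m (e \<noteq> f) (m e i j) k)"
    using lt m_lt by (cases e; cases f; simp add: m_int; simp add: mod_simps algebra_simps)
  then have "m e i (m f j k) = m (e \<noteq> f) (m e i j) k"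
    by (simp only: of_nat_eq_iff)
  then show "x \<otimes>\<^bsub>dihedral n\<^esub> y \<otimes>\<^bsub>dihedral n\<^esub> z = x \<otimes>\<^bsub>dihedral n\<^esub> (y \<otimes>\<^bsub>dihedral n\<^esub> z)"
    by (cases e; cases f; cases g) (simp_all add: dihedral_def m_def)
next
  fix x assume "x \<in> carrier (dihedral n)"
  then show "\<one>\<^bsub>dihedral n\<^esub> \<otimes>\<^bsub>dihedral n\<^esub> x = x"
    by (auto simp: dihedral_def)
next
  fix x assume x: "x \<in> carrier (dihedral n)"
  obtain i e where [simp]: "x = (i, e)" by (cases x)
  have lt: "i < n" using x by (auto simp: dihedral_def)
  show "\<exists>y\<in>carrier (dihedral n). y \<otimes>\<^bsub>dihedral n\<^esub> x = \<one>\<^bsub>dihedral n\<^esub>"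
  proof (cases e)
    case True
    then show ?thesis using lt by (intro bexI[of _ x]) (auto simp: dihedral_def)
  next
    case False
    then show ?thesis
      using lt assms by (intro bexI[of _ "((n - i) mod n, False)"]) (auto simp: dihedral_def mod_simps)
  qed
qed

lemma dihedral_pow_a:
  assumes "n > 1"
  shows "(1, False) [^]\<^bsub>dihedral n\<^esub> (k :: nat) = (k mod n, False)"
proof -
  interpret group "dihedral n" using dihedral_group assms by simp
  show ?thesis
  proof (induction k)
    case 0
    then show ?case by (simp add: dihedral_def)
  next
    case (Suc k)
    have "(1, False) [^]\<^bsub>dihedral n\<^esub> Suc k = (k mod n, False) \<otimes>\<^bsub>dihedral n\<^esub> (1, False)"
      by (simp only: nat_pow_Suc Suc.IH)
    also have "\<dots> = (Suc k mod n, False)"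
      by (simp add: dihedral_def mod_Suc_eq)
    finally show ?case .
  qed
qed

lemma dihedral_normal_form:
  assumes "n > 1" "i < n"
  shows "(1, False) [^]\<^bsub>dihedral n\<^esub> i \<otimes>\<^bsub>dihedral n\<^esub> (if e then (0, True) else \<one>\<^bsub>dihedral n\<^esub>) = (i, e)"
  using assms dihedral_pow_a[OF assms(1), of i] by (auto simp: dihedral_def)

lemma dihedral_relations:
  assumes "n > 1"
  defines "a \<equiv> (1, False)" and "b \<equiv> (0, True)"
  shows "a [^]\<^bsub>dihedral n\<^esub> n = \<one>\<^bsub>dihedral n\<^esub>"
    and "b \<otimes>\<^bsub>dihedral n\<^esub> b = \<one>\<^bsub>dihedral n\<^esub>"
    and "(a \<otimes>\<^bsub>dihedral n\<^esub> b) \<otimes>\<^bsub>dihedral n\<^esub> (a \<otimes>\<^bsub>dihedral n\<^esub> b) = \<one>\<^bsub>dihedral n\<^esub>"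
    and "card (carrier (dihedral n)) = 2 * n"
  using assms dihedral_pow_a[OF assms(1), of n]
  by (auto simp: dihedral_def card_cartesian_product)

lemma dihedral_generated:
  assumes "n > 1"
  shows "generate (dihedral n) {(1, False), (0, True)} = carrier (dihedral n)"
proof
  interpret group "dihedral n" using dihedral_group assms by simp
  let ?S = "{(1, False), (0, True)} :: dih set"
  have sub: "?S \<subseteq> carrier (dihedral n)" using assms by (auto simp: dihedral_def)
  show "generate (dihedral n) ?S \<subseteq> carrier (dihedral n)"
    using generate_in_carrier[OF sub] by blast
  have pow: "(1, False) [^]\<^bsub>dihedral n\<^esub> (k :: nat) \<in> generate (dihedral n) ?S" for k
    by (induction k) (auto intro: generate.intros)
  show "carrier (dihedral n) \<subseteq> generate (dihedral n) ?S"
  proof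
    fix x assume "x \<in> carrier (dihedral n)"
    then obtain i e where x: "x = (i, e)" "i < n" by (auto simp: dihedral_def)
    have "(if e then (0, True) else \<one>\<^bsub>dihedral n\<^esub>) \<in> generate (dihedral n) ?S"
      by (auto intro: generate.intros)
    from generate.eng[OF pow[of i] this] show "x \<in> generate (dihedral n) ?S"
      unfolding dihedral_normal_form[OF assms x(2)] x(1) .
  qed
qed


section \<open>Yetter-Drinfeld modules over a finite group\<close>

text \<open>
  Vector spaces over a field type \<open>'k\<close> are the locale \<^locale>\<open>vectorspace\<close> over \<open>class_ring\<close>.
  A \<open>kG\<close>-module is a vector space with a linear action of \<open>G\<close>.
\<close>

record ('k, 'g, 'v) kG_module = "('k, 'v) module" +
  act :: "'g \<Rightarrow> 'v \<Rightarrow> 'v"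

locale kG_module = G?: group G + M?: vectorspace class_ring M
  for G :: "('g, 'c) monoid_scheme" and M :: "('k :: field, 'g, 'v, 'd) kG_module_scheme" +
  assumes act_linear: "g \<in> carrier G \<Longrightarrow> linear_map class_ring M M (act M g)"
    and act_one: "v \<in> carrier M \<Longrightarrow> act M \<one>\<^bsub>G\<^esub> v = v"
    and act_mult: "g \<in> carrier G \<Longrightarrow> h \<in> carrier G \<Longrightarrow> v \<in> carrier M \<Longrightarrow>
          act M (g \<otimes>\<^bsub>G\<^esub> h) v = act M g (act M h v)"

text \<open>
  As \<open>G\<close> is finite, \<open>M \<otimes> kG\<close> is the direct sum of the spaces \<open>M \<otimes> g\<close>, so a linear map
  \<open>\<phi> : M \<rightarrow> M \<otimes> kG\<close> is given by its components: \<open>\<phi>(v) = \<Sum>\<^sub>g coact v g \<otimes> g\<close>.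
  With \<open>\<epsilon>(g) = 1\<close> and \<open>\<Delta>(g) = g \<otimes> g\<close> in \<open>kG\<close>, comparing components in the axioms
  \<open>(id \<otimes> \<epsilon>) \<phi> = id\<close> and \<open>(\<phi> \<otimes> id) \<phi> = (id \<otimes> \<Delta>) \<phi>\<close> gives \<open>counit\<close> and \<open>coassoc\<close>, and comparing
  the components at \<open>g h g\<^sup>-\<^sup>1\<close> in the compatibility of action and coaction gives \<open>compat\<close>.
\<close>

record ('k, 'g, 'v) yd_module = "('k, 'g, 'v) kG_module" +
  coact :: "'v \<Rightarrow> 'g \<Rightarrow> 'v"

locale yd_module = kG_module G M
  for G :: "('g, 'c) monoid_scheme" and M :: "('k :: field, 'g, 'v, 'd) yd_module_scheme" +
  assumes finite_group: "finite (carrier G)"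
    and coact_linear: "h \<in> carrier G \<Longrightarrow> linear_map class_ring M M (\<lambda>v. coact M v h)"
    and counit: "v \<in> carrier M \<Longrightarrow> (\<Oplus>\<^bsub>M\<^esub>h\<in>carrier G. coact M v h) = v"
    and coassoc: "g \<in> carrier G \<Longrightarrow> h \<in> carrier G \<Longrightarrow> v \<in> carrier M \<Longrightarrow>
          coact M (coact M v g) h = (if h = g then coact M v g else \<zero>\<^bsub>M\<^esub>)"
    and compat: "g \<in> carrier G \<Longrightarrow> h \<in> carrier G \<Longrightarrow> v \<in> carrier M \<Longrightarrow>
          coact M (act M g v) (g \<otimes>\<^bsub>G\<^esub> h \<otimes>\<^bsub>G\<^esub> inv\<^bsub>G\<^esub> g) = act M g (coact M v h)"

definition yd_submodule ::
  "('g, 'c) monoid_scheme \<Rightarrow> ('k :: field, 'g, 'v, 'd) yd_module_scheme \<Rightarrow> 'v set \<Rightarrow> bool" where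
  "yd_submodule G M N \<longleftrightarrow> subspace class_ring N M \<and>
     (\<forall>g\<in>carrier G. \<forall>v\<in>N. act M g v \<in> N \<and> coact M v g \<in> N)"

definition yd_indecomposable ::
  "('g, 'c) monoid_scheme \<Rightarrow> ('k :: field, 'g, 'v, 'd) yd_module_scheme \<Rightarrow> bool" where
  "yd_indecomposable G M \<longleftrightarrow> carrier M \<noteq> {\<zero>\<^bsub>M\<^esub>} \<and>
     (\<forall>N P. yd_submodule G M N \<and> yd_submodule G M P \<and>
        N <+>\<^bsub>M\<^esub> P = carrier M \<and> N \<inter> P = {\<zero>\<^bsub>M\<^esub>} \<longrightarrow> N = {\<zero>\<^bsub>M\<^esub>} \<or> P = {\<zero>\<^bsub>M\<^esub>})"

definition fd_indecomposable_yd ::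
  "('g, 'c) monoid_scheme \<Rightarrow> ('k :: field, 'g, 'v, 'd) yd_module_scheme \<Rightarrow> bool" where
  "fd_indecomposable_yd G M \<longleftrightarrow>
     yd_module G M \<and> vectorspace.fin_dim class_ring M \<and> yd_indecomposable G M"

definition yd_isomorphic ::
  "('g, 'c) monoid_scheme \<Rightarrow> ('k :: field, 'g, 'v, 'd) yd_module_scheme \<Rightarrow>
   ('k, 'g, 'w, 'e) yd_module_scheme \<Rightarrow> bool" where
  "yd_isomorphic G M N \<longleftrightarrow> (\<exists>f. linear_map class_ring M N f \<and> bij_betw f (carrier M) (carrier N) \<and>
     (\<forall>g\<in>carrier G. \<forall>v\<in>carrier M.
        f (act M g v) = act N g (f v) \<and> f (coact M v g) = coact N (f v) g))"


section \<open>Induced modules\<close>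

definition with_act :: "('k, 'v) module \<Rightarrow> ('g \<Rightarrow> 'v \<Rightarrow> 'v) \<Rightarrow> ('k, 'g, 'v) kG_module" where
  "with_act V \<alpha> = module.extend V (kG_module.fields \<alpha>)"

text \<open>The coaction \<open>\<phi>(v) = v \<otimes> z\<close>.\<close>

definition with_degree :: "('k, 'g, 'v) kG_module \<Rightarrow> 'g \<Rightarrow> ('k, 'g, 'v) yd_module" where
  "with_degree V z =
     kG_module.extend V (yd_module.fields (\<lambda>v g. if g = z then v else \<zero>\<^bsub>V\<^esub>))"

text \<open>
  \<open>kG \<otimes>\<^sub>k V\<close>, where a function \<open>f\<close> on \<open>G\<close> stands for \<open>\<Sum>\<^sub>x x \<otimes> f(x)\<close>, with action
  \<open>g (x \<otimes> v) = g x \<otimes> v\<close> and coaction \<open>\<phi>(x \<otimes> v) = (x \<otimes> v) \<otimes> x c x\<^sup>-\<^sup>1\<close>.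
\<close>

definition group_tensor ::
  "('g, 'm) monoid_scheme \<Rightarrow> ('k, 'g, 'v) kG_module \<Rightarrow> 'g \<Rightarrow> ('k, 'g, 'g \<Rightarrow> 'v) yd_module" where
  "group_tensor G V c =
     \<lparr>carrier = carrier G \<rightarrow>\<^sub>E carrier V, mult = undefined, one = undefined,
      zero = (\<lambda>x\<in>carrier G. \<zero>\<^bsub>V\<^esub>),
      add = (\<lambda>f f'. \<lambda>x\<in>carrier G. f x \<oplus>\<^bsub>V\<^esub> f' x),
      smult = (\<lambda>a f. \<lambda>x\<in>carrier G. a \<odot>\<^bsub>V\<^esub> f x),
      act = (\<lambda>g f. \<lambda>x\<in>carrier G. f (inv\<^bsub>G\<^esub> g \<otimes>\<^bsub>G\<^esub> x)),
      coact = (\<lambda>f y. \<lambda>x\<in>carrier G. if x \<otimes>\<^bsub>G\<^esub> c \<otimes>\<^bsub>G\<^esub> inv\<^bsub>G\<^esub> x = y then f x else \<zero>\<^bsub>V\<^esub>)\<rparr>"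

definition pure_tensor ::
  "('g, 'm) monoid_scheme \<Rightarrow> ('k, 'g, 'v) kG_module \<Rightarrow> 'g \<Rightarrow> 'v \<Rightarrow> 'g \<Rightarrow> 'v" where
  "pure_tensor G V g v = (\<lambda>x\<in>carrier G. if x = g then v else \<zero>\<^bsub>V\<^esub>)"

definition balancing_relations ::
  "('g, 'm) monoid_scheme \<Rightarrow> 'g set \<Rightarrow> ('k :: field, 'g, 'v) kG_module \<Rightarrow> 'g \<Rightarrow> ('g \<Rightarrow> 'v) set" where
  "balancing_relations G H V c = LinearCombinations.module.span class_ring (group_tensor G V c)
     {pure_tensor G V (g \<otimes>\<^bsub>G\<^esub> h) v \<ominus>\<^bsub>group_tensor G V c\<^esub> pure_tensor G V g (act V h v)
       | g h v. g \<in> carrier G \<and> h \<in> H \<and> v \<in> carrier V}"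

definition yd_quotient :: "('k, 'g, 'v) yd_module \<Rightarrow> 'v set \<Rightarrow> ('k, 'g, 'v set) yd_module" where
  "yd_quotient F R =
     \<lparr>carrier = a_rcosets\<^bsub>F\<^esub> R, mult = undefined, one = undefined,
      zero = R,
      add = (\<lambda>X Y. X <+>\<^bsub>F\<^esub> Y),
      smult = (\<lambda>a X. R <+>\<^bsub>F\<^esub> (\<lambda>w. a \<odot>\<^bsub>F\<^esub> w) ` X),
      act = (\<lambda>g X. R <+>\<^bsub>F\<^esub> act F g ` X),
      coact = (\<lambda>X y. R <+>\<^bsub>F\<^esub> (\<lambda>w. coact F w y) ` X)\<rparr>"

text \<open>
  \<open>kG \<otimes>\<^bsub>kH\<^esub> V\<close> for a \<open>kH\<close>-module \<open>V\<close>, with coaction \<open>\<phi>(g \<otimes> v) = (g \<otimes> v) \<otimes> g c g\<^sup>-\<^sup>1\<close>. This is well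
  defined when \<open>H\<close> centralizes \<open>c\<close>, and is determined by its values for \<open>g\<close> in a set of
  representatives of the left cosets of \<open>H\<close>; in the cases used below these are given by
  \<open>dihedral_conj\<close>.
\<close>

definition induced ::
  "('g, 'm) monoid_scheme \<Rightarrow> 'g set \<Rightarrow> ('k :: field, 'g, 'v) kG_module \<Rightarrow> 'g \<Rightarrow>
   ('k, 'g, ('g \<Rightarrow> 'v) set) yd_module" where
  "induced G H V c = yd_quotient (group_tensor G V c) (balancing_relations G H V c)"

lemma dihedral_inv:
  assumes "i < n"
  shows "inv\<^bsub>dihedral n\<^esub> (i, False) = ((n - i) mod n, False)"
    and "inv\<^bsub>dihedral n\<^esub> (i, True) = (i, True)"
proof -
  interpret group "dihedral n" using dihedral_group assms by simp
  show "inv\<^bsub>dihedral n\<^esub> (i, False) = ((n - i) mod n, False)"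
    by (rule inv_equality) (use assms in \<open>auto simp: dihedral_def mod_simps\<close>)
  show "inv\<^bsub>dihedral n\<^esub> (i, True) = (i, True)"
    by (rule inv_equality) (use assms in \<open>auto simp: dihedral_def\<close>)
qed

lemma dihedral_conj:
  assumes "n > 1" "j < n" "l < n"
  shows "(j, False) \<otimes>\<^bsub>dihedral n\<^esub> (0, True) \<otimes>\<^bsub>dihedral n\<^esub> inv\<^bsub>dihedral n\<^esub> (j, False) = (2 * j mod n, True)"
    and "(j, False) \<otimes>\<^bsub>dihedral n\<^esub> (1, True) \<otimes>\<^bsub>dihedral n\<^esub> inv\<^bsub>dihedral n\<^esub> (j, False) = ((2 * j + 1) mod n, True)"
    and "(0, True) \<otimes>\<^bsub>dihedral n\<^esub> (l, False) \<otimes>\<^bsub>dihedral n\<^esub> inv\<^bsub>dihedral n\<^esub> (0, True) = ((n - l) mod n, False)"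
proof -
  have "(j + (n - (n - j) mod n)) mod n = 2 * j mod n"
    using assms by (cases "j = 0") (auto simp: mult_2)
  moreover have "(Suc j mod n + (n - (n - j) mod n)) mod n = Suc (2 * j) mod n"
  proof (cases "j = 0")
    case True
    then show ?thesis using assms mod_add_self2[of 1 n] by simp
  next
    case False
    then have "(Suc j mod n + (n - (n - j) mod n)) mod n = (Suc j mod n + j) mod n"
      using assms by simp
    also have "\<dots> = (Suc j + j) mod n" by (rule mod_add_left_eq)
    finally show ?thesis by (simp add: mult_2)
  qed
  ultimately show "(j, False) \<otimes>\<^bsub>dihedral n\<^esub> (0, True) \<otimes>\<^bsub>dihedral n\<^esub> inv\<^bsub>dihedral n\<^esub> (j, False) = (2 * j mod n, True)"
    "(j, False) \<otimes>\<^bsub>dihedral n\<^esub> (1, True) \<otimes>\<^bsub>dihedral n\<^esub> inv\<^bsub>dihedral n\<^esub> (j, False) = ((2 * j + 1) mod n, True)"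
    using assms by (auto simp: dihedral_inv) (auto simp: dihedral_def)
  show "(0, True) \<otimes>\<^bsub>dihedral n\<^esub> (l, False) \<otimes>\<^bsub>dihedral n\<^esub> inv\<^bsub>dihedral n\<^esub> (0, True) = ((n - l) mod n, False)"
    using assms by (auto simp: dihedral_inv) (auto simp: dihedral_def)
qed


section \<open>The listed modules\<close>

definition primitive_root_of_unity :: "nat \<Rightarrow> 'k :: field \<Rightarrow> bool" where
  "primitive_root_of_unity t \<xi> \<longleftrightarrow> t > 0 \<and> \<xi> ^ t = 1 \<and> (\<forall>m. 0 < m \<and> m < t \<longrightarrow> \<xi> ^ m \<noteq> 1)"

text \<open>
  The entries \<open>t\<^sub>i\<^sub>j\<close>, with indices from \<open>1\<close> to \<open>r\<close>, of \<open>T\<close> (for \<open>c = 1\<close>) and of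
  \<open>T\<^sub>1\<close> (for \<open>c = \<xi>\<^bsup>t/2\<^esup>\<close>).
\<close>

function t_entry :: "'k :: comm_ring_1 \<Rightarrow> nat \<Rightarrow> nat \<Rightarrow> nat \<Rightarrow> 'k" where
  "t_entry c r i j =
     (if j < i \<or> r < j then 0
      else if i = r then 1
      else if i = j then - t_entry c r (i + 1) (j + 1)
      else - c * t_entry c r (i + 1) j - t_entry c r (i + 1) (j + 1))"
  by auto
termination by (relation "measure (\<lambda>(c, r, i, j). r - i)") auto

declare t_entry.simps [simp del]

definition t_mat :: "'k :: comm_ring_1 \<Rightarrow> nat \<Rightarrow> 'k mat" where
  "t_mat c r = mat r r (\<lambda>(i, j). t_entry c r (i + 1) (j + 1))"

text \<open>The module of column vectors of length \<open>r\<close> given by \<open>a \<mapsto> A\<close>, \<open>b \<mapsto> B\<close>.\<close>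

definition dih_matrix_module :: "nat \<Rightarrow> 'k :: field mat \<Rightarrow> 'k mat \<Rightarrow> ('k, dih, 'k vec) kG_module" where
  "dih_matrix_module r A B = with_act (module_vec TYPE('k) r)
     (\<lambda>(i, e) v. (A ^\<^sub>m i * (if e then B else 1\<^sub>m r)) *\<^sub>v v)"

text \<open>Indices for \<open>V\<^bsub>r,0\<^esub>\<close>, \<open>V'\<^bsub>r,0\<^esub>\<close>, \<open>V\<^bsub>r,t/2\<^esub>\<close>, \<open>V'\<^bsub>r,t/2\<^esub>\<close> and \<open>W\<^bsub>2r,i\<^esub>\<close>.\<close>

datatype dih_index = V0 nat | V0' nat | Vh nat | Vh' nat | W nat nat

fun dih_module :: "nat \<Rightarrow> 'k :: field \<Rightarrow> dih_index \<Rightarrow> ('k, dih, 'k vec) kG_module" where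
  "dih_module t \<xi> (V0 r) = dih_matrix_module r (jordan_block r (\<xi> ^ 0)) (t_mat 1 r)"
| "dih_module t \<xi> (V0' r) = dih_matrix_module r (jordan_block r (\<xi> ^ 0)) (- t_mat 1 r)"
| "dih_module t \<xi> (Vh r) =
     dih_matrix_module r (jordan_block r (\<xi> ^ (t div 2))) (t_mat (\<xi> ^ (t div 2)) r)"
| "dih_module t \<xi> (Vh' r) =
     dih_matrix_module r (jordan_block r (\<xi> ^ (t div 2))) (- t_mat (\<xi> ^ (t div 2)) r)"
| "dih_module t \<xi> (W r i) =
     dih_matrix_module (2 * r)
       (four_block_mat (jordan_block r (\<xi> ^ i)) (0\<^sub>m r r)
                       (0\<^sub>m r r) (the (mat_inverse (jordan_block r (\<xi> ^ i)))))
       (four_block_mat (0\<^sub>m r r) (1\<^sub>m r) (1\<^sub>m r) (0\<^sub>m r r))"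

definition dih_indices :: "nat \<Rightarrow> nat \<Rightarrow> nat \<Rightarrow> dih_index set" where
  "dih_indices p s t =
     {V0 r | r. 1 \<le> r \<and> r \<le> p ^ s} \<union> {V0' r | r. 1 \<le> r \<and> r \<le> p ^ s} \<union>
     {Vh r | r. 1 \<le> r \<and> r \<le> p ^ s} \<union> {Vh' r | r. 1 \<le> r \<and> r \<le> p ^ s} \<union>
     {W r i | r i. 1 \<le> r \<and> r \<le> p ^ s \<and> 1 \<le> i \<and> i \<le> t div 2 - 1}"

text \<open>
  The 1-dimensional module of the Klein four group \<open>{1, z, c, z c}\<close> on which \<open>z\<close> and \<open>c\<close>
  act by the \<open>m\<close>-th of the pairs \<open>(1, 1), (1, -1), (-1, 1), (-1, -1)\<close>, \<open>1 \<le> m \<le> 4\<close>.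
\<close>

definition klein_module :: "dih \<Rightarrow> dih \<Rightarrow> nat \<Rightarrow> ('k :: field, dih, 'k vec) kG_module" where
  "klein_module z c m =
     (let \<alpha> = (if m = 1 \<or> m = 2 then 1 else - 1); \<beta> = (if m = 1 \<or> m = 3 then 1 else - 1)
      in with_act (module_vec TYPE('k) 1)
           (\<lambda>h v. (if h = (0, False) then 1 else if h = z then \<alpha> else if h = c then \<beta> else \<alpha> * \<beta>) \<cdot>\<^sub>v v))"

text \<open>The module \<open>Q\<^bsub>r,j\<^esub>\<close> of the cyclic group generated by \<open>a\<close>.\<close>

definition cyclic_module :: "'k :: field \<Rightarrow> nat \<Rightarrow> nat \<Rightarrow> ('k, dih, 'k vec) kG_module" where
  "cyclic_module \<xi> r j = with_act (module_vec TYPE('k) r)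
     (\<lambda>(i, e) v. (jordan_block r (\<xi> ^ j) ^\<^sub>m i) *\<^sub>v v)"

text \<open>Indices for \<open>D(V\<^sub>m)\<close>, \<open>D(U\<^sub>m)\<close> and, with arguments in the order \<open>r, j, l\<close>, for \<open>D(Q\<^sup>l\<^bsub>r,j\<^esub>)\<close>.\<close>

datatype induced_index = DV nat | DU nat | DQ nat nat nat

fun induced_module ::
  "nat \<Rightarrow> 'k :: field \<Rightarrow> induced_index \<Rightarrow> ('k, dih, (dih \<Rightarrow> 'k vec) set) yd_module" where
  "induced_module n \<xi> (DV m) =
     induced (dihedral n) (generate (dihedral n) {(0, True), (n div 2, False)})
       (klein_module (n div 2, False) (0, True) m) (0, True)"
| "induced_module n \<xi> (DU m) =
     induced (dihedral n) (generate (dihedral n) {(1, True), (n div 2, False)})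
       (klein_module (n div 2, False) (1, True) m) (1, True)"
| "induced_module n \<xi> (DQ r j l) =
     induced (dihedral n) (generate (dihedral n) {(1, False)})
       (cyclic_module \<xi> r j) (l, False)"

definition induced_indices :: "nat \<Rightarrow> nat \<Rightarrow> nat \<Rightarrow> nat \<Rightarrow> induced_index set" where
  "induced_indices p s t n =
     {DV m | m. 1 \<le> m \<and> m \<le> 4} \<union> {DU m | m. 1 \<le> m \<and> m \<le> 4} \<union>
     {DQ r j l | r j l. 1 \<le> r \<and> r \<le> p ^ s \<and> j \<le> t - 1 \<and> 1 \<le> l \<and> l \<le> n div 2 - 1}"

end

theory Submission
  imports Defs "HOL-Library.Function_Algebras" "HOL-Library.Product_Plus"
    "HOL-Computational_Algebra.Primes" "HOL-Computational_Algebra.Polynomial"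
begin

text \<open>
  The idea is to attach a label to every finite dimensional indecomposable module, and to compare the
  possible labels with those of the listed modules.

  Call \<open>v\<close> homogeneous of degree \<open>g\<close> if its coaction is \<open>v \<otimes> g\<close>. The submodule generated by such a
  \<open>v\<close> is \<open>kGv\<close>, and its part of degree \<open>g\<close> only involves the centralizer of \<open>g\<close>. A label records a
  degree \<open>g\<close> together with the action of its centralizer on a generator. For a rotation \<open>g\<close> the vector
  \<open>v\<close> is taken to be the top of a Jordan chain of \<open>a\<close>, with eigenvalue \<open>l\<close> and length \<open>r \<le> p\<^sup>s\<close>. If
  \<open>g\<close> is central and \<open>l = l\<^sup>-\<^sup>1\<close>, then \<open>b v\<close> has the same degree and eigenvalue as \<open>v\<close>, and \<open>v\<close> is
  in addition required to be an eigenvector of the involution \<open>a b\<close>; otherwise \<open>b v\<close> is separated from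
  \<open>v\<close> by its degree or its eigenvalue, and \<open>kGv\<close> is the sum of two chains. If \<open>g\<close> is \<open>b\<close> or \<open>a b\<close>,
  the centralizer is a Klein four group acting on \<open>v\<close> by a character. The characteristic enters
  through \<open>(a - l)\<^sup>q = a\<^sup>q - l\<^sup>q\<close> for \<open>q = p\<^sup>s\<close>, which makes the generalized eigenspaces of \<open>a\<close> the
  eigenspaces of \<open>a\<^sup>q\<close>, an operator of order dividing \<open>t\<close>; so the projections onto them are averages.

  In each case the last vector of the chain, or \<open>v\<close> itself, lies in every nonzero submodule of \<open>kGv\<close>
  (\<open>soc_minimal\<close>). This has three consequences. First, a module generated by \<open>v\<close> is indecomposable.
  Secondly, two modules with the same label are isomorphic, because in the direct sum the pair of
  generators generates the graph of an isomorphism (\<open>cyclic_isomorphic\<close>). Thirdly, the label of a module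
  is unique up to replacing \<open>v\<close> by \<open>b v\<close> (\<open>gen_unique\<close>).

  Every indecomposable module has a label (\<open>indecomposable_has_generator\<close>). For a generator \<open>v\<close> of maximal
  chain length, a complement of \<open>kGv\<close> is found as the set of all vectors whose translates are killed by
  a functional \<open>\<phi>\<close> that does not vanish on the distinguished vector of \<open>kGv\<close>
  (\<open>indecomposable_imp_cyclic\<close>). That this set together with \<open>kGv\<close> is everything means that a linear
  system can be solved, by triangularity along the Jordan chain or by averaging over the Klein four group,
  whose order is invertible.

  It remains to find generators of the listed modules. The last unit vector generates under a Jordan
  block, which deals with the modules given by matrices. In an induced module \<open>kG \<otimes>\<^bsub>kH\<^esub> V\<close> the vector
  \<open>1 \<otimes> v\<close> is a generator if \<open>v\<close> is one for \<open>V\<close>, and it is nonzero because \<open>\<Sum>\<^bsub>x\<in>G\<^esub> x \<otimes> v\<^sub>x \<mapsto> \<Sum>\<^bsub>h\<in>H\<^esub> h v\<^sub>h\<close>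
  is a retraction onto \<open>V\<close>. The labels found in this way are representatives of all labels up to
  inversion.
\<close>

section \<open>Linear maps, submodules and isomorphisms, unfolded\<close>

lemma linear_map_iff:
  "linear_map (class_ring :: 'k :: field ring) M N f \<longleftrightarrow>
     vectorspace (class_ring :: 'k ring) M \<and> vectorspace (class_ring :: 'k ring) N \<and>
     (\<forall>v\<in>carrier M. f v \<in> carrier N) \<and>
     (\<forall>v\<in>carrier M. \<forall>w\<in>carrier M. f (v \<oplus>\<^bsub>M\<^esub> w) = f v \<oplus>\<^bsub>N\<^esub> f w) \<and>
     (\<forall>c. \<forall>v\<in>carrier M. f (c \<odot>\<^bsub>M\<^esub> v) = c \<odot>\<^bsub>N\<^esub> f v)"
  by (auto simp: linear_map_def mod_hom_def mod_hom_axioms_def LinearCombinations.module_hom_def vectorspace_def)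

lemma subspace_iff:
  "subspace (class_ring :: 'k :: field ring) N M \<longleftrightarrow>
     vectorspace (class_ring :: 'k ring) M \<and> N \<subseteq> carrier M \<and> \<zero>\<^bsub>M\<^esub> \<in> N \<and>
     (\<forall>v\<in>N. \<forall>w\<in>N. v \<oplus>\<^bsub>M\<^esub> w \<in> N) \<and> (\<forall>c. \<forall>v\<in>N. c \<odot>\<^bsub>M\<^esub> v \<in> N)"
  by (auto simp: VectorSpace.subspace_def submodule_def vectorspace_def)

lemma linear_map_zero:
  assumes "linear_map (class_ring :: 'k :: field ring) M N f"
  shows "f \<zero>\<^bsub>M\<^esub> = \<zero>\<^bsub>N\<^esub>"
proof -
  interpret linear_map "class_ring :: 'k ring" M N f by (fact assms)
  show ?thesis by simp
qed

lemma linear_map_finsum: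
  assumes "linear_map (class_ring :: 'k :: field ring) M N f"
    and "g \<in> A \<rightarrow> carrier M"
  shows "f (\<Oplus>\<^bsub>M\<^esub>x\<in>A. g x) = (\<Oplus>\<^bsub>N\<^esub>x\<in>A. f (g x))"
proof -
  interpret linear_map "class_ring :: 'k ring" M N f by (fact assms)
  show ?thesis using assms(2)
  proof (induction A rule: infinite_finite_induct)
    case (insert x A)
    then have "g \<in> A \<rightarrow> carrier M" "g x \<in> carrier M" by auto
    moreover have "(\<lambda>x. f (g x)) \<in> A \<rightarrow> carrier N" "f (g x) \<in> carrier N"
      using calculation by auto
    ultimately show ?case using insert by simp
  qed simp_all
qed

lemma linear_map_comp:
  assumes "linear_map (class_ring :: 'k :: field ring) M N f" "linear_map class_ring N P g"
  shows "linear_map class_ring M P (g \<circ> f)"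
  using assms unfolding linear_map_iff by auto

lemma linear_map_inv:
  assumes f: "linear_map (class_ring :: 'k :: field ring) M N f" and bij: "bij_betw f (carrier M) (carrier N)"
  shows "linear_map class_ring N M (inv_into (carrier M) f)"
proof -
  let ?g = "inv_into (carrier M) f"
  interpret linear_map "class_ring :: 'k ring" M N f by (fact f)
  have gM: "?g w \<in> carrier M" and fg: "f (?g w) = w" if "w \<in> carrier N" for w
    using bij that by (auto simp: bij_betw_def inv_into_into f_inv_into_f)
  have inj: "x = y" if "f x = f y" "x \<in> carrier M" "y \<in> carrier M" for x y
    using bij that by (auto simp: bij_betw_def inj_on_def)
  show ?thesis
    unfolding linear_map_iff
  proof (intro conjI ballI allI)
    show "?g (v \<oplus>\<^bsub>N\<^esub> w) = ?g v \<oplus>\<^bsub>M\<^esub> ?g w" if "v \<in> carrier N" "w \<in> carrier N" for v w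
      using that by (intro inj) (simp_all add: fg gM)
    show "?g (c \<odot>\<^bsub>N\<^esub> v) = c \<odot>\<^bsub>M\<^esub> ?g v" if "v \<in> carrier N" for c v
      using that by (intro inj) (simp_all add: fg gM)
  qed (use gM f[unfolded linear_map_iff] in auto)
qed

lemma (in yd_module) act_closed:
  assumes "g \<in> carrier G" "v \<in> carrier M" shows "act M g v \<in> carrier M"
  using act_linear[OF assms(1)] assms(2) by (simp add: linear_map_iff)

lemma (in yd_module) coact_closed:
  assumes "g \<in> carrier G" "v \<in> carrier M" shows "coact M v g \<in> carrier M"
  using coact_linear[OF assms(1)] assms(2) by (simp add: linear_map_iff)

lemma yd_isomorphic_inverse:
  fixes M :: "('k :: field, 'g, 'v, 'd) yd_module_scheme"
    and N :: "('k, 'g, 'w, 'e) yd_module_scheme"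
  assumes M: "yd_module G M" and iso: "yd_isomorphic G M N"
  obtains f f' where "linear_map class_ring M N f" "bij_betw f (carrier M) (carrier N)"
    "\<forall>g\<in>carrier G. \<forall>v\<in>carrier M. f (act M g v) = act N g (f v) \<and> f (coact M v g) = coact N (f v) g"
    "linear_map class_ring N M f'" "bij_betw f' (carrier N) (carrier M)"
    "\<forall>g\<in>carrier G. \<forall>v\<in>carrier N. f' (act N g v) = act M g (f' v) \<and> f' (coact N v g) = coact M (f' v) g"
    "\<forall>v\<in>carrier M. f' (f v) = v" "\<forall>w\<in>carrier N. f (f' w) = w"
proof -
  obtain f where f: "linear_map class_ring M N f" "bij_betw f (carrier M) (carrier N)"
    and act: "\<And>g v. g \<in> carrier G \<Longrightarrow> v \<in> carrier M \<Longrightarrow> f (act M g v) = act N g (f v)"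
    and coact: "\<And>g v. g \<in> carrier G \<Longrightarrow> v \<in> carrier M \<Longrightarrow> f (coact M v g) = coact N (f v) g"
    using iso unfolding yd_isomorphic_def by blast
  let ?g = "inv_into (carrier M) f"
  interpret M: yd_module G M by (fact M)
  have gM: "?g w \<in> carrier M" and fg: "f (?g w) = w" if "w \<in> carrier N" for w
    using f(2) that by (auto simp: bij_betw_def inv_into_into f_inv_into_f)
  have gf: "?g (f v) = v" if "v \<in> carrier M" for v
    using f(2) that by (auto simp: bij_betw_def)
  have 1: "?g (act N x w) = act M x (?g w)" if "x \<in> carrier G" "w \<in> carrier N" for x w
    using act[of x "?g w"] gf[of "act M x (?g w)"] by (simp add: that fg gM M.act_closed)
  have 2: "?g (coact N w x) = coact M (?g w) x" if "x \<in> carrier G" "w \<in> carrier N" for x w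
    using coact[of x "?g w"] gf[of "coact M (?g w) x"] by (simp add: that fg gM M.coact_closed)
  show ?thesis
    by (rule that[OF f _ linear_map_inv[OF f] bij_betw_inv_into[OF f(2)]]) (simp_all add: act coact 1 2 gf fg)
qed

lemma yd_isomorphic_sym:
  fixes M :: "('k :: field, 'g, 'v, 'd) yd_module_scheme"
    and N :: "('k, 'g, 'w, 'e) yd_module_scheme"
  assumes M: "yd_module G M" and iso: "yd_isomorphic G M N"
  shows "yd_isomorphic G N M"
  by (rule yd_isomorphic_inverse[OF M iso], unfold yd_isomorphic_def) blast

lemma yd_isomorphic_trans:
  fixes M :: "('k :: field, 'g, 'v, 'd) yd_module_scheme"
    and N :: "('k, 'g, 'w, 'e) yd_module_scheme" and P :: "('k, 'g, 'x, 'h) yd_module_scheme"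
  assumes "yd_isomorphic G M N" "yd_isomorphic G N P"
  shows "yd_isomorphic G M P"
proof -
  obtain f where f: "linear_map class_ring M N f" "bij_betw f (carrier M) (carrier N)"
    "\<And>g v. g \<in> carrier G \<Longrightarrow> v \<in> carrier M \<Longrightarrow> f (act M g v) = act N g (f v)"
    "\<And>g v. g \<in> carrier G \<Longrightarrow> v \<in> carrier M \<Longrightarrow> f (coact M v g) = coact N (f v) g"
    using assms(1) unfolding yd_isomorphic_def by blast
  obtain h where h: "linear_map class_ring N P h" "bij_betw h (carrier N) (carrier P)"
    "\<And>g v. g \<in> carrier G \<Longrightarrow> v \<in> carrier N \<Longrightarrow> h (act N g v) = act P g (h v)"
    "\<And>g v. g \<in> carrier G \<Longrightarrow> v \<in> carrier N \<Longrightarrow> h (coact N v g) = coact P (h v) g"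
    using assms(2) unfolding yd_isomorphic_def by blast
  have "f v \<in> carrier N" if "v \<in> carrier M" for v using f(1) that unfolding linear_map_iff by blast
  then show ?thesis
    unfolding yd_isomorphic_def
    by (intro exI[of _ "h \<circ> f"] conjI linear_map_comp[OF f(1) h(1)] bij_betw_trans[OF f(2) h(2)])
      (simp add: f h)
qed

lemma yd_submodule_image:
  assumes M: "yd_module G M"
    and f: "linear_map class_ring M N f" "bij_betw f (carrier M) (carrier N)"
    and act: "\<And>g v. g \<in> carrier G \<Longrightarrow> v \<in> carrier M \<Longrightarrow> f (act M g v) = act N g (f v)"
    and coact: "\<And>g v. g \<in> carrier G \<Longrightarrow> v \<in> carrier M \<Longrightarrow> f (coact M v g) = coact N (f v) g"
    and S: "yd_submodule G M S"
  shows "yd_submodule G N (f ` S)"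
proof -
  interpret linear_map class_ring M N f by (fact f)
  have SM: "S \<subseteq> carrier M" and S0: "\<zero>\<^bsub>M\<^esub> \<in> S"
    and Sadd: "\<And>v w. v \<in> S \<Longrightarrow> w \<in> S \<Longrightarrow> v \<oplus>\<^bsub>M\<^esub> w \<in> S" and Ssc: "\<And>c v. v \<in> S \<Longrightarrow> c \<odot>\<^bsub>M\<^esub> v \<in> S"
    and Sact: "\<And>g v. g \<in> carrier G \<Longrightarrow> v \<in> S \<Longrightarrow> act M g v \<in> S"
    and Sco: "\<And>g v. g \<in> carrier G \<Longrightarrow> v \<in> S \<Longrightarrow> coact M v g \<in> S"
    using S unfolding yd_submodule_def subspace_iff by blast+
  show ?thesis
    unfolding yd_submodule_def subspace_iff
  proof (intro conjI ballI allI)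
    show "\<zero>\<^bsub>N\<^esub> \<in> f ` S" using linear_map_zero[OF f(1)] S0 by force
    show "x \<oplus>\<^bsub>N\<^esub> y \<in> f ` S" if "x \<in> f ` S" "y \<in> f ` S" for x y
    proof -
      from that obtain v w where "v \<in> S" "w \<in> S" "x = f v" "y = f w" by auto
      then show ?thesis using SM f_add[of v w] Sadd[of v w] by (metis image_eqI subsetD)
    qed
    show "c \<odot>\<^bsub>N\<^esub> x \<in> f ` S" if "x \<in> f ` S" for c x
    proof -
      from that obtain v where "v \<in> S" "x = f v" by auto
      then show ?thesis using SM f_smult[of c v] Ssc[of v c] by (metis UNIV_I image_eqI partial_object.select_convs(1) subsetD)
    qed
    show "act N g x \<in> f ` S" if "g \<in> carrier G" "x \<in> f ` S" for g x
      using that SM act[of g] Sact by (metis (no_types, lifting) image_iff subsetD)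
    show "coact N x g \<in> f ` S" if "g \<in> carrier G" "x \<in> f ` S" for g x
      using that SM coact[of g] Sco by (metis (no_types, lifting) image_iff subsetD)
    show "vectorspace class_ring N" by unfold_locales
    show "f ` S \<subseteq> carrier N" using SM by auto
  qed
qed

lemma yd_indecomposable_iso:
  assumes M: "yd_module G M" and N: "yd_module G N"
    and iso: "yd_isomorphic G M N" and ind: "yd_indecomposable G N"
  shows "yd_indecomposable G M"
proof -
  obtain f where f: "linear_map class_ring M N f" "bij_betw f (carrier M) (carrier N)"
    and act: "\<And>g v. g \<in> carrier G \<Longrightarrow> v \<in> carrier M \<Longrightarrow> f (act M g v) = act N g (f v)"
    and coact: "\<And>g v. g \<in> carrier G \<Longrightarrow> v \<in> carrier M \<Longrightarrow> f (coact M v g) = coact N (f v) g"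
    using iso unfolding yd_isomorphic_def by blast
  interpret linear_map class_ring M N f by (fact f)
  have inj: "inj_on f (carrier M)" and img: "f ` carrier M = carrier N"
    using f(2) by (auto simp: bij_betw_def)
  have zero: "f \<zero>\<^bsub>M\<^esub> = \<zero>\<^bsub>N\<^esub>" by (rule linear_map_zero[OF f(1)])
  have fadd: "f (v \<oplus>\<^bsub>M\<^esub> w) = f v \<oplus>\<^bsub>N\<^esub> f w" if "v \<in> carrier M" "w \<in> carrier M" for v w
    using f(1) that by (simp add: linear_map_iff)
  show ?thesis
    unfolding yd_indecomposable_def
  proof (intro conjI allI impI)
    show "carrier M \<noteq> {\<zero>\<^bsub>M\<^esub>}"
      using ind img zero unfolding yd_indecomposable_def by auto
    fix S T
    assume *: "yd_submodule G M S \<and> yd_submodule G M T \<and> S <+>\<^bsub>M\<^esub> T = carrier M \<and> S \<inter> T = {\<zero>\<^bsub>M\<^esub>}"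
    then have sub: "S \<subseteq> carrier M" "T \<subseteq> carrier M" unfolding yd_submodule_def subspace_iff by auto
    have "f ` S <+>\<^bsub>N\<^esub> f ` T = f ` (S <+>\<^bsub>M\<^esub> T)"
    proof -
      have "f v \<oplus>\<^bsub>N\<^esub> f w = f (v \<oplus>\<^bsub>M\<^esub> w)" if "v \<in> S" "w \<in> T" for v w
        using fadd[OF subsetD[OF sub(1) that(1)] subsetD[OF sub(2) that(2)]] by simp
      then have "(\<lambda>(v, w). f v \<oplus>\<^bsub>N\<^esub> f w) ` (S \<times> T) = (\<lambda>(v, w). f (v \<oplus>\<^bsub>M\<^esub> w)) ` (S \<times> T)"
        by (intro image_cong) auto
      moreover have "f ` S <+>\<^bsub>N\<^esub> f ` T = (\<lambda>(v, w). f v \<oplus>\<^bsub>N\<^esub> f w) ` (S \<times> T)"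
        unfolding set_add_def' by force
      moreover have "f ` (S <+>\<^bsub>M\<^esub> T) = (\<lambda>(v, w). f (v \<oplus>\<^bsub>M\<^esub> w)) ` (S \<times> T)"
        unfolding set_add_def' by force
      ultimately show ?thesis by simp
    qed
    moreover have "f ` S \<inter> f ` T = {\<zero>\<^bsub>N\<^esub>}"
      using inj_on_image_Int[OF inj sub] * zero by auto
    ultimately have "f ` S = {\<zero>\<^bsub>N\<^esub>} \<or> f ` T = {\<zero>\<^bsub>N\<^esub>}"
      using ind yd_submodule_image[OF M f act coact] * img unfolding yd_indecomposable_def by auto
    moreover have "X = {\<zero>\<^bsub>M\<^esub>}" if "f ` X = {\<zero>\<^bsub>N\<^esub>}" "X \<subseteq> carrier M" for X
      using inj_on_image_eq_iff[OF inj that(2), of "{\<zero>\<^bsub>M\<^esub>}"] that(1) zero by auto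
    ultimately show "S = {\<zero>\<^bsub>M\<^esub>} \<or> T = {\<zero>\<^bsub>M\<^esub>}" using sub by blast
  qed
qed

section \<open>Yetter-Drinfeld modules as operators on a vector space\<close>

text \<open>
  The operators \<open>\<rho> g\<close> and \<open>\<pi> g\<close> are the action of \<open>g\<close> and the component of degree \<open>g\<close> of the
  coaction. The module itself is the image of the idempotent \<open>\<rho> 1\<close>: in this way a module whose
  carrier is a proper subset of a type is still described by total operators, to which the linear
  algebra of type classes applies.
\<close>
locale yd_rep = group G + vector_space scale
  for G :: "('g, 'c) monoid_scheme" (structure)
    and scale :: "'k :: field \<Rightarrow> 'w :: ab_group_add \<Rightarrow> 'w" (infixr "*s" 75) +
  fixes \<rho> \<pi> :: "'g \<Rightarrow> 'w \<Rightarrow> 'w"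
  assumes finite_G: "finite (carrier G)"
    and rho_add: "g \<in> carrier G \<Longrightarrow> \<rho> g (v + w) = \<rho> g v + \<rho> g w"
    and rho_scale: "g \<in> carrier G \<Longrightarrow> \<rho> g (c *s v) = c *s \<rho> g v"
    and pi_add: "g \<in> carrier G \<Longrightarrow> \<pi> g (v + w) = \<pi> g v + \<pi> g w"
    and pi_scale: "g \<in> carrier G \<Longrightarrow> \<pi> g (c *s v) = c *s \<pi> g v"
    and rho_mult: "g \<in> carrier G \<Longrightarrow> h \<in> carrier G \<Longrightarrow> \<rho> (g \<otimes> h) v = \<rho> g (\<rho> h v)"
    and pi_sum: "(\<Sum>h\<in>carrier G. \<pi> h v) = \<rho> \<one> v"
    and pi_pi: "g \<in> carrier G \<Longrightarrow> h \<in> carrier G \<Longrightarrow> \<pi> h (\<pi> g v) = (if h = g then \<pi> g v else 0)"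
    and pi_rho: "g \<in> carrier G \<Longrightarrow> h \<in> carrier G \<Longrightarrow> \<pi> (g \<otimes> h \<otimes> inv g) (\<rho> g v) = \<rho> g (\<pi> h v)"

definition yd_of ::
  "('g, 'c) monoid_scheme \<Rightarrow> ('k \<Rightarrow> 'w \<Rightarrow> 'w :: ab_group_add) \<Rightarrow> ('g \<Rightarrow> 'w \<Rightarrow> 'w) \<Rightarrow> ('g \<Rightarrow> 'w \<Rightarrow> 'w) \<Rightarrow>
   ('k, 'g, 'w) yd_module" where
  "yd_of G scale \<rho> \<pi> =
     \<lparr>carrier = {v. \<rho> \<one>\<^bsub>G\<^esub> v = v}, mult = undefined, one = undefined, zero = 0, add = (+),
      smult = scale, act = \<rho>, coact = (\<lambda>v g. \<pi> g v)\<rparr>"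

lemma yd_of_simps [simp]:
  "carrier (yd_of G scale \<rho> \<pi>) = {v. \<rho> \<one>\<^bsub>G\<^esub> v = v}"
  "zero (yd_of G scale \<rho> \<pi>) = 0" "add (yd_of G scale \<rho> \<pi>) = (+)"
  "smult (yd_of G scale \<rho> \<pi>) = scale" "act (yd_of G scale \<rho> \<pi>) = \<rho>"
  "coact (yd_of G scale \<rho> \<pi>) v g = \<pi> g v"
  by (simp_all add: yd_of_def)

context yd_rep
begin

abbreviation "M \<equiv> {v. \<rho> \<one> v = v}"

lemma rho_0 [simp]: "g \<in> carrier G \<Longrightarrow> \<rho> g 0 = 0"
  using rho_add[of g 0 0] by simp
lemma pi_0 [simp]: "g \<in> carrier G \<Longrightarrow> \<pi> g 0 = 0"
  using pi_add[of g 0 0] by simp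
lemma rho_minus: "g \<in> carrier G \<Longrightarrow> \<rho> g (- v) = - \<rho> g v"
  using rho_add[of g v "- v"] by (simp add: eq_neg_iff_add_eq_0 add.commute)
lemma rho_diff: "g \<in> carrier G \<Longrightarrow> \<rho> g (v - w) = \<rho> g v - \<rho> g w"
  using rho_add[of g v "- w"] by (simp add: rho_minus)
lemma rho_sum: "g \<in> carrier G \<Longrightarrow> \<rho> g (\<Sum>x\<in>A. f x) = (\<Sum>x\<in>A. \<rho> g (f x))"
  by (induction A rule: infinite_finite_induct) (simp_all add: rho_add)
lemma pi_setsum: "g \<in> carrier G \<Longrightarrow> \<pi> g (\<Sum>x\<in>A. f x) = (\<Sum>x\<in>A. \<pi> g (f x))"
  by (induction A rule: infinite_finite_induct) (simp_all add: pi_add)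

lemma rho_M [simp]: "g \<in> carrier G \<Longrightarrow> \<rho> \<one> (\<rho> g v) = \<rho> g v"
  using rho_mult[of \<one> g v] by simp
lemma rho_one_right [simp]: "g \<in> carrier G \<Longrightarrow> \<rho> g (\<rho> \<one> v) = \<rho> g v"
  using rho_mult[of g \<one> v] by simp

lemma pi_one: "g \<in> carrier G \<Longrightarrow> \<pi> g (\<rho> \<one> v) = \<pi> g v"
proof -
  assume g: "g \<in> carrier G"
  have "\<pi> g (\<rho> \<one> v) = (\<Sum>h\<in>carrier G. \<pi> g (\<pi> h v))"
    by (simp add: pi_sum[symmetric] pi_setsum g)
  also have "\<dots> = (\<Sum>h\<in>carrier G. if h = g then \<pi> g v else 0)"
    by (intro sum.cong) (auto simp: pi_pi g)
  finally show ?thesis using g finite_G by (simp add: sum.delta)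
qed

lemma pi_M [simp]: "g \<in> carrier G \<Longrightarrow> \<rho> \<one> (\<pi> g v) = \<pi> g v"
  using pi_rho[of \<one> g v] pi_one[of g v] by simp

lemma rho_inv [simp]: "g \<in> carrier G \<Longrightarrow> \<rho> (inv g) (\<rho> g v) = \<rho> \<one> v"
  using rho_mult[of "inv g" g v] by simp
lemma rho_eq_0_iff: "g \<in> carrier G \<Longrightarrow> \<rho> \<one> v = v \<Longrightarrow> \<rho> g v = 0 \<longleftrightarrow> v = 0"
  using rho_inv[of g v] by (metis inv_closed rho_0)

lemma pi_ex: "\<rho> \<one> v = v \<Longrightarrow> v \<noteq> 0 \<Longrightarrow> \<exists>h\<in>carrier G. \<pi> h v \<noteq> 0"
  using pi_sum[of v] by (metis sum.neutral)

lemma M_zero [simp]: "\<rho> \<one> 0 = 0" by simp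
lemma M_add: "\<rho> \<one> v = v \<Longrightarrow> \<rho> \<one> w = w \<Longrightarrow> \<rho> \<one> (v + w) = v + w" by (simp add: rho_add)
lemma M_scale: "\<rho> \<one> v = v \<Longrightarrow> \<rho> \<one> (c *s v) = c *s v" by (simp add: rho_scale)
lemma vectorspace_yd_of: "vectorspace class_ring (yd_of G scale \<rho> \<pi>)"
proof (rule vs_criteria)
  show "\<forall>v\<in>carrier (yd_of G scale \<rho> \<pi>). \<exists>w\<in>carrier (yd_of G scale \<rho> \<pi>).
      v \<oplus>\<^bsub>yd_of G scale \<rho> \<pi>\<^esub> w = \<zero>\<^bsub>yd_of G scale \<rho> \<pi>\<^esub>"
  proof
    fix v assume "v \<in> carrier (yd_of G scale \<rho> \<pi>)"
    then show "\<exists>w\<in>carrier (yd_of G scale \<rho> \<pi>).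
      v \<oplus>\<^bsub>yd_of G scale \<rho> \<pi>\<^esub> w = \<zero>\<^bsub>yd_of G scale \<rho> \<pi>\<^esub>"
      by (intro bexI[of _ "- v"]) (simp_all add: rho_minus)
  qed
qed (simp_all add: class_field M_add M_scale add.commute add.assoc scale_left_distrib scale_right_distrib)

lemma finsum_yd_of:
  assumes "f \<in> A \<rightarrow> M"
  shows "finsum (yd_of G scale \<rho> \<pi>) f A = sum f A"
proof -
  interpret V: vectorspace class_ring "yd_of G scale \<rho> \<pi>" by (rule vectorspace_yd_of)
  show ?thesis using assms
    by (induction A rule: infinite_finite_induct) (auto simp: Pi_def)
qed

lemma yd_module_yd_of: "yd_module G (yd_of G scale \<rho> \<pi>)"
proof -
  have "linear_map class_ring (yd_of G scale \<rho> \<pi>) (yd_of G scale \<rho> \<pi>) (\<rho> g)"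
    "linear_map class_ring (yd_of G scale \<rho> \<pi>) (yd_of G scale \<rho> \<pi>) (\<pi> g)" if "g \<in> carrier G" for g
    using that unfolding linear_map_iff
    by (simp_all add: vectorspace_yd_of rho_add rho_scale pi_add pi_scale)
  moreover have "(\<Oplus>\<^bsub>yd_of G scale \<rho> \<pi>\<^esub>h\<in>carrier G. \<pi> h v) = v" if "\<rho> \<one> v = v" for v
    using that by (subst finsum_yd_of) (auto simp: pi_sum)
  ultimately show ?thesis
    unfolding yd_module_def yd_module_axioms_def kG_module_def kG_module_axioms_def
    using finite_G vectorspace_yd_of
    by (auto simp: rho_mult pi_pi pi_rho)
qed

definition subm :: "'w set \<Rightarrow> bool" where
  "subm S \<longleftrightarrow> S \<subseteq> M \<and> 0 \<in> S \<and> (\<forall>v\<in>S. \<forall>w\<in>S. v + w \<in> S) \<and> (\<forall>c. \<forall>v\<in>S. c *s v \<in> S) \<and>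
     (\<forall>g\<in>carrier G. \<forall>v\<in>S. \<rho> g v \<in> S \<and> \<pi> g v \<in> S)"

lemma yd_submodule_yd_of: "yd_submodule G (yd_of G scale \<rho> \<pi>) S \<longleftrightarrow> subm S"
  unfolding yd_submodule_def subspace_iff subm_def using vectorspace_yd_of by simp

lemma submD:
  assumes "subm S"
  shows "v \<in> S \<Longrightarrow> \<rho> \<one> v = v" "0 \<in> S" "v \<in> S \<Longrightarrow> w \<in> S \<Longrightarrow> v + w \<in> S" "v \<in> S \<Longrightarrow> c *s v \<in> S"
    "g \<in> carrier G \<Longrightarrow> v \<in> S \<Longrightarrow> \<rho> g v \<in> S" "g \<in> carrier G \<Longrightarrow> v \<in> S \<Longrightarrow> \<pi> g v \<in> S"
  using assms unfolding subm_def by auto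

lemma subm_diff: "subm S \<Longrightarrow> v \<in> S \<Longrightarrow> w \<in> S \<Longrightarrow> v - w \<in> S"
  using submD(3)[of S v "(-1) *s w"] submD(4)[of S w "-1"] by (simp add: scale_minus_left)

lemma subm_sum: "subm S \<Longrightarrow> (\<And>x. x \<in> A \<Longrightarrow> f x \<in> S) \<Longrightarrow> (\<Sum>x\<in>A. f x) \<in> S"
  by (induction A rule: infinite_finite_induct) (auto simp: submD)

lemma subm_Int: "subm S \<Longrightarrow> subm T \<Longrightarrow> subm (S \<inter> T)"
  unfolding subm_def by auto

text \<open>The subspace \<open>kGv\<close>.\<close>
definition cyc :: "'w \<Rightarrow> 'w set" where
  "cyc v = {(\<Sum>g\<in>carrier G. c g *s \<rho> g v) | c. True}"

lemma cyc_least: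
  assumes "v \<in> S" "0 \<in> S" "\<And>x y. x \<in> S \<Longrightarrow> y \<in> S \<Longrightarrow> x + y \<in> S" "\<And>c x. x \<in> S \<Longrightarrow> c *s x \<in> S"
    "\<And>g. g \<in> carrier G \<Longrightarrow> \<rho> g v \<in> S"
  shows "cyc v \<subseteq> S"
proof -
  have "(\<Sum>g\<in>A. c g *s \<rho> g v) \<in> S" if "A \<subseteq> carrier G" for c A
    using finite_subset[OF that finite_G] that
    by (induction A rule: finite_induct) (auto simp: assms)
  then show ?thesis unfolding cyc_def by auto
qed

lemma cyc_subm_least: "subm S \<Longrightarrow> v \<in> S \<Longrightarrow> cyc v \<subseteq> S"
  by (rule cyc_least) (auto simp: submD)

lemma cyc_M: "w \<in> cyc v \<Longrightarrow> \<rho> \<one> w = w"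
  unfolding cyc_def by (auto simp: rho_sum rho_scale intro!: sum.cong)

lemma cyc_0: "0 \<in> cyc v"
  unfolding cyc_def by (auto intro!: exI[of _ "\<lambda>_. 0"])

lemma cyc_add: "x \<in> cyc v \<Longrightarrow> y \<in> cyc v \<Longrightarrow> x + y \<in> cyc v"
  unfolding cyc_def
proof clarify
  fix c d
  show "\<exists>f. (\<Sum>g\<in>carrier G. c g *s \<rho> g v) + (\<Sum>g\<in>carrier G. d g *s \<rho> g v) = (\<Sum>g\<in>carrier G. f g *s \<rho> g v) \<and> True"
    by (intro exI[of _ "\<lambda>g. c g + d g"]) (simp add: scale_left_distrib sum.distrib)
qed

lemma cyc_scale: "x \<in> cyc v \<Longrightarrow> a *s x \<in> cyc v"
  unfolding cyc_def
proof clarify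
  fix c
  show "\<exists>f. a *s (\<Sum>g\<in>carrier G. c g *s \<rho> g v) = (\<Sum>g\<in>carrier G. f g *s \<rho> g v) \<and> True"
    by (intro exI[of _ "\<lambda>g. a * c g"]) (simp add: scale_sum_right)
qed

lemma cyc_sum: "(\<And>x. x \<in> A \<Longrightarrow> f x \<in> cyc v) \<Longrightarrow> (\<Sum>x\<in>A. f x) \<in> cyc v"
  by (induction A rule: infinite_finite_induct) (auto simp: cyc_0 cyc_add)

lemma cyc_rho_self: "h \<in> carrier G \<Longrightarrow> \<rho> h v \<in> cyc v"
proof -
  assume h: "h \<in> carrier G"
  have "\<rho> h v = (\<Sum>g\<in>carrier G. (if g = h then 1 else 0) *s \<rho> g v)"
    using h finite_G by (simp add: if_distrib[of "\<lambda>c. c *s _"] cong: if_cong)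
  then show ?thesis unfolding cyc_def by (intro CollectI exI conjI TrueI)
qed

lemma cyc_self: "\<rho> \<one> v = v \<Longrightarrow> v \<in> cyc v"
  using cyc_rho_self[of \<one> v] by simp

lemma cyc_rho: "h \<in> carrier G \<Longrightarrow> w \<in> cyc v \<Longrightarrow> \<rho> h w \<in> cyc v"
proof -
  assume h: "h \<in> carrier G" and "w \<in> cyc v"
  then obtain c where w: "w = (\<Sum>g\<in>carrier G. c g *s \<rho> g v)" unfolding cyc_def by auto
  show "\<rho> h w \<in> cyc v"
    unfolding w rho_sum[OF h] rho_scale[OF h]
    by (rule cyc_sum) (simp add: cyc_scale cyc_rho_self rho_mult[symmetric] h)
qed

lemma pi_rho_homog:
  assumes "g \<in> carrier G" "h \<in> carrier G" "x \<in> carrier G" "\<pi> g v = v"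
  shows "\<pi> h (\<rho> x v) = (if x \<otimes> g \<otimes> inv x = h then \<rho> x v else 0)"
proof -
  let ?k = "x \<otimes> g \<otimes> inv x"
  have k: "?k \<in> carrier G" using assms by simp
  have eq: "\<pi> ?k (\<rho> x v) = \<rho> x v" using pi_rho[OF assms(3,1), of v] by (simp only: assms(4))
  have "\<pi> h (\<rho> x v) = \<pi> h (\<pi> ?k (\<rho> x v))" by (simp only: eq)
  also have "\<dots> = (if h = ?k then \<rho> x v else 0)" using pi_pi[OF k assms(2), of "\<rho> x v"] by (simp only: eq)
  finally show ?thesis by (simp only: eq_commute[of h])
qed

lemma cyc_subm:
  assumes g: "g \<in> carrier G" and v: "\<pi> g v = v"
  shows "subm (cyc v)"
proof -
  have "\<pi> h w \<in> cyc v" if h: "h \<in> carrier G" and "w \<in> cyc v" for h w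
  proof -
    obtain c where w: "w = (\<Sum>g\<in>carrier G. c g *s \<rho> g v)" using \<open>w \<in> cyc v\<close> unfolding cyc_def by auto
    show ?thesis
      unfolding w pi_setsum[OF h] pi_scale[OF h]
      by (rule cyc_sum) (simp add: cyc_scale cyc_rho_self cyc_0 pi_rho_homog[OF g h _ v])
  qed
  then show ?thesis unfolding subm_def
    by (auto simp: cyc_M cyc_0 cyc_add cyc_scale cyc_rho)
qed

definition centralizer :: "'g \<Rightarrow> 'g set" where
  "centralizer g = {z \<in> carrier G. z \<otimes> g \<otimes> inv z = g}"

text \<open>
  The translate \<open>x v\<close> has degree \<open>x g x\<^sup>-\<^sup>1\<close>, so only the centralizer of \<open>g\<close> contributes to degree
  \<open>g\<close>.
\<close>
lemma pi_cyc:
  assumes g: "g \<in> carrier G" and v: "\<pi> g v = v" and u: "u \<in> cyc v"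
  obtains c where "\<pi> g u = (\<Sum>z\<in>centralizer g. c z *s \<rho> z v)"
proof -
  obtain c where w: "u = (\<Sum>x\<in>carrier G. c x *s \<rho> x v)" using u unfolding cyc_def by auto
  have "\<pi> g u = (\<Sum>x\<in>carrier G. if x \<in> centralizer g then c x *s \<rho> x v else 0)"
    unfolding w pi_setsum[OF g]
    by (intro sum.cong) (auto simp: pi_scale g pi_rho_homog[OF g g _ v] centralizer_def)
  also have "\<dots> = (\<Sum>z\<in>centralizer g. c z *s \<rho> z v)"
    using finite_G by (subst sum.inter_restrict[symmetric])
      (auto simp: centralizer_def Int_def intro!: sum.cong)
  finally show ?thesis using that by blast
qed

lemma pi_cyc_support:
  assumes g: "g \<in> carrier G" and v: "\<pi> g v = v" and u: "u \<in> cyc v"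
    and h: "h \<in> carrier G" "\<pi> h u \<noteq> 0"
  obtains x where "x \<in> carrier G" "x \<otimes> g \<otimes> inv x = h"
proof -
  obtain c where w: "u = (\<Sum>x\<in>carrier G. c x *s \<rho> x v)" using u unfolding cyc_def by auto
  have "\<pi> h u = (\<Sum>x\<in>carrier G. c x *s (if x \<otimes> g \<otimes> inv x = h then \<rho> x v else 0))"
    unfolding w pi_setsum[OF h(1)]
    by (intro sum.cong) (auto simp: pi_scale h pi_rho_homog[OF g h(1) _ v])
  also have "\<dots> = 0" if "\<And>x. x \<in> carrier G \<Longrightarrow> x \<otimes> g \<otimes> inv x \<noteq> h"
    by (rule sum.neutral) (simp add: that)
  finally show ?thesis using h(2) that by blast
qed

text \<open>
  All degrees occurring in \<open>kGv\<close> are conjugate to \<open>g\<close>, so a translate of a nonzero homogeneous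
  component of \<open>u\<close> has degree \<open>g\<close>.
\<close>
lemma subm_meets_degree:
  assumes g: "g \<in> carrier G" and v: "\<pi> g v = v" and S: "subm S" "S \<subseteq> cyc v" and u: "u \<in> S" "u \<noteq> 0"
  obtains w where "w \<in> S" "w \<noteq> 0" "\<pi> g w = w"
proof -
  obtain h where h: "h \<in> carrier G" "\<pi> h u \<noteq> 0" using pi_ex[of u] submD(1)[OF S(1) u(1)] u by auto
  obtain x where x: "x \<in> carrier G" "x \<otimes> g \<otimes> inv x = h"
    using pi_cyc_support[OF g v _ h] u S by blast
  let ?w = "\<rho> (inv x) (\<pi> h u)"
  have gx: "inv x \<otimes> h \<otimes> inv (inv x) = g" using x g by (simp add: x(2)[symmetric] m_assoc inv_solve_left')
  have "\<pi> g ?w = ?w"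
    using pi_rho_homog[of h g "inv x" "\<pi> h u"] pi_pi[OF h(1) h(1)] x h g gx by simp
  moreover have "?w \<noteq> 0" using rho_eq_0_iff[of "inv x" "\<pi> h u"] x h by simp
  ultimately show ?thesis using that[of ?w] submD(5,6)[OF S(1)] x h u by simp
qed

section \<open>Indecomposable modules and cyclic modules\<close>

lemma indecomposable_iff:
  "yd_indecomposable G (yd_of G scale \<rho> \<pi>) \<longleftrightarrow> (\<exists>v. \<rho> \<one> v = v \<and> v \<noteq> 0) \<and>
     (\<forall>S T. subm S \<and> subm T \<and> (\<forall>m. \<rho> \<one> m = m \<longrightarrow> (\<exists>x\<in>S. \<exists>y\<in>T. m = x + y)) \<and> S \<inter> T = {0} \<longrightarrow>
        S = {0} \<or> T = {0})"
proof -
  have sums: "S <+>\<^bsub>yd_of G scale \<rho> \<pi>\<^esub> T = M \<longleftrightarrow> (\<forall>m. \<rho> \<one> m = m \<longrightarrow> (\<exists>x\<in>S. \<exists>y\<in>T. m = x + y))"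
    if "subm S" "subm T" for S T
  proof -
    have sum: "S <+>\<^bsub>yd_of G scale \<rho> \<pi>\<^esub> T = {x + y | x y. x \<in> S \<and> y \<in> T}"
      unfolding set_add_def' by auto
    have "{x + y | x y. x \<in> S \<and> y \<in> T} \<subseteq> M"
      using submD(1)[OF that(1)] submD(1)[OF that(2)] M_add by blast
    then have "{x + y | x y. x \<in> S \<and> y \<in> T} = M \<longleftrightarrow> M \<subseteq> {x + y | x y. x \<in> S \<and> y \<in> T}" by blast
    also have "\<dots> \<longleftrightarrow> (\<forall>m. \<rho> \<one> m = m \<longrightarrow> (\<exists>x\<in>S. \<exists>y\<in>T. m = x + y))" by blast
    finally show ?thesis unfolding sum .
  qed
  have *: "subm S \<and> subm T \<and> S <+>\<^bsub>yd_of G scale \<rho> \<pi>\<^esub> T = M \<and> S \<inter> T = {0} \<longleftrightarrow>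
      subm S \<and> subm T \<and> (\<forall>m. \<rho> \<one> m = m \<longrightarrow> (\<exists>x\<in>S. \<exists>y\<in>T. m = x + y)) \<and> S \<inter> T = {0}" for S T
    by (intro conj_cong refl sums)
  have **: "M \<noteq> {0} \<longleftrightarrow> (\<exists>v. \<rho> \<one> v = v \<and> v \<noteq> 0)" by auto
  show ?thesis
    unfolding yd_indecomposable_def yd_submodule_yd_of yd_of_simps * ** ..
qed

text \<open>The vector \<open>e\<close> would lie in both summands of a decomposition.\<close>
lemma indecomposableI:
  assumes "e \<noteq> 0" "\<rho> \<one> e = e" and e: "\<And>S u. subm S \<Longrightarrow> u \<in> S \<Longrightarrow> u \<noteq> 0 \<Longrightarrow> e \<in> S"
  shows "yd_indecomposable G (yd_of G scale \<rho> \<pi>)"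
  unfolding indecomposable_iff
proof (intro conjI allI impI)
  show "\<exists>v. \<rho> \<one> v = v \<and> v \<noteq> 0" using assms by blast
  fix S T
  assume *: "subm S \<and> subm T \<and> (\<forall>m. \<rho> \<one> m = m \<longrightarrow> (\<exists>x\<in>S. \<exists>y\<in>T. m = x + y)) \<and> S \<inter> T = {0}"
  show "S = {0} \<or> T = {0}"
  proof (rule ccontr)
    assume "\<not> (S = {0} \<or> T = {0})"
    then obtain x y where "x \<in> S" "x \<noteq> 0" "y \<in> T" "y \<noteq> 0"
      using * submD(2)[of S] submD(2)[of T] by auto
    then have "e \<in> S \<inter> T" using e * by blast
    then show False using * assms(1) by auto
  qed
qed

text \<open>
  The vectors all of whose translates are killed by \<open>\<phi>\<close> form the largest \<open>G\<close>-stable subspace of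
  the kernel of \<open>\<phi>\<close>. As \<open>\<phi>\<close> sees only the degree \<open>g\<close>, the number \<open>\<phi>(x \<pi>\<^sub>h m)\<close> is \<open>\<phi>(x m)\<close> or \<open>0\<close>
  according to whether \<open>x h x\<^sup>-\<^sup>1\<close> is \<open>g\<close>; so this subspace is also stable under the coaction.
\<close>
lemma functional_subm:
  assumes g: "g \<in> carrier G" and phi_add: "\<And>v w. \<phi> (v + w) = \<phi> v + (\<phi> w :: 'k)"
    and phi_scale: "\<And>c v. \<phi> (c *s v) = c * \<phi> v"
    and phi_g: "\<And>v. \<rho> \<one> v = v \<Longrightarrow> \<phi> (\<pi> g v) = \<phi> v"
  shows "subm {m. \<rho> \<one> m = m \<and> (\<forall>x\<in>carrier G. \<phi> (\<rho> x m) = 0)}"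
proof -
  have phi0: "\<phi> 0 = 0" using phi_scale[of 0 0] by simp
  have "\<phi> (\<rho> x (\<pi> h m)) = 0" if m: "\<rho> \<one> m = m" "\<forall>x\<in>carrier G. \<phi> (\<rho> x m) = 0"
    and x: "x \<in> carrier G" and h: "h \<in> carrier G" for x h m
  proof -
    let ?h = "x \<otimes> h \<otimes> inv x"
    have eq: "\<rho> x (\<pi> h m) = \<pi> ?h (\<rho> x m)" by (simp add: pi_rho x h)
    have "\<phi> (\<pi> ?h (\<rho> x m)) = \<phi> (\<pi> g (\<pi> ?h (\<rho> x m)))" by (rule phi_g[symmetric]) (simp add: x h)
    also have "\<dots> = 0" using pi_pi[of ?h g "\<rho> x m"] phi_g[of "\<rho> x m"] m x h g by (auto simp: phi0)
    finally show ?thesis by (simp add: eq)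
  qed
  then show ?thesis
    unfolding subm_def
    by (auto simp: M_add M_scale rho_add rho_scale phi_add phi_scale phi0 rho_mult[symmetric])
qed

text \<open>
  Let \<open>P\<close> be the submodule of the vectors all of whose translates are killed by \<open>\<phi>\<close>. It meets
  \<open>kGv\<close> in \<open>0\<close>, because a nonzero intersection would contain \<open>e\<close>, on which \<open>\<phi>\<close> does not vanish. If
  moreover every \<open>m\<close> can be matched by some \<open>w\<close> in \<open>kGv\<close> on which \<open>\<phi>\<close> and its translates take the
  same values, then \<open>m - w\<close> is in \<open>P\<close>. Hence \<open>kGv\<close> has the complement \<open>P\<close>, and in an
  indecomposable module \<open>P\<close> must be zero.
\<close>
lemma indecomposable_imp_cyclic:
  assumes ind: "yd_indecomposable G (yd_of G scale \<rho> \<pi>)"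
    and g: "g \<in> carrier G" and v: "\<pi> g v = v"
    and phi_add: "\<And>v w. \<phi> (v + w) = \<phi> v + (\<phi> w :: 'k)" and phi_scale: "\<And>c v. \<phi> (c *s v) = c * \<phi> v"
    and phi_g: "\<And>v. \<rho> \<one> v = v \<Longrightarrow> \<phi> (\<pi> g v) = \<phi> v"
    and e: "e \<in> cyc v" "\<phi> e \<noteq> 0" "\<And>S u. subm S \<Longrightarrow> S \<subseteq> cyc v \<Longrightarrow> u \<in> S \<Longrightarrow> u \<noteq> 0 \<Longrightarrow> e \<in> S"
    and solve: "\<And>m. \<rho> \<one> m = m \<Longrightarrow> \<exists>w\<in>cyc v. \<forall>x\<in>carrier G. \<phi> (\<rho> x m) = \<phi> (\<rho> x w)"
    and m: "\<rho> \<one> m = m"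
  shows "m \<in> cyc v"
proof -
  let ?P = "{m. \<rho> \<one> m = m \<and> (\<forall>x\<in>carrier G. \<phi> (\<rho> x m) = 0)}"
  have P: "subm ?P" by (rule functional_subm[OF g phi_add phi_scale phi_g])
  have N: "subm (cyc v)" by (rule cyc_subm[OF g v])
  have "cyc v \<inter> ?P = {0}"
  proof (rule ccontr)
    assume "cyc v \<inter> ?P \<noteq> {0}"
    then obtain u where "u \<in> cyc v \<inter> ?P" "u \<noteq> 0" using submD(2)[OF N] submD(2)[OF P] by blast
    then have "e \<in> ?P" using e(3)[OF subm_Int[OF N P]] by blast
    then show False using e(2) by (metis (mono_tags, lifting) mem_Collect_eq one_closed)
  qed
  moreover have dec: "\<exists>x\<in>cyc v. \<exists>y\<in>?P. m = x + y" if m: "\<rho> \<one> m = m" for m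
  proof -
    obtain w where w: "w \<in> cyc v" "\<forall>x\<in>carrier G. \<phi> (\<rho> x m) = \<phi> (\<rho> x w)" using solve[OF m] by blast
    have "\<phi> (\<rho> x (m - w)) = 0" if "x \<in> carrier G" for x
    proof -
      have "\<phi> (\<rho> x m) = \<phi> (\<rho> x (m - w)) + \<phi> (\<rho> x w)"
        by (simp add: phi_add[symmetric] rho_add[symmetric] that)
      then show ?thesis using w(2) that by simp
    qed
    then have "m - w \<in> ?P" using m cyc_M[OF w(1)] by (simp add: rho_diff)
    then show ?thesis using w(1) by (intro bexI[of _ w] bexI[of _ "m - w"]) auto
  qed
  ultimately have "cyc v = {0} \<or> ?P = {0}"
    using ind N P unfolding indecomposable_iff by blast
  moreover have "cyc v \<noteq> {0}" using e(1,2) phi_scale[of 0 0] by auto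
  ultimately have "?P = {0}" by simp
  with dec[OF m] show ?thesis by auto
qed

text \<open>
  When the centralizer \<open>C\<close> of \<open>g\<close> acts on \<open>v\<close> and on \<open>\<phi>\<close> by the character \<open>\<chi>\<close> and its order is
  invertible, the solution is the sum of \<open>\<phi>(y\<^sup>-\<^sup>1 m) y v\<close> over all \<open>y\<close>, divided by \<open>|C| \<phi>(v)\<close>. In
  its value at \<open>x\<close> only the \<open>y\<close> with \<open>x y\<close> in \<open>C\<close> contribute, since the other translates of \<open>v\<close>
  have the wrong degree, and each of them contributes \<open>\<phi>(x m)/|C|\<close>.
\<close>
lemma solve_by_averaging:
  assumes g: "g \<in> carrier G" and v: "\<pi> g v = v"
    and phi_add: "\<And>v w. \<phi> (v + w) = \<phi> v + (\<phi> w :: 'k)" and phi_scale: "\<And>c v. \<phi> (c *s v) = c * \<phi> v"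
    and phi_g: "\<And>v. \<rho> \<one> v = v \<Longrightarrow> \<phi> (\<pi> g v) = \<phi> v"
    and chi: "\<And>z. z \<in> centralizer g \<Longrightarrow> \<rho> z v = \<chi> z *s v" "\<And>z m. z \<in> centralizer g \<Longrightarrow> \<rho> \<one> m = m \<Longrightarrow> \<phi> (\<rho> z m) = \<chi> z * \<phi> m"
    and phi_v: "\<phi> v \<noteq> 0" and card: "of_nat (card (centralizer g)) \<noteq> (0 :: 'k)" and m: "\<rho> \<one> m = m"
  shows "\<exists>w\<in>cyc v. \<forall>x\<in>carrier G. \<phi> (\<rho> x m) = \<phi> (\<rho> x w)"
proof -
  have phi0: "\<phi> 0 = 0" using phi_scale[of 0 0] by simp
  have phi_sum: "\<phi> (\<Sum>y\<in>A. f y) = (\<Sum>y\<in>A. \<phi> (f y))" for A and f :: "'g \<Rightarrow> 'w"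
    by (induction A rule: infinite_finite_induct) (simp_all add: phi_add phi0)
  have vM: "\<rho> \<one> v = v" using pi_M[OF g, of v] v by simp
  have centr_sub: "centralizer g \<subseteq> carrier G" unfolding centralizer_def by auto
  have centr_inv: "inv z \<in> centralizer g" if "z \<in> centralizer g" for z
  proof -
    have z: "z \<in> carrier G" "z \<otimes> g \<otimes> inv z = g" using that unfolding centralizer_def by auto
    have "inv z \<otimes> (z \<otimes> g \<otimes> inv z) \<otimes> inv (inv z) = g" using z(1) g by (simp add: m_assoc inv_solve_left')
    then show ?thesis using z unfolding centralizer_def by simp
  qed
  have chi_inv: "\<chi> (inv z) * \<chi> z = 1" if z: "z \<in> centralizer g" for z
  proof -
    have zG: "z \<in> carrier G" using z centr_sub by auto
    have "\<phi> v = \<phi> (\<rho> (inv z) (\<rho> z v))" by (simp add: zG vM)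
    also have "\<dots> = \<chi> (inv z) * \<chi> z * \<phi> v"
      using chi(2)[OF centr_inv[OF z], of "\<rho> z v"] chi(2)[OF z, of v] zG vM by simp
    finally show ?thesis using phi_v by simp
  qed
  let ?d = "of_nat (card (centralizer g)) * \<phi> v"
  let ?w = "\<Sum>y\<in>carrier G. (\<phi> (\<rho> (inv y) m) / ?d) *s \<rho> y v"
  have "\<phi> (\<rho> x ?w) = \<phi> (\<rho> x m)" if x: "x \<in> carrier G" for x
  proof -
    have "\<phi> (\<rho> x ?w) = (\<Sum>y\<in>carrier G. \<phi> (\<rho> (inv y) m) / ?d * \<phi> (\<rho> (x \<otimes> y) v))"
      using x by (simp add: rho_sum rho_scale phi_sum phi_scale rho_mult)
    also have "\<dots> = (\<Sum>z\<in>carrier G. \<phi> (\<rho> (inv (inv x \<otimes> z)) m) / ?d * \<phi> (\<rho> z v))"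
      by (rule sum.reindex_bij_witness[where i="\<lambda>z. inv x \<otimes> z" and j="\<lambda>y. x \<otimes> y"])
        (auto simp: x m_assoc[symmetric])
    also have "\<dots> = (\<Sum>z\<in>centralizer g. \<phi> (\<rho> (inv (inv x \<otimes> z)) m) / ?d * \<phi> (\<rho> z v))"
    proof (rule sum.mono_neutral_right[OF finite_G centr_sub], rule ballI)
      fix z assume z: "z \<in> carrier G - centralizer g"
      then have "\<pi> g (\<rho> z v) = 0" using pi_rho_homog[OF g g _ v, of z] unfolding centralizer_def by auto
      then show "\<phi> (\<rho> (inv (inv x \<otimes> z)) m) / ?d * \<phi> (\<rho> z v) = 0"
        using phi_g[of "\<rho> z v"] z by (simp add: phi0)
    qed
    also have "\<dots> = (\<Sum>z\<in>centralizer g. \<phi> (\<rho> x m) / of_nat (card (centralizer g)))"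
    proof (rule sum.cong)
      fix z assume z: "z \<in> centralizer g"
      then have zG: "z \<in> carrier G" using centr_sub by auto
      have "\<rho> (inv (inv x \<otimes> z)) m = \<rho> (inv z) (\<rho> x m)"
        using x zG by (simp add: inv_mult_group rho_mult)
      then have "\<phi> (\<rho> (inv (inv x \<otimes> z)) m) = \<chi> (inv z) * \<phi> (\<rho> x m)"
        using chi(2)[OF centr_inv[OF z], of "\<rho> x m"] x by simp
      moreover have "\<phi> (\<rho> z v) = \<chi> z * \<phi> v" using chi(2)[OF z vM] .
      ultimately have "\<phi> (\<rho> (inv (inv x \<otimes> z)) m) / ?d * \<phi> (\<rho> z v) =
          (\<chi> (inv z) * \<chi> z) * \<phi> (\<rho> x m) / of_nat (card (centralizer g))"
        using phi_v card by (simp add: field_simps)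
      then show "\<phi> (\<rho> (inv (inv x \<otimes> z)) m) / ?d * \<phi> (\<rho> z v) = \<phi> (\<rho> x m) / of_nat (card (centralizer g))"
        by (simp add: chi_inv[OF z])
    qed simp
    also have "\<dots> = \<phi> (\<rho> x m)" using card by simp
    finally show ?thesis .
  qed
  moreover have "?w \<in> cyc v" by (intro cyc_sum cyc_scale cyc_rho_self)
  ultimately show ?thesis by (intro bexI[of _ ?w]) auto
qed

end

section \<open>Isomorphic cyclic modules\<close>

locale yd_rep_pair = A: yd_rep G scale1 \<rho>1 \<pi>1 + B: yd_rep G scale2 \<rho>2 \<pi>2
  for G :: "('g, 'c) monoid_scheme" (structure)
    and scale1 :: "'k :: field \<Rightarrow> 'w1 :: ab_group_add \<Rightarrow> 'w1" and \<rho>1 \<pi>1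
    and scale2 :: "'k \<Rightarrow> 'w2 :: ab_group_add \<Rightarrow> 'w2" and \<rho>2 \<pi>2
begin

abbreviation "scaleP \<equiv> (\<lambda>c z. (scale1 c (fst z), scale2 c (snd z)))"
abbreviation "\<rho>P \<equiv> (\<lambda>g z. (\<rho>1 g (fst z), \<rho>2 g (snd z)))"
abbreviation "\<pi>P \<equiv> (\<lambda>g z. (\<pi>1 g (fst z), \<pi>2 g (snd z)))"

lemma sum_pair: "(\<Sum>x\<in>A. (f x, g x)) = (\<Sum>x\<in>A. f x, \<Sum>x\<in>A. g x)"
  by (induction A rule: infinite_finite_induct) (auto simp: zero_prod_def)

sublocale P: yd_rep G scaleP \<rho>P \<pi>P
  by unfold_locales
    (simp_all add: prod_eq_iff A.finite_G A.rho_add B.rho_add A.rho_scale B.rho_scale A.pi_add B.pi_add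
      A.pi_scale B.pi_scale A.rho_mult B.rho_mult A.pi_pi B.pi_pi A.pi_rho B.pi_rho sum_pair A.pi_sum B.pi_sum
      A.scale_left_distrib B.scale_left_distrib A.scale_right_distrib B.scale_right_distrib)

text \<open>
  If every nonzero submodule of \<open>kG(v, w)\<close> contains an element with both components nonzero, then
  no nonzero element of \<open>kG(v, w)\<close> has a zero component; so \<open>v\<close> and \<open>w\<close> have the same annihilator.
\<close>
lemma component_zero:
  assumes g: "g \<in> carrier G" and v: "\<pi>1 g v = v" and w: "\<pi>2 g w = w"
    and e: "fst e \<noteq> 0" "snd e \<noteq> 0" "\<And>S u. P.subm S \<Longrightarrow> S \<subseteq> P.cyc (v, w) \<Longrightarrow> u \<in> S \<Longrightarrow> u \<noteq> 0 \<Longrightarrow> e \<in> S"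
    and u: "u \<in> P.cyc (v, w)"
  shows "fst u = 0 \<longleftrightarrow> snd u = 0"
proof -
  have cyc: "P.subm (P.cyc (v, w))" by (rule P.cyc_subm[OF g]) (simp add: v w)
  have "P.subm {u. \<rho>P \<one> u = u \<and> fst u = 0}" "P.subm {u. \<rho>P \<one> u = u \<and> snd u = 0}"
    unfolding P.subm_def
    by (simp_all add: prod_eq_iff subset_iff A.M_add A.M_scale B.M_add B.M_scale)
  note Int = this[THEN P.subm_Int[OF cyc]]
  have "P.cyc (v, w) \<inter> {u. \<rho>P \<one> u = u \<and> fst u = 0} = {u \<in> P.cyc (v, w). fst u = 0}"
    "P.cyc (v, w) \<inter> {u. \<rho>P \<one> u = u \<and> snd u = 0} = {u \<in> P.cyc (v, w). snd u = 0}"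
    using P.cyc_M by blast+
  with Int have 1: "P.subm {u \<in> P.cyc (v, w). fst u = 0}" and 2: "P.subm {u \<in> P.cyc (v, w). snd u = 0}"
    by simp_all
  show ?thesis
  proof
    assume "fst u = 0"
    then show "snd u = 0" using e(3)[OF 1, of u] e(1) u by (auto simp: prod_eq_iff)
  next
    assume "snd u = 0"
    then show "fst u = 0" using e(3)[OF 2, of u] e(2) u by (auto simp: prod_eq_iff)
  qed
qed

text \<open>
  In this situation \<open>kG(v, w)\<close> is the graph of an isomorphism that maps \<open>v\<close> to \<open>w\<close>.
\<close>
lemma cyclic_isomorphic:
  assumes g: "g \<in> carrier G" and v: "\<pi>1 g v = v" and w: "\<pi>2 g w = w"
    and e: "fst e \<noteq> 0" "snd e \<noteq> 0" "\<And>S u. P.subm S \<Longrightarrow> S \<subseteq> P.cyc (v, w) \<Longrightarrow> u \<in> S \<Longrightarrow> u \<noteq> 0 \<Longrightarrow> e \<in> S"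
    and gen1: "\<And>m. \<rho>1 \<one> m = m \<Longrightarrow> m \<in> A.cyc v" and gen2: "\<And>m. \<rho>2 \<one> m = m \<Longrightarrow> m \<in> B.cyc w"
  shows "yd_isomorphic G (yd_of G scale1 \<rho>1 \<pi>1) (yd_of G scale2 \<rho>2 \<pi>2)"
proof -
  let ?C = "P.cyc (v, w)"
  have cyc: "P.subm ?C" by (rule P.cyc_subm[OF g]) (simp add: v w)
  have zero: "fst u = 0 \<longleftrightarrow> snd u = 0" if "u \<in> ?C" for u
    by (rule component_zero[OF g v w e(1,2) _ that]) (rule e(3))
  have pair: "(\<Sum>x\<in>carrier G. scale1 (c x) (\<rho>1 x v), \<Sum>x\<in>carrier G. scale2 (c x) (\<rho>2 x w)) \<in> ?C" for c
    unfolding P.cyc_def by (auto simp: sum_pair)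
  have ex1: "\<exists>n. (m, n) \<in> ?C" if m: "\<rho>1 \<one> m = m" for m
    using gen1[OF m] pair unfolding A.cyc_def by blast
  have ex2: "\<exists>m. (m, n) \<in> ?C" if n: "\<rho>2 \<one> n = n" for n
    using gen2[OF n] pair unfolding B.cyc_def by blast
  have uniq1: "n = n'" if "(m, n) \<in> ?C" "(m, n') \<in> ?C" for m n n'
    using zero[OF P.subm_diff[OF cyc that]] by simp
  have uniq2: "m = m'" if "(m, n) \<in> ?C" "(m', n) \<in> ?C" for m m' n
    using zero[OF P.subm_diff[OF cyc that]] by simp
  define f where "f m = (THE n. (m, n) \<in> ?C)" for m
  have f: "(m, f m) \<in> ?C" if "\<rho>1 \<one> m = m" for m
    unfolding f_def using ex1[OF that] uniq1 by (metis (mono_tags, lifting) theI)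
  have f_eq: "f m = n" if "(m, n) \<in> ?C" for m n
    using uniq1 that unfolding f_def by blast
  have C_M: "\<rho>1 \<one> m = m" "\<rho>2 \<one> n = n" if "(m, n) \<in> ?C" for m n
    using P.cyc_M[OF that] by auto
  show ?thesis
    unfolding yd_isomorphic_def linear_map_iff yd_of_simps
  proof (intro exI[of _ f] conjI ballI allI A.vectorspace_yd_of B.vectorspace_yd_of)
    show "f m \<in> B.M" if "m \<in> A.M" for m using C_M(2)[OF f] that by auto
    show "f (m + n) = f m + f n" if "m \<in> A.M" "n \<in> A.M" for m n
      using f_eq[of "m + n" "f m + f n"] P.submD(3)[OF cyc f f, of m n] that by simp
    show "f (scale1 c m) = scale2 c (f m)" if "m \<in> A.M" for c m
      using f_eq[of "scale1 c m" "scale2 c (f m)"] P.submD(4)[OF cyc f, of m c] that by simp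
    show "f (\<rho>1 x m) = \<rho>2 x (f m)" if "x \<in> carrier G" "m \<in> A.M" for x m
      using f_eq[of "\<rho>1 x m" "\<rho>2 x (f m)"] P.submD(5)[OF cyc _ f, of x m] that by simp
    show "f (\<pi>1 x m) = \<pi>2 x (f m)" if "x \<in> carrier G" "m \<in> A.M" for x m
      using f_eq[of "\<pi>1 x m" "\<pi>2 x (f m)"] P.submD(6)[OF cyc _ f, of x m] that by simp
    show "bij_betw f A.M B.M"
    proof (rule bij_betwI')
      show "f x = f y \<longleftrightarrow> x = y" if "x \<in> A.M" "y \<in> A.M" for x y
        using f[of x] f[of y] uniq2 that by auto
      show "f x \<in> B.M" if "x \<in> A.M" for x using C_M(2)[OF f] that by auto
      show "\<exists>x\<in>A.M. y = f x" if "y \<in> B.M" for y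
        using ex2[of y] that f_eq C_M(1) by blast
    qed
  qed
qed

end

section \<open>Every finite dimensional Yetter-Drinfeld module is given by operators\<close>

text \<open>
  A basis \<open>B\<close> identifies a module with the functions supported on \<open>B\<close>. Composing with the restriction
  of functions to \<open>B\<close> extends all operators to the type of all functions.
\<close>
lemma yd_rep_exists:
  fixes M :: "('k :: field, 'g, 'v, 'd) yd_module_scheme"
  assumes M: "yd_module G M" and fd: "vectorspace.fin_dim class_ring M"
  obtains \<rho> \<pi> where "yd_rep G (\<lambda>c (f :: 'v \<Rightarrow> 'k) x. c * f x) \<rho> \<pi>"
    "yd_isomorphic G M (yd_of G (\<lambda>c (f :: 'v \<Rightarrow> 'k) x. c * f x) \<rho> \<pi>)"
proof -
  interpret M: yd_module G M by (fact M)
  obtain B where B: "finite B" "M.basis B" using M.finite_basis_exists[OF fd] by blast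
  have BM: "B \<subseteq> carrier M" using B(2) unfolding M.basis_def by auto
  let ?sc = "\<lambda>c (f :: 'v \<Rightarrow> 'k) x. c * f x"
  define L where "L f = M.lincomb f B" for f :: "'v \<Rightarrow> 'k"
  have L_M: "L f \<in> carrier M" for f unfolding L_def using BM by auto
  have L_add: "L (f + g) = L f \<oplus>\<^bsub>M\<^esub> L g" for f g
    using M.lincomb_sum[OF B(1) BM, of f g] unfolding L_def plus_fun_def by simp
  have L_scale: "L (?sc c f) = c \<odot>\<^bsub>M\<^esub> L f" for c f
    using M.lincomb_smult[OF BM, of f c] unfolding L_def by simp
  have L_bij: "\<exists>!f. f \<in> B \<rightarrow>\<^sub>E UNIV \<and> L f = v" if "v \<in> carrier M" for v
    using M.basis_criterion[OF B(1) BM] B(2) that unfolding L_def by simp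
  define C where "C v = (\<lambda>x. if x \<in> B then (THE f. f \<in> B \<rightarrow>\<^sub>E UNIV \<and> L f = v) x else 0)" for v
  have L_cong: "L f = L g" if "\<And>x. x \<in> B \<Longrightarrow> f x = g x" for f g
    unfolding L_def M.lincomb_def using that BM by (intro M.finsum_cong') auto
  have LC: "L (C v) = v" if "v \<in> carrier M" for v
  proof -
    have "L (C v) = L (THE f. f \<in> B \<rightarrow>\<^sub>E UNIV \<and> L f = v)" by (rule L_cong) (simp add: C_def)
    then show ?thesis using theI'[OF L_bij[OF that]] by simp
  qed
  have CL: "C (L f) = (\<lambda>x. if x \<in> B then f x else 0)" for f
  proof -
    have "L (restrict f B) = L f" by (rule L_cong) simp
    then have "(THE g. g \<in> B \<rightarrow>\<^sub>E UNIV \<and> L g = L f) = restrict f B"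
      using L_bij[OF L_M, of f] by (intro the1_equality) auto
    then show ?thesis unfolding C_def by auto
  qed
  have C_add: "C (v \<oplus>\<^bsub>M\<^esub> w) = C v + C w" if "v \<in> carrier M" "w \<in> carrier M" for v w
  proof -
    have "C (L (C v + C w)) = C v + C w" unfolding CL by (auto simp: C_def)
    then show ?thesis by (simp add: L_add LC that)
  qed
  have C_scale: "C (c \<odot>\<^bsub>M\<^esub> v) = ?sc c (C v)" if "v \<in> carrier M" for c v
  proof -
    have "C (L (?sc c (C v))) = ?sc c (C v)" unfolding CL by (auto simp: C_def)
    then show ?thesis by (simp add: L_scale LC that)
  qed
  have C0: "C \<zero>\<^bsub>M\<^esub> = 0" using C_scale[of "\<zero>\<^bsub>M\<^esub>" 0] by (simp add: zero_fun_def)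
  define \<rho> where "\<rho> g f = C (act M g (L f))" for g f
  define \<pi> where "\<pi> g f = C (coact M (L f) g)" for g f
  note cl = M.act_closed M.coact_closed L_M
  have act_add: "act M g (v \<oplus>\<^bsub>M\<^esub> w) = act M g v \<oplus>\<^bsub>M\<^esub> act M g w"
    and coact_add: "coact M (v \<oplus>\<^bsub>M\<^esub> w) g = coact M v g \<oplus>\<^bsub>M\<^esub> coact M w g"
    if "g \<in> carrier G" "v \<in> carrier M" "w \<in> carrier M" for g v w
    using M.act_linear[OF that(1)] M.coact_linear[OF that(1)] that(2,3) by (simp_all add: linear_map_iff)
  have act_scale: "act M g (c \<odot>\<^bsub>M\<^esub> v) = c \<odot>\<^bsub>M\<^esub> act M g v"
    and coact_scale: "coact M (c \<odot>\<^bsub>M\<^esub> v) g = c \<odot>\<^bsub>M\<^esub> coact M v g"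
    if "g \<in> carrier G" "v \<in> carrier M" for g v c
    using M.act_linear[OF that(1)] M.coact_linear[OF that(1)] that(2) by (simp_all add: linear_map_iff)
  have one: "\<rho> \<one>\<^bsub>G\<^esub> f = (\<lambda>x. if x \<in> B then f x else 0)" for f
    unfolding \<rho>_def by (simp add: M.act_one L_M CL)
  have C_sum: "C (finsum M h A) = (\<Sum>x\<in>A. C (h x))" if "h \<in> A \<rightarrow> carrier M" for h and A :: "'g set"
    using that by (induction A rule: infinite_finite_induct) (auto simp: C0 C_add Pi_def)
  have rep: "yd_rep G ?sc \<rho> \<pi>"
  proof (intro yd_rep.intro yd_rep_axioms.intro M.is_group)
    show "vector_space ?sc" by unfold_locales (auto simp: fun_eq_iff algebra_simps)
    show "finite (carrier G)" by (rule M.finite_group)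
    fix g f h c assume g: "g \<in> carrier G"
    show "\<rho> g (f + h) = \<rho> g f + \<rho> g h" "\<rho> g (?sc c f) = ?sc c (\<rho> g f)"
      "\<pi> g (f + h) = \<pi> g f + \<pi> g h" "\<pi> g (?sc c f) = ?sc c (\<pi> g f)"
      unfolding \<rho>_def \<pi>_def using g
      by (simp_all add: L_add L_scale act_add coact_add act_scale coact_scale cl C_add C_scale)
    fix k assume k: "k \<in> carrier G"
    show "\<rho> (g \<otimes>\<^bsub>G\<^esub> k) f = \<rho> g (\<rho> k f)" unfolding \<rho>_def using g k by (simp add: LC cl M.act_mult)
    show "\<pi> k (\<pi> g f) = (if k = g then \<pi> g f else 0)"
      unfolding \<pi>_def using g k by (simp add: LC cl M.coassoc C0)
    show "\<pi> (g \<otimes>\<^bsub>G\<^esub> k \<otimes>\<^bsub>G\<^esub> inv\<^bsub>G\<^esub> g) (\<rho> g f) = \<rho> g (\<pi> k f)"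
      unfolding \<pi>_def \<rho>_def using g k by (simp add: LC cl M.compat)
  next
    fix f
    have "(\<Sum>h\<in>carrier G. \<pi> h f) = C (\<Oplus>\<^bsub>M\<^esub>h\<in>carrier G. coact M (L f) h)"
      unfolding \<pi>_def by (rule C_sum[symmetric]) (simp add: cl)
    then show "(\<Sum>h\<in>carrier G. \<pi> h f) = \<rho> \<one>\<^bsub>G\<^esub> f"
      by (simp add: M.counit L_M \<rho>_def M.act_one)
  qed
  interpret R: yd_rep G ?sc \<rho> \<pi> by (fact rep)
  have C_carr: "\<rho> \<one>\<^bsub>G\<^esub> (C v) = C v" for v unfolding one by (auto simp: C_def)
  have "yd_isomorphic G M (yd_of G ?sc \<rho> \<pi>)"
    unfolding yd_isomorphic_def linear_map_iff
  proof (intro exI[of _ C] conjI ballI allI)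
    show "vectorspace class_ring M" by unfold_locales
    show "vectorspace class_ring (yd_of G ?sc \<rho> \<pi>)" by (rule R.vectorspace_yd_of)
    show "bij_betw C (carrier M) (carrier (yd_of G ?sc \<rho> \<pi>))"
    proof (rule bij_betw_byWitness[where f'=L])
      show "\<forall>f\<in>carrier (yd_of G ?sc \<rho> \<pi>). C (L f) = f" by (simp add: CL one)
    qed (auto simp: LC C_carr L_M)
  qed (simp_all add: C_carr C_add C_scale \<rho>_def \<pi>_def LC M.act_one)
  then show ?thesis using that rep by blast
qed

section \<open>Polynomials in a linear operator\<close>

locale linear_operator = vector_space scale
  for scale :: "'k :: field \<Rightarrow> 'w :: ab_group_add \<Rightarrow> 'w" (infixr "*s" 75) +
  fixes T :: "'w \<Rightarrow> 'w"
  assumes T_add: "T (v + w) = T v + T w" and T_scale: "T (c *s v) = c *s T v"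
begin

text \<open>The vector \<open>p(T) v\<close>.\<close>
definition po :: "'k poly \<Rightarrow> 'w \<Rightarrow> 'w" where
  "po p v = fold_coeffs (\<lambda>c x. c *s v + T x) p 0"

lemma T_0 [simp]: "T 0 = 0" using T_add[of 0 0] by simp

lemma po_0 [simp]: "po 0 v = 0" by (simp add: po_def)

lemma po_pCons [simp]: "po (pCons c p) v = c *s v + T (po p v)"
  by (cases "c = 0 \<and> p = 0") (auto simp: po_def)

lemma po_1 [simp]: "po 1 v = v" by (simp add: one_pCons)

lemma po_add: "po (p + q) v = po p v + po q v"
  by (induction p q rule: poly_induct2) (simp_all add: T_add scale_left_distrib)

lemma po_smult: "po (Polynomial.smult c p) v = c *s po p v"
  by (induction p) (simp_all add: T_scale scale_right_distrib)

lemma po_mult: "po (p * q) v = po p (po q v)"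
  by (induction p) (simp_all add: po_add po_smult)

lemma po_vec_add: "po p (v + w) = po p v + po p w"
  by (induction p) (simp_all add: T_add scale_right_distrib)

lemma po_vec_scale: "po p (c *s v) = c *s po p v"
  by (induction p) (simp_all add: T_scale scale_right_distrib mult.commute)

lemma po_vec_0 [simp]: "po p 0 = 0" using po_vec_scale[of p 0 0] by simp

lemma po_vec_minus: "po p (- v) = - po p v"
  using po_vec_scale[of p "-1" v] by (simp add: scale_minus_left)

lemma po_vec_diff: "po p (v - w) = po p v - po p w"
  using po_vec_add[of p v "- w"] by (simp add: po_vec_minus)

lemma po_commute:
  assumes "\<And>v w. S (v + w) = S v + S w" "\<And>c v. S (c *s v) = c *s S v" "\<And>v. S (T v) = T (S v)"
  shows "S (po p v) = po p (S v)"
proof -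
  have "S 0 = 0" using assms(1)[of 0 0] by simp
  then show ?thesis by (induction p) (simp_all add: assms)
qed

lemma po_swap: "po p (po q v) = po q (po p v)"
  by (simp add: po_mult[symmetric] mult.commute)

lemma po_T: "po p (T v) = T (po p v)"
  by (rule po_commute[symmetric]) (simp_all add: T_add T_scale)

lemma po_linear: "po [:-l, 1:] v = T v - l *s v"
  by (simp add: scale_minus_left)

lemma po_power_0_mono: "po (L ^ r) v = 0 \<Longrightarrow> r \<le> k \<Longrightarrow> po (L ^ k) v = 0"
  using po_mult[of "L ^ (k - r)" "L ^ r" v] by (simp add: power_add[symmetric])

lemma po_eigen: "T v = l *s v \<Longrightarrow> po p v = poly p l *s v"
  by (induction p) (simp_all add: T_scale scale_left_distrib mult.commute)

text \<open>
  The last vector of a Jordan chain lies in every nonzero invariant subspace of its span: write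
  \<open>p = (x - l)\<^sup>k p'\<close> with \<open>p'(l) \<noteq> 0\<close>; then \<open>(T - l)\<^bsup>r-1-k\<^esup>\<close> maps \<open>p(T) v\<close> to \<open>p'(l) (T - l)\<^bsup>r-1\<^esup> v\<close>.
\<close>
lemma chain_socle:
  assumes r: "r \<ge> 1" and v: "po ([:-l, 1:] ^ r) v = 0" and p: "po p v \<noteq> 0"
  obtains q where "po q (po p v) = po ([:-l, 1:] ^ (r - 1)) v"
proof -
  let ?L = "[:-l, 1:]"
  have "p \<noteq> 0" using p by auto
  then obtain p' where p': "p = ?L ^ order l p * p'" "\<not> ?L dvd p'" using order_decomp by blast
  define k where "k = order l p"
  have k: "p = ?L ^ k * p'" using p'(1) by (simp add: k_def)
  have "k < r"
  proof (rule ccontr)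
    assume "\<not> k < r"
    then have "po (?L ^ k) v = 0" using po_power_0_mono[OF v] by simp
    then have "po p v = 0" unfolding k by (simp add: po_mult po_swap[of "?L ^ k"])
    then show False using p by simp
  qed
  have c: "poly p' l \<noteq> 0" using p'(2) by (simp add: poly_eq_0_iff_dvd)
  have "?L dvd p' - [:poly p' l:]" by (simp add: poly_eq_0_iff_dvd[symmetric])
  then obtain p'' where "p' - [:poly p' l:] = ?L * p''" by (elim dvdE)
  then have p'': "p' = [:poly p' l:] + ?L * p''" by (simp add: algebra_simps)
  have "?L ^ (r - 1 - k) * p = ?L ^ (r - 1) * p'"
    unfolding k using \<open>k < r\<close> by (simp add: mult.assoc[symmetric] power_add[symmetric])
  also have "\<dots> = Polynomial.smult (poly p' l) (?L ^ (r - 1)) + p'' * (?L * ?L ^ (r - 1))"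
    by (subst p'') (simp add: algebra_simps)
  also have "?L * ?L ^ (r - 1) = ?L ^ r" using r by (simp add: power_eq_if)
  finally have "po (?L ^ (r - 1 - k)) (po p v) = poly p' l *s po (?L ^ (r - 1)) v"
    by (simp only: po_mult[symmetric] po_add po_smult) (simp add: po_mult v)
  then have "po (Polynomial.smult (inverse (poly p' l)) (?L ^ (r - 1 - k))) (po p v) = po (?L ^ (r - 1)) v"
    using c by (simp add: po_smult)
  then show ?thesis using that by blast
qed

text \<open>
  For the coefficients of \<open>p\<close> in the powers of \<open>L\<close> the system is triangular, with the nonzero
  value of \<open>\<phi>\<close> at the last vector of the chain on the diagonal. It is solved from \<open>k = r - 1\<close>
  downwards.
\<close>
lemma chain_functional_solve:
  assumes r: "r \<ge> 1" and v: "po (L ^ r) v = 0"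
    and phi_add: "\<And>v w. \<phi> (v + w) = \<phi> v + (\<phi> w :: 'k)" and phi_scale: "\<And>c v. \<phi> (c *s v) = c * \<phi> v"
    and e: "\<phi> (po (L ^ (r - 1)) v) \<noteq> 0"
  shows "\<exists>p. \<forall>k<r. \<phi> (po (L ^ k) (po p v)) = y k"
proof -
  have phi0: "\<phi> 0 = 0" using phi_scale[of 0 0] by simp
  have "\<exists>p. \<forall>k. r - j \<le> k \<and> k < r \<longrightarrow> \<phi> (po (L ^ k) (po p v)) = y k" if "j \<le> r" for j
    using that
  proof (induction j)
    case 0
    then show ?case by auto
  next
    case (Suc j)
    then obtain p where p: "\<And>k. r - j \<le> k \<Longrightarrow> k < r \<Longrightarrow> \<phi> (po (L ^ k) (po p v)) = y k" by auto
    define k0 where "k0 = r - Suc j"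
    define c where "c = (y k0 - \<phi> (po (L ^ k0) (po p v))) / \<phi> (po (L ^ (r - 1)) v)"
    have new: "po (L ^ k) (po (p + Polynomial.smult c (L ^ j)) v) = po (L ^ k) (po p v) + c *s po (L ^ (k + j)) v" for k
      by (simp add: po_add po_smult po_vec_add po_vec_scale po_mult power_add)
    have "\<phi> (po (L ^ k) (po (p + Polynomial.smult c (L ^ j)) v)) = y k" if "r - Suc j \<le> k" "k < r" for k
    proof (cases "k = k0")
      case True
      have "k0 + j = r - 1" using Suc.prems by (simp add: k0_def)
      then show ?thesis unfolding new True using e by (simp add: phi_add phi_scale c_def)
    next
      case False
      then have "r - j \<le> k" "r \<le> k + j" using that unfolding k0_def by auto
      then show ?thesis unfolding new using p that(2) po_power_0_mono[OF v] by (simp add: phi_add phi0)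
    qed
    then show ?case by blast
  qed
  from this[of r] show ?thesis by simp
qed

text \<open>Every polynomial in \<open>T\<close> is a combination of powers of \<open>T - l\<close>.\<close>
lemma functional_vanishes:
  assumes phi_add: "\<And>v w. \<phi> (v + w) = \<phi> v + (\<phi> w :: 'k)" and phi_scale: "\<And>c v. \<phi> (c *s v) = c * \<phi> v"
    and m: "po ([:-l, 1:] ^ r) m = 0" "\<And>k. k < r \<Longrightarrow> \<phi> (po ([:-l, 1:] ^ k) m) = 0"
  shows "\<phi> (po f m) = 0"
proof -
  let ?L = "[:-l, 1:]"
  have phi0: "\<phi> 0 = 0" using phi_scale[of 0 0] by simp
  have "\<forall>k. \<phi> (po (?L ^ k) m) = 0"
    using m(2) po_power_0_mono[OF m(1)] phi0 by (metis linorder_not_less)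
  then show ?thesis
  proof (induction f arbitrary: m)
    case 0
    then show ?case by (simp add: phi0)
  next
    case (pCons c f)
    have T: "T m = po ?L m + l *s m" by (simp add: scale_minus_left)
    have "\<phi> (po (?L ^ k) (T m)) = 0" for k
    proof -
      have "po (?L ^ k) (po ?L m) = po (?L ^ Suc k) m" by (simp only: power_Suc2 po_mult)
      then show ?thesis
        unfolding T po_vec_add po_vec_scale phi_add phi_scale
        using pCons.prems[rule_format, of "Suc k"] pCons.prems[rule_format, of k]
        by (simp del: po_pCons power_Suc)
    qed
    then have "\<phi> (po f (T m)) = 0" using pCons.IH by blast
    moreover have "\<phi> m = 0" using pCons.prems[rule_format, of 0] by simp
    ultimately show ?case by (simp add: phi_add phi_scale po_T)
  qed
qed

end

section \<open>Arithmetic of the parameters\<close>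

locale dih_setup =
  fixes p s t n :: nat and \<xi> :: "'k :: field"
  assumes char: "CHAR('k) = p" and odd_p: "odd p" and s: "s \<ge> 1" and p_t: "\<not> p dvd t"
    and n: "n = p ^ s * t" and even_n: "even n" and xi: "primitive_root_of_unity t \<xi>"
begin

definition q where "q = p ^ s"

lemma prime_p: "prime p"
  using prime_CHAR_semidom[where 'a='k] char odd_p by (cases "p = 0") auto

lemma p_ge: "p \<ge> 3"
  using prime_p odd_p prime_ge_2_nat[of p] by (cases "p = 2") auto

lemma n_q: "n = q * t" by (simp add: n q_def)
lemma odd_q: "odd q" using odd_p by (simp add: q_def)
lemma even_t: "even t" using even_n odd_q by (simp add: n_q)
lemma t_pos: "t > 0" using xi by (simp add: primitive_root_of_unity_def)
lemma t_ge: "t \<ge> 2" using t_pos even_t by presburger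
lemma q_ge: "q \<ge> 3"
  using p_ge self_le_power[of p s] s unfolding q_def by linarith
lemma n_ge: "n \<ge> 6" using mult_le_mono[OF q_ge t_ge] by (simp add: n_q)
lemma n_pos: "n > 0" "n > 1" "n \<noteq> 0" "1 < n" "Suc 0 < n" using n_ge by auto

lemma two_nonzero: "(2 :: 'k) \<noteq> 0"
proof
  assume "(2 :: 'k) = 0"
  then have "of_nat 2 = (0 :: 'k)" by simp
  then have "p dvd 2" unfolding of_nat_eq_0_iff_char_dvd char .
  then show False using p_ge by (auto dest: dvd_imp_le)
qed

lemma t_nonzero: "of_nat t \<noteq> (0 :: 'k)"
  using p_t by (simp add: of_nat_eq_0_iff_char_dvd char)

lemma xi_t: "\<xi> ^ t = 1" and xi_neq: "0 < m \<Longrightarrow> m < t \<Longrightarrow> \<xi> ^ m \<noteq> 1"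
  using xi by (simp_all add: primitive_root_of_unity_def)

lemma xi_nonzero: "\<xi> \<noteq> 0" using xi_t t_pos by (metis power_0_left zero_neq_one less_numeral_extra(3))

lemma frobenius_diff: "(x - y) ^ q = x ^ q - (y :: 'k) ^ q"
  using freshmans_dream'[of q s "x" "- y"] prime_p char odd_q by (simp add: q_def)

lemma frobenius_inj: "x ^ q = y ^ q \<longleftrightarrow> x = (y :: 'k)"
  using frobenius_diff[of x y] by (auto simp: power_0_left)

lemma frobenius_poly: "[:- l, 1:] ^ q = [:0, 1:] ^ q - [:(l :: 'k) ^ q:]"
proof -
  have "CHAR('k poly) = p" by (simp add: char)
  then have "([:0, 1:] + [:- l:] :: 'k poly) ^ q = [:0, 1:] ^ q + [:- l:] ^ q"
    using freshmans_dream'[of q s "[:0, 1:] :: 'k poly" "[:- l:]"] prime_p by (simp add: q_def)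
  then show ?thesis using odd_q by (simp add: poly_const_pow)
qed

lemma xi_pow_inj: "\<xi> ^ i = \<xi> ^ j \<longleftrightarrow> i = j" if "i < t" "j < t"
proof -
  have aux: "i = j" if "\<xi> ^ i = \<xi> ^ j" "i \<le> j" "j < t" for i j
  proof (rule ccontr)
    assume "i \<noteq> j"
    have "\<xi> ^ j = \<xi> ^ i * \<xi> ^ (j - i)" using that(2) by (simp flip: power_add)
    then have "\<xi> ^ (j - i) = 1" using that xi_nonzero by simp
    then show False using xi_neq[of "j - i"] that \<open>i \<noteq> j\<close> by auto
  qed
  show ?thesis using aux[of i j] aux[of j i] that by (cases "i \<le> j") auto
qed

lemma xi_half: "\<xi> ^ (t div 2) = - 1"
proof -
  have "(\<xi> ^ (t div 2)) ^ 2 = 1" using even_t xi_t by (simp add: power_mult[symmetric])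
  moreover have "\<xi> ^ (t div 2) \<noteq> 1" using t_ge by (intro xi_neq) auto
  ultimately show ?thesis by (simp add: power2_eq_1_iff)
qed

lemma xi_pow_t: "(\<xi> ^ i) ^ t = 1"
  by (metis power_mult mult.commute xi_t power_one)

text \<open>
  The polynomial \<open>x\<^sup>t - 1\<close> has at most \<open>t\<close> roots, and the powers of \<open>\<xi>\<close> are \<open>t\<close> of them.
\<close>
lemma roots_of_unity: "x ^ t = 1 \<Longrightarrow> \<exists>j<t. x = \<xi> ^ j"
proof -
  assume x: "x ^ t = 1"
  let ?P = "monom 1 t - 1 :: 'k poly"
  have "degree ?P = t"
    using t_pos using degree_add_eq_left[of "- 1 :: 'k poly" "monom 1 t"] by (simp add: degree_monom_eq)
  moreover have P0: "?P \<noteq> 0" using \<open>degree ?P = t\<close> t_pos by force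
  ultimately have fin: "finite {x. poly ?P x = 0}" "card {x. poly ?P x = 0} \<le> t"
    using poly_roots_finite[OF P0] card_poly_roots_bound[OF P0] by simp_all
  have "(\<lambda>j. \<xi> ^ j) ` {..<t} \<subseteq> {x. poly ?P x = 0}" by (auto simp: poly_monom xi_pow_t)
  moreover have "card ((\<lambda>j. \<xi> ^ j) ` {..<t}) = t"
    by (subst card_image) (auto simp: inj_on_def xi_pow_inj)
  ultimately have "(\<lambda>j. \<xi> ^ j) ` {..<t} = {x. poly ?P x = 0}"
    using fin by (intro card_seteq) auto
  moreover have "x \<in> {x. poly ?P x = 0}" using x by (simp add: poly_monom)
  ultimately show ?thesis by auto
qed

text \<open>
  Orthogonality of characters. The exponent \<open>q\<close> is harmless because the Frobenius map is
  injective.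
\<close>
lemma xi_sum: "(\<Sum>i<t. (\<xi> ^ i) ^ (q * j)) = (if j = 0 then of_nat t else 0)" if "j < t"
proof (cases "j = 0")
  case False
  have "(\<xi> ^ j) ^ q \<noteq> 1 ^ q" unfolding frobenius_inj using xi_neq[of j] False that by auto
  then have x: "\<xi> ^ (q * j) \<noteq> 1" by (simp add: power_mult[symmetric] mult.commute)
  have "(\<Sum>i<t. (\<xi> ^ i) ^ (q * j)) = (\<Sum>i<t. (\<xi> ^ (q * j)) ^ i)"
    by (intro sum.cong refl) (simp add: power_mult[symmetric] mult.commute)
  also have "\<dots> = ((\<xi> ^ (q * j)) ^ t - 1) / (\<xi> ^ (q * j) - 1)" by (rule geometric_sum[OF x])
  finally show ?thesis using False xi_pow_t by simp
qed simp

end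

section \<open>Representations of the dihedral group\<close>

lemma dih_carrier [simp]: "(i, e) \<in> carrier (dihedral n) \<longleftrightarrow> i < n"
  by (auto simp: dihedral_def)

lemma dih_mult [simp]:
  "(i, e) \<otimes>\<^bsub>dihedral n\<^esub> (j, f) = ((if e then i + (n - j) else i + j) mod n, e \<noteq> f)"
  by (simp add: dihedral_def)

lemma dih_one [simp]: "\<one>\<^bsub>dihedral n\<^esub> = (0, False)"
  by (simp add: dihedral_def)

lemma dih_conj_rotation:
  assumes "i < n" "l < n"
  shows "(i, False) \<otimes>\<^bsub>dihedral n\<^esub> (l, e) \<otimes>\<^bsub>dihedral n\<^esub> inv\<^bsub>dihedral n\<^esub> (i, False) =
     (if e then (l + 2 * i) mod n else l, e)"
proof (cases e)
  case True
  have "((i + l) mod n + (n - (n - i) mod n)) mod n = (l + 2 * i) mod n"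
  proof (cases "i = 0")
    case False
    then have "n - (n - i) mod n = i" using assms by simp
    then have "((i + l) mod n + (n - (n - i) mod n)) mod n = (i + l + i) mod n" by (simp add: mod_add_left_eq)
    moreover have "i + l + i = l + 2 * i" by simp
    ultimately show ?thesis by (simp only:)
  qed (use assms in simp)
  then show ?thesis using True assms by (simp add: dihedral_inv)
next
  case False
  have "((i + l) mod n + (n - i) mod n) mod n = l" using assms by (simp add: mod_add_eq ac_simps)
  then show ?thesis using False assms by (simp add: dihedral_inv)
qed

lemma dih_conj_b:
  assumes "l < n"
  shows "(0, True) \<otimes>\<^bsub>dihedral n\<^esub> (l, e) \<otimes>\<^bsub>dihedral n\<^esub> inv\<^bsub>dihedral n\<^esub> (0, True) = ((n - l) mod n, e)"
  using assms by (auto simp: dihedral_inv)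

lemma dih_inverse:
  assumes "i < n"
  shows "inv\<^bsub>dihedral n\<^esub> (i, e) = (if e then (i, True) else ((n - i) mod n, False))"
  using assms by (simp add: dihedral_inv)

locale dih_rep = dih_setup p s t n \<xi> + yd_rep "dihedral n" scale \<rho> \<pi>
  for p s t n :: nat and \<xi> :: "'k :: field"
    and scale :: "'k \<Rightarrow> 'w :: ab_group_add \<Rightarrow> 'w" (infixr "*s" 75) and \<rho> \<pi>
begin

abbreviation "A \<equiv> \<rho> (Suc 0, False)"
abbreviation "B \<equiv> \<rho> (0, True)"
abbreviation "I \<equiv> \<rho> (0, False)"

text \<open>
  Reducing the exponent makes \<open>n - 1\<close> available as an exponent for the inverse of \<open>a\<close>.
\<close>
definition Apow :: "nat \<Rightarrow> 'w \<Rightarrow> 'w" where "Apow k = \<rho> (k mod n, False)"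
abbreviation "A' \<equiv> Apow (n - Suc 0)"

lemma carr: "(Suc 0, False) \<in> carrier (dihedral n)" "(0, e) \<in> carrier (dihedral n)"
  "(k mod n, e) \<in> carrier (dihedral n)"
  using n_pos by auto

sublocale op: linear_operator scale A
  by unfold_locales (simp_all add: rho_add rho_scale n_pos)

abbreviation "po \<equiv> op.po"
abbreviation "L l \<equiv> [:- (l :: 'k), 1:]"

lemma Apow_add: "Apow (j + k) v = Apow j (Apow k v)"
  unfolding Apow_def using rho_mult[of "(j mod n, False)" "(k mod n, False)" v] carr(3)
  by (simp add: mod_add_eq)

lemma Apow_0: "Apow 0 v = I v" by (simp add: Apow_def)
lemma Apow_1: "Apow 1 v = A v" "Apow (Suc 0) v = A v" using n_pos by (simp_all add: Apow_def)
lemma Apow_n: "Apow n v = I v" by (simp add: Apow_def)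
lemma Apow_Suc: "Apow (Suc k) v = A (Apow k v)" using Apow_add[of 1 k v] Apow_1 by simp
lemma Apow_Suc2: "Apow (Suc k) v = Apow k (A v)" using Apow_add[of k 1 v] Apow_1 by simp
lemma I_Apow [simp]: "I (Apow k v) = Apow k v" using rho_M[OF carr(3)] by (simp add: Apow_def)
lemma I_A [simp]: "I (A v) = A v" using rho_M[OF carr(1)] by simp
lemma I_B [simp]: "I (B v) = B v" using rho_M[OF carr(2)] by simp
lemma B_I [simp]: "B (I v) = B v" using rho_one_right[OF carr(2)] by simp
lemma Apow_lin: "Apow k (v + w) = Apow k v + Apow k w" "Apow k (c *s v) = c *s Apow k v"
  "Apow k (v - w) = Apow k v - Apow k w" "Apow k 0 = 0"
  unfolding Apow_def by (simp_all add: rho_add rho_scale rho_diff n_pos)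
lemma B_lin: "B (v + w) = B v + B w" "B (c *s v) = c *s B v" "B (v - w) = B v - B w" "B 0 = 0"
  by (simp_all add: rho_add rho_scale rho_diff n_pos)
lemma A_lin: "A (v + w) = A v + A w" "A (c *s v) = c *s A v" "A (v - w) = A v - A w" "A 0 = 0"
  by (simp_all add: rho_add rho_scale rho_diff n_pos)
lemma I_lin: "I (v + w) = I v + I w" "I (c *s v) = c *s I v" "I (v - w) = I v - I w" "I 0 = 0"
  by (simp_all add: rho_add rho_scale rho_diff n_pos)

lemma A_A': "A (A' v) = I v" "A' (A v) = I v"
  using Apow_Suc[of "n - Suc 0" v] Apow_Suc2[of "n - Suc 0" v] n_pos by (simp_all add: Apow_n)

lemma BB: "B (B v) = I v"
  using rho_mult[OF carr(2) carr(2), of True True v] n_pos by (simp)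

lemma rho_True: "i < n \<Longrightarrow> \<rho> (i, True) v = Apow i (B v)"
  using rho_mult[of "(i, False)" "(0, True)" v] by (simp add: Apow_def)
lemma rho_False: "i < n \<Longrightarrow> \<rho> (i, False) v = Apow i v"
  by (simp add: Apow_def)

lemma B_A: "B (A v) = A' (B v)"
  using rho_mult[of "(0, True)" "(Suc 0, False)" v] rho_True[of "n - Suc 0" v] n_pos by simp

lemma B_A': "B (A' v) = A (B v)"
proof -
  have "B (A' v) = A (A' (B (A' v)))" by (simp only: A_A' I_B)
  also have "\<dots> = A (B (A (A' v)))" by (simp only: B_A)
  also have "\<dots> = A (B v)" by (simp only: A_A' B_I)
  finally show ?thesis .
qed

lemma A_B: "A (B v) = B (A' v)" by (simp add: B_A')

lemma B_Apow: "Apow k (B v) = B (((Apow (n - Suc 0)) ^^ k) v)" if "I v = v"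
proof (induction k)
  case (Suc k)
  then show ?case by (simp add: Apow_Suc A_B)
qed (simp add: Apow_0 that)

lemma closed_G:
  assumes "\<And>w. w \<in> S \<Longrightarrow> I w = w" "\<And>w. w \<in> S \<Longrightarrow> A w \<in> S" "\<And>w. w \<in> S \<Longrightarrow> B w \<in> S"
    and "g \<in> carrier (dihedral n)" "w \<in> S"
  shows "\<rho> g w \<in> S"
proof -
  have *: "Apow k w \<in> S" if "w \<in> S" for k w
    by (induction k) (simp_all add: Apow_0 Apow_Suc assms(1,2) that)
  obtain i e where g: "g = (i, e)" "i < n" using assms(4) by (cases g) auto
  show ?thesis unfolding g(1) by (cases e) (simp_all add: * rho_True rho_False g(2) assms(3,5))
qed

lemma pi_rho_False: "i < n \<Longrightarrow> l < n \<Longrightarrow> \<pi> (l, False) (\<rho> (i, False) v) = \<rho> (i, False) (\<pi> (l, False) v)"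
  using pi_rho[of "(i, False)" "(l, False)" v] dih_conj_rotation[of i n l False] by simp

lemma pi_Apow: "l < n \<Longrightarrow> \<pi> (l, False) (Apow k v) = Apow k (\<pi> (l, False) v)"
  using pi_rho_False[of "k mod n" l v] n_pos by (simp add: Apow_def)

lemma pi_A: "l < n \<Longrightarrow> \<pi> (l, False) (A v) = A (\<pi> (l, False) v)"
  using pi_Apow[of l 1 v] by (simp add: Apow_1)

lemma pi_B: "l < n \<Longrightarrow> \<pi> ((n - l) mod n, False) (B v) = B (\<pi> (l, False) v)"
  using pi_rho[of "(0, True)" "(l, False)" v] dih_conj_b[of l n False] by simp

lemma pi_po: "l < n \<Longrightarrow> \<pi> (l, False) (po f v) = po f (\<pi> (l, False) v)"
  by (rule op.po_commute) (simp_all add: pi_add pi_scale pi_A)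

lemma Apow_po: "Apow k (po f v) = po f (Apow k v)"
  by (rule op.po_commute) (simp_all add: Apow_lin Apow_Suc[symmetric] Apow_Suc2[symmetric])

lemma I_po: "I (po f v) = po f (I v)"
  using Apow_po[of 0] by (simp add: Apow_0)

lemma po_x_power: "po ([:0, 1:] ^ k) v = Apow k v" if "I v = v"
  by (induction k) (simp_all add: that Apow_0 Apow_Suc op.po_mult)

text \<open>In characteristic \<open>p\<close> this is the identity \<open>(x - l)\<^sup>q = x\<^sup>q - l\<^sup>q\<close>.\<close>
lemma po_frobenius: "po (L l ^ q) v = Apow q v - l ^ q *s v" if "I v = v"
proof -
  have "po (L l ^ q) v + po [:l ^ q:] v = po ([:0, 1:] ^ q) v"
    unfolding op.po_add[symmetric] frobenius_poly by simp
  then show ?thesis using po_x_power[OF that] by (simp add: eq_diff_eq)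
qed

lemma Apow_cyc_eigen: "Apow q v = l ^ q *s v" if "I v = v" "r \<le> q" "po (L l ^ r) v = 0"
  using po_frobenius[OF that(1), of l] op.po_power_0_mono[OF that(3,2)] by simp

text \<open>
  The projection onto the generalized \<open>l\<close>-eigenspace of \<open>a\<close>. Since \<open>(a - l)\<^sup>q = a\<^sup>q - l\<^sup>q\<close>, this is
  the \<open>l\<^sup>q\<close>-eigenspace of \<open>a\<^sup>q\<close>, whose order divides \<open>t\<close>; as \<open>t\<close> is invertible, averaging over the
  powers of \<open>a\<^sup>q\<close> gives the projection.
\<close>
definition el :: "'k \<Rightarrow> 'w \<Rightarrow> 'w" where
  "el l v = (\<Sum>j<t. (inverse (l ^ (q * j)) / of_nat t) *s Apow (q * j) v)"

lemma el_add: "el l (v + w) = el l v + el l w"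
  by (simp add: el_def Apow_lin scale_right_distrib sum.distrib)
lemma el_scale: "el l (c *s v) = c *s el l v"
  by (simp add: el_def Apow_lin scale_sum_right mult.commute)
lemma el_0 [simp]: "el l 0 = 0" by (simp add: el_def Apow_lin)
lemma el_sum: "el l (\<Sum>x\<in>X. f x) = (\<Sum>x\<in>X. el l (f x))"
  by (induction X rule: infinite_finite_induct) (simp_all add: el_add)
lemma el_commute:
  assumes "\<And>v w. S (v + w) = S v + S w" "\<And>c v. S (c *s v) = c *s S v" "\<And>k v. S (Apow k v) = Apow k (S v)"
  shows "S (el l v) = el l (S v)"
proof -
  have "S 0 = 0" using assms(1)[of 0 0] by simp
  then have "S (\<Sum>x\<in>X. f x) = (\<Sum>x\<in>X. S (f x))" for X and f :: "nat \<Rightarrow> 'w"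
    by (induction X rule: infinite_finite_induct) (simp_all add: assms)
  then show ?thesis by (simp add: el_def assms)
qed
lemma el_A: "el l (A v) = A (el l v)"
  by (rule el_commute[symmetric]) (simp_all add: A_lin Apow_Suc[symmetric] Apow_Suc2[symmetric])
lemma el_Apow: "el l (Apow k v) = Apow k (el l v)"
  by (rule el_commute[symmetric]) (simp_all add: Apow_lin Apow_add[symmetric] add.commute)
lemma el_po: "el l (po f v) = po f (el l v)"
  by (rule op.po_commute) (simp_all add: el_add el_scale el_A)
lemma el_pi: "m < n \<Longrightarrow> el l (\<pi> (m, False) v) = \<pi> (m, False) (el l v)"
  by (rule el_commute[symmetric]) (simp_all add: pi_add pi_scale pi_Apow)
lemma I_el [simp]: "I (el l v) = el l v"
  by (simp add: el_def rho_sum rho_scale n_pos)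
lemma el_subm: "subm S \<Longrightarrow> v \<in> S \<Longrightarrow> el l v \<in> S"
  unfolding el_def Apow_def by (intro subm_sum) (simp_all add: submD n_pos)

lemma el_eigen:
  assumes "I v = v" "Apow q v = m ^ q *s v" "l ^ t = 1" "m ^ t = 1"
  shows "el l v = (if m = l then v else 0)"
proof -
  have l0: "l \<noteq> 0" using assms(3) t_pos by (auto simp: power_0_left)
  have "Apow (q * j) v = (m ^ q) ^ j *s v" for j
    by (induction j) (simp_all add: Apow_0 assms Apow_add Apow_lin)
  then have "el l v = (\<Sum>j<t. (inverse (l ^ (q * j)) / of_nat t * (m ^ q) ^ j) *s v)"
    by (simp add: el_def)
  also have "\<dots> = (\<Sum>j<t. ((m / l) ^ q) ^ j / of_nat t) *s v"
    unfolding scale_sum_left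
    by (intro sum.cong refl) (simp add: divide_simps power_mult power_divide)
  also have "(\<Sum>j<t. ((m / l) ^ q) ^ j / of_nat t) = (\<Sum>j<t. ((m / l) ^ q) ^ j) / of_nat t"
    by (simp add: sum_divide_distrib)
  also have "(\<Sum>j<t. ((m / l) ^ q) ^ j) = (if m = l then of_nat t else 0)"
  proof (cases "m = l")
    case True
    then show ?thesis using l0 by simp
  next
    case False
    then have x: "(m / l) ^ q \<noteq> 1" using l0 frobenius_inj[of "m / l" 1] by auto
    have "(m / l) ^ t = 1" by (simp add: power_divide assms)
    then have "((m / l) ^ q) ^ t = 1" by (metis power_mult mult.commute power_one)
    then show ?thesis using geometric_sum[OF x, of t] False by simp
  qed
  finally show ?thesis using t_nonzero by simp
qed

lemma el_range: "Apow q (el l v) = l ^ q *s el l v" if "l ^ t = 1"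
proof -
  have l0: "l \<noteq> 0" using that t_pos by (auto simp: power_0_left)
  define f where "f j = (inverse (l ^ (q * j)) / of_nat t) *s Apow (q * j) v" for j
  have "Apow q (el l v) = (\<Sum>j<t. Apow q (f j))"
    unfolding el_def f_def Apow_def by (simp add: rho_sum n_pos)
  also have "\<dots> = (\<Sum>j<t. l ^ q *s f (Suc j))"
    unfolding f_def using l0 by (intro sum.cong refl) (simp add: Apow_lin Apow_add power_add field_simps)
  also have "\<dots> = l ^ q *s (\<Sum>j<t. f (Suc j))" by (simp add: scale_sum_right)
  also have "(\<Sum>j<t. f (Suc j)) = (\<Sum>j<t. f j)"
  proof -
    have "l ^ (q * t) = 1" by (metis that power_mult mult.commute power_one)
    then have "f t = f 0" unfolding f_def by (simp add: n_q[symmetric] Apow_n Apow_0)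
    moreover have "f 0 + (\<Sum>j<t. f (Suc j)) = (\<Sum>j<t. f j) + f t"
      using sum.lessThan_Suc_shift[of f t] sum.lessThan_Suc[of f t] by (simp add: add.commute)
    ultimately show ?thesis by (simp add: add.commute)
  qed
  finally show ?thesis by (simp add: el_def f_def)
qed

lemma el_complete: "(\<Sum>i<t. el (\<xi> ^ i) v) = I v"
proof -
  \<comment> \<open>Inverting the roots of unity turns the inverse powers in the projections into powers.\<close>
  have "(\<Sum>i<t. el (\<xi> ^ i) v) = (\<Sum>i<t. el (inverse (\<xi> ^ i)) v)"
  proof (rule sum.reindex_bij_witness[where i="\<lambda>i. (t - i) mod t" and j="\<lambda>i. (t - i) mod t"])
    fix i assume i: "i \<in> {..<t}"
    have "\<xi> ^ ((t - i) mod t) * \<xi> ^ i = 1"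
      using i xi_t by (cases "i = 0") (simp_all flip: power_add)
    then show "el (inverse (\<xi> ^ ((t - i) mod t))) v = el (\<xi> ^ i) v"
      by (simp add: inverse_unique)
  qed (auto simp: t_pos, (metis diff_diff_cancel diff_self_eq_0 diff_zero less_imp_le mod_less mod_self diff_less neq0_conv not_less0 t_pos)+)
  also have "\<dots> = (\<Sum>i<t. \<Sum>j<t. ((\<xi> ^ i) ^ (q * j) / of_nat t) *s Apow (q * j) v)"
    by (simp add: el_def power_inverse)
  also have "\<dots> = (\<Sum>j<t. (\<Sum>i<t. (\<xi> ^ i) ^ (q * j) / of_nat t) *s Apow (q * j) v)"
    by (subst sum.swap) (simp add: scale_sum_left)
  also have "\<dots> = (\<Sum>j<t. if j = 0 then I v else 0)"
    by (intro sum.cong refl) (auto simp: sum_divide_distrib[symmetric] xi_sum t_nonzero Apow_0)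
  also have "\<dots> = I v" using t_pos by simp
  finally show ?thesis .
qed

text \<open>
  The relation \<open>b a = a\<^sup>-\<^sup>1 b\<close> gives \<open>(a - l\<^sup>-\<^sup>1) b = -l\<^sup>-\<^sup>1 b a\<^sup>-\<^sup>1 (a - l)\<close>, so \<open>b\<close> maps Jordan chains
  for \<open>l\<close> to Jordan chains for \<open>l\<^sup>-\<^sup>1\<close>, up to units.
\<close>
lemma po_L_B:
  assumes "I w = w" "l \<noteq> 0"
  shows "po (L (inverse l) ^ k) (B w) = ((- inverse l) ^ k) *s B ((A' ^^ k) (po (L l ^ k) w))"
  using assms(1)
proof (induction k arbitrary: w)
  case (Suc k)
  have "po (L (inverse l)) (B w) = A (B w) - inverse l *s B w" by (rule op.po_linear)
  also have "\<dots> = (- inverse l) *s B (A' (po (L l) w))"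
    unfolding op.po_linear using assms(2) Suc.prems
    by (simp add: A_B Apow_lin A_A' B_lin scale_right_diff_distrib scale_minus_left)
  finally have 1: "po (L (inverse l)) (B w) = (- inverse l) *s B (A' (po (L l) w))" .
  have A'_pow: "(A' ^^ j) (A' x) = A' ((A' ^^ j) x)" for j x
    by (induction j) simp_all
  have "po (L (inverse l) ^ Suc k) (B w) = po (L (inverse l) ^ k) (po (L (inverse l)) (B w))"
    by (simp only: power_Suc2 op.po_mult)
  also have "\<dots> = (- inverse l) *s po (L (inverse l) ^ k) (B (A' (po (L l) w)))"
    by (simp only: 1 op.po_vec_scale)
  also have "\<dots> = (- inverse l) *s ((- inverse l) ^ k *s B ((A' ^^ k) (po (L l ^ k) (A' (po (L l) w)))))"
    by (subst Suc.IH) simp_all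
  also have "\<dots> = (- inverse l) ^ Suc k *s B ((A' ^^ k) (A' (po (L l ^ k) (po (L l) w))))"
    by (simp only: scale_scale power_Suc Apow_po)
  also have "\<dots> = (- inverse l) ^ Suc k *s B ((A' ^^ Suc k) (po (L l ^ Suc k) w))"
    by (simp only: A'_pow funpow.simps comp_apply power_Suc2 op.po_mult)
  finally show ?case .
qed simp

end

section \<open>Generators of indecomposable modules\<close>

text \<open>
  A label \<open>g, \<dots>\<close> describes a generator \<open>v\<close> of degree \<open>g\<close> by the action of the centralizer of \<open>g\<close>.
  For \<open>Central g l \<epsilon> r\<close> and \<open>Cyclic g l r\<close> the degree is a rotation and \<open>v\<close> is the top of a Jordan
  chain of \<open>a\<close> with eigenvalue \<open>l\<close> and length \<open>r\<close>; in the central case \<open>a b\<close> moreover maps \<open>v\<close> to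
  \<open>\<epsilon> v\<close>. For \<open>Klein g \<alpha> \<beta>\<close> the degree is \<open>b\<close> or \<open>a b\<close>, and the two generators of its centralizer,
  a Klein four group, act on \<open>v\<close> by \<open>\<alpha>\<close> and \<open>\<beta>\<close>.
\<close>
datatype 'k label = Central dih 'k 'k nat | Cyclic dih 'k nat | Klein dih 'k 'k

definition jordan_chain :: "('k :: field, dih, 'v, 'd) kG_module_scheme \<Rightarrow> 'k \<Rightarrow> nat \<Rightarrow> 'v \<Rightarrow> bool" where
  "jordan_chain M l r v \<longleftrightarrow> r \<ge> 1 \<and> (\<exists>u. u 0 = v \<and>
     (\<forall>k<r. u k \<in> carrier M \<and> act M (1, False) (u k) = l \<odot>\<^bsub>M\<^esub> u k \<oplus>\<^bsub>M\<^esub> u (Suc k)) \<and>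
     u r = \<zero>\<^bsub>M\<^esub> \<and> u (r - 1) \<noteq> \<zero>\<^bsub>M\<^esub>)"

fun is_gen :: "nat \<Rightarrow> ('k :: field, dih, 'v, 'd) yd_module_scheme \<Rightarrow> 'k label \<Rightarrow> 'v \<Rightarrow> bool" where
  "is_gen n M (Central g l \<epsilon> r) v \<longleftrightarrow> v \<in> carrier M \<and> coact M v g = v \<and> jordan_chain M l r v \<and>
     act M (1, True) v = \<epsilon> \<odot>\<^bsub>M\<^esub> v"
| "is_gen n M (Cyclic g l r) v \<longleftrightarrow> v \<in> carrier M \<and> coact M v g = v \<and> jordan_chain M l r v"
| "is_gen n M (Klein g \<alpha> \<beta>) v \<longleftrightarrow> v \<in> carrier M \<and> v \<noteq> \<zero>\<^bsub>M\<^esub> \<and> coact M v g = v \<and>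
     act M (n div 2, False) v = \<alpha> \<odot>\<^bsub>M\<^esub> v \<and> act M g v = \<beta> \<odot>\<^bsub>M\<^esub> v"

context dih_setup
begin

abbreviation "central \<equiv> {(0 :: nat, False), (n div 2, False)}"

text \<open>
  The two kinds of labels with a rotation as degree differ in whether \<open>v\<close> and \<open>b v\<close> have the same
  degree and the same generalized eigenvalue, that is, in whether \<open>g\<close> and \<open>l\<close> are both their own
  inverses.
\<close>
fun valid :: "'k label \<Rightarrow> bool" where
  "valid (Central g l \<epsilon> r) \<longleftrightarrow> g \<in> central \<and> l\<^sup>2 = 1 \<and> \<epsilon>\<^sup>2 = 1 \<and> 1 \<le> r \<and> r \<le> q"
| "valid (Cyclic g l r) \<longleftrightarrow> (\<exists>m<n. g = (m, False)) \<and> l ^ t = 1 \<and> 1 \<le> r \<and> r \<le> q \<and> \<not> (g \<in> central \<and> l\<^sup>2 = 1)"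
| "valid (Klein g \<alpha> \<beta>) \<longleftrightarrow> g \<in> {(0, True), (1, True)} \<and> \<alpha>\<^sup>2 = 1 \<and> \<beta>\<^sup>2 = 1"

lemma square_t: "l\<^sup>2 = 1 \<Longrightarrow> l ^ t = (1 :: 'k)"
  using even_t by (metis dvd_mult_div_cancel power_mult power_one)

lemma central_iff: "m < n \<Longrightarrow> (m, False) \<in> central \<longleftrightarrow> (n - m) mod n = m"
proof -
  assume "m < n"
  then show ?thesis using even_n by (cases "m = 0") auto
qed

lemma half: "n div 2 < n" "2 * (n div 2) = n" "n div 2 \<noteq> 0" "1 < n div 2"
  using n_ge even_n by auto

end

fun label_degree :: "'k label \<Rightarrow> dih" where
  "label_degree (Central g l \<epsilon> r) = g"
| "label_degree (Cyclic g l r) = g"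
| "label_degree (Klein g \<alpha> \<beta>) = g"

lemma (in dih_setup) degree_carrier: "valid X \<Longrightarrow> label_degree X \<in> carrier (dihedral n)"
  using n_pos half by (cases X) auto

context dih_rep
begin

abbreviation "R \<equiv> yd_of (dihedral n) scale \<rho> \<pi>"

text \<open>The vector that will be shown to lie in every nonzero submodule of \<open>kGv\<close>.\<close>
fun soc :: "'k label \<Rightarrow> 'w \<Rightarrow> 'w" where
  "soc (Central g l \<epsilon> r) v = po (L l ^ (r - 1)) v"
| "soc (Cyclic g l r) v = po (L l ^ (r - 1)) v"
| "soc (Klein g \<alpha> \<beta>) v = v"

lemma jordan_chain_iff:
  "jordan_chain R l r v \<longleftrightarrow> r \<ge> 1 \<and> I v = v \<and> po (L l ^ r) v = 0 \<and> po (L l ^ (r - 1)) v \<noteq> 0"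
proof
  assume "jordan_chain R l r v"
  then obtain u where r: "r \<ge> 1" and u: "u 0 = v" "\<And>k. k < r \<Longrightarrow> I (u k) = u k"
    "\<And>k. k < r \<Longrightarrow> A (u k) = l *s u k + u (Suc k)" "u r = 0" "u (r - 1) \<noteq> 0"
    unfolding jordan_chain_def by auto
  have "u k = po (L l ^ k) v" if "k \<le> r" for k
    using that
  proof (induction k)
    case (Suc k)
    then have "u (Suc k) = po (L l) (u k)" using u(3)[of k] unfolding op.po_linear by simp
    then show ?case using Suc by (simp only: Suc_leD power_Suc op.po_mult)
  qed (simp add: u)
  from this[of r] this[of "r - 1"] show "r \<ge> 1 \<and> I v = v \<and> po (L l ^ r) v = 0 \<and> po (L l ^ (r - 1)) v \<noteq> 0"
    using u r by auto
next
  assume *: "r \<ge> 1 \<and> I v = v \<and> po (L l ^ r) v = 0 \<and> po (L l ^ (r - 1)) v \<noteq> 0"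
  have "A (po (L l ^ k) v) = l *s po (L l ^ k) v + po (L l ^ Suc k) v" for k
    unfolding power_Suc op.po_mult op.po_linear by simp
  then show "jordan_chain R l r v"
    unfolding jordan_chain_def using *
    by (intro conjI exI[of _ "\<lambda>k. po (L l ^ k) v"]) (simp_all add: I_po)
qed

lemma gen_degree: "is_gen n R X v \<Longrightarrow> \<pi> (label_degree X) v = v"
  by (cases X) auto

lemma gen_I: "is_gen n R X v \<Longrightarrow> I v = v"
  by (cases X) auto

lemma subm_po: "subm S \<Longrightarrow> w \<in> S \<Longrightarrow> po f w \<in> S"
  by (induction f) (simp_all add: submD n_pos)

lemma cyc_po: "w \<in> cyc v \<Longrightarrow> po f w \<in> cyc v"
  by (induction f) (simp_all add: cyc_0 cyc_add cyc_scale cyc_rho n_pos)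

lemma soc_cyc: "is_gen n R X v \<Longrightarrow> soc X v \<in> cyc v"
  using cyc_self[of v] gen_I[of X v] by (cases X) (simp_all add: cyc_po del: is_gen.simps)

lemma soc_nonzero: "is_gen n R X v \<Longrightarrow> soc X v \<noteq> 0"
  by (cases X) (simp_all add: jordan_chain_iff)

lemma cyc_subset:
  assumes "I v = v" "v \<in> S" "0 \<in> S" "\<And>x y. x \<in> S \<Longrightarrow> y \<in> S \<Longrightarrow> x + y \<in> S" "\<And>c x. x \<in> S \<Longrightarrow> c *s x \<in> S"
    "\<And>w. w \<in> S \<Longrightarrow> I w = w" "\<And>w. w \<in> S \<Longrightarrow> A w \<in> S" "\<And>w. w \<in> S \<Longrightarrow> B w \<in> S"
  shows "cyc v \<subseteq> S"
  by (rule cyc_least) (use assms closed_G[of S, OF assms(6-8)] in auto)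

lemma central_B: "is_gen n R (Central g l \<epsilon> r) v \<Longrightarrow> B v = \<epsilon> *s A' v"
proof -
  assume "is_gen n R (Central g l \<epsilon> r) v"
  then have "A (B v) = \<epsilon> *s v" using rho_True[of 1 v] n_pos by (simp add: Apow_1)
  then have "A' (A (B v)) = \<epsilon> *s A' v" by (simp add: Apow_lin)
  then show ?thesis by (simp only: A_A' I_B)
qed

text \<open>
  As \<open>b v = \<epsilon> a\<^sup>-\<^sup>1 v\<close>, the vectors \<open>f(a) v\<close> already form a subspace stable under \<open>b\<close>.
\<close>
lemma central_cyc:
  assumes v: "is_gen n R (Central g l \<epsilon> r) v" and u: "u \<in> cyc v"
  obtains f where "u = po f v"
proof -
  have I: "I v = v" using gen_I[OF v] .
  let ?S = "range (\<lambda>f. po f v)"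
  have A': "A' w \<in> ?S" if "w \<in> ?S" for w
  proof -
    obtain f where "w = po f v" using \<open>w \<in> ?S\<close> by auto
    then have "A' w = po (f * [:0, 1:] ^ (n - Suc 0)) v"
      by (simp only: Apow_po op.po_mult po_x_power[OF I])
    then show ?thesis by blast
  qed
  have plus: "x + y \<in> ?S" if "x \<in> ?S" "y \<in> ?S" for x y
    using that by (auto simp: op.po_add[symmetric])
  have scl: "c *s x \<in> ?S" if "x \<in> ?S" for c x
    using that by (auto simp: op.po_smult[symmetric])
  have v_S: "v \<in> ?S" using op.po_1 by (metis rangeI)
  have zero_S: "0 \<in> ?S" using op.po_0 by (metis rangeI)
  have "B (po f v) \<in> ?S" for f
    by (induction f) (simp_all add: B_lin zero_S B_A central_B[OF v] plus scl A' v_S del: is_gen.simps)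
  moreover have "A w \<in> ?S" if "w \<in> ?S" for w
    using that op.po_pCons[of 0] by (auto intro!: image_eqI[of _ _ "pCons 0 _"])
  ultimately have "cyc v \<subseteq> ?S"
    by (intro cyc_subset I v_S zero_S plus scl) (auto simp: I_po I)
  then show ?thesis using u that by blast
qed

text \<open>
  The operator \<open>b\<close> swaps the two summands, and \<open>a\<close> acts on the second one through \<open>a\<^sup>-\<^sup>1\<close>.
\<close>
lemma cyclic_cyc:
  assumes I: "I v = v" and u: "u \<in> cyc v"
  obtains f h where "u = po f v + B (po h v)"
proof -
  let ?S = "{po f v + B (po h v) | f h. True}"
  have S: "po f v + B (po h v) \<in> ?S" for f h by blast
  have A': "A' (po f v) = po (f * [:0, 1:] ^ (n - Suc 0)) v" for f
    by (simp only: Apow_po op.po_mult po_x_power[OF I])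
  have "cyc v \<subseteq> ?S"
  proof (rule cyc_subset[OF I])
    show "v \<in> ?S" using S[of 1 0] by (simp add: B_lin)
    show "0 \<in> ?S" using S[of 0 0] by (simp add: B_lin)
    fix x assume "x \<in> ?S"
    then obtain f h where x: "x = po f v + B (po h v)" by blast
    show "I x = x" unfolding x by (simp add: I_lin I_po I)
    show "c *s x \<in> ?S" for c
      using S[of "Polynomial.smult c f" "Polynomial.smult c h"] unfolding x
      by (simp add: op.po_smult B_lin scale_right_distrib)
    have "A x = po (pCons 0 f) v + B (po (h * [:0, 1:] ^ (n - Suc 0)) v)"
      unfolding x A'[symmetric] by (simp add: A_lin A_B)
    then show "A x \<in> ?S" by blast
    have "B x = po h v + B (po f v)"
      unfolding x by (simp add: B_lin BB I_po I add.commute)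
    then show "B x \<in> ?S" by blast
    fix y assume "y \<in> ?S"
    then obtain f' h' where y: "y = po f' v + B (po h' v)" by blast
    have "x + y = po (f + f') v + B (po (h + h') v)"
      unfolding x y by (simp add: op.po_add B_lin)
    then show "x + y \<in> ?S" by blast
  qed
  then show ?thesis using u that by blast
qed

text \<open>
  The projection onto the part of degree \<open>g\<close> and generalized eigenvalue \<open>l\<close>. For a generator \<open>v\<close>
  with a cyclic label it separates the two summands \<open>f(a) v\<close> and \<open>b h(a) v\<close>.
\<close>
definition pr :: "dih \<Rightarrow> 'k \<Rightarrow> 'w \<Rightarrow> 'w" where "pr g l v = el l (\<pi> g v)"

lemma pr_add: "g \<in> carrier (dihedral n) \<Longrightarrow> pr g l (v + w) = pr g l v + pr g l w"
  by (simp add: pr_def pi_add el_add)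
lemma pr_scale: "g \<in> carrier (dihedral n) \<Longrightarrow> pr g l (c *s v) = c *s pr g l v"
  by (simp add: pr_def pi_scale el_scale)
lemma pr_subm: "g \<in> carrier (dihedral n) \<Longrightarrow> subm S \<Longrightarrow> v \<in> S \<Longrightarrow> pr g l v \<in> S"
  by (simp add: pr_def el_subm submD)
lemma pr_po: "m < n \<Longrightarrow> pr (m, False) l (po f v) = po f (pr (m, False) l v)"
  by (simp add: pr_def pi_po el_po)
lemma pr_Apow: "m < n \<Longrightarrow> pr (m, False) l (Apow k v) = Apow k (pr (m, False) l v)"
  by (simp add: pr_def pi_Apow el_Apow)
lemma I_pr [simp]: "I (pr g l v) = pr g l v" by (simp add: pr_def)
lemma pi_pr: "m < n \<Longrightarrow> \<pi> (m, False) (pr (m, False) l v) = pr (m, False) l v"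
  by (simp add: pr_def el_pi[symmetric] pi_pi)
lemma Apow_pr: "l ^ t = 1 \<Longrightarrow> Apow q (pr g l v) = l ^ q *s pr g l v"
  by (simp add: pr_def el_range)

lemma pr_eigen:
  assumes "m < n" "m' < n" "\<pi> (m', False) v = v" "I v = v" "Apow q v = l' ^ q *s v" "l ^ t = 1" "l' ^ t = 1"
  shows "pr (m, False) l v = (if (m', l') = (m, l) then v else 0)"
proof (cases "m' = m")
  case True
  then show ?thesis unfolding pr_def using assms el_eigen[of v l' l] by simp
next
  case False
  have "\<pi> (m, False) v = \<pi> (m, False) (\<pi> (m', False) v)" by (simp add: assms)
  also have "\<dots> = 0" using assms False by (subst pi_pi) auto
  finally show ?thesis using False by (simp add: pr_def)
qed

lemma pr_chain:
  assumes "m < n" "m' < n" "\<pi> (m', False) v = v" "I v = v" "po (L l' ^ r) v = 0" "r \<le> q" "l ^ t = 1" "l' ^ t = 1"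
  shows "pr (m, False) l v = (if (m', l') = (m, l) then v else 0)"
  using assms Apow_cyc_eigen[OF assms(4,6,5)] by (intro pr_eigen) auto

lemma B_chain:
  assumes "I v = v" "l ^ t = 1" "po (L l ^ r) v = 0"
  shows "po (L (inverse l) ^ r) (B v) = 0"
proof -
  have l0: "l \<noteq> 0" using assms(2) t_pos by (auto simp: power_0_left)
  have "(A' ^^ k) 0 = 0" for k by (induction k) (simp_all add: Apow_lin)
  then show ?thesis using po_L_B[OF assms(1) l0, of r] assms(3) by (simp add: B_lin)
qed

lemma pi_B_deg: "m < n \<Longrightarrow> \<pi> (m, False) v = v \<Longrightarrow> \<pi> ((n - m) mod n, False) (B v) = B v"
  using pi_B[of m v] by simp

lemma inverse_root: "l ^ t = 1 \<Longrightarrow> inverse l ^ t = (1 :: 'k)"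
  by (simp add: power_inverse)

lemma inverse_eq_iff: "l ^ t = 1 \<Longrightarrow> inverse l = l \<longleftrightarrow> l\<^sup>2 = (1 :: 'k)"
proof -
  assume "l ^ t = 1"
  then have "l \<noteq> 0" using t_pos by (auto simp: power_0_left)
  then show ?thesis unfolding power2_eq_square by (metis left_inverse inverse_unique)
qed

text \<open>
  The vector \<open>b v\<close> has degree \<open>g\<^sup>-\<^sup>1\<close> and generalized eigenvalue \<open>l\<^sup>-\<^sup>1\<close>, and validity of the label
  says that this pair is different from \<open>(g, l)\<close>.
\<close>
lemma pr_B_zero:
  assumes X: "valid (Cyclic (m, False) l r)" and v: "I v = v" "\<pi> (m, False) v = v" "po (L l ^ r) v = 0"
  shows "pr (m, False) l (B v) = 0"
proof -
  have *: "m < n" "l ^ t = 1" "r \<le> q" "\<not> ((m, False) \<in> central \<and> l\<^sup>2 = 1)" using X by auto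
  have ne: "((n - m) mod n, inverse l) \<noteq> (m, l)"
    using *(4) central_iff[OF *(1)] inverse_eq_iff[OF *(2)] by auto
  have "pr (m, False) l (B v) = (if ((n - m) mod n, inverse l) = (m, l) then B v else 0)"
    by (rule pr_chain[where r=r])
      (use * v pi_B_deg[of m v] B_chain[of v l r] inverse_root n_pos in auto)
  then show ?thesis unfolding if_not_P[OF ne] .
qed

lemma cyclic_pr:
  assumes X: "valid (Cyclic (m, False) l r)" and v: "is_gen n R (Cyclic (m, False) l r) v"
    and u: "u = po f v + B (po h v)"
  shows "pr (m, False) l u = po f v" "pr (m, False) l (B u) = po h v"
proof -
  have *: "m < n" "l ^ t = 1" "r \<le> q" using X by auto
  have g: "(m, False) \<in> carrier (dihedral n)" using * by simp
  have v': "I v = v" "\<pi> (m, False) v = v" "po (L l ^ r) v = 0" using v by (auto simp: jordan_chain_iff)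
  have po: "I (po k v) = po k v" "\<pi> (m, False) (po k v) = po k v" "po (L l ^ r) (po k v) = 0" for k
    using v' * by (simp_all add: I_po pi_po op.po_swap[of "L l ^ r"])
  have 1: "pr (m, False) l (po k v) = po k v" for k
    using pr_chain[OF *(1) *(1) po(2) po(1) po(3) *(3) *(2) *(2)] by simp
  have 2: "pr (m, False) l (B (po k v)) = 0" for k by (rule pr_B_zero[OF X po])
  show "pr (m, False) l u = po f v" unfolding u by (simp add: pr_add[OF g] 1 2)
  have "B u = po h v + B (po f v)" unfolding u by (simp add: B_lin BB po add.commute)
  then show "pr (m, False) l (B u) = po h v" by (simp add: pr_add[OF g] 1 2)
qed

lemma centr_klein:
  assumes "g = (k, True)" "k \<le> 1"
  shows "centralizer g = {(0, False), (n div 2, False), (k, True), (k + n div 2, True)}"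
proof -
  have kn: "k < n" "k + n div 2 < n" using assms half by auto
  have "(i, e) \<in> centralizer g \<longleftrightarrow> (i, e) \<in> {(0, False), (n div 2, False), (k, True), (k + n div 2, True)}" for i e
  proof (cases "i < n")
    case True
    show ?thesis
    proof (cases e)
      case False
      have "(k + 2 * i) mod n = k \<longleftrightarrow> i = 0 \<or> i = n div 2"
      proof
        assume "(k + 2 * i) mod n = k"
        then have "n dvd 2 * i" using kn by (metis add_diff_cancel_left' dvd_minus_mod mod_less mod_eq_dvd_iff_nat le_add1)
        then obtain c where c: "2 * i = n * c" by blast
        then have "c < 2" using True using mult_le_mono2[of 2 c n] by linarith
        then show "i = 0 \<or> i = n div 2" using c half(2) by (cases c) auto
      qed (use kn half in auto)
      then show ?thesis using False True assms kn dih_conj_rotation[of i n k True] by (auto simp: centralizer_def)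
    next
      case e: True
      have "(i, True) \<otimes>\<^bsub>dihedral n\<^esub> (k, True) \<otimes>\<^bsub>dihedral n\<^esub> inv\<^bsub>dihedral n\<^esub> (i, True) = ((i + (n - k) + i) mod n, True)"
        using True by (simp add: dihedral_inv mod_add_left_eq)
      moreover have "(i + (n - k) + i) mod n = k \<longleftrightarrow> i = k \<or> i = k + n div 2"
      proof
        assume *: "(i + (n - k) + i) mod n = k"
        have "(i + (n - k) + i + k) mod n = (k + k) mod n" using * by (metis mod_add_left_eq)
        moreover have "i + (n - k) + i + k = 2 * i + n" using kn by simp
        ultimately have "(2 * i + n) mod n = (2 * k) mod n" by (simp only: mult_2)
        then have 1: "(2 * i) mod n = (2 * k) mod n" by (simp only: mod_add_self2)
        have "2 * k < n" using assms n_ge by simp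
        then have 2: "(2 * i) mod n = 2 * k" using 1 by simp
        then have "2 * i = 2 * k \<or> 2 * i = 2 * k + n"
        proof -
          have "2 * i = n * (2 * i div n) + 2 * k" using 2 by (metis mult_div_mod_eq)
          moreover have "2 * i div n < 2" using True by (simp add: div_less_iff_less_mult)
          ultimately show ?thesis by (cases "2 * i div n") auto
        qed
        then show "i = k \<or> i = k + n div 2" using half(2) by auto
      next
        assume "i = k \<or> i = k + n div 2"
        then show "(i + (n - k) + i) mod n = k"
        proof
          assume "i = k"
          then have "i + (n - k) + i = k + n" using kn by simp
          then show ?thesis using kn by simp
        next
          assume "i = k + n div 2"
          then have "i + (n - k) + i = k + 2 * n" using kn half(2) by simp
          then show ?thesis using kn by (metis mod_less mod_mult_self3 add.commute)
        qed
      qed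
      ultimately show ?thesis using e True assms kn by (auto simp: centralizer_def)
    qed
  next
    case False
    then show ?thesis using assms kn n_pos half by (auto simp: centralizer_def)
  qed
  then have *: "x \<in> centralizer g \<longleftrightarrow> x \<in> {(0, False), (n div 2, False), (k, True), (k + n div 2, True)}" for x
    by (cases x) (simp only:)
  show ?thesis by (rule Set.set_eqI) (rule *)
qed

definition klein_char :: "dih \<Rightarrow> 'k \<Rightarrow> 'k \<Rightarrow> dih \<Rightarrow> 'k" where
  "klein_char g \<alpha> \<beta> z = (if z = (0, False) then 1 else if z = (n div 2, False) then \<alpha>
     else if z = g then \<beta> else \<alpha> * \<beta>)"

lemma rho_klein: "k \<le> 1 \<Longrightarrow> \<rho> (k + n div 2, True) w = \<rho> (n div 2, False) (\<rho> (k, True) w)"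
proof -
  assume k: "k \<le> 1"
  have "k + n div 2 < n" "k < n" using k half n_ge by linarith+
  then show ?thesis using rho_mult[of "(n div 2, False)" "(k, True)" w] half by (simp add: add.commute)
qed

lemma klein_char:
  assumes "g = (k, True)" "k \<le> 1" "I v = v" "\<rho> (n div 2, False) v = \<alpha> *s v" "\<rho> g v = \<beta> *s v" "z \<in> centralizer g"
  shows "\<rho> z v = klein_char g \<alpha> \<beta> z *s v"
proof -
  consider "z = (0, False)" | "z = (n div 2, False)" | "z = g" | "z = (k + n div 2, True)"
    using assms(6) centr_klein[OF assms(1,2)] assms(1) by blast
  then show ?thesis
  proof cases
    case 4
    then have "\<rho> z v = \<alpha> *s \<beta> *s v"
      using rho_klein[OF assms(2), of v] assms(4,5) half
      by (simp add: assms(1)[symmetric] rho_scale mult.commute)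
    then show ?thesis using 4 half assms(1) by (simp add: klein_char_def)
  qed (use assms half in \<open>simp_all add: klein_char_def\<close>)
qed

lemma klein_pi_cyc:
  assumes X: "valid (Klein g \<alpha> \<beta>)" and v: "is_gen n R (Klein g \<alpha> \<beta>) v" and u: "u \<in> cyc v"
  obtains c where "\<pi> g u = c *s v"
proof -
  obtain k where k: "g = (k, True)" "k \<le> 1" using X by auto
  have g: "g \<in> carrier (dihedral n)" using degree_carrier[OF X] by simp
  obtain c where c: "\<pi> g u = (\<Sum>z\<in>centralizer g. c z *s \<rho> z v)" using pi_cyc[OF g _ u] v by auto
  also have "\<dots> = (\<Sum>z\<in>centralizer g. (c z * klein_char g \<alpha> \<beta> z) *s v)"
    using v k by (intro sum.cong refl) (simp add: klein_char[OF k])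
  also have "\<dots> = (\<Sum>z\<in>centralizer g. c z * klein_char g \<alpha> \<beta> z) *s v" by (simp add: scale_sum_left)
  finally show ?thesis using that by blast
qed

text \<open>
  A nonzero vector \<open>u\<close> of \<open>kGv\<close> is carried to the socle by operators that preserve submodules. In
  the central case \<open>u = f(a) v\<close>, and a polynomial in \<open>a\<close> leads to the end of the chain. In the
  cyclic case projecting \<open>u\<close> or \<open>b u\<close> first produces a nonzero vector of this form. In the Klein
  case the part of degree \<open>g\<close> of \<open>kGv\<close> is the line through \<open>v\<close>.
\<close>
lemma soc_minimal:
  assumes X: "valid X" and v: "is_gen n R X v" and S: "subm S" "S \<subseteq> cyc v" and u: "u \<in> S" "u \<noteq> 0"
  shows "soc X v \<in> S"
proof (cases X)
  case (Central g l \<epsilon> r)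
  have v': "po (L l ^ r) v = 0" "r \<ge> 1" using v unfolding Central by (simp_all add: jordan_chain_iff)
  obtain f where f: "u = po f v" using central_cyc[of g l \<epsilon> r v u] v S u unfolding Central by blast
  obtain h where "po h (po f v) = po (L l ^ (r - 1)) v"
    using op.chain_socle[OF v'(2,1), of f] u f by blast
  then show ?thesis using subm_po[OF S(1) u(1), of h] unfolding Central f by simp
next
  case (Cyclic g l r)
  obtain m where m: "m < n" "g = (m, False)" using X unfolding Cyclic by auto
  have g: "g \<in> carrier (dihedral n)" using m by simp
  have v': "po (L l ^ r) v = 0" "r \<ge> 1" "I v = v" using v unfolding Cyclic by (simp_all add: jordan_chain_iff)
  obtain f h where fh: "u = po f v + B (po h v)" using cyclic_cyc[OF v'(3)] S u by blast
  have pr: "pr g l u = po f v" "pr g l (B u) = po h v"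
    using cyclic_pr[of m l r v u f h] X v fh unfolding Cyclic m by auto
  have *: "soc X v \<in> S" if w: "po f v \<in> S" "po f v \<noteq> 0" for f
  proof -
    obtain k where "po k (po f v) = po (L l ^ (r - 1)) v" using op.chain_socle[OF v'(2,1), of f] w by blast
    then show ?thesis using subm_po[OF S(1) w(1), of k] unfolding Cyclic by simp
  qed
  have "po f v \<in> S" "po h v \<in> S"
    using pr_subm[OF g S(1), of u l] pr_subm[OF g S(1), of "B u" l] u submD(5)[OF S(1)] n_pos by (simp_all add: pr)
  moreover have "po f v \<noteq> 0 \<or> po h v \<noteq> 0" using u(2) fh by (auto simp: B_lin)
  ultimately show ?thesis using * by blast
next
  case (Klein g \<alpha> \<beta>)
  have g: "g \<in> carrier (dihedral n)" using degree_carrier[OF X] Klein by simp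
  obtain w where w: "w \<in> S" "w \<noteq> 0" "\<pi> g w = w"
    using subm_meets_degree[OF g _ S u] v Klein by auto
  obtain c where c: "\<pi> g w = c *s v" using klein_pi_cyc[of g \<alpha> \<beta> v w] X v w S unfolding Klein by blast
  then have "c \<noteq> 0" using w by auto
  then have "v = inverse c *s w" using c w by simp
  then show ?thesis using submD(4)[OF S(1) w(1), of "inverse c"] unfolding Klein by simp
qed

lemma gen_indecomposable:
  assumes X: "valid X" and v: "is_gen n R X v" and gen: "\<And>m. I m = m \<Longrightarrow> m \<in> cyc v"
  shows "yd_indecomposable (dihedral n) R"
proof (rule indecomposableI)
  show "soc X v \<noteq> 0" by (rule soc_nonzero[OF v])
  show "\<rho> \<one>\<^bsub>dihedral n\<^esub> (soc X v) = soc X v" using soc_cyc[OF v] cyc_M by simp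
  show "soc X v \<in> S" if "subm S" "u \<in> S" "u \<noteq> 0" for S u
  proof -
    have "S \<subseteq> cyc v" using gen submD(1)[OF that(1)] by auto
    then show ?thesis using soc_minimal[OF X v that(1) _ that(2,3)] by blast
  qed
qed

end

section \<open>The generator determines the label\<close>

lemma (in vector_space) functional_exists:
  assumes "w \<noteq> 0"
  shows "\<exists>\<phi> :: 'b \<Rightarrow> 'a. (\<forall>x y. \<phi> (x + y) = \<phi> x + \<phi> y) \<and> (\<forall>c x. \<phi> (scale c x) = c * \<phi> x) \<and> \<phi> w = 1"
proof -
  interpret vp: vector_space_pair scale "(*) :: 'a \<Rightarrow> 'a \<Rightarrow> 'a"
    by unfold_locales (simp_all add: algebra_simps)
  have "independent {w}" using assms by simp
  then obtain \<phi> where \<phi>: "Vector_Spaces.linear scale (*) \<phi>" "\<forall>x\<in>{w}. \<phi> x = (1 :: 'a)"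
    using vp.linear_independent_extend[of "{w}" "\<lambda>_. 1"] by blast
  interpret Vector_Spaces.linear scale "(*)" \<phi> by (fact \<phi>)
  show ?thesis using \<phi>(2) add scale by (intro exI[of _ \<phi>]) simp
qed

text \<open>The label of \<open>b v\<close> when \<open>v\<close> is a generator with a cyclic label.\<close>
fun inverse_label :: "nat \<Rightarrow> 'k :: field label \<Rightarrow> 'k label" where
  "inverse_label n (Cyclic g l r) = Cyclic ((n - fst g) mod n, snd g) (inverse l) r"
| "inverse_label n X = X"

context dih_rep
begin

lemma soc_degree:
  assumes X: "valid X" and v: "is_gen n R X v"
  shows "\<pi> (label_degree X) (soc X v) = soc X v"
proof (cases X)
  case (Central g l \<epsilon> r)
  then obtain m where "g = (m, False)" "m < n" using X n_pos half by auto
  then show ?thesis using v unfolding Central by (simp add: pi_po)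
next
  case (Cyclic g l r)
  then obtain m where "g = (m, False)" "m < n" using X by auto
  then show ?thesis using v unfolding Cyclic by (simp add: pi_po)
qed (use v in simp)

lemma chain_A:
  assumes "r \<ge> 1" "po (L l ^ r) v = 0"
  shows "A (po (L l ^ (r - 1)) v) = l *s po (L l ^ (r - 1)) v"
proof -
  have "po (L l) (po (L l ^ (r - 1)) v) = po (L l ^ r) v"
    unfolding op.po_mult[symmetric] using assms(1) by (simp only: power_Suc[symmetric]) simp
  then show ?thesis unfolding op.po_linear assms(2) by simp
qed

lemma A'_eigen: "A v = l *s v \<Longrightarrow> I v = v \<Longrightarrow> l \<noteq> 0 \<Longrightarrow> A' v = inverse l *s v"
proof -
  assume *: "A v = l *s v" "I v = v" "l \<noteq> 0"
  have "v = A' (A v)" using *(2) by (simp only: A_A')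
  also have "\<dots> = l *s A' v" using * by (simp add: Apow_lin)
  finally have "inverse l *s v = inverse l *s l *s A' v" by simp
  then show ?thesis using * by simp
qed

text \<open>
  The last vector \<open>e\<close> of the chain is an eigenvector of \<open>b\<close>, and its eigenvalue recovers \<open>\<epsilon>\<close> from
  \<open>l\<close> and \<open>r\<close>.
\<close>
lemma central_soc_B:
  assumes X: "valid (Central g l \<epsilon> r)" and v: "is_gen n R (Central g l \<epsilon> r) v"
  defines "e \<equiv> po (L l ^ (r - 1)) v"
  shows "B e = ((- 1) ^ (r - 1) * \<epsilon> * l) *s e"
proof -
  have l: "l * l = 1" using X by (simp add: power2_eq_square)
  then have l0: "l \<noteq> 0" by auto
  have il: "inverse l = l" using l by (simp add: inverse_unique)
  have v': "r \<ge> 1" "I v = v" "po (L l ^ r) v = 0" using v by (auto simp: jordan_chain_iff)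
  have Ie: "I e = e" unfolding e_def by (simp add: I_po v')
  have Ae: "A' e = l *s e" using A'_eigen[OF _ Ie l0] chain_A[OF v'(1,3)] il unfolding e_def by simp
  have A'e: "(A' ^^ k) e = l ^ k *s e" for k
    by (induction k) (simp_all add: Apow_lin Ae mult.commute)
  have "\<epsilon> *s l *s e = po (L l ^ (r - 1)) (B v)"
    unfolding central_B[OF v] by (simp only: op.po_vec_scale Apow_po[symmetric] e_def[symmetric] Ae)
  also have "\<dots> = ((- l) ^ (r - 1)) *s B (l ^ (r - 1) *s e)"
    using po_L_B[OF v'(2) l0, of "r - 1"] unfolding il e_def[symmetric] A'e .
  also have "\<dots> = (((- l) * l) ^ (r - 1)) *s B e"
    by (simp only: B_lin scale_scale power_mult_distrib)
  also have "(- l) * l = - 1" using l by simp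
  finally have 1: "\<epsilon> *s l *s e = (- 1) ^ (r - 1) *s B e" .
  have "(- 1) ^ (r - 1) *s (\<epsilon> *s l *s e) = ((- 1) ^ (r - 1) * (- 1) ^ (r - 1)) *s B e"
    unfolding 1 by simp
  also have "(- 1) ^ (r - 1) * (- 1) ^ (r - 1) = (1 :: 'k)"
    by (simp add: power_mult_distrib[symmetric])
  finally show ?thesis by (simp add: mult.assoc)
qed

lemma gen_M_subm: "subm {m. I m = m}"
  unfolding subm_def using rho_M pi_M by (simp add: I_lin)

text \<open>The nonzero submodule generated by the socle for \<open>v\<close> contains the socle for \<open>w\<close>.\<close>
lemma soc_in_cyc_soc:
  assumes X: "valid X" "is_gen n R X v" and Y: "valid Y" "is_gen n R Y w"
    and gen: "\<And>m. I m = m \<Longrightarrow> m \<in> cyc w"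
  shows "soc Y w \<in> cyc (soc X v)"
proof -
  have S: "subm (cyc (soc X v))" using cyc_subm[OF degree_carrier[OF X(1)] soc_degree[OF X]] .
  have "I (soc X v) = soc X v" using submD(1)[OF gen_M_subm] soc_cyc[OF X(2)] cyc_M by simp
  then have "soc X v \<in> cyc (soc X v)" using cyc_self by simp
  moreover have "cyc (soc X v) \<subseteq> cyc w" using gen submD(1)[OF S] by auto
  ultimately show ?thesis using soc_minimal[OF Y S _ _ soc_nonzero[OF X(2)]] by blast
qed

lemma same_degree:
  assumes "g \<in> carrier (dihedral n)" "h \<in> carrier (dihedral n)" "\<pi> g v = v" "\<pi> h v = v" "v \<noteq> 0"
  shows "g = h"
  using pi_pi[OF assms(1,2), of v] assms by (auto split: if_splits)

lemma same_eigenvalue: "T v = a *s v \<Longrightarrow> T v = b *s v \<Longrightarrow> v \<noteq> 0 \<Longrightarrow> a = b"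
  by (metis scale_cancel_right)

text \<open>
  The two socles are proportional, so \<open>a\<close>, \<open>b\<close> and the coaction have the same eigenvalues and the
  same degree on them. The length of the chain is determined because each generator is a
  polynomial in \<open>a\<close> applied to the other.
\<close>
lemma central_unique:
  assumes X: "valid (Central g l \<epsilon> r)" "is_gen n R (Central g l \<epsilon> r) v" and Y: "valid Y" "is_gen n R Y w"
    and genX: "\<And>m. I m = m \<Longrightarrow> m \<in> cyc v" and genY: "\<And>m. I m = m \<Longrightarrow> m \<in> cyc w"
  shows "Y = Central g l \<epsilon> r"
proof -
  let ?X = "Central g l \<epsilon> r"
  define e where "e = soc ?X v"
  define e' where "e' = soc Y w"
  have v': "r \<ge> 1" "I v = v" "po (L l ^ r) v = 0" using X(2) by (auto simp: jordan_chain_iff)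
  have Ae: "A e = l *s e" using chain_A[OF v'(1,3)] by (simp add: e_def)
  have Be: "B e = ((- 1) ^ (r - 1) * \<epsilon> * l) *s e" using central_soc_B[OF X] by (simp add: e_def)
  have Ie: "I e = e" by (simp add: e_def I_po v')
  have e0: "e \<noteq> 0" "e' \<noteq> 0" using soc_nonzero[OF X(2)] soc_nonzero[OF Y(2)] by (auto simp only: e_def e'_def)
  have "cyc e \<subseteq> range (\<lambda>c. c *s e)"
  proof (rule cyc_subset[OF Ie])
    show "e \<in> range (\<lambda>c. c *s e)" by (metis rangeI scale_one)
    show "0 \<in> range (\<lambda>c. c *s e)" by (metis rangeI scale_zero_left)
  qed (auto simp: scale_left_distrib[symmetric] Ae Be A_lin B_lin I_lin Ie)
  moreover have "e' \<in> cyc e" unfolding e_def e'_def by (rule soc_in_cyc_soc[OF X Y genY])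
  ultimately obtain c where c: "e' = c *s e" by auto
  have Ae': "A e' = l *s e'" and Be': "B e' = ((- 1) ^ (r - 1) * \<epsilon> * l) *s e'"
    unfolding c by (simp_all add: A_lin B_lin Ae Be mult.commute)
  have gc: "g \<in> carrier (dihedral n)" using degree_carrier[OF X(1)] by simp
  have "\<pi> g e' = e'" using soc_degree[OF X] gc unfolding c e_def by (simp add: pi_scale)
  then have g: "label_degree Y = g"
    using same_degree[OF degree_carrier[OF Y(1)] gc _ _ e0(2)] soc_degree[OF Y] by (simp add: e'_def)
  show ?thesis
  proof (cases Y)
    case Y': (Central g' l' \<epsilon>' r')
    have w': "r' \<ge> 1" "I w = w" "po (L l' ^ r') w = 0" "po (L l' ^ (r' - 1)) w \<noteq> 0"
      using Y(2) unfolding Y' by (auto simp: jordan_chain_iff)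
    have "A e' = l' *s e'" using chain_A[OF w'(1,3)] by (simp add: e'_def Y')
    then have l: "l' = l" using same_eigenvalue[of A, OF _ Ae' e0(2)] by blast
    obtain f where f: "w = po f v" using central_cyc[OF X(2) genX[OF w'(2)]] .
    obtain h where h: "v = po h w" using central_cyc[of g' l' \<epsilon>' r' w v] Y(2) genY[OF v'(2)] unfolding Y' by blast
    have "po (L l ^ r) w = 0"
      unfolding f using v'(3) by (simp only: op.po_swap[of "L l ^ _"] op.po_vec_0)
    moreover have "po (L l ^ r') v = 0"
      by (subst h) (use w'(3) l in \<open>simp only: op.po_swap[of "L l ^ _"] op.po_vec_0\<close>)
    moreover have "po (L l ^ (r - 1)) v \<noteq> 0" using X(2) by (auto simp: jordan_chain_iff)
    ultimately have "\<not> r \<le> r' - 1" "\<not> r' \<le> r - 1" using w'(4) op.po_power_0_mono l by blast+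
    then have r: "r' = r" using v'(1) w'(1) by linarith
    have "B e' = ((- 1) ^ (r - 1) * \<epsilon>' * l) *s e'"
      using central_soc_B[of g' l' \<epsilon>' r' w] Y unfolding Y' e'_def l r by simp
    then have "(- 1) ^ (r - 1) * \<epsilon>' * l = (- 1) ^ (r - 1) * \<epsilon> * l"
      using same_eigenvalue[of B, OF _ Be' e0(2)] by blast
    moreover have "l \<noteq> 0" using X(1) by auto
    ultimately have "\<epsilon>' = \<epsilon>" by simp
    then show ?thesis using g l r Y' by simp
  next
    case Y': (Cyclic g' l' r')
    have w': "r' \<ge> 1" "po (L l' ^ r') w = 0" using Y(2) unfolding Y' by (auto simp: jordan_chain_iff)
    have "A e' = l' *s e'" using chain_A[OF w'] by (simp add: e'_def Y')
    then have "l' = l" using same_eigenvalue[of A, OF _ Ae' e0(2)] by blast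
    then show ?thesis using X(1) Y(1) g unfolding Y' by auto
  next
    case (Klein g' \<alpha>' \<beta>')
    then show ?thesis using X(1) Y(1) g by auto
  qed
qed

text \<open>As \<open>n\<close> is even, \<open>b\<close> and \<open>a b\<close> are not conjugate.\<close>
lemma conj_parity:
  assumes "x \<in> carrier (dihedral n)" "k < n"
  obtains m where "x \<otimes>\<^bsub>dihedral n\<^esub> (k, True) \<otimes>\<^bsub>dihedral n\<^esub> inv\<^bsub>dihedral n\<^esub> x = (m, True)" "even m = even k"
proof -
  obtain i e where x: "x = (i, e)" "i < n" using assms by (cases x) auto
  show ?thesis
  proof (cases e)
    case True
    have "x \<otimes>\<^bsub>dihedral n\<^esub> (k, True) \<otimes>\<^bsub>dihedral n\<^esub> inv\<^bsub>dihedral n\<^esub> x = ((i + (n - k) + i) mod n, True)"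
      using True x by (simp add: dihedral_inv mod_add_left_eq)
    moreover have "even ((i + (n - k) + i) mod n) = even k"
      using assms even_n by (subst dvd_mod_iff[OF even_n]) (auto simp: even_diff_nat)
    ultimately show ?thesis using that by blast
  next
    case False
    have "x \<otimes>\<^bsub>dihedral n\<^esub> (k, True) \<otimes>\<^bsub>dihedral n\<^esub> inv\<^bsub>dihedral n\<^esub> x = ((k + 2 * i) mod n, True)"
      using dih_conj_rotation[of i n k True] False x assms by simp
    moreover have "even ((k + 2 * i) mod n) = even k"
      by (subst dvd_mod_iff[OF even_n]) auto
    ultimately show ?thesis using that by blast
  qed
qed

lemma klein_unique:
  assumes X: "valid (Klein g \<alpha> \<beta>)" "is_gen n R (Klein g \<alpha> \<beta>) v" and Y: "valid Y" "is_gen n R Y w"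
    and genX: "\<And>m. I m = m \<Longrightarrow> m \<in> cyc v"
  shows "Y = Klein g \<alpha> \<beta>"
proof -
  let ?h = "label_degree Y"
  have hc: "?h \<in> carrier (dihedral n)" by (rule degree_carrier[OF Y(1)])
  have gc: "g \<in> carrier (dihedral n)" using degree_carrier[OF X(1)] by simp
  obtain k where k: "g = (k, True)" "k \<le> 1" using X(1) by auto
  have w: "I w = w" "\<pi> ?h w = w" using gen_I[OF Y(2)] gen_degree[OF Y(2)] by auto
  have w0: "w \<noteq> 0"
    using soc_nonzero[OF Y(2)] soc_cyc[OF Y(2)] by (cases Y) (auto simp del: is_gen.simps simp: gen_I)
  obtain x where x: "x \<in> carrier (dihedral n)" "x \<otimes>\<^bsub>dihedral n\<^esub> g \<otimes>\<^bsub>dihedral n\<^esub> inv\<^bsub>dihedral n\<^esub> x = ?h"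
    using pi_cyc_support[OF gc _ genX[OF w(1)] hc] X(2) w w0 by auto
  obtain m where m: "?h = (m, True)" "even m = even k"
    using conj_parity[OF x(1), of k] x(2) k n_ge by auto
  obtain h \<alpha>' \<beta>' where Y': "Y = Klein h \<alpha>' \<beta>'" using Y(1) m(1) by (cases Y) auto
  have "h = g" using Y(1) m k unfolding Y' by (auto simp: le_Suc_eq)
  obtain c where "\<pi> g w = c *s v" using klein_pi_cyc[OF X genX[OF w(1)]] .
  then have c: "w = c *s v" using w(2) Y' \<open>h = g\<close> by simp
  have "\<rho> (n div 2, False) w = \<alpha> *s w" "\<rho> g w = \<beta> *s w"
    using X(2) gc half unfolding c by (simp_all add: rho_scale mult.commute)
  moreover have "\<rho> (n div 2, False) w = \<alpha>' *s w" "\<rho> g w = \<beta>' *s w"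
    using Y(2) unfolding Y' \<open>h = g\<close> by simp_all
  ultimately have "\<alpha>' = \<alpha>" "\<beta>' = \<beta>" using w0 by auto
  then show ?thesis using Y' \<open>h = g\<close> by simp
qed

lemma gen_B:
  assumes X: "valid (Cyclic (m, False) l r)" and v: "is_gen n R (Cyclic (m, False) l r) v"
  shows "is_gen n R (Cyclic ((n - m) mod n, False) (inverse l) r) (B v)"
proof -
  have *: "m < n" "l ^ t = 1" using X by auto
  have l0: "l \<noteq> 0" using *(2) t_pos by (auto simp: power_0_left)
  have v': "r \<ge> 1" "I v = v" "\<pi> (m, False) v = v" "po (L l ^ r) v = 0" "po (L l ^ (r - 1)) v \<noteq> 0"
    using v by (auto simp: jordan_chain_iff)
  let ?e = "po (L l ^ (r - 1)) v"
  have Ie: "I ?e = ?e" by (simp add: I_po v')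
  have A': "A' ?e = inverse l *s ?e" by (rule A'_eigen[OF chain_A[OF v'(1,4)] Ie l0])
  have "(A' ^^ k) ?e = inverse l ^ k *s ?e" for k
    by (induction k) (simp_all only: funpow.simps comp_apply id_apply Apow_lin A' power_0 scale_one scale_scale power_Suc2)
  then have "po (L (inverse l) ^ (r - 1)) (B v) = ((- inverse l) ^ (r - 1) * inverse l ^ (r - 1)) *s B ?e"
    using po_L_B[OF v'(2) l0, of "r - 1"] by (simp add: B_lin)
  moreover have "B ?e \<noteq> 0" using rho_eq_0_iff[OF carr(2)[of True], of ?e] Ie v'(5) by simp
  ultimately have "po (L (inverse l) ^ (r - 1)) (B v) \<noteq> 0" using l0 by simp
  moreover have "po (L (inverse l) ^ r) (B v) = 0" by (rule B_chain[OF v'(2) *(2) v'(4)])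
  ultimately show ?thesis using v' * pi_B_deg[OF *(1) v'(3)] by (simp add: jordan_chain_iff)
qed

lemma cyclic_length:
  assumes X: "valid (Cyclic (m, False) l r)" "is_gen n R (Cyclic (m, False) l r) v"
    and Y: "valid (Cyclic (m, False) l r')" "is_gen n R (Cyclic (m, False) l r') w" and w: "w \<in> cyc v"
  shows "r' \<le> r"
proof -
  have v': "I v = v" "po (L l ^ r) v = 0" using X(2) by (auto simp: jordan_chain_iff)
  have w': "I w = w" "\<pi> (m, False) w = w" "po (L l ^ r') w = 0" "po (L l ^ (r' - 1)) w \<noteq> 0" "r' \<ge> 1"
    using Y(2) by (auto simp: jordan_chain_iff)
  have *: "m < n" "l ^ t = 1" "r' \<le> q" using Y(1) by auto
  obtain f h where fh: "w = po f v + B (po h v)" using cyclic_cyc[OF v'(1) w] .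
  have "pr (m, False) l w = w" using pr_chain[OF *(1) *(1) w'(2,1,3) *(3) *(2) *(2)] by simp
  then have "w = po f v" using cyclic_pr(1)[OF X fh] by simp
  then have "po (L l ^ r) w = 0" using v'(2) by (simp only: op.po_swap[of "L l ^ _"] op.po_vec_0)
  then have "\<not> r \<le> r' - 1" using w'(4) op.po_power_0_mono by blast
  then show ?thesis using w'(5) by linarith
qed

text \<open>
  The socle \<open>e'\<close> for \<open>w\<close> is a combination of \<open>e\<close> and \<open>b e\<close>, where \<open>e\<close> is the socle for \<open>v\<close>. These
  two vectors differ in degree or in eigenvalue, so \<open>e'\<close> is proportional to one of them, which
  gives the two alternatives.
\<close>
lemma cyclic_unique:
  assumes X: "valid (Cyclic (m, False) l r)" "is_gen n R (Cyclic (m, False) l r) v"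
    and Y: "valid (Cyclic (m', False) l' r')" "is_gen n R (Cyclic (m', False) l' r') w"
    and genX: "\<And>m. I m = m \<Longrightarrow> m \<in> cyc v" and genY: "\<And>m. I m = m \<Longrightarrow> m \<in> cyc w"
  shows "(m', l', r') = (m, l, r) \<or> (m', l', r') = ((n - m) mod n, inverse l, r)"
proof -
  let ?X = "Cyclic (m, False) l r" and ?Y = "Cyclic (m', False) l' r'"
  define e where "e = soc ?X v"
  define e' where "e' = soc ?Y w"
  have mX: "m < n" "l ^ t = 1" "r \<le> q" "r \<ge> 1" and mY: "m' < n" "l' ^ t = 1" "r' \<le> q" "r' \<ge> 1" using X(1) Y(1) by auto
  have v': "I v = v" "po (L l ^ r) v = 0" and w': "I w = w" "po (L l' ^ r') w = 0"
    using X(2) Y(2) by (auto simp: jordan_chain_iff)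
  have Ae: "A e = l *s e" "A e' = l' *s e'"
    using chain_A[OF mX(4) v'(2)] chain_A[OF mY(4) w'(2)] by (simp_all add: e_def e'_def)
  have Ie: "I e = e" "I e' = e'" by (simp_all add: e_def e'_def I_po v' w')
  have pe: "\<pi> (m, False) e = e" "\<pi> (m', False) e' = e'"
    using soc_degree[OF X] soc_degree[OF Y] unfolding e_def e'_def by simp_all
  have e0: "e \<noteq> 0" "e' \<noteq> 0" using soc_nonzero[OF X(2)] soc_nonzero[OF Y(2)] by (auto simp only: e_def e'_def)
  have Le: "po (L l ^ 1) e = 0" "po (L l' ^ 1) e' = 0" unfolding power_one_right op.po_linear Ae by simp_all
  have gc: "(m, False) \<in> carrier (dihedral n)" using mX by simp
  have q1: "1 \<le> q" using q_ge by simp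
  have "e' \<in> cyc e" unfolding e_def e'_def by (rule soc_in_cyc_soc[OF X Y genY])
  then obtain f h where "e' = po f e + B (po h e)" by (rule cyclic_cyc[OF Ie(1)])
  then obtain x y where e': "e' = x *s e + y *s B e" by (auto simp: op.po_eigen[OF Ae(1)] B_lin)
  have val1: "valid (Cyclic (m, False) l 1)" using X(1) q1 by auto
  have "pr (m, False) l e = e" using pr_chain[OF mX(1) mX(1) pe(1) Ie(1) Le(1) q1 mX(2) mX(2)] by simp
  moreover have "pr (m, False) l (B e) = 0" by (rule pr_B_zero[OF val1 Ie(1) pe(1) Le(1)])
  ultimately have "pr (m, False) l e' = x *s e"
    unfolding e' by (simp add: pr_add[OF gc] pr_scale[OF gc])
  moreover have "pr (m, False) l e' = (if (m', l') = (m, l) then e' else 0)"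
    by (rule pr_chain[OF mX(1) mY(1) pe(2) Ie(2) Le(2) q1 mX(2) mY(2)])
  ultimately have xe: "(if (m', l') = (m, l) then e' else 0) = x *s e" by simp
  show ?thesis
  proof (cases "(m', l') = (m, l)")
    case True
    have "r' \<le> r" using cyclic_length[OF X, of r' w] Y True genX[OF w'(1)] by simp
    moreover have "r \<le> r'" using cyclic_length[of m l r' w r v] X Y True genY[OF v'(1)] by simp
    ultimately show ?thesis using True by simp
  next
    case False
    have "x *s e = 0" using xe unfolding if_not_P[OF False] by (rule sym)
    then have e'': "e' = y *s B e" using e' by simp
    let ?m = "(n - m) mod n"
    have "\<pi> (?m, False) e' = e'" unfolding e'' using pi_B_deg[OF mX(1) pe(1)] by (simp add: pi_scale n_pos)
    then have m': "m' = ?m"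
      using same_degree[of "(m', False)" "(?m, False)" e'] pe(2) e0(2) mY(1) n_pos by simp
    have "po (L (inverse l) ^ 1) (B e) = 0" by (rule B_chain[OF Ie(1) mX(2) Le(1)])
    then have "A (B e) = inverse l *s B e" unfolding power_one_right op.po_linear by simp
    then have "A e' = inverse l *s e'" unfolding e'' by (simp add: A_lin mult.commute)
    then have l': "l' = inverse l" using same_eigenvalue[of A, OF Ae(2) _ e0(2)] by blast
    have mm: "(n - m') mod n = m" using m' mX(1) by (cases "m = 0") simp_all
    have Bw: "is_gen n R (Cyclic (m, False) l r') (B w)"
      using gen_B[OF Y] unfolding mm l' by simp
    have val': "valid (Cyclic (m, False) l r')" using X(1) Y(1) by auto
    have "r' \<le> r" by (rule cyclic_length[OF X val' Bw genX]) simp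
    moreover have "r \<le> r'"
    proof (rule cyclic_length[OF val' Bw X])
      have S: "subm (cyc (B w))" using cyc_subm[OF gc] gen_degree[OF Bw] by simp
      have "B (B w) \<in> cyc (B w)" using submD(5)[OF S, of "(0, True)" "B w"] cyc_self[of "B w"] n_pos by simp
      then have "w \<in> cyc (B w)" by (simp add: BB w')
      then show "v \<in> cyc (B w)" using cyc_subm_least[OF S] genY[OF v'(1)] by blast
    qed
    ultimately show ?thesis using m' l' by simp
  qed
qed

lemma gen_unique:
  assumes X: "valid X" "is_gen n R X v" and Y: "valid Y" "is_gen n R Y w"
    and genX: "\<And>m. I m = m \<Longrightarrow> m \<in> cyc v" and genY: "\<And>m. I m = m \<Longrightarrow> m \<in> cyc w"
  shows "Y = X \<or> Y = inverse_label n X"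
proof (cases X)
  case (Central g l \<epsilon> r)
  then show ?thesis using central_unique[of g l \<epsilon> r v Y w] assms by auto
next
  case (Klein g \<alpha> \<beta>)
  then show ?thesis using klein_unique[of g \<alpha> \<beta> v Y w] assms by auto
next
  case X': (Cyclic g l r)
  show ?thesis
  proof (cases Y)
    case (Central g' l' \<epsilon>' r')
    then have "X = Y" using central_unique[of g' l' \<epsilon>' r' w X v] assms by auto
    then show ?thesis by simp
  next
    case (Klein g' \<alpha>' \<beta>')
    then have "X = Y" using klein_unique[of g' \<alpha>' \<beta>' w X v] assms by auto
    then show ?thesis by simp
  next
    case Y': (Cyclic g' l' r')
    obtain m m' where "g = (m, False)" "g' = (m', False)" using X(1) Y(1) X' Y' by auto
    then show ?thesis using cyclic_unique[of m l r v m' l' r' w] assms X' Y' by auto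
  qed
qed

end

context dih_rep
begin

section \<open>Every indecomposable module has a generator\<close>

lemma A'_pow_po: "I w = w \<Longrightarrow> (A' ^^ k) w = po (([:0, 1:] ^ (n - Suc 0)) ^ k) w"
proof (induction k)
  case (Suc k)
  have "A' (po f w) = po ([:0, 1:] ^ (n - Suc 0)) (po f w)" for f
    by (rule po_x_power[symmetric]) (simp add: I_po Suc.prems)
  then show ?case using Suc by (simp add: op.po_mult)
qed simp

lemma pr_self: "m < n \<Longrightarrow> l ^ t = 1 \<Longrightarrow> pr (m, False) l (pr (m, False) l w) = pr (m, False) l w"
  using pr_eigen[of m m "pr (m, False) l w" l l] by (simp add: pi_pr Apow_pr)

text \<open>
  It suffices to match the values of \<open>\<phi>\<close> after applying \<open>(a - l)\<^sup>k\<close> for \<open>k < r\<close>, since \<open>(a - l)\<^sup>r\<close>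
  kills both \<open>m\<close> and \<open>v\<close>.
\<close>
lemma chain_solve:
  assumes phi_add: "\<And>v w. \<phi> (v + w) = \<phi> v + (\<phi> w :: 'k)" and phi_scale: "\<And>c v. \<phi> (c *s v) = c * \<phi> v"
    and v: "r \<ge> 1" "po (L l ^ r) v = 0" "\<phi> (po (L l ^ (r - 1)) v) \<noteq> 0" and m: "po (L l ^ r) m = 0"
  obtains f where "\<And>h. \<phi> (po h m) = \<phi> (po h (po f v))"
proof -
  have phi0: "\<phi> 0 = 0" using phi_scale[of 0 0] by simp
  have phi_diff: "\<phi> (x - y) = \<phi> x - \<phi> y" for x y
    using phi_add[of "x - y" y] by (simp add: eq_diff_eq)
  obtain f where f: "\<And>k. k < r \<Longrightarrow> \<phi> (po (L l ^ k) (po f v)) = \<phi> (po (L l ^ k) m)"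
    using op.chain_functional_solve[of r "L l" v \<phi> "\<lambda>k. \<phi> (po (L l ^ k) m)"] v phi_add phi_scale by blast
  have "po (L l ^ r) (m - po f v) = 0" unfolding op.po_vec_diff op.po_swap[of "L l ^ r" f] by (simp only: v m op.po_vec_0 diff_self)
  moreover have "\<phi> (po (L l ^ k) (m - po f v)) = 0" if "k < r" for k
    unfolding op.po_vec_diff phi_diff using f[OF that] by simp
  ultimately have "\<phi> (po h (m - po f v)) = 0" for h
    using op.functional_vanishes[of \<phi> l r "m - po f v" h] phi_add phi_scale by blast
  then show ?thesis using that unfolding op.po_vec_diff phi_diff by simp
qed

text \<open>
  The functional is \<open>\<phi> \<circ> pr\<close>, where \<open>\<phi>\<close> does not vanish on the socle. The conditions for the
  rotations \<open>x = a\<^sup>k\<close> are met by some \<open>f(a) v\<close>, those for the reflections \<open>x = a\<^sup>k b\<close> by some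
  \<open>b h(a) v\<close>, and neither vector disturbs the conditions of the other kind. The hypothesis on \<open>r\<close>
  says that no chain of the same degree and eigenvalue is longer than the one of \<open>v\<close>.
\<close>
lemma cyclic_complete:
  assumes ind: "yd_indecomposable (dihedral n) R"
    and X: "valid (Cyclic (m, False) l r)" and v: "is_gen n R (Cyclic (m, False) l r) v"
    and r: "\<And>w. I w = w \<Longrightarrow> po (L l ^ r) (pr (m, False) l w) = 0"
    and y: "I y = y"
  shows "y \<in> cyc v"
proof -
  let ?X = "Cyclic (m, False) l r"
  let ?pr = "pr (m, False) l"
  have *: "m < n" "l ^ t = 1" "r \<le> q" "r \<ge> 1" using X by auto
  have g: "(m, False) \<in> carrier (dihedral n)" using * by simp
  have v': "I v = v" "\<pi> (m, False) v = v" "po (L l ^ r) v = 0" using v by (auto simp: jordan_chain_iff)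
  define e where "e = po (L l ^ (r - 1)) v"
  have e_soc: "e = soc ?X v" by (simp add: e_def)
  have "e \<noteq> 0" unfolding e_soc by (rule soc_nonzero[OF v])
  then obtain \<phi> where phi: "\<And>x y. \<phi> (x + y) = \<phi> x + \<phi> y" "\<And>c x. \<phi> (c *s x) = c * \<phi> x" "\<phi> e = 1"
    using functional_exists[OF \<open>e \<noteq> 0\<close>] by blast
  have prv: "?pr v = v" using pr_chain[OF *(1) *(1) v'(2,1,3) *(3) *(2) *(2)] by simp
  have pr_pov: "?pr (po f v) = po f v" for f by (simp add: pr_po *(1) prv)
  have pr_Bpov: "?pr (B (po f v)) = 0" for f
    by (rule pr_B_zero[OF X]) (simp_all add: I_po v' pi_po * op.po_swap[of "L l ^ r"])
  have solve: "\<exists>f. \<forall>k. \<phi> (Apow k (?pr w)) = \<phi> (Apow k (po f v))" if w: "I w = w" for w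
  proof -
    obtain f where "\<And>h. \<phi> (po h (?pr w)) = \<phi> (po h (po f v))"
      using chain_solve[of \<phi> r l v "?pr w"] phi *(4) v'(3) r[OF w] unfolding e_def by auto
    then have "\<phi> (po ([:0, 1:] ^ k) (?pr w)) = \<phi> (po ([:0, 1:] ^ k) (po f v))" for k by blast
    then show ?thesis by (auto simp: po_x_power I_po v')
  qed
  show ?thesis
  proof (rule indecomposable_imp_cyclic[OF ind g v'(2), of "\<lambda>x. \<phi> (?pr x)" e])
    show "\<phi> (?pr (x + z)) = \<phi> (?pr x) + \<phi> (?pr z)" "\<phi> (?pr (c *s x)) = c * \<phi> (?pr x)" for x z c
      by (simp_all add: pr_add[OF g] pr_scale[OF g] phi)
    show "\<phi> (?pr (\<pi> (m, False) w)) = \<phi> (?pr w)" for w by (simp add: pr_def pi_pi * )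
    show "e \<in> cyc v" using soc_cyc[OF v] by (simp only: e_soc)
    show "\<phi> (?pr e) \<noteq> 0" using phi(3) unfolding e_def pr_pov by simp
    show "e \<in> S" if "subm S" "S \<subseteq> cyc v" "u \<in> S" "u \<noteq> 0" for S u
      using soc_minimal[OF X v that] by (simp only: e_soc)
    show "\<rho> \<one>\<^bsub>dihedral n\<^esub> y = y" using y by simp
    fix w assume "\<rho> \<one>\<^bsub>dihedral n\<^esub> w = w"
    then have w: "I w = w" by simp
    obtain f h where f: "\<And>k. \<phi> (Apow k (?pr w)) = \<phi> (Apow k (po f v))"
      and h: "\<And>k. \<phi> (Apow k (?pr (B w))) = \<phi> (Apow k (po h v))"
      using solve[OF w] solve[of "B w"] by auto
    let ?z = "po f v + B (po h v)"
    have Bz: "B ?z = po h v + B (po f v)" by (simp add: B_lin BB I_po v' add.commute)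
    have 1: "\<phi> (?pr (Apow k w)) = \<phi> (?pr (Apow k ?z))" for k
      using f[of k] by (simp add: pr_Apow *(1) pr_add[OF g] pr_pov pr_Bpov)
    have 2: "\<phi> (?pr (Apow k (B w))) = \<phi> (?pr (Apow k (B ?z)))" for k
      unfolding Bz using h[of k] by (simp add: pr_Apow *(1) pr_add[OF g] pr_pov pr_Bpov)
    have "\<phi> (?pr (\<rho> x w)) = \<phi> (?pr (\<rho> x ?z))" if "x \<in> carrier (dihedral n)" for x
    proof -
      obtain i b where x: "x = (i, b)" "i < n" using \<open>x \<in> _\<close> by (cases x) auto
      show ?thesis
      proof (cases b)
        case True
        then have "x = (i, True)" using x by simp
        then show ?thesis unfolding \<open>x = (i, True)\<close> rho_True[OF x(2)] by (intro 2)
      next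
        case False
        then have "x = (i, False)" using x by simp
        then show ?thesis unfolding \<open>x = (i, False)\<close> rho_False[OF x(2)] by (intro 1)
      qed
    qed
    moreover have "?z \<in> cyc v"
      using cyc_self[of v] v' n_pos by (intro cyc_add cyc_rho cyc_po) simp_all
    ultimately show "\<exists>z\<in>cyc v. \<forall>x\<in>carrier (dihedral n). \<phi> (?pr (\<rho> x w)) = \<phi> (?pr (\<rho> x z))" by blast
  qed
qed

text \<open>
  A vector is the sum of its components in the generalized eigenspaces for the powers \<open>\<xi>\<^sup>i\<close>, and
  \<open>b\<close> maps the component for \<open>\<xi>\<^sup>i\<close> to the one for \<open>\<xi>\<^sup>-\<^sup>i\<close>. As \<open>l\<close> and the degree are their own
  inverses, \<open>b\<close> preserves the component in question.
\<close>
lemma pr_B_central: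
  assumes m: "m < n" "(m, False) \<in> central" and l: "l\<^sup>2 = 1" and w: "I w = w"
  shows "pr (m, False) l (B w) = B (pr (m, False) l w)"
proof -
  have lt: "l ^ t = 1" using square_t[OF l] .
  define y where "y = \<pi> (m, False) w"
  have Iy: "I y = y" unfolding y_def using pi_M[of "(m, False)" w] m by simp
  have By: "\<pi> (m, False) (B w) = B y"
    using pi_B[OF m(1), of w] central_iff[OF m(1)] m(2) by (simp add: y_def)
  have sum: "y = (\<Sum>i<t. el (\<xi> ^ i) y)" using el_complete[of y] Iy by simp
  have components: "el l (B (el (\<xi> ^ i) y)) = B (el l (el (\<xi> ^ i) y))" for i
  proof -
    let ?z = "el (\<xi> ^ i) y"
    have z: "I ?z = ?z" "Apow q ?z = (\<xi> ^ i) ^ q *s ?z" by (simp_all add: el_range xi_pow_t)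
    have "po (L (\<xi> ^ i) ^ q) ?z = 0" using po_frobenius[OF z(1), of "\<xi> ^ i"] z(2) by simp
    then have "po (L (inverse (\<xi> ^ i)) ^ q) (B ?z) = 0" by (rule B_chain[OF z(1) xi_pow_t])
    then have "Apow q (B ?z) = inverse (\<xi> ^ i) ^ q *s B ?z"
      using Apow_cyc_eigen[of "B ?z" q "inverse (\<xi> ^ i)"] by simp
    then have "el l (B ?z) = (if inverse (\<xi> ^ i) = l then B ?z else 0)"
      using el_eigen[of "B ?z" "inverse (\<xi> ^ i)" l] lt inverse_root[OF xi_pow_t] by simp
    moreover have "el l ?z = (if \<xi> ^ i = l then ?z else 0)"
      using el_eigen[OF z lt xi_pow_t] .
    moreover have "inverse (\<xi> ^ i) = l \<longleftrightarrow> \<xi> ^ i = l"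
      using inverse_eq_iff[OF lt] l by (metis inverse_inverse_eq)
    ultimately show ?thesis by (simp add: B_lin)
  qed
  have B_sum: "B (\<Sum>i<t. f i) = (\<Sum>i<t. B (f i))" for f :: "nat \<Rightarrow> 'w"
    by (simp add: rho_sum n_pos)
  have "el l (B y) = (\<Sum>i<t. el l (B (el (\<xi> ^ i) y)))"
    by (subst sum) (simp only: B_sum el_sum)
  also have "\<dots> = B (\<Sum>i<t. el l (el (\<xi> ^ i) y))" by (simp only: components B_sum)
  also have "(\<Sum>i<t. el l (el (\<xi> ^ i) y)) = el l y" by (subst (2) sum) (simp only: el_sum)
  finally show ?thesis by (simp add: pr_def By y_def)
qed

text \<open>
  The functional \<open>\<phi>\<close> must transform under \<open>b\<close> by the scalar \<open>\<mu>\<close> by which \<open>b\<close> acts on the socle;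
  then the conditions for \<open>x = a\<^sup>k b\<close> follow from those for powers of \<open>a\<close>. Symmetrizing any
  functional \<open>\<phi>\<^sub>0\<close> with \<open>\<phi>\<^sub>0(e) = 1\<close> with respect to \<open>b\<close> achieves this with \<open>\<phi>(e) = 2\<close>, which is
  nonzero as \<open>p\<close> is odd.
\<close>
lemma central_complete:
  assumes ind: "yd_indecomposable (dihedral n) R"
    and X: "valid (Central g l \<epsilon> r)" and v: "is_gen n R (Central g l \<epsilon> r) v"
    and r: "\<And>w. I w = w \<Longrightarrow> po (L l ^ r) (pr g l w) = 0"
    and y: "I y = y"
  shows "y \<in> cyc v"
proof -
  let ?X = "Central g l \<epsilon> r"
  have "g \<in> central" using X by simp
  then obtain m where m: "g = (m, False)" "m < n" "(m, False) \<in> central" using n_pos(1) half(1) by auto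
  let ?pr = "pr g l"
  have *: "l\<^sup>2 = 1" "l ^ t = 1" "\<epsilon>\<^sup>2 = 1" "r \<le> q" "r \<ge> 1" using X square_t by auto
  have g: "g \<in> carrier (dihedral n)" using m by simp
  have v': "I v = v" "\<pi> g v = v" "po (L l ^ r) v = 0" using v by (auto simp: jordan_chain_iff)
  define e where "e = po (L l ^ (r - 1)) v"
  define \<mu> where "\<mu> = (- 1) ^ (r - 1) * \<epsilon> * l"
  have e_soc: "e = soc ?X v" by (simp add: e_def)
  have Be: "B e = \<mu> *s e" using central_soc_B[OF X v] by (simp only: e_def \<mu>_def)
  have mu: "\<mu> * \<mu> = 1"
    using * by (simp add: \<mu>_def power2_eq_square power_mult_distrib[symmetric] algebra_simps)
  have "e \<noteq> 0" unfolding e_soc by (rule soc_nonzero[OF v])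
  then obtain \<phi>0 where phi0: "\<And>x y. \<phi>0 (x + y) = \<phi>0 x + \<phi>0 y" "\<And>c x. \<phi>0 (c *s x) = c * \<phi>0 x" "\<phi>0 e = 1"
    using functional_exists[OF \<open>e \<noteq> 0\<close>] by blast
  have prv: "?pr v = v"
    using pr_chain[OF m(2) m(2) v'(2)[unfolded m(1)] v'(1,3) *(4) *(2) *(2)] by (simp add: m(1))
  have pr_pov: "?pr (po f v) = po f v" for f
    using prv m by (simp add: pr_po)
  have prB: "?pr (B w) = B (?pr w)" if "I w = w" for w
    unfolding m(1) by (rule pr_B_central[OF m(2,3) *(1) that])
  have pr2: "?pr (?pr w) = ?pr w" for w unfolding m(1) by (rule pr_self[OF m(2) *(2)])
  define \<phi> where "\<phi> x = \<phi>0 (?pr x) + \<mu> * \<phi>0 (?pr (B x))" for x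
  have phi: "\<phi> (x + z) = \<phi> x + \<phi> z" "\<phi> (c *s x) = c * \<phi> x" for x z c
    by (simp_all add: \<phi>_def B_lin pr_add[OF g] pr_scale[OF g] phi0 algebra_simps)
  have phi_B: "\<phi> (B w) = \<mu> * \<phi> w" if "I w = w" for w
  proof -
    have "\<phi> (B w) = \<phi>0 (?pr (B w)) + \<mu> * \<phi>0 (?pr w)" by (simp add: \<phi>_def BB that)
    also have "\<dots> = (\<mu> * \<mu>) * \<phi>0 (?pr (B w)) + \<mu> * \<phi>0 (?pr w)" by (simp add: mu)
    also have "\<dots> = \<mu> * \<phi> w" by (simp add: \<phi>_def algebra_simps)
    finally show ?thesis .
  qed
  have phi_pr: "\<phi> (?pr w) = \<phi> w" if "I w = w" for w
    using prB[OF that] prB[of "?pr w"] by (simp add: \<phi>_def pr2)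
  have "?pr e = e" unfolding e_def by (rule pr_pov)
  then have phi_e: "\<phi> e = 2" using phi0 mu by (simp add: \<phi>_def Be pr_scale[OF g])
  have pi_B': "\<pi> g (B w) = B (\<pi> g w)" for w
    using pi_B[OF m(2), of w] central_iff[OF m(2)] m by simp
  show ?thesis
  proof (rule indecomposable_imp_cyclic[OF ind g v'(2), of \<phi> e])
    show "\<phi> (x + z) = \<phi> x + \<phi> z" "\<phi> (c *s x) = c * \<phi> x" for x z c by (fact phi)+
    show "\<phi> (\<pi> g w) = \<phi> w" for w
    proof -
      have "?pr (\<pi> g x) = ?pr x" for x by (simp add: pr_def pi_pi g)
      then show ?thesis by (simp only: \<phi>_def pi_B'[symmetric])
    qed
    show "e \<in> cyc v" using soc_cyc[OF v] by (simp only: e_soc)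
    show "\<phi> e \<noteq> 0" using phi_e two_nonzero by simp
    show "e \<in> S" if "subm S" "S \<subseteq> cyc v" "u \<in> S" "u \<noteq> 0" for S u
      using soc_minimal[OF X v that] by (simp only: e_soc)
    show "\<rho> \<one>\<^bsub>dihedral n\<^esub> y = y" using y by simp
    fix w assume "\<rho> \<one>\<^bsub>dihedral n\<^esub> w = w"
    then have w: "I w = w" by simp
    obtain f where f: "\<And>h. \<phi> (po h (?pr w)) = \<phi> (po h (po f v))"
      using chain_solve[of \<phi> r l v "?pr w"] phi *(5) v'(3) r[OF w] phi_e two_nonzero unfolding e_def by auto
    have pow: "\<phi> (po h w) = \<phi> (po h (po f v))" for h
    proof -
      have "\<phi> (po h w) = \<phi> (?pr (po h w))" by (rule phi_pr[symmetric]) (simp add: I_po w)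
      also have "?pr (po h w) = po h (?pr w)" using m by (simp add: pr_po)
      finally show ?thesis using f by simp
    qed
    let ?z = "po f v"
    have z: "I ?z = ?z" by (simp add: I_po v')
    have 1: "\<phi> (Apow k w) = \<phi> (Apow k ?z)" for k
      using pow[of "[:0, 1:] ^ k"] by (simp only: po_x_power[OF w] po_x_power[OF z])
    have 2: "\<phi> (Apow k (B w)) = \<phi> (Apow k (B ?z))" for k
    proof -
      have "\<phi> (Apow k (B x)) = \<mu> * \<phi> (po (([:0, 1:] ^ (n - Suc 0)) ^ k) x)" if x: "I x = x" for x
      proof -
        have "\<phi> (Apow k (B x)) = \<phi> (B (po (([:0, 1:] ^ (n - Suc 0)) ^ k) x))"
          by (simp only: B_Apow[OF x] A'_pow_po[OF x])
        also have "\<dots> = \<mu> * \<phi> (po (([:0, 1:] ^ (n - Suc 0)) ^ k) x)"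
          by (rule phi_B) (simp only: I_po x)
        finally show ?thesis .
      qed
      then show ?thesis using pow w z by simp
    qed
    have "\<phi> (\<rho> x w) = \<phi> (\<rho> x ?z)" if "x \<in> carrier (dihedral n)" for x
    proof -
      obtain i b where x: "x = (i, b)" "i < n" using \<open>x \<in> _\<close> by (cases x) auto
      show ?thesis
      proof (cases b)
        case True
        then have "x = (i, True)" using x by simp
        then show ?thesis unfolding \<open>x = (i, True)\<close> rho_True[OF x(2)] by (intro 2)
      next
        case False
        then have "x = (i, False)" using x by simp
        then show ?thesis unfolding \<open>x = (i, False)\<close> rho_False[OF x(2)] by (intro 1)
      qed
    qed
    moreover have "?z \<in> cyc v" using cyc_self[of v] v' by (simp add: cyc_po)
    ultimately show "\<exists>z\<in>cyc v. \<forall>x\<in>carrier (dihedral n). \<phi> (\<rho> x w) = \<phi> (\<rho> x z)" by blast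
  qed
qed

lemma klein_operators:
  assumes g: "g = (k, True)" "k \<le> 1"
  shows "\<pi> g (\<rho> (n div 2, False) w) = \<rho> (n div 2, False) (\<pi> g w)" "\<pi> g (\<rho> g w) = \<rho> g (\<pi> g w)"
    "\<rho> (n div 2, False) (\<rho> (n div 2, False) w) = I w" "\<rho> g (\<rho> g w) = I w"
    "\<rho> g (\<rho> (n div 2, False) w) = \<rho> (n div 2, False) (\<rho> g w)"
proof -
  have gc: "g \<in> carrier (dihedral n)" and hc: "(n div 2, False) \<in> carrier (dihedral n)"
    using g half n_ge by auto
  have pi_centr: "\<pi> g (\<rho> z w) = \<rho> z (\<pi> g w)" if "z \<in> centralizer g" for z
    using pi_rho[OF _ gc, of z w] that by (auto simp: centralizer_def)
  show "\<pi> g (\<rho> (n div 2, False) w) = \<rho> (n div 2, False) (\<pi> g w)" "\<pi> g (\<rho> g w) = \<rho> g (\<pi> g w)"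
    using pi_centr[of "(n div 2, False)"] pi_centr[of g] centr_klein[OF g] g(1) by blast+
  show "\<rho> (n div 2, False) (\<rho> (n div 2, False) w) = I w"
    using rho_mult[OF hc hc, of w] half by (simp add: mult_2[symmetric])
  have "g \<otimes>\<^bsub>dihedral n\<^esub> g = (0, False)" using g n_ge by (auto simp: le_Suc_eq)
  then show "\<rho> g (\<rho> g w) = I w" using rho_mult[OF gc gc, of w] by simp
  have "n - n div 2 = n div 2" using half(2) by linarith
  then have "g \<otimes>\<^bsub>dihedral n\<^esub> (n div 2, False) = (n div 2, False) \<otimes>\<^bsub>dihedral n\<^esub> g"
    using g by (simp add: add.commute)
  then show "\<rho> g (\<rho> (n div 2, False) w) = \<rho> (n div 2, False) (\<rho> g w)"
    using rho_mult[OF gc hc, of w] rho_mult[OF hc gc, of w] by simp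
qed

text \<open>
  Symmetrizing a functional with respect to the two generators of the Klein four group makes it
  transform by the character \<open>(\<alpha>, \<beta>)\<close> of \<open>v\<close>. The order \<open>4\<close> of the group is invertible.
\<close>
lemma klein_complete:
  assumes ind: "yd_indecomposable (dihedral n) R"
    and X: "valid (Klein g \<alpha> \<beta>)" and v: "is_gen n R (Klein g \<alpha> \<beta>) v"
    and y: "I y = y"
  shows "y \<in> cyc v"
proof -
  let ?X = "Klein g \<alpha> \<beta>"
  obtain k where k: "g = (k, True)" "k \<le> 1" using X by auto
  have g: "g \<in> carrier (dihedral n)" using degree_carrier[OF X] by simp
  let ?Z = "\<rho> (n div 2, False)" and ?C = "\<rho> g"
  have hc: "(n div 2, False) \<in> carrier (dihedral n)" using half by simp
  have v': "I v = v" "\<pi> g v = v" "?Z v = \<alpha> *s v" "?C v = \<beta> *s v" "v \<noteq> 0" using v by auto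
  have ab: "\<alpha> * \<alpha> = 1" "\<beta> * \<beta> = 1" using X by (auto simp: power2_eq_square)
  have centr_g: "centralizer g = {(0, False), (n div 2, False), (k, True), (k + n div 2, True)}"
    by (rule centr_klein[OF k])
  note piZ = klein_operators(1)[OF k] and piC = klein_operators(2)[OF k] and ZZ = klein_operators(3)[OF k]
    and CC = klein_operators(4)[OF k] and ZC = klein_operators(5)[OF k]
  obtain \<phi>0 where phi0: "\<And>x y. \<phi>0 (x + y) = \<phi>0 x + \<phi>0 y" "\<And>c x. \<phi>0 (c *s x) = c * \<phi>0 x" "\<phi>0 v = 1"
    using functional_exists[OF v'(5)] by blast
  define \<psi> where "\<psi> x = \<phi>0 (\<pi> g x) + \<alpha> * \<phi>0 (\<pi> g (?Z x))" for x
  define \<phi> where "\<phi> x = \<psi> x + \<beta> * \<psi> (?C x)" for x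
  have psi: "\<psi> (x + z) = \<psi> x + \<psi> z" "\<psi> (c *s x) = c * \<psi> x" for x z c
    by (simp_all add: \<psi>_def rho_add rho_scale pi_add pi_scale g half phi0 algebra_simps)
  have phi: "\<phi> (x + z) = \<phi> x + \<phi> z" "\<phi> (c *s x) = c * \<phi> x" for x z c
    by (simp_all add: \<phi>_def rho_add rho_scale g psi algebra_simps)
  have psi_Z: "\<psi> (?Z w) = \<alpha> * \<psi> w" if "I w = w" for w
  proof -
    have "\<psi> (?Z w) = (\<alpha> * \<alpha>) * \<phi>0 (\<pi> g (?Z w)) + \<alpha> * \<phi>0 (\<pi> g w)"
      by (simp add: \<psi>_def ZZ that ab)
    also have "\<dots> = \<alpha> * \<psi> w" by (simp add: \<psi>_def algebra_simps)
    finally show ?thesis .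
  qed
  have I_rho: "I (\<rho> x w) = \<rho> x w" if "x \<in> carrier (dihedral n)" for x w
    using rho_M[OF that] by simp
  have phi_Z: "\<phi> (?Z w) = \<alpha> * \<phi> w" if "I w = w" for w
    using psi_Z[OF that] psi_Z[of "?C w"] I_rho[OF g] by (simp add: \<phi>_def ZC algebra_simps)
  have phi_C: "\<phi> (?C w) = \<beta> * \<phi> w" if "I w = w" for w
  proof -
    have "\<phi> (?C w) = (\<beta> * \<beta>) * \<psi> (?C w) + \<beta> * \<psi> w" by (simp add: \<phi>_def CC that ab)
    also have "\<dots> = \<beta> * \<phi> w" by (simp add: \<phi>_def algebra_simps)
    finally show ?thesis .
  qed
  have phi_g: "\<phi> (\<pi> g w) = \<phi> w" for w
    by (simp add: \<phi>_def \<psi>_def piZ[symmetric] piC[symmetric] pi_pi g)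
  have "\<psi> v = 1 + \<alpha> * \<alpha>" by (simp only: \<psi>_def v' pi_scale[OF g] phi0) simp
  then have "\<psi> v = 2" using ab by simp
  then have "\<phi> v = 2 + (\<beta> * \<beta>) * 2" by (simp add: \<phi>_def v' psi)
  then have phi_v: "\<phi> v = 2 * 2" using ab by simp
  have four: "2 * 2 \<noteq> (0 :: 'k)" using two_nonzero by (simp only: mult_eq_0_iff simp_thms)
  have kn: "k < n" "k + n div 2 < n" using k half n_ge by linarith+
  have phi_chi: "\<phi> (\<rho> z w) = klein_char g \<alpha> \<beta> z * \<phi> w" if "z \<in> centralizer g" "I w = w" for z w
  proof -
    have "z = (0, False) \<or> z = (n div 2, False) \<or> z = g \<or> z = (k + n div 2, True)"
      using that(1) by (simp only: centr_g k(1)[symmetric] insert_iff empty_iff simp_thms)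
    then consider "z = (0, False)" | "z = (n div 2, False)" | "z = g" | "z = (k + n div 2, True)" by blast
    then show ?thesis
    proof cases
      case 4
      then have "\<phi> (\<rho> z w) = \<alpha> * \<beta> * \<phi> w"
        using rho_klein[OF k(2), of w] phi_Z[OF I_rho[OF g], of w] phi_C[OF that(2)]
        by (simp add: k(1)[symmetric])
      then show ?thesis using 4 half k(1) by (simp add: klein_char_def)
    qed (use that half k(1) phi_Z phi_C in \<open>simp_all add: klein_char_def\<close>)
  qed
  have "card (centralizer g) = 4" unfolding centr_g using half by simp
  then have card: "of_nat (card (centralizer g)) = (2 * 2 :: 'k)" by simp
  show ?thesis
  proof (rule indecomposable_imp_cyclic[OF ind g v'(2), of \<phi> v])
    show "\<phi> (x + z) = \<phi> x + \<phi> z" "\<phi> (c *s x) = c * \<phi> x" for x z c by (fact phi)+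
    show "\<phi> (\<pi> g w) = \<phi> w" for w by (fact phi_g)
    show "v \<in> cyc v" using cyc_self v' by simp
    show "\<phi> v \<noteq> 0" unfolding phi_v by (fact four)
    show "v \<in> S" if "subm S" "S \<subseteq> cyc v" "u \<in> S" "u \<noteq> 0" for S u
      using soc_minimal[OF X v that] by simp
    show "\<rho> \<one>\<^bsub>dihedral n\<^esub> y = y" using y by simp
    fix w assume w: "\<rho> \<one>\<^bsub>dihedral n\<^esub> w = w"
    show "\<exists>z\<in>cyc v. \<forall>x\<in>carrier (dihedral n). \<phi> (\<rho> x w) = \<phi> (\<rho> x z)"
    proof (rule solve_by_averaging[OF g v'(2) phi phi_g _ _ _ _ w])
      show "\<rho> z v = klein_char g \<alpha> \<beta> z *s v" if "z \<in> centralizer g" for z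
        using klein_char[OF k v'(1) v'(3) v'(4) that] .
      show "\<phi> (\<rho> z m) = klein_char g \<alpha> \<beta> z * \<phi> m" if "z \<in> centralizer g" "\<rho> \<one>\<^bsub>dihedral n\<^esub> m = m" for z m
        using phi_chi that by simp
      show "\<phi> v \<noteq> 0" unfolding phi_v by (fact four)
      show "of_nat (card (centralizer g)) \<noteq> (0 :: 'k)" unfolding card by (fact four)
    qed
  qed
qed

text \<open>
  The eigenvectors \<open>w + U w\<close> and \<open>w - U w\<close> have the sum \<open>2 w\<close>, so \<open>f\<close> does not kill both.
\<close>
lemma involution_split:
  assumes U: "\<And>x y. U (x + y) = U x + U y" "\<And>c x. U (c *s x) = c *s U x" and inv: "U (U w) = w"
    and f: "\<And>x y. f (x + y) = f x + (f y :: 'w)" "\<And>c x. f (c *s x) = c *s f x" "f w \<noteq> 0"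
  shows "\<exists>a. a\<^sup>2 = 1 \<and> f (w + a *s U w) \<noteq> 0 \<and> U (w + a *s U w) = a *s (w + a *s U w)"
proof -
  have "f (w + 1 *s U w) \<noteq> 0 \<or> f (w + (- 1) *s U w) \<noteq> 0"
  proof (rule ccontr)
    assume "\<not> ?thesis"
    then have "f w + 1 *s f (U w) = 0" "f w + (- 1) *s f (U w) = 0" by (simp_all only: f) blast+
    then have "(f w + 1 *s f (U w)) + (f w + (- 1) *s f (U w)) = 0" by (simp only: add_0_left)
    then have "f w + f w = 0" by (simp add: scale_minus_left)
    then have "(2 :: 'k) *s f w = 0" by (metis scale_left_distrib scale_one one_add_one)
    then show False using two_nonzero f(3) by simp
  qed
  moreover have eigen: "U (w + a *s U w) = a *s (w + a *s U w)" if "a * a = 1" for a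
    using that by (simp add: U inv scale_right_distrib add.commute)
  ultimately show ?thesis
  proof (elim disjE)
    assume "f (w + 1 *s U w) \<noteq> 0"
    then show ?thesis by (intro exI[of _ 1] conjI eigen) simp_all
  next
    assume "f (w + (- 1) *s U w) \<noteq> 0"
    then show ?thesis by (intro exI[of _ "- 1"] conjI eigen) simp_all
  qed
qed

text \<open>
  A nonzero module contains a nonzero homogeneous vector. If its degree is a rotation \<open>g\<close>, some
  projection \<open>pr g l\<close> is nonzero, and \<open>v\<close> is chosen in its image as the top of a chain of the
  greatest possible length \<open>r\<close>. When \<open>g\<close> and \<open>l\<close> are their own inverses, \<open>v\<close> can be replaced by an
  eigenvector of the involution \<open>a b\<close> without shortening the chain. If the degree is a reflection,
  a translate has degree \<open>b\<close> or \<open>a b\<close>, and the Klein four group has a common eigenvector there. In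
  all cases the chosen vector generates the module by the completeness lemmas above.
\<close>
lemma indecomposable_has_generator:
  assumes ind: "yd_indecomposable (dihedral n) R"
  obtains X v where "valid X" "is_gen n R X v" "\<And>m. I m = m \<Longrightarrow> m \<in> cyc v"
proof -
  obtain w0 where w0: "I w0 = w0" "w0 \<noteq> 0" using ind unfolding indecomposable_iff by auto
  obtain h0 where h0: "h0 \<in> carrier (dihedral n)" "\<pi> h0 w0 \<noteq> 0" using pi_ex[of w0] w0 by auto
  obtain m b where mb: "h0 = (m, b)" "m < n" using h0(1) by (cases h0) auto
  show ?thesis
  proof (cases b)
    case False
    let ?g = "(m, False)"
    have g: "?g \<in> carrier (dihedral n)" using mb by simp
    have "(\<Sum>i<t. el (\<xi> ^ i) (\<pi> ?g w0)) \<noteq> 0"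
      using el_complete[of "\<pi> ?g w0"] h0(2) pi_M[OF g, of w0] mb False by simp
    then obtain i where i: "pr ?g (\<xi> ^ i) w0 \<noteq> 0" unfolding pr_def by (meson sum.neutral)
    define l where "l = \<xi> ^ i"
    have lt: "l ^ t = 1" unfolding l_def by (rule xi_pow_t)
    let ?E = "{w. I w = w \<and> \<pi> ?g w = w \<and> Apow q w = l ^ q *s w}"
    have prE: "pr ?g l w \<in> ?E" for w using mb lt by (simp add: pi_pr Apow_pr)
    have Eq: "po (L l ^ q) w = 0" if "w \<in> ?E" for w using po_frobenius[of w l] that by simp
    \<comment> \<open>The greatest length of a chain is the least exponent that kills the whole space.\<close>
    define r where "r = (LEAST r. \<forall>w\<in>?E. po (L l ^ r) w = 0)"
    have rE: "po (L l ^ r) w = 0" if "w \<in> ?E" for w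
      using LeastI[of "\<lambda>r. \<forall>w\<in>?E. po (L l ^ r) w = 0" q] Eq that unfolding r_def by blast
    have rq: "r \<le> q" unfolding r_def by (rule Least_le) (use Eq in blast)
    have r1: "r \<ge> 1"
    proof (rule ccontr)
      assume "\<not> r \<ge> 1"
      then have "r = 0" by simp
      then show False using rE[OF prE, of w0] i unfolding l_def by simp
    qed
    obtain v where v: "v \<in> ?E" "po (L l ^ (r - 1)) v \<noteq> 0"
      using not_less_Least[of "r - 1" "\<lambda>r. \<forall>w\<in>?E. po (L l ^ r) w = 0"] r1 unfolding r_def[symmetric] by auto
    have rpr: "po (L l ^ r) (pr ?g l w) = 0" for w by (rule rE[OF prE])
    show ?thesis
    proof (cases "?g \<in> central \<and> l\<^sup>2 = 1")
      case False
      let ?X = "Cyclic ?g l r"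
      have X: "valid ?X" using False mb lt r1 rq by auto
      have gen: "is_gen n R ?X v" using v r1 rE[OF v(1)] by (simp add: jordan_chain_iff)
      show ?thesis using that[OF X gen] cyclic_complete[OF ind X gen rpr] by blast
    next
      case True
      have il: "inverse l = l" using True inverse_eq_iff[OF lt] by simp
      have BE: "B w \<in> ?E" if w: "w \<in> ?E" for w
      proof -
        have "po (L l ^ q) (B w) = 0" using B_chain[OF _ lt Eq[OF w]] w unfolding il by simp
        then have "Apow q (B w) = l ^ q *s B w" using Apow_cyc_eigen[of "B w" q l] by simp
        then show ?thesis using pi_B_deg[OF mb(2), of w] w central_iff[OF mb(2)] True by simp
      qed
      have AE: "A w \<in> ?E" if w: "w \<in> ?E" for w
        using w pi_A[OF mb(2), of w] by (simp add: Apow_Suc2[symmetric] Apow_Suc A_lin)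
      let ?U = "\<lambda>w. A (B w)"
      have UU: "?U (?U v) = v" using v by (simp add: B_A A_A' BB)
      obtain a where a: "a\<^sup>2 = 1" "po (L l ^ (r - 1)) (v + a *s ?U v) \<noteq> 0" "?U (v + a *s ?U v) = a *s (v + a *s ?U v)"
        using involution_split[of ?U v "po (L l ^ (r - 1))", OF _ _ UU op.po_vec_add op.po_vec_scale v(2)]
        by (auto simp only: A_lin B_lin)
      let ?v = "v + a *s ?U v"
      have vE: "?v \<in> ?E"
        using v(1) AE[OF BE[OF v(1)]] mb(2)
        by (simp add: I_lin pi_add pi_scale Apow_lin scale_right_distrib mult.commute)
      let ?X = "Central ?g l a r"
      have X: "valid ?X" using True a r1 rq by auto
      have gen: "is_gen n R ?X ?v"
        using vE rE[OF vE] a r1 rho_True[of 1 ?v] n_pos by (simp add: jordan_chain_iff Apow_1)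
      show ?thesis using that[OF X gen] central_complete[OF ind X gen rpr] by blast
    qed
  next
    case True
    \<comment> \<open>Every reflection is conjugate to \<open>b\<close> or to \<open>ab\<close>.\<close>
    define c where "c = m div 2"
    define k where "k = m mod 2"
    have k1: "k \<le> 1" by (simp add: k_def)
    let ?g = "(k, True)" and ?x = "((n - c) mod n, False)"
    have g: "?g \<in> carrier (dihedral n)" using k1 n_ge by simp
    have x: "?x \<in> carrier (dihedral n)" using n_pos by simp
    have "(m + 2 * ((n - c) mod n)) mod n = k"
    proof -
      have "m = 2 * c + k" by (simp add: c_def k_def)
      moreover have "c \<le> n" using mb(2) by (simp add: c_def)
      ultimately have "m + 2 * (n - c) = k + 2 * n" by simp
      then have "(m + 2 * (n - c)) mod n = k" using k1 n_ge by simp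
      then show ?thesis by (metis mod_add_right_eq mod_mult_right_eq)
    qed
    then have conj: "?x \<otimes>\<^bsub>dihedral n\<^esub> h0 \<otimes>\<^bsub>dihedral n\<^esub> inv\<^bsub>dihedral n\<^esub> ?x = ?g"
      using dih_conj_rotation[of "(n - c) mod n" n m True] mb True n_pos by simp
    define w where "w = \<rho> ?x (\<pi> h0 w0)"
    have pw: "\<pi> ?g w = w"
      using pi_rho[OF x h0(1), of "\<pi> h0 w0"] conj pi_pi[OF h0(1) h0(1)] by (simp add: w_def)
    have Iw: "I w = w" unfolding w_def using rho_M[OF x] by simp
    have w_nz: "w \<noteq> 0" unfolding w_def using rho_eq_0_iff[OF x, of "\<pi> h0 w0"] h0 pi_M[OF h0(1), of w0] by simp
    have hc: "(n div 2, False) \<in> carrier (dihedral n)" using half by simp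
    let ?Z = "\<rho> (n div 2, False)" and ?C = "\<rho> ?g"
    note piZ = klein_operators(1)[OF refl k1] and piC = klein_operators(2)[OF refl k1]
      and ZZ = klein_operators(3)[OF refl k1] and CC = klein_operators(4)[OF refl k1]
      and ZC = klein_operators(5)[OF refl k1, symmetric]
    have I_rho: "I (\<rho> x w) = \<rho> x w" if "x \<in> carrier (dihedral n)" for x w
      using rho_M[OF that] by simp
    obtain a where a: "a\<^sup>2 = 1" "w + a *s ?Z w \<noteq> 0" "?Z (w + a *s ?Z w) = a *s (w + a *s ?Z w)"
      using involution_split[of ?Z w "\<lambda>x. x", OF rho_add[OF hc] rho_scale[OF hc] _ refl refl w_nz] ZZ[of w] Iw
      by auto
    define w' where "w' = w + a *s ?Z w"
    have w': "I w' = w'" "\<pi> ?g w' = w'" "?Z w' = a *s w'" "w' \<noteq> 0"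
      using a unfolding w'_def by (simp_all add: I_lin Iw I_rho[OF hc] pi_add[OF g] pi_scale[OF g] pw piZ)
    obtain b where b: "b\<^sup>2 = 1" "w' + b *s ?C w' \<noteq> 0" "?C (w' + b *s ?C w') = b *s (w' + b *s ?C w')"
      using involution_split[of ?C w' "\<lambda>x. x", OF rho_add[OF g] rho_scale[OF g] _ refl refl w'(4)] CC[of w'] w'(1)
      by auto
    let ?v = "w' + b *s ?C w'"
    let ?X = "Klein ?g a b"
    have X: "valid ?X" using k1 a b by (auto simp: le_Suc_eq)
    have "?Z ?v = a *s ?v"
      by (simp add: rho_add[OF hc] rho_scale[OF hc] w' ZC rho_scale[OF g] scale_right_distrib mult.commute)
    then have gen: "is_gen n R ?X ?v"
      using b(2,3) by (simp add: I_lin w' I_rho[OF g] pi_add[OF g] pi_scale[OF g] piC)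
    show ?thesis using that[OF X gen] klein_complete[OF ind X gen] by blast
  qed
qed

end

section \<open>Labels of Yetter-Drinfeld modules\<close>

definition generated :: "('g, 'c) monoid_scheme \<Rightarrow> ('k :: field, 'g, 'v, 'd) yd_module_scheme \<Rightarrow> 'v \<Rightarrow> bool" where
  "generated G M v \<longleftrightarrow> (\<forall>S. yd_submodule G M S \<longrightarrow> v \<in> S \<longrightarrow> carrier M \<subseteq> S)"

definition has_label :: "nat \<Rightarrow> ('k :: field, dih, 'v, 'd) yd_module_scheme \<Rightarrow> 'k label \<Rightarrow> bool" where
  "has_label n M X \<longleftrightarrow> (\<exists>v. is_gen n M X v \<and> generated (dihedral n) M v)"

lemma jordan_chain_iso:
  assumes f: "linear_map class_ring M N f" "inj_on f (carrier M)"
    and act: "\<And>v. v \<in> carrier M \<Longrightarrow> f (act M (1, False) v) = act N (1, False) (f v)"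
    and J: "jordan_chain M l r v"
  shows "jordan_chain N l r (f v)"
proof -
  obtain u where r: "r \<ge> 1" and u: "u 0 = v" "\<And>k. k < r \<Longrightarrow> u k \<in> carrier M"
    "\<And>k. k < r \<Longrightarrow> act M (1, False) (u k) = l \<odot>\<^bsub>M\<^esub> u k \<oplus>\<^bsub>M\<^esub> u (Suc k)"
    "u r = \<zero>\<^bsub>M\<^esub>" "u (r - 1) \<noteq> \<zero>\<^bsub>M\<^esub>"
    using J unfolding jordan_chain_def by auto
  interpret V: vectorspace class_ring M using f(1) by (simp add: linear_map_iff)
  have closed: "x \<in> carrier M \<Longrightarrow> f x \<in> carrier N" and add: "x \<in> carrier M \<Longrightarrow> y \<in> carrier M \<Longrightarrow> f (x \<oplus>\<^bsub>M\<^esub> y) = f x \<oplus>\<^bsub>N\<^esub> f y"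
    and sc: "x \<in> carrier M \<Longrightarrow> f (c \<odot>\<^bsub>M\<^esub> x) = c \<odot>\<^bsub>N\<^esub> f x" for x y c
    using f(1) by (simp_all add: linear_map_iff)
  have uM: "u k \<in> carrier M" if "k \<le> r" for k using u(2)[of k] u(4) that by (cases "k = r") simp_all
  have zero: "f \<zero>\<^bsub>M\<^esub> = \<zero>\<^bsub>N\<^esub>" by (rule linear_map_zero[OF f(1)])
  have "act N (1, False) (f (u k)) = l \<odot>\<^bsub>N\<^esub> f (u k) \<oplus>\<^bsub>N\<^esub> f (u (Suc k))" if "k < r" for k
  proof -
    have "act N (1, False) (f (u k)) = f (l \<odot>\<^bsub>M\<^esub> u k \<oplus>\<^bsub>M\<^esub> u (Suc k))"
      using act[OF u(2)[OF that]] u(3)[OF that] by simp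
    then show ?thesis using that by (simp add: add sc uM)
  qed
  moreover have "f (u (r - 1)) \<noteq> \<zero>\<^bsub>N\<^esub>"
    using inj_onD[OF f(2), of "u (r - 1)" "\<zero>\<^bsub>M\<^esub>"] uM[of "r - 1"] u(5) zero by auto
  ultimately show ?thesis
    unfolding jordan_chain_def using r u(1,4) zero closed u(2) by (intro conjI exI[of _ "\<lambda>k. f (u k)"]) auto
qed

lemma has_label_iso:
  fixes M :: "('k :: field, dih, 'v, 'd) yd_module_scheme" and N :: "('k, dih, 'w, 'e) yd_module_scheme"
  assumes n: "n > 1" and M: "yd_module (dihedral n) M" and N: "yd_module (dihedral n) N"
    and iso: "yd_isomorphic (dihedral n) M N" and X: "has_label n M X"
    and deg: "label_degree X \<in> carrier (dihedral n)"
  shows "has_label n N X"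
proof -
  let ?G = "dihedral n"
  obtain f f' where f: "linear_map class_ring M N f" "bij_betw f (carrier M) (carrier N)"
    and f_hom: "\<forall>g\<in>carrier ?G. \<forall>v\<in>carrier M. f (act M g v) = act N g (f v) \<and> f (coact M v g) = coact N (f v) g"
    and f': "linear_map class_ring N M f'" "bij_betw f' (carrier N) (carrier M)"
    and f'_hom: "\<forall>g\<in>carrier ?G. \<forall>v\<in>carrier N. f' (act N g v) = act M g (f' v) \<and> f' (coact N v g) = coact M (f' v) g"
    and ff': "\<forall>v\<in>carrier M. f' (f v) = v" "\<forall>w\<in>carrier N. f (f' w) = w"
    using yd_isomorphic_inverse[OF M iso] .
  note act = f_hom[rule_format, THEN conjunct1] and coact = f_hom[rule_format, THEN conjunct2]
    and act' = f'_hom[rule_format, THEN conjunct1] and coact' = f'_hom[rule_format, THEN conjunct2]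
    and ff' = ff'[rule_format]
  have inj: "inj_on f (carrier M)" and img: "f ` carrier M = carrier N" using f(2) by (auto simp: bij_betw_def)
  have zero: "f \<zero>\<^bsub>M\<^esub> = \<zero>\<^bsub>N\<^esub>" by (rule linear_map_zero[OF f(1)])
  interpret M: yd_module ?G M by (fact M)
  obtain v where v: "is_gen n M X v" "generated ?G M v" using X unfolding has_label_def by blast
  have vM: "v \<in> carrier M" using v(1) by (cases X) auto
  have sc: "f (c \<odot>\<^bsub>M\<^esub> x) = c \<odot>\<^bsub>N\<^esub> f x" and closed: "f x \<in> carrier N" if "x \<in> carrier M" for x c
    using f(1) that by (simp_all add: linear_map_iff)
  have J: "jordan_chain M l r v \<Longrightarrow> jordan_chain N l r (f v)" for l r
    by (rule jordan_chain_iso[OF f(1) inj]) (use act n in auto)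
  have deg_f: "coact N (f v) (label_degree X) = f v"
    using coact[OF deg vM] v(1) by (cases X) auto
  have A: "act N x (f v) = c \<odot>\<^bsub>N\<^esub> f v" if "x \<in> carrier ?G" "act M x v = c \<odot>\<^bsub>M\<^esub> v" for x c
    using act[OF that(1) vM] sc[OF vM] that(2) by simp
  have "is_gen n N X (f v)"
  proof (cases X)
    case (Central g l \<epsilon> r)
    then show ?thesis using v(1) J A[of "(1, True)"] deg_f closed[OF vM] n by simp
  next
    case (Cyclic g l r)
    then show ?thesis using v(1) J deg_f closed[OF vM] by simp
  next
    case (Klein g \<alpha> \<beta>)
    have "f v \<noteq> \<zero>\<^bsub>N\<^esub>" using inj_onD[OF inj, of v "\<zero>\<^bsub>M\<^esub>"] vM v(1) Klein zero by auto
    then show ?thesis using v(1) A[of "(n div 2, False)"] A[of g] deg deg_f closed[OF vM] n Klein by simp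
  qed
  moreover have "generated ?G N (f v)"
    unfolding generated_def
  proof (intro allI impI)
    fix S assume S: "yd_submodule ?G N S" "f v \<in> S"
    have "yd_submodule ?G M (f' ` S)" by (rule yd_submodule_image[OF N f' act' coact' S(1)])
    moreover have "v \<in> f' ` S" using S(2) ff'(1)[OF vM] by force
    ultimately have "carrier M \<subseteq> f' ` S" using v(2) unfolding generated_def by blast
    moreover have "S \<subseteq> carrier N" using S(1) unfolding yd_submodule_def subspace_iff by blast
    moreover have "f x \<in> S" if "x \<in> f' ` S" for x
      using that ff'(2) calculation(2) by (auto simp: subset_iff)
    ultimately show "carrier N \<subseteq> S" unfolding img[symmetric] by blast
  qed
  ultimately show ?thesis unfolding has_label_def by blast
qed

lemma (in dih_rep) generated_iff:
  assumes g: "g \<in> carrier (dihedral n)" and v: "\<pi> g v = v" and I: "I v = v"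
  shows "generated (dihedral n) R v \<longleftrightarrow> (\<forall>m. I m = m \<longrightarrow> m \<in> cyc v)"
proof
  assume "generated (dihedral n) R v"
  then have "carrier R \<subseteq> cyc v"
    unfolding generated_def using cyc_subm[OF g v] cyc_self[of v] I by (simp add: yd_submodule_yd_of)
  then show "\<forall>m. I m = m \<longrightarrow> m \<in> cyc v" by auto
next
  assume *: "\<forall>m. I m = m \<longrightarrow> m \<in> cyc v"
  show "generated (dihedral n) R v"
    unfolding generated_def yd_submodule_yd_of
  proof (intro allI impI)
    fix S assume "subm S" "v \<in> S"
    then show "carrier R \<subseteq> S" using cyc_subm_least * by auto
  qed
qed

lemma (in dih_rep) has_label_iff:
  assumes "valid X"
  shows "has_label n R X \<longleftrightarrow> (\<exists>v. is_gen n R X v \<and> (\<forall>m. I m = m \<longrightarrow> m \<in> cyc v))"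
  unfolding has_label_def
  using generated_iff[OF degree_carrier[OF assms] gen_degree gen_I] by blast

context dih_setup
begin

lemma dih_rep_intro: "yd_rep (dihedral n) scale \<rho> \<pi> \<Longrightarrow> dih_rep p s t n \<xi> scale \<rho> \<pi>"
  by (intro dih_rep.intro dih_setup_axioms)

text \<open>
  In the direct sum the pair \<open>(v, w)\<close> of generators has the same label. Its socle therefore lies
  in every nonzero submodule of \<open>kG(v, w)\<close>, and both of its components are nonzero.
\<close>
lemma rep_isomorphic:
  fixes scale1 :: "'k \<Rightarrow> 'w1 :: ab_group_add \<Rightarrow> 'w1" and scale2 :: "'k \<Rightarrow> 'w2 :: ab_group_add \<Rightarrow> 'w2"
  assumes rep1: "yd_rep (dihedral n) scale1 \<rho>1 \<pi>1" and rep2: "yd_rep (dihedral n) scale2 \<rho>2 \<pi>2"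
    and X: "valid X" and l1: "has_label n (yd_of (dihedral n) scale1 \<rho>1 \<pi>1) X"
    and l2: "has_label n (yd_of (dihedral n) scale2 \<rho>2 \<pi>2) X"
  shows "yd_isomorphic (dihedral n) (yd_of (dihedral n) scale1 \<rho>1 \<pi>1) (yd_of (dihedral n) scale2 \<rho>2 \<pi>2)"
proof -
  interpret A: dih_rep p s t n \<xi> scale1 \<rho>1 \<pi>1 by (rule dih_rep_intro[OF rep1])
  interpret B: dih_rep p s t n \<xi> scale2 \<rho>2 \<pi>2 by (rule dih_rep_intro[OF rep2])
  interpret pair: yd_rep_pair "dihedral n" scale1 \<rho>1 \<pi>1 scale2 \<rho>2 \<pi>2 by unfold_locales
  interpret P: dih_rep p s t n \<xi> pair.scaleP pair.\<rho>P pair.\<pi>P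
    by (rule dih_rep_intro) unfold_locales
  obtain v where v: "is_gen n A.R X v" "\<And>m. A.I m = m \<Longrightarrow> m \<in> A.cyc v"
    using l1 unfolding A.has_label_iff[OF X] by blast
  obtain w where w: "is_gen n B.R X w" "\<And>m. B.I m = m \<Longrightarrow> m \<in> B.cyc w"
    using l2 unfolding B.has_label_iff[OF X] by blast
  have chain: "jordan_chain P.R l r (v, w)" if J: "jordan_chain A.R l r v" "jordan_chain B.R l r w" for l r
  proof -
    obtain u where u: "r \<ge> 1" "u 0 = v" "\<And>k. k < r \<Longrightarrow> A.I (u k) = u k"
      "\<And>k. k < r \<Longrightarrow> A.A (u k) = scale1 l (u k) + u (Suc k)" "u r = 0" "u (r - 1) \<noteq> 0"
      using J(1) unfolding jordan_chain_def by auto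
    obtain u' where u': "u' 0 = w" "\<And>k. k < r \<Longrightarrow> B.I (u' k) = u' k"
      "\<And>k. k < r \<Longrightarrow> B.A (u' k) = scale2 l (u' k) + u' (Suc k)" "u' r = 0" "u' (r - 1) \<noteq> 0"
      using J(2) unfolding jordan_chain_def by auto
    show ?thesis
      unfolding jordan_chain_def
      by (intro conjI exI[of _ "\<lambda>k. (u k, u' k)"]) (use u u' in \<open>simp_all add: zero_prod_def\<close>)
  qed
  have gen: "is_gen n P.R X (v, w)"
    using v(1) w(1) by (cases X) (simp_all add: chain zero_prod_def)
  have po: "fst (P.po f z) = A.po f (fst z)" "snd (P.po f z) = B.po f (snd z)" for f z
    by (induction f) simp_all
  have soc: "fst (P.soc X (v, w)) = A.soc X v" "snd (P.soc X (v, w)) = B.soc X w"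
    by (cases X; simp add: po)+
  show ?thesis
  proof (rule pair.cyclic_isomorphic[OF degree_carrier[OF X] A.gen_degree[OF v(1)] B.gen_degree[OF w(1)], of "P.soc X (v, w)"])
    show "fst (P.soc X (v, w)) \<noteq> 0" unfolding soc by (rule A.soc_nonzero[OF v(1)])
    show "snd (P.soc X (v, w)) \<noteq> 0" unfolding soc by (rule B.soc_nonzero[OF w(1)])
    show "P.soc X (v, w) \<in> S" if "pair.P.subm S" "S \<subseteq> pair.P.cyc (v, w)" "u \<in> S" "u \<noteq> 0" for S u
      by (rule P.soc_minimal[OF X gen that])
    show "m \<in> A.cyc v" if "\<rho>1 \<one>\<^bsub>dihedral n\<^esub> m = m" for m using v(2) that by simp
    show "m \<in> B.cyc w" if "\<rho>2 \<one>\<^bsub>dihedral n\<^esub> m = m" for m using w(2) that by simp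
  qed
qed

text \<open>This transfers statements about modules given by operators to arbitrary modules.\<close>
lemma model_exists:
  fixes M :: "('k, dih, 'v, 'd) yd_module_scheme"
  assumes M: "yd_module (dihedral n) M" and fd: "vectorspace.fin_dim class_ring M"
  obtains \<rho> \<pi> where "yd_rep (dihedral n) (\<lambda>c (f :: 'v \<Rightarrow> 'k) x. c * f x) \<rho> \<pi>"
    "yd_isomorphic (dihedral n) M (yd_of (dihedral n) (\<lambda>c (f :: 'v \<Rightarrow> 'k) x. c * f x) \<rho> \<pi>)"
    "\<forall>X. valid X \<longrightarrow> (has_label n M X \<longleftrightarrow> has_label n (yd_of (dihedral n) (\<lambda>c (f :: 'v \<Rightarrow> 'k) x. c * f x) \<rho> \<pi>) X)"
proof -
  let ?sc = "\<lambda>c (f :: 'v \<Rightarrow> 'k) x. c * f x"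
  obtain \<rho> \<pi> where rep: "yd_rep (dihedral n) ?sc \<rho> \<pi>"
    and iso: "yd_isomorphic (dihedral n) M (yd_of (dihedral n) ?sc \<rho> \<pi>)"
    using yd_rep_exists[OF M fd] .
  have R: "yd_module (dihedral n) (yd_of (dihedral n) ?sc \<rho> \<pi>)" by (rule yd_rep.yd_module_yd_of[OF rep])
  note iso' = yd_isomorphic_sym[OF M iso]
  have "has_label n M X \<longleftrightarrow> has_label n (yd_of (dihedral n) ?sc \<rho> \<pi>) X" if "valid X" for X
    using has_label_iso[OF n_pos(2) M R iso _ degree_carrier[OF that]]
      has_label_iso[OF n_pos(2) R M iso' _ degree_carrier[OF that]] by blast
  then show ?thesis using that[OF rep iso] by blast
qed

lemma label_indecomposable:
  fixes M :: "('k, dih, 'v, 'd) yd_module_scheme"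
  assumes M: "yd_module (dihedral n) M" and fd: "vectorspace.fin_dim class_ring M"
    and X: "valid X" "has_label n M X"
  shows "fd_indecomposable_yd (dihedral n) M"
proof -
  obtain \<rho> \<pi> where rep: "yd_rep (dihedral n) (\<lambda>c (f :: 'v \<Rightarrow> 'k) x. c * f x) \<rho> \<pi>"
    and iso: "yd_isomorphic (dihedral n) M (yd_of (dihedral n) (\<lambda>c (f :: 'v \<Rightarrow> 'k) x. c * f x) \<rho> \<pi>)"
    and lab: "\<forall>X. valid X \<longrightarrow> (has_label n M X \<longleftrightarrow> has_label n (yd_of (dihedral n) (\<lambda>c (f :: 'v \<Rightarrow> 'k) x. c * f x) \<rho> \<pi>) X)"
    using model_exists[OF M fd] .
  interpret R: dih_rep p s t n \<xi> "\<lambda>c (f :: 'v \<Rightarrow> 'k) x. c * f x" \<rho> \<pi> by (rule dih_rep_intro[OF rep])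
  obtain v where "is_gen n R.R X v" "\<And>m. R.I m = m \<Longrightarrow> m \<in> R.cyc v"
    using lab[rule_format, OF X(1)] X unfolding R.has_label_iff[OF X(1)] by blast
  from R.gen_indecomposable[OF X(1) this] have "yd_indecomposable (dihedral n) R.R" .
  then show ?thesis
    unfolding fd_indecomposable_yd_def
    using yd_indecomposable_iso[OF M R.yd_module_yd_of iso] M fd by blast
qed

lemma label_unique:
  fixes M :: "('k, dih, 'v, 'd) yd_module_scheme"
  assumes M: "yd_module (dihedral n) M" and fd: "vectorspace.fin_dim class_ring M"
    and X: "valid X" "has_label n M X" and Y: "valid Y" "has_label n M Y"
  shows "Y = X \<or> Y = inverse_label n X"
proof -
  obtain \<rho> \<pi> where rep: "yd_rep (dihedral n) (\<lambda>c (f :: 'v \<Rightarrow> 'k) x. c * f x) \<rho> \<pi>"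
    and iso: "yd_isomorphic (dihedral n) M (yd_of (dihedral n) (\<lambda>c (f :: 'v \<Rightarrow> 'k) x. c * f x) \<rho> \<pi>)"
    and lab: "\<forall>X. valid X \<longrightarrow> (has_label n M X \<longleftrightarrow> has_label n (yd_of (dihedral n) (\<lambda>c (f :: 'v \<Rightarrow> 'k) x. c * f x) \<rho> \<pi>) X)"
    using model_exists[OF M fd] .
  interpret R: dih_rep p s t n \<xi> "\<lambda>c (f :: 'v \<Rightarrow> 'k) x. c * f x" \<rho> \<pi> by (rule dih_rep_intro[OF rep])
  obtain v where v: "is_gen n R.R X v" "\<And>m. R.I m = m \<Longrightarrow> m \<in> R.cyc v"
    using lab[rule_format, OF X(1)] X unfolding R.has_label_iff[OF X(1)] by blast
  obtain w where w: "is_gen n R.R Y w" "\<And>m. R.I m = m \<Longrightarrow> m \<in> R.cyc w"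
    using lab[rule_format, OF Y(1)] Y unfolding R.has_label_iff[OF Y(1)] by blast
  show ?thesis by (rule R.gen_unique[OF X(1) v(1) Y(1) w(1) v(2) w(2)])
qed

lemma label_isomorphic:
  fixes M :: "('k, dih, 'v, 'd) yd_module_scheme" and N :: "('k, dih, 'w, 'e) yd_module_scheme"
  assumes M: "yd_module (dihedral n) M" "vectorspace.fin_dim class_ring M"
    and N: "yd_module (dihedral n) N" "vectorspace.fin_dim class_ring N"
    and X: "valid X" "has_label n M X" "has_label n N X"
  shows "yd_isomorphic (dihedral n) M N"
proof -
  obtain \<rho> \<pi> where rep: "yd_rep (dihedral n) (\<lambda>c (f :: 'v \<Rightarrow> 'k) x. c * f x) \<rho> \<pi>"
    and iso: "yd_isomorphic (dihedral n) M (yd_of (dihedral n) (\<lambda>c (f :: 'v \<Rightarrow> 'k) x. c * f x) \<rho> \<pi>)"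
    and lab: "\<forall>X. valid X \<longrightarrow> (has_label n M X \<longleftrightarrow> has_label n (yd_of (dihedral n) (\<lambda>c (f :: 'v \<Rightarrow> 'k) x. c * f x) \<rho> \<pi>) X)"
    using model_exists[OF M] .
  obtain \<rho>' \<pi>' where rep': "yd_rep (dihedral n) (\<lambda>c (f :: 'w \<Rightarrow> 'k) x. c * f x) \<rho>' \<pi>'"
    and iso': "yd_isomorphic (dihedral n) N (yd_of (dihedral n) (\<lambda>c (f :: 'w \<Rightarrow> 'k) x. c * f x) \<rho>' \<pi>')"
    and lab': "\<forall>X. valid X \<longrightarrow> (has_label n N X \<longleftrightarrow> has_label n (yd_of (dihedral n) (\<lambda>c (f :: 'w \<Rightarrow> 'k) x. c * f x) \<rho>' \<pi>') X)"
    using model_exists[OF N] .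
  show ?thesis
    using rep_isomorphic[OF rep rep' X(1)] lab lab' X
      yd_isomorphic_trans[OF yd_isomorphic_trans[OF iso] yd_isomorphic_sym[OF N(1) iso']] by blast
qed

lemma label_exists:
  fixes M :: "('k, dih, 'v, 'd) yd_module_scheme"
  assumes M: "fd_indecomposable_yd (dihedral n) M"
  obtains X where "valid X" "has_label n M X"
proof -
  have M': "yd_module (dihedral n) M" "vectorspace.fin_dim class_ring M" "yd_indecomposable (dihedral n) M"
    using M unfolding fd_indecomposable_yd_def by auto
  obtain \<rho> \<pi> where rep: "yd_rep (dihedral n) (\<lambda>c (f :: 'v \<Rightarrow> 'k) x. c * f x) \<rho> \<pi>"
    and iso: "yd_isomorphic (dihedral n) M (yd_of (dihedral n) (\<lambda>c (f :: 'v \<Rightarrow> 'k) x. c * f x) \<rho> \<pi>)"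
    and lab: "\<forall>X. valid X \<longrightarrow> (has_label n M X \<longleftrightarrow> has_label n (yd_of (dihedral n) (\<lambda>c (f :: 'v \<Rightarrow> 'k) x. c * f x) \<rho> \<pi>) X)"
    using model_exists[OF M'(1,2)] .
  interpret R: dih_rep p s t n \<xi> "\<lambda>c (f :: 'v \<Rightarrow> 'k) x. c * f x" \<rho> \<pi> by (rule dih_rep_intro[OF rep])
  have "yd_indecomposable (dihedral n) R.R"
    by (rule yd_indecomposable_iso[OF R.yd_module_yd_of M'(1) yd_isomorphic_sym[OF M'(1) iso] M'(3)])
  then obtain X v where "valid X" "is_gen n R.R X v" "\<And>m. R.I m = m \<Longrightarrow> m \<in> R.cyc v"
    using R.indecomposable_has_generator by blast
  then show ?thesis using that[of X] lab R.has_label_iff[of X] by blast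
qed

text \<open>Together with \<open>v\<close> also \<open>b v\<close> is a generator.\<close>
lemma label_inverse:
  fixes M :: "('k, dih, 'v, 'd) yd_module_scheme"
  assumes M: "yd_module (dihedral n) M" and fd: "vectorspace.fin_dim class_ring M"
    and X: "valid (Cyclic (m, False) l r)" "has_label n M (Cyclic (m, False) l r)"
  shows "has_label n M (Cyclic ((n - m) mod n, False) (inverse l) r)"
    and "valid (Cyclic ((n - m) mod n, False) (inverse l) r)"
proof -
  let ?X = "Cyclic (m, False) l r" and ?Y = "Cyclic ((n - m) mod n, False) (inverse l) r"
  have m: "m < n" and lt: "l ^ t = 1" using X(1) by auto
  have "inverse l ^ 2 = 1 \<longleftrightarrow> l\<^sup>2 = 1" by (simp add: power_inverse)
  moreover have "((n - m) mod n, False) \<in> central \<longleftrightarrow> (m, False) \<in> central"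
    using central_iff[OF m] central_iff[of "(n - m) mod n"] m n_pos by (cases "m = 0") auto
  ultimately show Y: "valid ?Y" using X(1) n_pos by (auto simp: power_inverse)
  obtain \<rho> \<pi> where rep: "yd_rep (dihedral n) (\<lambda>c (f :: 'v \<Rightarrow> 'k) x. c * f x) \<rho> \<pi>"
    and iso: "yd_isomorphic (dihedral n) M (yd_of (dihedral n) (\<lambda>c (f :: 'v \<Rightarrow> 'k) x. c * f x) \<rho> \<pi>)"
    and lab: "\<forall>X. valid X \<longrightarrow> (has_label n M X \<longleftrightarrow> has_label n (yd_of (dihedral n) (\<lambda>c (f :: 'v \<Rightarrow> 'k) x. c * f x) \<rho> \<pi>) X)"
    using model_exists[OF M fd] .
  interpret R: dih_rep p s t n \<xi> "\<lambda>c (f :: 'v \<Rightarrow> 'k) x. c * f x" \<rho> \<pi> by (rule dih_rep_intro[OF rep])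
  obtain v where v: "is_gen n R.R ?X v" "\<And>m. R.I m = m \<Longrightarrow> m \<in> R.cyc v"
    using lab[rule_format, OF X(1)] X unfolding R.has_label_iff[OF X(1)] by blast
  have Bv: "is_gen n R.R ?Y (R.B v)" by (rule R.gen_B[OF X(1) v(1)])
  have S: "R.subm (R.cyc (R.B v))"
    using R.cyc_subm[OF degree_carrier[OF Y]] R.gen_degree[OF Bv] by simp
  have "R.B (R.B v) \<in> R.cyc (R.B v)"
    using R.submD(5)[OF S, of "(0, True)" "R.B v"] R.cyc_self[of "R.B v"] n_pos by simp
  then have "v \<in> R.cyc (R.B v)" using R.BB R.gen_I[OF v(1)] by simp
  then have "m \<in> R.cyc (R.B v)" if "R.I m = m" for m using R.cyc_subm_least[OF S] v(2)[OF that] by blast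
  then show "has_label n M ?Y" using Bv lab[rule_format, OF Y] R.has_label_iff[OF Y] by blast
qed

end

section \<open>Modules with a single degree\<close>

lemma vectorspace_cong:
  fixes V :: "('k :: field, 'v, 'c) module_scheme" and M :: "('k, 'v, 'd) module_scheme"
  assumes V: "vectorspace class_ring V"
    and eq: "carrier M = carrier V" "add M = add V" "zero M = zero V" "smult M = smult V"
  shows "vectorspace class_ring M"
proof -
  interpret V: vectorspace class_ring V by (fact V)
  show ?thesis
  proof (rule vs_criteria)
    show "\<forall>v\<in>carrier M. \<exists>w\<in>carrier M. v \<oplus>\<^bsub>M\<^esub> w = \<zero>\<^bsub>M\<^esub>"
      unfolding eq by (metis V.a_inv_closed V.r_neg)
  qed (auto simp: eq class_field V.a_ac V.smult_assoc1 V.smult_l_distr V.smult_r_distr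
      intro: V.smult_l_distr[simplified] V.smult_assoc1[simplified] V.smult_one[simplified])
qed

lemma with_degree_simps [simp]:
  "carrier (with_degree (with_act V \<alpha>) z) = carrier V" "add (with_degree (with_act V \<alpha>) z) = add V"
  "zero (with_degree (with_act V \<alpha>) z) = zero V" "smult (with_degree (with_act V \<alpha>) z) = smult V"
  "act (with_degree (with_act V \<alpha>) z) = \<alpha>"
  "coact (with_degree (with_act V \<alpha>) z) v g = (if g = z then v else \<zero>\<^bsub>V\<^esub>)"
  by (simp_all add: with_degree_def with_act_def kG_module.defs module.defs yd_module.defs)

lemma with_act_simps [simp]:
  "carrier (with_act V \<alpha>) = carrier V" "add (with_act V \<alpha>) = add V"
  "zero (with_act V \<alpha>) = zero V" "smult (with_act V \<alpha>) = smult V" "act (with_act V \<alpha>) = \<alpha>"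
  by (simp_all add: with_act_def kG_module.defs module.defs)

lemma dih_conj_central:
  assumes "even n" "n > 1" "z \<in> {(0, False), (n div 2, False)}" "g \<in> carrier (dihedral n)" "h \<in> carrier (dihedral n)"
  shows "g \<otimes>\<^bsub>dihedral n\<^esub> h \<otimes>\<^bsub>dihedral n\<^esub> inv\<^bsub>dihedral n\<^esub> g = z \<longleftrightarrow> h = z"
proof -
  interpret group "dihedral n" using dihedral_group assms by simp
  have z: "z \<in> carrier (dihedral n)" using assms by auto
  have "n - n div 2 = n div 2" using assms by auto
  then have comm: "g \<otimes>\<^bsub>dihedral n\<^esub> z = z \<otimes>\<^bsub>dihedral n\<^esub> g"
    using assms by (cases g) (auto simp: add.commute)
  have "g \<otimes>\<^bsub>dihedral n\<^esub> h \<otimes>\<^bsub>dihedral n\<^esub> inv\<^bsub>dihedral n\<^esub> g = z \<longleftrightarrow> g \<otimes>\<^bsub>dihedral n\<^esub> h = z \<otimes>\<^bsub>dihedral n\<^esub> g"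
    using inv_solve_right'[of z "g \<otimes>\<^bsub>dihedral n\<^esub> h" g] assms z by auto
  also have "\<dots> \<longleftrightarrow> h = z" unfolding comm[symmetric] using Units_l_cancel[of g h z] assms z by auto
  finally show ?thesis .
qed

text \<open>
  The conditions on \<open>a\<close> and \<open>b\<close> are defining relations of the dihedral group, and the degree \<open>z\<close>
  is central, so that the coaction is compatible with the action.
\<close>
lemma dihedral_action:
  fixes V :: "('k :: field, 'v) module"
  assumes n: "even n" "n > 1" and z: "z \<in> {(0, False), (n div 2, False)}"
    and V: "vectorspace class_ring V"
    and a: "linear_map class_ring V V a" and b: "linear_map class_ring V V b"
    and a_n: "\<And>v. v \<in> carrier V \<Longrightarrow> (a ^^ n) v = v" and bb: "\<And>v. v \<in> carrier V \<Longrightarrow> b (b v) = v"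
    and aba: "\<And>v. v \<in> carrier V \<Longrightarrow> a (b (a v)) = b v"
    and \<alpha>: "\<And>i e v. i < n \<Longrightarrow> v \<in> carrier V \<Longrightarrow> \<alpha> (i, e) v = (a ^^ i) (if e then b v else v)"
  shows "yd_module (dihedral n) (with_degree (with_act V \<alpha>) z)"
proof -
  let ?G = "dihedral n" and ?M = "with_degree (with_act V \<alpha>) z"
  interpret G: group ?G using dihedral_group n by simp
  have M: "vectorspace class_ring ?M" by (rule vectorspace_cong[OF V]) simp_all
  interpret M: vectorspace class_ring ?M by (fact M)
  interpret V: vectorspace class_ring V by (fact V)
  have aV: "a v \<in> carrier V" and bV: "b v \<in> carrier V" if "v \<in> carrier V" for v
    using a b that by (simp_all add: linear_map_iff)
  have pow_lin: "linear_map class_ring V V (a ^^ i)" for i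
  proof (induction i)
    case 0
    then show ?case using V by (simp add: linear_map_iff)
  next
    case (Suc i)
    then show ?case using linear_map_comp[OF Suc a] by (simp add: comp_def)
  qed
  have powV: "(a ^^ i) v \<in> carrier V" if "v \<in> carrier V" for i v
    using pow_lin[of i] that by (simp add: linear_map_iff)
  have lin: "linear_map class_ring V V (\<lambda>v. (a ^^ i) (if e then b v else v))" for i e
    using linear_map_comp[OF b pow_lin[of i]] pow_lin[of i] by (cases e) (simp_all add: comp_def)
  have pow_mod: "(a ^^ (k mod n)) v = (a ^^ k) v" if v: "v \<in> carrier V" for k v
  proof -
    have "(a ^^ (n * j)) v = v" for j
      by (induction j) (simp_all add: funpow_add a_n v)
    then show ?thesis using funpow_add[of "k mod n" "n * (k div n)" a] by (simp add: v)
  qed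
  have sandwich: "(a ^^ j) (b ((a ^^ j) v)) = b v" if "v \<in> carrier V" for j v
    using that
  proof (induction j arbitrary: v)
    case (Suc j)
    have "(a ^^ Suc j) (b ((a ^^ Suc j) v)) = a ((a ^^ j) (b ((a ^^ j) (a v))))"
      by (simp add: funpow_swap1)
    then show ?case using Suc aV aba by simp
  qed simp
  have b_pow: "b ((a ^^ j) v) = (a ^^ (n - j)) (b v)" if j: "j \<le> n" and v: "v \<in> carrier V" for j v
  proof -
    have "(a ^^ (n - j)) (b v) = (a ^^ (n - j)) ((a ^^ j) (b ((a ^^ j) v)))" by (simp only: sandwich[OF v])
    also have "\<dots> = (a ^^ n) (b ((a ^^ j) v))" using j by (simp add: funpow_add[symmetric, THEN fun_cong, simplified])
    also have "\<dots> = b ((a ^^ j) v)" by (rule a_n) (simp add: bV powV v)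
    finally show ?thesis ..
  qed
  have mult: "\<alpha> (g \<otimes>\<^bsub>?G\<^esub> h) v = \<alpha> g (\<alpha> h v)"
    if gh: "g \<in> carrier ?G" "h \<in> carrier ?G" and v: "v \<in> carrier V" for g h v
  proof -
    obtain i e j f where [simp]: "g = (i, e)" "h = (j, f)" "i < n" "j < n" using gh by (cases g; cases h) auto
    define w where "w = (if f then b v else v)"
    have w: "w \<in> carrier V" using v bV by (simp add: w_def)
    have R: "\<alpha> g (\<alpha> h v) = (a ^^ i) (if e then b ((a ^^ j) w) else (a ^^ j) w)"
      using v w powV by (simp add: \<alpha> w_def)
    show ?thesis
    proof (cases e)
      case False
      have "\<alpha> (g \<otimes>\<^bsub>?G\<^esub> h) v = (a ^^ ((i + j) mod n)) w"
        using False v n by (simp add: \<alpha> w_def)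
      then show ?thesis unfolding R using False by (simp add: pow_mod[OF w] funpow_add)
    next
      case True
      have "\<alpha> (g \<otimes>\<^bsub>?G\<^esub> h) v = (a ^^ ((i + (n - j)) mod n)) (b w)"
        using True v n bb by (simp add: \<alpha> w_def)
      also have "\<dots> = (a ^^ i) ((a ^^ (n - j)) (b w))" by (simp add: pow_mod[OF bV[OF w]] funpow_add)
      also have "\<dots> = (a ^^ i) (b ((a ^^ j) w))" by (subst b_pow) (simp_all add: w less_imp_le[OF \<open>j < n\<close>])
      finally show ?thesis unfolding R using True by simp
    qed
  qed
  have \<alpha>_lin: "linear_map class_ring ?M ?M (\<alpha> g)" if gG: "g \<in> carrier ?G" for g
  proof -
    obtain i e where g: "g = (i, e)" "i < n" using gG by (cases g) auto
    show ?thesis using lin[of i e] M by (cases e) (simp_all add: linear_map_iff g \<alpha> aV bV)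
  qed
  have zG: "z \<in> carrier ?G" using z n by auto
  have counit: "(\<Oplus>\<^bsub>?M\<^esub>h\<in>carrier ?G. coact ?M v h) = v" if "v \<in> carrier V" for v
  proof -
    have "(\<Oplus>\<^bsub>?M\<^esub>h\<in>carrier ?G. if h = z then v else \<zero>\<^bsub>?M\<^esub>) = v"
      by (rule M.add.finprod_singleton_swap[OF zG]) (use that in \<open>auto simp: dihedral_def\<close>)
    then show ?thesis unfolding with_degree_simps .
  qed
  have \<alpha>0: "\<alpha> g \<zero>\<^bsub>V\<^esub> = \<zero>\<^bsub>V\<^esub>" if "g \<in> carrier ?G" for g
    using linear_map_zero[OF \<alpha>_lin[OF that]] by simp
  show ?thesis
    unfolding yd_module_def yd_module_axioms_def kG_module_def kG_module_axioms_def
  proof (intro conjI allI impI)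
    show "linear_map class_ring ?M ?M (\<lambda>v. coact ?M v h)" for h
      using M M.zero_closed M.smult_r_null by (simp add: linear_map_iff)
    show "coact ?M (act ?M g v) (g \<otimes>\<^bsub>?G\<^esub> h \<otimes>\<^bsub>?G\<^esub> inv\<^bsub>?G\<^esub> g) = act ?M g (coact ?M v h)"
      if "g \<in> carrier ?G" "h \<in> carrier ?G" "v \<in> carrier ?M" for g h v
      using dih_conj_central[OF n z that(1,2)] that by (simp add: \<alpha>0)
    show "finite (carrier ?G)" by (simp add: dihedral_def)
    show "act ?M \<one>\<^bsub>?G\<^esub> v = v" if "v \<in> carrier ?M" for v using that n by (simp add: \<alpha>)
  qed (use \<alpha>_lin mult counit G.is_group M in \<open>simp_all\<close>)
qed

lemma matrix_module_yd:
  fixes A B :: "'k :: field mat"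
  assumes n: "even n" "n > 1" and z: "z \<in> {(0, False), (n div 2, False)}"
    and A: "A \<in> carrier_mat r r" and B: "B \<in> carrier_mat r r"
    and rel: "A ^\<^sub>m n = 1\<^sub>m r" "A * B * A = B" "B * B = 1\<^sub>m r"
  shows "yd_module (dihedral n) (with_degree (dih_matrix_module r A B) z)"
    and "vectorspace.fin_dim class_ring (with_degree (dih_matrix_module r A B) z)"
proof -
  have lin: "linear_map class_ring (module_vec TYPE('k) r) (module_vec TYPE('k) r) (\<lambda>v. C *\<^sub>v v)"
    if "C \<in> carrier_mat r r" for C :: "'k mat"
    unfolding linear_map_iff using that
    by (auto simp: vec_vs module_vec_simps mult_add_distrib_mat_vec mult_mat_vec)
  have pow: "((\<lambda>v. A *\<^sub>v v) ^^ i) v = (A ^\<^sub>m i) *\<^sub>v v" if "v \<in> carrier_vec r" for i v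
    using that
  proof (induction i arbitrary: v)
    case 0
    then show ?case using A by simp
  next
    case (Suc i)
    have "((\<lambda>v. A *\<^sub>v v) ^^ Suc i) v = ((\<lambda>v. A *\<^sub>v v) ^^ i) (A *\<^sub>v v)" by (simp add: funpow_swap1)
    also have "\<dots> = (A ^\<^sub>m Suc i) *\<^sub>v v"
      using Suc A by (simp add: assoc_mult_mat_vec[of "A ^\<^sub>m i" r r A r])
    finally show ?case .
  qed
  show "yd_module (dihedral n) (with_degree (dih_matrix_module r A B) z)"
    unfolding dih_matrix_module_def
  proof (rule dihedral_action[OF n z vec_vs lin[OF A] lin[OF B]])
    fix v assume "v \<in> carrier (module_vec TYPE('k) r)"
    then have v: "v \<in> carrier_vec r" by (simp add: module_vec_simps)
    show "((\<lambda>v. A *\<^sub>v v) ^^ n) v = v" using v by (simp add: pow rel)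
    show "B *\<^sub>v (B *\<^sub>v v) = v" using v B rel(3) assoc_mult_mat_vec[of B r r B r v] by simp
    have "A *\<^sub>v (B *\<^sub>v (A *\<^sub>v v)) = (A * B * A) *\<^sub>v v"
      using A B v by (simp add: assoc_mult_mat_vec[of _ r r _ r])
    then show "A *\<^sub>v (B *\<^sub>v (A *\<^sub>v v)) = B *\<^sub>v v" by (simp add: rel)
    show "(case (i, e) of (i, e) \<Rightarrow> \<lambda>v. (A ^\<^sub>m i * (if e then B else 1\<^sub>m r)) *\<^sub>v v) v =
        ((\<lambda>v. A *\<^sub>v v) ^^ i) (if e then B *\<^sub>v v else v)" for i e
      using A B v by (cases e) (simp_all add: pow assoc_mult_mat_vec[of _ r r B r])
  qed
  interpret vs: vec_space "TYPE('k)" r .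
  let ?M = "with_degree (dih_matrix_module r A B) z"
  interpret M: vectorspace class_ring ?M
    unfolding dih_matrix_module_def by (rule vectorspace_cong[OF vec_vs[where n=r]]) (simp_all add: module_vec_simps)
  let ?E = "set (unit_vecs r) :: 'k vec set"
  have E: "finite ?E" "?E \<subseteq> carrier ?M" unfolding unit_vecs_def dih_matrix_module_def by (auto simp: module_vec_simps)
  have sub: "submodule class_ring (M.span ?E) ?M" using M.span_is_submodule[OF E(2)] .
  have "carrier ?M \<subseteq> M.span ?E"
  proof -
    have "submodule class_ring (M.span ?E) (module_vec TYPE('k) r)"
      using sub vec_module[of r] unfolding submodule_def by (simp add: dih_matrix_module_def)
    then have "vs.span ?E \<subseteq> M.span ?E"
      using vs.span_is_subset[OF M.in_own_span[OF E(2)]] by simp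
    then show ?thesis using vs.span_unit_vecs_is_carrier by (simp add: dih_matrix_module_def module_vec_simps)
  qed
  then show "vectorspace.fin_dim class_ring ?M"
    unfolding M.fin_dim_def using E M.span_is_subset2[OF E(2)] by blast
qed

lemma subspace_vec_UNIV:
  fixes S :: "'k :: field vec set"
  assumes "subspace class_ring S (module_vec TYPE('k) r)" and "\<And>i. i < r \<Longrightarrow> unit_vec r i \<in> S"
  shows "carrier_vec r \<subseteq> S"
proof -
  interpret vs: vec_space "TYPE('k)" r .
  have "set (unit_vecs r) \<subseteq> S" using assms(2) by (auto simp: unit_vecs_def)
  then have "vs.span (set (unit_vecs r)) \<subseteq> S"
    using vs.span_is_subset assms(1) unfolding VectorSpace.subspace_def by blast
  then show ?thesis by (simp add: vs.span_unit_vecs_is_carrier)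
qed

section \<open>Jordan blocks\<close>

lemma mult_mat_unit_vec:
  fixes A :: "'k :: semiring_1 mat"
  assumes "A \<in> carrier_mat m r" "j < r"
  shows "A *\<^sub>v unit_vec r j = col A j"
  using assms by (intro eq_vecI) (auto simp: scalar_prod_right_unit)

lemma jordan_block_unit_vec:
  fixes l :: "'k :: comm_ring_1"
  assumes "j < r"
  shows "jordan_block r l *\<^sub>v unit_vec r j = l \<cdot>\<^sub>v unit_vec r j + (if j = 0 then 0\<^sub>v r else unit_vec r (j - 1))"
  using assms by (subst mult_mat_unit_vec[of _ r]) (auto simp: unit_vec_def intro!: eq_vecI)

text \<open>Subtracting \<open>l\<close> from the Jordan block shifts the unit vectors down.\<close>
lemma jordan_block_cyclic:
  fixes l :: "'k :: field"
  assumes S: "subspace class_ring S (module_vec TYPE('k) r)"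
    and closed: "\<And>v. v \<in> S \<Longrightarrow> jordan_block r l *\<^sub>v v \<in> S" and e: "unit_vec r (r - 1) \<in> S" and r: "r \<ge> 1"
  shows "carrier_vec r \<subseteq> S"
proof (rule subspace_vec_UNIV[OF S])
  have add: "x + y \<in> S" and sc: "c \<cdot>\<^sub>v x \<in> S" and carr: "x \<in> carrier_vec r" if "x \<in> S" "y \<in> S" for x y c
    using S that unfolding subspace_iff by (auto simp: module_vec_simps)
  have *: "unit_vec r (r - 1 - k) \<in> S" if "k < r" for k
    using that
  proof (induction k)
    case (Suc k)
    let ?j = "r - 1 - k"
    have j: "?j < r" "?j \<noteq> 0" "?j - 1 = r - 1 - Suc k" using Suc by auto
    have IH: "unit_vec r ?j \<in> S" using Suc by simp
    have "(- l) \<cdot>\<^sub>v unit_vec r ?j + jordan_block r l *\<^sub>v unit_vec r ?j \<in> S"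
      by (rule add[OF sc[OF IH IH] closed[OF IH]])
    also have "(- l) \<cdot>\<^sub>v unit_vec r ?j + jordan_block r l *\<^sub>v unit_vec r ?j = unit_vec r (?j - 1)"
      unfolding jordan_block_unit_vec[OF j(1)] using j by (intro eq_vecI) auto
    finally show ?case using j by simp
  qed (use e in simp)
  show "unit_vec r i \<in> S" if "i < r" for i
    using *[of "r - 1 - i"] that by simp
qed

lemma sum_jordan_block:
  assumes "i < r"
  shows "(\<Sum>k<r. (if i = k then l else if Suc i = k then 1 else 0) * f k) =
    l * f i + (if Suc i < r then f (Suc i) else (0 :: 'k :: comm_ring_1))"
proof -
  have "(\<Sum>k<r. (if i = k then l else if Suc i = k then 1 else 0) * f k) =
     (\<Sum>k<r. (if k = i then l * f k else 0) + (if k = Suc i then f k else 0))"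
    by (intro sum.cong) auto
  also have "\<dots> = l * f i + (if Suc i < r then f (Suc i) else 0)"
    using assms by (simp add: sum.distrib)
  finally show ?thesis .
qed

lemma sum_jordan_block_right:
  assumes "j < r"
  shows "(\<Sum>k<r. f k * (if k = j then l else if Suc k = j then 1 else 0)) =
    l * f j + (if 0 < j then f (j - 1) else (0 :: 'k :: comm_ring_1))"
proof -
  have "(\<Sum>k<r. f k * (if k = j then l else if Suc k = j then 1 else 0)) =
     (\<Sum>k<r. (if k = j then l * f k else 0) + (if k = j - 1 \<and> 0 < j then f k else 0))"
    by (intro sum.cong) auto
  also have "\<dots> = l * f j + (if 0 < j then f (j - 1) else 0)"
    using assms by (cases "0 < j") (auto simp: sum.distrib)
  finally show ?thesis .
qed

lemma t_entry_zero: "j < i \<or> r < j \<Longrightarrow> t_entry c r i j = 0"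
  by (subst t_entry.simps) simp

lemma t_entry_last: "t_entry c r r r = 1" "j \<noteq> r \<Longrightarrow> t_entry c r r j = 0"
  by (subst t_entry.simps, simp) (rule t_entry_zero, auto)

lemma t_entry_rec: "i < r \<Longrightarrow> j \<le> r \<Longrightarrow> t_entry c r i j = - c * t_entry c r (i + 1) j - t_entry c r (i + 1) (j + 1)"
  by (subst t_entry.simps) (auto simp: t_entry_zero)

lemma jordan_t_mat_index:
  assumes "i < r" "j < r"
  shows "(jordan_block r c * t_mat c r) $$ (i, j) = c * t_entry c r (i + 1) (j + 1) + t_entry c r (i + 2) (j + 1)"
proof -
  have "(jordan_block r c * t_mat c r) $$ (i, j) =
      (\<Sum>k<r. (if i = k then c else if Suc i = k then 1 else 0) * t_entry c r (k + 1) (j + 1))"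
    using assms by (auto simp: t_mat_def scalar_prod_def atLeast0LessThan intro!: sum.cong)
  also have "\<dots> = c * t_entry c r (i + 1) (j + 1) + (if Suc i < r then t_entry c r (i + 2) (j + 1) else 0)"
    using sum_jordan_block[OF assms(1), of c "\<lambda>k. t_entry c r (k + 1) (j + 1)"] by simp
  also have "(if Suc i < r then t_entry c r (i + 2) (j + 1) else 0) = t_entry c r (i + 2) (j + 1)"
    using assms by (auto simp: t_entry_zero)
  finally show ?thesis .
qed

text \<open>
  Since \<open>c\<^sup>2 = 1\<close>, comparing the entries at \<open>(i, j)\<close> leads exactly to \<open>c\<close> times the recursion for
  \<open>t\<^bsub>i,j-1\<^esub>\<close>.
\<close>
lemma jordan_t_jordan:
  fixes c :: "'k :: comm_ring_1"
  assumes c: "c * c = 1"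
  shows "jordan_block r c * t_mat c r * jordan_block r c = t_mat c r"
proof (rule eq_matI)
  fix i j assume "i < dim_row (t_mat c r)" "j < dim_col (t_mat c r)"
  then have ij: "i < r" "j < r" by (simp_all add: t_mat_def)
  let ?t = "t_entry c r"
  have "(jordan_block r c * t_mat c r * jordan_block r c) $$ (i, j) =
      (\<Sum>k<r. (c * ?t (i + 1) (k + 1) + ?t (i + 2) (k + 1)) * (if k = j then c else if Suc k = j then 1 else 0))"
  proof -
    have "(jordan_block r c * t_mat c r * jordan_block r c) $$ (i, j) =
      (\<Sum>k<r. (jordan_block r c * t_mat c r) $$ (i, k) * jordan_block r c $$ (k, j))"
      using ij by (auto simp: scalar_prod_def atLeast0LessThan t_mat_def intro!: sum.cong)
    also have "\<dots> = (\<Sum>k<r. (c * ?t (i + 1) (k + 1) + ?t (i + 2) (k + 1)) * (if k = j then c else if Suc k = j then 1 else 0))"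
      using ij by (intro sum.cong refl) (simp only: jordan_t_mat_index lessThan_iff jordan_block_index)
    finally show ?thesis .
  qed
  also have "\<dots> = c * (c * ?t (i + 1) (j + 1) + ?t (i + 2) (j + 1)) + (if 0 < j then c * ?t (i + 1) j + ?t (i + 2) j else 0)"
    using sum_jordan_block_right[OF ij(2), of "\<lambda>k. c * ?t (i + 1) (k + 1) + ?t (i + 2) (k + 1)" c] by simp
  also have "(if 0 < j then c * ?t (i + 1) j + ?t (i + 2) j else 0) = c * ?t (i + 1) j + ?t (i + 2) j"
    by (auto simp: t_entry_zero)
  also have "c * (c * ?t (i + 1) (j + 1) + ?t (i + 2) (j + 1)) + (c * ?t (i + 1) j + ?t (i + 2) j) = ?t (i + 1) (j + 1)"
  proof (cases "i + 1 < r")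
    case True
    have rec: "?t (i + 1) j = - c * ?t (i + 2) j - ?t (i + 2) (j + 1)"
      using t_entry_rec[OF True, of j c] ij by simp
    have "c * ?t (i + 1) j = - (c * c) * ?t (i + 2) j - c * ?t (i + 2) (j + 1)"
      unfolding rec by (simp add: algebra_simps)
    then show ?thesis by (simp add: algebra_simps c mult.assoc[symmetric])
  next
    case False
    then have "i + 1 = r" using ij by simp
    then show ?thesis using ij t_entry_last(2)[of j r c]
      by (simp add: t_entry_zero mult.assoc[symmetric] c)
  qed
  also have "\<dots> = t_mat c r $$ (i, j)" using ij by (simp add: t_mat_def)
  finally show "(jordan_block r c * t_mat c r * jordan_block r c) $$ (i, j) = t_mat c r $$ (i, j)" .
qed (simp_all add: t_mat_def)

lemma jordan_t_last:
  fixes c :: "'k :: comm_ring_1"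
  assumes r: "r \<ge> 1" and c: "c * c = 1"
  shows "jordan_block r c *\<^sub>v (t_mat c r *\<^sub>v unit_vec r (r - 1)) = c \<cdot>\<^sub>v unit_vec r (r - 1)"
proof -
  have T: "t_mat c r \<in> carrier_mat r r" by (simp add: t_mat_def)
  have "jordan_block r c *\<^sub>v (t_mat c r *\<^sub>v unit_vec r (r - 1)) = (jordan_block r c * t_mat c r) *\<^sub>v unit_vec r (r - 1)"
    by (rule assoc_mult_mat_vec[OF _ T, symmetric]) auto
  also have "\<dots> = col (jordan_block r c * t_mat c r) (r - 1)"
    using r T by (intro mult_mat_unit_vec[of _ r]) auto
  also have "\<dots> = c \<cdot>\<^sub>v unit_vec r (r - 1)"
  proof (rule eq_vecI)
    fix i assume "i < dim_vec (c \<cdot>\<^sub>v unit_vec r (r - 1))"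
    then have i: "i < r" by simp
    have "col (jordan_block r c * t_mat c r) (r - 1) $ i = c * t_entry c r (i + 1) r + t_entry c r (i + 2) r"
      using jordan_t_mat_index[of i r "r - 1" c] i r T by simp
    also have "\<dots> = (if i = r - 1 then c else 0)"
    proof (cases "i = r - 1")
      case True
      then show ?thesis using r by (simp add: t_entry_last t_entry_zero)
    next
      case False
      then have "t_entry c r (i + 1) r = - c * t_entry c r (i + 2) r - t_entry c r (i + 2) (r + 1)"
        using t_entry_rec[of "i + 1" r r c] i by simp
      then have "c * t_entry c r (i + 1) r = - (c * c) * t_entry c r (i + 2) r" by (simp add: t_entry_zero)
      then show ?thesis using False c by simp
    qed
    also have "\<dots> = (c \<cdot>\<^sub>v unit_vec r (r - 1)) $ i" using i r by simp
    finally show "col (jordan_block r c * t_mat c r) (r - 1) $ i = (c \<cdot>\<^sub>v unit_vec r (r - 1)) $ i" .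
  qed (use T in simp)
  finally show ?thesis .
qed

lemma matrix_module_simps:
  "carrier (with_degree (dih_matrix_module r A B) z) = carrier_vec r"
  "add (with_degree (dih_matrix_module r A B) z) = (+)"
  "zero (with_degree (dih_matrix_module r A B) z) = 0\<^sub>v r"
  "smult (with_degree (dih_matrix_module r A B) z) = (\<cdot>\<^sub>v)"
  "act (with_degree (dih_matrix_module r A B) z) (i, e) v = (A ^\<^sub>m i * (if e then B else 1\<^sub>m r)) *\<^sub>v v"
  "coact (with_degree (dih_matrix_module r A B) z) v g = (if g = z then v else 0\<^sub>v r)"
  by (simp_all add: dih_matrix_module_def module_vec_simps)

lemma matrix_module_act_a:
  assumes "A \<in> carrier_mat r r"
  shows "act (with_degree (dih_matrix_module r A B) z) (1, False) v = A *\<^sub>v v"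
  using assms by (simp add: matrix_module_simps)

lemma matrix_module_act_b:
  assumes "A \<in> carrier_mat r r" "B \<in> carrier_mat r r"
  shows "act (with_degree (dih_matrix_module r A B) z) (0, True) v = B *\<^sub>v v"
  using assms by (simp add: matrix_module_simps)

lemma pow_mat_add: "A \<in> carrier_mat r r \<Longrightarrow> A ^\<^sub>m (i + j) = A ^\<^sub>m i * A ^\<^sub>m j" for A :: "'k :: semiring_1 mat"
proof (induction j)
  case (Suc j)
  then show ?case by (simp add: assoc_mult_mat[of _ r r _ r _ r])
qed simp

lemma pow_mat_mult: "A \<in> carrier_mat r r \<Longrightarrow> (A ^\<^sub>m i) ^\<^sub>m j = A ^\<^sub>m (i * j)" for A :: "'k :: semiring_1 mat"
  by (induction j) (simp_all add: pow_mat_add[symmetric] add.commute)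

lemma one_mat_pow: "(1\<^sub>m r) ^\<^sub>m k = (1\<^sub>m r :: 'k :: semiring_1 mat)"
  by (induction k) simp_all

lemma matrix_submodule:
  assumes A: "A \<in> carrier_mat r r" and B: "B \<in> carrier_mat r r" and n: "n > 1"
    and S: "yd_submodule (dihedral n) (with_degree (dih_matrix_module r A B) z) S"
  shows "subspace class_ring S (module_vec TYPE('k :: field) r)"
    and "\<And>v. v \<in> S \<Longrightarrow> A *\<^sub>v v \<in> S" and "\<And>v. v \<in> S \<Longrightarrow> (B :: 'k mat) *\<^sub>v v \<in> S"
proof -
  show "subspace class_ring S (module_vec TYPE('k) r)"
    using S vec_vs[of r] unfolding yd_submodule_def subspace_iff
    by (simp add: matrix_module_simps module_vec_simps)
  have "act (with_degree (dih_matrix_module r A B) z) g v \<in> S" if "g \<in> carrier (dihedral n)" "v \<in> S" for g v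
    using S that unfolding yd_submodule_def by blast
  from this[of "(1, False)"] this[of "(0, True)"] n
  show "A *\<^sub>v v \<in> S" "B *\<^sub>v v \<in> S" if "v \<in> S" for v
    using that by (simp_all only: matrix_module_act_a[OF A] matrix_module_act_b[OF A B] dih_carrier)
qed

context dih_setup
begin

text \<open>These are the coefficients of \<open>(1 + x)\<^sup>q = 1 + x\<^sup>q\<close>.\<close>
lemma choose_q: "0 < d \<Longrightarrow> d < q \<Longrightarrow> of_nat (q choose d) = (0 :: 'k)"
proof -
  assume d: "0 < d" "d < q"
  have "of_nat (q choose d) = coeff ([:1, 1 :: 'k:] ^ q) d"
    using d by (subst coeff_linear_poly_power) auto
  also have "[:1, 1 :: 'k:] ^ q = [:0, 1:] ^ q - [:(- 1) ^ q:]" using frobenius_poly[of "- 1"] by simp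
  also have "coeff \<dots> d = 0"
    using d by (simp add: coeff_linear_poly_power coeff_pCons split: nat.splits)
  finally show ?thesis .
qed

lemma jordan_block_pow_q: "r \<le> q \<Longrightarrow> jordan_block r (l :: 'k) ^\<^sub>m q = l ^ q \<cdot>\<^sub>m 1\<^sub>m r"
  unfolding jordan_block_pow
proof (rule eq_matI)
  fix i j assume r: "r \<le> q" and "i < dim_row (l ^ q \<cdot>\<^sub>m 1\<^sub>m r)" "j < dim_col (l ^ q \<cdot>\<^sub>m 1\<^sub>m r)"
  then show "mat r r (\<lambda>(i, j). if i \<le> j then of_nat (q choose (j - i)) * l ^ (q + i - j) else 0) $$ (i, j) = (l ^ q \<cdot>\<^sub>m 1\<^sub>m r) $$ (i, j)"
    using choose_q[of "j - i"] by auto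
qed auto

lemma jordan_block_pow_n: "r \<le> q \<Longrightarrow> l ^ t = 1 \<Longrightarrow> jordan_block r (l :: 'k) ^\<^sub>m n = 1\<^sub>m r"
proof -
  assume r: "r \<le> q" and l: "l ^ t = 1"
  have "(c \<cdot>\<^sub>m 1\<^sub>m r) ^\<^sub>m k = c ^ k \<cdot>\<^sub>m (1\<^sub>m r :: 'k mat)" for c k
    by (induction k) (auto simp: mult_smult_distrib[of _ r r _ r] mult_smult_assoc_mat[of _ r r _ r] intro!: eq_matI)
  then have "jordan_block r l ^\<^sub>m n = (l ^ q) ^ t \<cdot>\<^sub>m 1\<^sub>m r"
    using pow_mat_mult[of "jordan_block r l" r q t] by (simp add: n_q jordan_block_pow_q[OF r])
  also have "(l ^ q) ^ t = 1" using l by (metis power_mult mult.commute power_one)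
  finally show ?thesis by (auto intro!: eq_matI)
qed

lemma jordan_block_inverse:
  assumes "r \<le> q" "l ^ t = 1"
  defines "J \<equiv> jordan_block r (l :: 'k)" and "J' \<equiv> the (mat_inverse (jordan_block r l))"
  shows "J' \<in> carrier_mat r r" "J * J' = 1\<^sub>m r" "J' * J = 1\<^sub>m r" "J' ^\<^sub>m n = 1\<^sub>m r"
proof -
  have J: "J \<in> carrier_mat r r" by (simp add: J_def)
  have Jn: "J ^\<^sub>m n = 1\<^sub>m r" unfolding J_def by (rule jordan_block_pow_n[OF assms(1,2)])
  have J1: "J ^\<^sub>m 1 = J" using J by simp
  have n1: "1 + (n - 1) = n" "n - 1 + 1 = n" using n_pos by simp_all
  have JJ: "J * J ^\<^sub>m (n - 1) = 1\<^sub>m r" "J ^\<^sub>m (n - 1) * J = 1\<^sub>m r"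
    using pow_mat_add[OF J, of 1 "n - 1"] pow_mat_add[OF J, of "n - 1" 1] unfolding n1 J1 Jn by (simp_all only:)
  have "J \<in> Units (ring_mat TYPE('k) r ())"
    unfolding Units_def ring_mat_def using J JJ by (auto intro!: bexI[of _ "J ^\<^sub>m (n - 1)"])
  then obtain K where "mat_inverse J = Some K" using mat_inverse(1)[OF J, of "()"] by (cases "mat_inverse J") auto
  then show 1: "J' \<in> carrier_mat r r" "J * J' = 1\<^sub>m r" "J' * J = 1\<^sub>m r"
    using mat_inverse(2)[OF J] by (auto simp: J_def J'_def)
  have P: "J ^\<^sub>m (n - 1) \<in> carrier_mat r r" using J by simp
  have "J' = J' * (J * J ^\<^sub>m (n - 1))" using JJ 1 by simp
  also have "\<dots> = (J' * J) * J ^\<^sub>m (n - 1)" by (rule assoc_mult_mat[OF 1(1) J P, symmetric])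
  also have "\<dots> = J ^\<^sub>m (n - 1)" by (simp only: 1 left_mult_one_mat[OF P])
  finally have J': "J' = J ^\<^sub>m (n - 1)" .
  have "J' ^\<^sub>m n = (J ^\<^sub>m n) ^\<^sub>m (n - 1)"
    unfolding J' pow_mat_mult[OF J] by (simp only: mult.commute)
  then show "J' ^\<^sub>m n = 1\<^sub>m r" by (simp only: Jn one_mat_pow)
qed

lemma unit_vec_chain:
  assumes A: "A \<in> carrier_mat m m" and r: "1 \<le> r" "r \<le> m"
    and e: "\<And>j. j < r \<Longrightarrow> A *\<^sub>v unit_vec m j = l \<cdot>\<^sub>v unit_vec m j + (if j = 0 then 0\<^sub>v m else unit_vec m (j - 1))"
  shows "jordan_chain (with_degree (dih_matrix_module m A B) z) (l :: 'k) r (unit_vec m (r - 1))"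
proof -
  let ?u = "\<lambda>k. if k < r then unit_vec m (r - 1 - k) else 0\<^sub>v m :: 'k vec"
  have ne: "unit_vec m 0 \<noteq> (0\<^sub>v m :: 'k vec)"
  proof
    assume "unit_vec m 0 = (0\<^sub>v m :: 'k vec)"
    then have "unit_vec m 0 $ 0 = (0\<^sub>v m :: 'k vec) $ 0" by simp
    then show False using r by simp
  qed
  have step: "A *\<^sub>v ?u k = l \<cdot>\<^sub>v ?u k + ?u (Suc k)" if "k < r" for k
    using e[of "r - 1 - k"] that by (cases "Suc k = r") auto
  show ?thesis
    unfolding jordan_chain_def matrix_module_act_a[OF A]
    by (rule conjI[OF r(1)], rule exI[of _ ?u]) (use r step ne in \<open>simp add: matrix_module_simps(1-4)\<close>)
qed

text \<open>
  The relation \<open>T\<^sup>2 = 1\<close> need not be computed entry by entry: \<open>J T J = T\<close> implies that \<open>T\<^sup>2\<close>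
  commutes with \<open>J\<close>, so it suffices to evaluate \<open>T\<^sup>2\<close> on the last unit vector, which generates
  everything under \<open>J\<close>.
\<close>
lemma central_matrix_module:
  assumes r: "1 \<le> r" "r \<le> q" and c: "c * c = (1 :: 'k)" and d: "d * d = 1" and z: "z \<in> central"
    and T: "T = d \<cdot>\<^sub>m t_mat c r"
  defines "M \<equiv> with_degree (dih_matrix_module r (jordan_block r c) T) z"
  shows "yd_module (dihedral n) M" "vectorspace.fin_dim class_ring M" "has_label n M (Central z c (d * c) r)"
proof -
  let ?J = "jordan_block r c" and ?e = "unit_vec r (r - 1) :: 'k vec"
  have ct: "c ^ t = 1" using square_t c by (simp add: power2_eq_square)
  have Tc: "t_mat c r \<in> carrier_mat r r" by (simp add: t_mat_def)
  have J: "?J \<in> carrier_mat r r" and T': "T \<in> carrier_mat r r" by (simp_all add: T t_mat_def)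
  have Jn: "?J ^\<^sub>m n = 1\<^sub>m r" by (rule jordan_block_pow_n[OF r(2) ct])
  have JTJ: "?J * T * ?J = T"
  proof -
    have "?J * T = d \<cdot>\<^sub>m (?J * t_mat c r)" unfolding T by (rule mult_smult_distrib[OF J Tc])
    then have "?J * T * ?J = d \<cdot>\<^sub>m (?J * t_mat c r * ?J)"
      using mult_smult_assoc_mat[OF mult_carrier_mat[OF J Tc] J, of d] by simp
    then show ?thesis by (simp only: jordan_t_jordan[OF c] T)
  qed
  have e: "?e \<in> carrier_vec r" by simp
  have JTe: "?J *\<^sub>v (T *\<^sub>v ?e) = (d * c) \<cdot>\<^sub>v ?e"
  proof -
    have "T *\<^sub>v ?e = d \<cdot>\<^sub>v (t_mat c r *\<^sub>v ?e)" unfolding T using Tc by (intro eq_vecI) (auto simp: smult_scalar_prod_distrib[of _ r])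
    then have "?J *\<^sub>v (T *\<^sub>v ?e) = d \<cdot>\<^sub>v (?J *\<^sub>v (t_mat c r *\<^sub>v ?e))"
      using mult_mat_vec[OF J, of "t_mat c r *\<^sub>v ?e" d] Tc e by simp
    then show ?thesis using jordan_t_last[OF r(1) c] by (simp add: smult_smult_assoc)
  qed
  have mv: "(X * Y) *\<^sub>v v = X *\<^sub>v (Y *\<^sub>v v)" if "X \<in> carrier_mat r r" "Y \<in> carrier_mat r r" "v \<in> carrier_vec r"
    for X Y :: "'k mat" and v by (rule assoc_mult_mat_vec[OF that])
  have JTJv: "?J *\<^sub>v (T *\<^sub>v (?J *\<^sub>v v)) = T *\<^sub>v v" if "v \<in> carrier_vec r" for v
  proof -
    have "T *\<^sub>v v = (?J * T * ?J) *\<^sub>v v" by (simp only: JTJ)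
    also have "\<dots> = (?J * T) *\<^sub>v (?J *\<^sub>v v)" by (rule mv[OF mult_carrier_mat[OF J T'] J that])
    also have "\<dots> = ?J *\<^sub>v (T *\<^sub>v (?J *\<^sub>v v))" by (rule mv[OF J T' mult_mat_vec_carrier[OF J that]])
    finally show ?thesis by (rule sym)
  qed
  define P where "P = the (mat_inverse ?J)"
  note inv = jordan_block_inverse[OF r(2) ct, folded P_def]
  have P: "P \<in> carrier_mat r r" by (rule inv)
  have JP: "?J *\<^sub>v (P *\<^sub>v v) = v" "P *\<^sub>v (?J *\<^sub>v v) = v" if "v \<in> carrier_vec r" for v
    using mv[OF J P that] mv[OF P J that] that unfolding inv(2,3) by simp_all
  have TJv: "T *\<^sub>v (?J *\<^sub>v v) = P *\<^sub>v (T *\<^sub>v v)" if "v \<in> carrier_vec r" for v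
    using JP(2)[of "T *\<^sub>v (?J *\<^sub>v v)"] JTJv[OF that] that J T' by simp
  have TPv: "T *\<^sub>v (P *\<^sub>v v) = ?J *\<^sub>v (T *\<^sub>v v)" if "v \<in> carrier_vec r" for v
    using JTJv[of "P *\<^sub>v v"] JP(1)[OF that] that P by simp
  have T0: "T *\<^sub>v 0\<^sub>v r = 0\<^sub>v r" using T' by (intro eq_vecI) auto
  have TT: "T *\<^sub>v (T *\<^sub>v v) = v" if v: "v \<in> carrier_vec r" for v
  proof -
    let ?S = "{v \<in> carrier_vec r. T *\<^sub>v (T *\<^sub>v v) = v}"
    have "carrier_vec r \<subseteq> ?S"
    proof (rule jordan_block_cyclic[OF _ _ _ r(1)])
      show "subspace class_ring ?S (module_vec TYPE('k) r)"
        using T' T0 unfolding subspace_iff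
        by (auto simp: vec_vs module_vec_simps mult_add_distrib_mat_vec mult_mat_vec)
      show "?J *\<^sub>v v \<in> ?S" if "v \<in> ?S" for v
        using that mult_mat_vec_carrier[OF J, of v] T' TJv[of v] TPv[of "T *\<^sub>v v"] by simp
      have "T *\<^sub>v ?e = (d * c) \<cdot>\<^sub>v (P *\<^sub>v ?e)"
        using JP(2)[of "T *\<^sub>v ?e"] JTe T' mult_mat_vec[OF P e, of "d * c"] by simp
      then have "T *\<^sub>v (T *\<^sub>v ?e) = (d * c) \<cdot>\<^sub>v (?J *\<^sub>v (T *\<^sub>v ?e))"
        using mult_mat_vec[OF T', of "P *\<^sub>v ?e" "d * c"] TPv[OF e] P e by simp
      also have "\<dots> = ((d * d) * (c * c)) \<cdot>\<^sub>v ?e" unfolding JTe by (simp add: smult_smult_assoc mult.assoc mult.left_commute)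
      finally show "?e \<in> ?S" by (simp add: c d)
    qed
    then show ?thesis using v by blast
  qed
  have TT': "T * T = 1\<^sub>m r"
  proof (rule eq_matI)
    fix i j assume "i < dim_row (1\<^sub>m r :: 'k mat)" "j < dim_col (1\<^sub>m r :: 'k mat)"
    then have ij: "i < r" "j < r" by simp_all
    have "col (T * T) j = (T * T) *\<^sub>v unit_vec r j" using ij T' by (intro mult_mat_unit_vec[symmetric]) auto
    also have "\<dots> = unit_vec r j" using mv[OF T' T', of "unit_vec r j"] TT by simp
    finally have "col (T * T) j $ i = unit_vec r j $ i" by simp
    then show "(T * T) $$ (i, j) = 1\<^sub>m r $$ (i, j)" using ij T' by auto
  qed (use T' in auto)
  show "yd_module (dihedral n) M" "vectorspace.fin_dim class_ring M"
    unfolding M_def by (rule matrix_module_yd[OF even_n n_pos(2) z J T' Jn JTJ TT'])+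
  have "is_gen n M (Central z c (d * c) r) ?e"
  proof -
    have "act M (1, True) ?e = ?J *\<^sub>v (T *\<^sub>v ?e)"
      unfolding M_def matrix_module_simps using mv[OF J T' e] J by simp
    moreover have "jordan_chain M c r ?e"
      unfolding M_def by (rule unit_vec_chain[OF J r(1)]) (simp_all add: jordan_block_unit_vec)
    ultimately show ?thesis using JTe by (simp add: M_def matrix_module_simps)
  qed
  moreover have "generated (dihedral n) M ?e"
    unfolding generated_def
  proof (intro allI impI)
    fix S assume S: "yd_submodule (dihedral n) M S" "?e \<in> S"
    note sub = matrix_submodule[OF J T' n_pos(2) S(1)[unfolded M_def]]
    show "carrier M \<subseteq> S"
      using jordan_block_cyclic[OF sub(1) sub(2) S(2) r(1)] by (simp add: M_def matrix_module_simps)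
  qed
  ultimately show "has_label n M (Central z c (d * c) r)" unfolding has_label_def by blast
qed

lemma two_block_module:
  assumes r: "1 \<le> r" "r \<le> q" and l: "l ^ t = (1 :: 'k)" and z: "z \<in> central"
  defines "M \<equiv> with_degree (dih_matrix_module (2 * r)
       (four_block_mat (jordan_block r l) (0\<^sub>m r r) (0\<^sub>m r r) (the (mat_inverse (jordan_block r l))))
       (four_block_mat (0\<^sub>m r r) (1\<^sub>m r) (1\<^sub>m r) (0\<^sub>m r r))) z"
  shows "yd_module (dihedral n) M" "vectorspace.fin_dim class_ring M" "has_label n M (Cyclic z l r)"
proof -
  let ?J = "jordan_block r l"
  define J' where "J' = the (mat_inverse ?J)"
  let ?A = "four_block_mat ?J (0\<^sub>m r r) (0\<^sub>m r r) J'"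
  let ?B = "four_block_mat (0\<^sub>m r r) (1\<^sub>m r) (1\<^sub>m r) (0\<^sub>m r r) :: 'k mat"
  let ?m = "2 * r" and ?e = "unit_vec (2 * r) (r - 1) :: 'k vec"
  have J: "?J \<in> carrier_mat r r" by simp
  note J' = jordan_block_inverse[OF r(2) l, folded J'_def]
  have A: "?A \<in> carrier_mat ?m ?m" and B: "?B \<in> carrier_mat ?m ?m"
    using J'(1) four_block_carrier_mat[of _ r r _ r r] by (simp_all add: mult_2)
  have An: "?A ^\<^sub>m n = 1\<^sub>m ?m"
    by (subst pow_four_block_mat[OF J J'(1)]) (simp add: jordan_block_pow_n[OF r(2) l] J'(4) mult_2)
  have BB: "?B * ?B = 1\<^sub>m ?m"
    by (subst mult_four_block_mat[of _ r r _ r _ r _ _ r _ r]) (simp_all add: mult_2)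
  have ABA: "?A * ?B * ?A = ?B"
  proof -
    have "?A * ?B = four_block_mat (0\<^sub>m r r) ?J J' (0\<^sub>m r r)"
      using J'(1) by (subst mult_four_block_mat[of _ r r _ r _ r _ _ r _ r]) simp_all
    also have "\<dots> * ?A = ?B"
      using J' by (subst mult_four_block_mat[of _ r r _ r _ r _ _ r _ r]) simp_all
    finally show ?thesis .
  qed
  have M: "M = with_degree (dih_matrix_module ?m ?A ?B) z" by (simp add: M_def J'_def)
  show "yd_module (dihedral n) M" "vectorspace.fin_dim class_ring M"
    unfolding M by (rule matrix_module_yd[OF even_n n_pos(2) z A B An ABA BB])+
  have Ae: "?A *\<^sub>v unit_vec ?m j = l \<cdot>\<^sub>v unit_vec ?m j + (if j = 0 then 0\<^sub>v ?m else unit_vec ?m (j - 1))"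
    if "j < r" for j
    using that A J'(1) by (subst mult_mat_unit_vec[OF A]) (auto simp: unit_vec_def intro!: eq_vecI)
  have Be: "?B *\<^sub>v unit_vec ?m j = unit_vec ?m (r + j)" if "j < r" for j
    using that B by (subst mult_mat_unit_vec[OF B]) (auto simp: unit_vec_def intro!: eq_vecI)
  have "is_gen n M (Cyclic z l r) ?e"
    using unit_vec_chain[OF A r(1) _ Ae, of ?B z] r by (simp add: M matrix_module_simps)
  moreover have "generated (dihedral n) M ?e"
    unfolding generated_def
  proof (intro allI impI)
    fix S assume S: "yd_submodule (dihedral n) M S" "?e \<in> S"
    note sub = matrix_submodule[OF A B n_pos(2) S(1)[unfolded M]]
    have add: "x + y \<in> S" and sc: "c \<cdot>\<^sub>v x \<in> S" if "x \<in> S" "y \<in> S" for x y c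
      using sub(1) that unfolding subspace_iff by (auto simp: module_vec_simps)
    have *: "unit_vec ?m (r - 1 - k) \<in> S" if "k < r" for k
      using that
    proof (induction k)
      case (Suc k)
      let ?j = "r - 1 - k"
      have j: "?j < r" "?j \<noteq> 0" "?j - 1 = r - 1 - Suc k" using Suc by auto
      have IH: "unit_vec ?m ?j \<in> S" using Suc by simp
      have "(- l) \<cdot>\<^sub>v unit_vec ?m ?j + ?A *\<^sub>v unit_vec ?m ?j \<in> S"
        by (rule add[OF sc[OF IH IH] sub(2)[OF IH]])
      also have "(- l) \<cdot>\<^sub>v unit_vec ?m ?j + ?A *\<^sub>v unit_vec ?m ?j = unit_vec ?m (?j - 1)"
        unfolding Ae[OF j(1)] using j by (intro eq_vecI) auto
      finally show ?case using j by simp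
    qed (use S in simp)
    have 1: "unit_vec ?m i \<in> S" if "i < r" for i using *[of "r - 1 - i"] that by simp
    have "unit_vec ?m i \<in> S" if "i < ?m" for i
    proof (cases "i < r")
      case False
      then have "i - r < r" "r + (i - r) = i" using that by auto
      then show ?thesis using sub(3)[OF 1[of "i - r"]] Be[of "i - r"] by simp
    qed (rule 1)
    then show "carrier M \<subseteq> S"
      using subspace_vec_UNIV[OF sub(1)] by (simp add: M matrix_module_simps)
  qed
  ultimately show "has_label n M (Cyclic z l r)" unfolding has_label_def by blast
qed

fun matrix_label :: "dih \<Rightarrow> dih_index \<Rightarrow> 'k label" where
  "matrix_label z (V0 r) = Central z 1 1 r"
| "matrix_label z (V0' r) = Central z 1 (- 1) r"
| "matrix_label z (Vh r) = Central z (- 1) (- 1) r"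
| "matrix_label z (Vh' r) = Central z (- 1) 1 r"
| "matrix_label z (W r i) = Cyclic z (\<xi> ^ i) r"

lemma dih_module_label:
  assumes z: "z \<in> central" and x: "x \<in> dih_indices p s t"
  defines "M \<equiv> with_degree (dih_module t \<xi> x) z"
  shows "yd_module (dihedral n) M" "vectorspace.fin_dim class_ring M"
    "has_label n M (matrix_label z x)" "valid (matrix_label z x)"
proof -
  have neg: "- t_mat c r = (- 1) \<cdot>\<^sub>m t_mat c r" and pos: "t_mat c r = 1 \<cdot>\<^sub>m t_mat c r" for c :: 'k and r
    by (auto intro!: eq_matI)
  have "yd_module (dihedral n) M \<and> vectorspace.fin_dim class_ring M \<and> has_label n M (matrix_label z x) \<and>
    valid (matrix_label z x)"
  proof (cases x)
    case (V0 r)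
    then have r: "1 \<le> r" "r \<le> q" using x by (auto simp: dih_indices_def q_def)
    from central_matrix_module[OF r _ _ z pos, of 1] show ?thesis using r z by (simp add: M_def V0)
  next
    case (V0' r)
    then have r: "1 \<le> r" "r \<le> q" using x by (auto simp: dih_indices_def q_def)
    from central_matrix_module[OF r _ _ z neg, of 1] show ?thesis using r z by (simp add: M_def V0')
  next
    case (Vh r)
    then have r: "1 \<le> r" "r \<le> q" using x by (auto simp: dih_indices_def q_def)
    from central_matrix_module[OF r _ _ z pos, of "- 1"] show ?thesis using r z by (simp add: M_def Vh xi_half)
  next
    case (Vh' r)
    then have r: "1 \<le> r" "r \<le> q" using x by (auto simp: dih_indices_def q_def)
    from central_matrix_module[OF r _ _ z neg, of "- 1"] show ?thesis using r z by (simp add: M_def Vh' xi_half)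
  next
    case (W r i)
    then have r: "1 \<le> r" "r \<le> q" "1 \<le> i" "i \<le> t div 2 - 1" using x by (auto simp: dih_indices_def q_def)
    have "(\<xi> ^ i)\<^sup>2 \<noteq> 1"
      using xi_neq[of "i * 2"] r even_t by (auto simp: power_mult[symmetric])
    moreover have "\<exists>m<n. z = (m, False)" using z half n_pos by auto
    ultimately have "valid (Cyclic z (\<xi> ^ i) r)" using r by (auto simp: xi_pow_t)
    with two_block_module[OF r(1,2) xi_pow_t z, of i] show ?thesis by (simp add: M_def W)
  qed
  then show "yd_module (dihedral n) M" "vectorspace.fin_dim class_ring M"
    "has_label n M (matrix_label z x)" "valid (matrix_label z x)" by blast+
qed

end

section \<open>Finite dimension, quotients and images\<close>

lemma (in yd_module) finsum_subspace_closed: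
  assumes "subspace class_ring S M" "f \<in> A \<rightarrow> S"
  shows "(\<Oplus>\<^bsub>M\<^esub>x\<in>A. f x) \<in> S"
proof -
  have S: "S \<subseteq> carrier M" "\<zero>\<^bsub>M\<^esub> \<in> S" "\<And>x y. x \<in> S \<Longrightarrow> y \<in> S \<Longrightarrow> x \<oplus>\<^bsub>M\<^esub> y \<in> S"
    using assms(1) unfolding subspace_iff by auto
  show ?thesis using assms(2)
  proof (induction A rule: infinite_finite_induct)
    case (insert x A)
    then have "f \<in> A \<rightarrow> carrier M" "f x \<in> carrier M" "f x \<in> S" "f \<in> A \<rightarrow> S" using S(1) by auto
    then show ?case using insert S(3) by simp
  qed (simp_all add: S)
qed

lemma linear_map_span:
  assumes T: "linear_map (class_ring :: 'k :: field ring) M N T" and X: "X \<subseteq> carrier M"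
    and S: "subspace class_ring S N" "\<And>x. x \<in> X \<Longrightarrow> T x \<in> S" and f: "f \<in> LinearCombinations.module.span class_ring M X"
  shows "T f \<in> S"
proof -
  have M: "vectorspace class_ring M" using T by (simp add: linear_map_iff)
  interpret M: vectorspace class_ring M by (fact M)
  have cl: "\<And>v. v \<in> carrier M \<Longrightarrow> T v \<in> carrier N" "\<And>v w. v \<in> carrier M \<Longrightarrow> w \<in> carrier M \<Longrightarrow> T (v \<oplus>\<^bsub>M\<^esub> w) = T v \<oplus>\<^bsub>N\<^esub> T w"
    "\<And>c v. v \<in> carrier M \<Longrightarrow> T (c \<odot>\<^bsub>M\<^esub> v) = c \<odot>\<^bsub>N\<^esub> T v"
    using T by (simp_all add: linear_map_iff)
  have S': "\<zero>\<^bsub>N\<^esub> \<in> S" "\<And>v w. v \<in> S \<Longrightarrow> w \<in> S \<Longrightarrow> v \<oplus>\<^bsub>N\<^esub> w \<in> S" "\<And>c v. v \<in> S \<Longrightarrow> c \<odot>\<^bsub>N\<^esub> v \<in> S"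
    using S(1) unfolding subspace_iff by auto
  have "subspace class_ring {v \<in> carrier M. T v \<in> S} M"
    unfolding subspace_iff using M linear_map_zero[OF T] S' by (simp add: cl)
  then have "submodule class_ring {v \<in> carrier M. T v \<in> S} M"
    unfolding VectorSpace.subspace_def by blast
  then have "M.span X \<subseteq> {v \<in> carrier M. T v \<in> S}"
    by (rule M.span_is_subset[rotated]) (use X S(2) in auto)
  then show ?thesis using f by blast
qed

lemma span_yd_submodule:
  assumes M: "yd_module G M" and X: "X \<subseteq> carrier M"
    and act: "\<And>g x. g \<in> carrier G \<Longrightarrow> x \<in> X \<Longrightarrow> act M g x \<in> LinearCombinations.module.span class_ring M X"
    and coact: "\<And>g x. g \<in> carrier G \<Longrightarrow> x \<in> X \<Longrightarrow> coact M x g \<in> LinearCombinations.module.span class_ring M X"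
  shows "yd_submodule G M (LinearCombinations.module.span class_ring M X)"
proof -
  interpret M: yd_module G M by (fact M)
  have S: "subspace class_ring (M.span X) M" using M.span_is_subspace[OF X] .
  show ?thesis
    unfolding yd_submodule_def
    using S linear_map_span[OF M.act_linear X S act] linear_map_span[OF M.coact_linear X S coact] by blast
qed

text \<open>The finitely many translates of a homogeneous generator span the module.\<close>
lemma generated_fin_dim:
  fixes M :: "('k :: field, 'g, 'v, 'd) yd_module_scheme"
  assumes M: "yd_module G M" and v: "v \<in> carrier M" "g \<in> carrier G" "coact M v g = v" and gen: "generated G M v"
  shows "vectorspace.fin_dim class_ring M"
proof -
  interpret M: yd_module G M by (fact M)
  let ?X = "(\<lambda>x. act M x v) ` carrier G"
  have X: "?X \<subseteq> carrier M" "finite ?X" using M.act_closed v M.finite_group by auto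
  have in_span: "x \<in> M.span ?X" if "x \<in> ?X" for x using M.in_own_span[OF X(1)] that by blast
  have "yd_submodule G M (M.span ?X)"
  proof (rule span_yd_submodule[OF M X(1)])
    show "act M y w \<in> M.span ?X" if y: "y \<in> carrier G" and w: "w \<in> ?X" for y w
    proof -
      obtain x where x: "w = act M x v" "x \<in> carrier G" using w by blast
      then have "act M y w = act M (y \<otimes>\<^bsub>G\<^esub> x) v" using M.act_mult y v by simp
      then show ?thesis using in_span x y by simp
    qed
    show "coact M w y \<in> M.span ?X" if y: "y \<in> carrier G" and w: "w \<in> ?X" for y w
    proof -
      obtain x where x: "w = act M x v" "x \<in> carrier G" using w by blast
      let ?k = "x \<otimes>\<^bsub>G\<^esub> g \<otimes>\<^bsub>G\<^esub> inv\<^bsub>G\<^esub> x"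
      have "coact M w ?k = w" using M.compat[OF x(2) v(2,1)] v(3) x(1) by simp
      then have "coact M w y = (if y = ?k then w else \<zero>\<^bsub>M\<^esub>)"
        using M.coassoc[of ?k y w] x y v M.act_closed by simp
      moreover have "\<zero>\<^bsub>M\<^esub> \<in> M.span ?X" by (rule M.span_zero)
      ultimately show ?thesis using in_span w by simp
    qed
  qed
  moreover have "v \<in> M.span ?X"
    using in_span[of "act M \<one>\<^bsub>G\<^esub> v"] M.act_one[OF v(1)] by force
  ultimately have "carrier M \<subseteq> M.span ?X" using gen unfolding generated_def by blast
  then show ?thesis
    unfolding M.fin_dim_def using X M.span_is_subset2[OF X(1)] by blast
qed

text \<open>
  Every axiom is an identity between operations that are respected by \<open>p\<close>, so it passes to the
  image.
\<close>
lemma yd_module_image: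
  fixes F :: "('k :: field, 'g, 'v, 'd) yd_module_scheme" and Q :: "('k, 'g, 'w, 'e) yd_module_scheme"
  assumes F: "yd_module G F"
    and img: "p ` carrier F = carrier Q" and zero: "p \<zero>\<^bsub>F\<^esub> = \<zero>\<^bsub>Q\<^esub>"
    and add: "\<And>v w. v \<in> carrier F \<Longrightarrow> w \<in> carrier F \<Longrightarrow> p v \<oplus>\<^bsub>Q\<^esub> p w = p (v \<oplus>\<^bsub>F\<^esub> w)"
    and smult: "\<And>c v. v \<in> carrier F \<Longrightarrow> c \<odot>\<^bsub>Q\<^esub> p v = p (c \<odot>\<^bsub>F\<^esub> v)"
    and act: "\<And>g v. g \<in> carrier G \<Longrightarrow> v \<in> carrier F \<Longrightarrow> act Q g (p v) = p (act F g v)"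
    and coact: "\<And>g v. g \<in> carrier G \<Longrightarrow> v \<in> carrier F \<Longrightarrow> coact Q (p v) g = p (coact F v g)"
  shows "yd_module G Q" "linear_map class_ring F Q p"
proof -
  interpret F: yd_module G F by (fact F)
  have pQ: "p v \<in> carrier Q" if "v \<in> carrier F" for v using img that by blast
  have all: "(\<forall>x\<in>carrier Q. P x) \<longleftrightarrow> (\<forall>v\<in>carrier F. P (p v))" for P unfolding img[symmetric] by blast
  have all2: "(\<forall>x y. x \<in> carrier Q \<and> y \<in> carrier Q \<longrightarrow> P x y) \<longleftrightarrow> (\<forall>v\<in>carrier F. \<forall>w\<in>carrier F. P (p v) (p w))" for P
    unfolding img[symmetric] by blast
  have all3: "(\<forall>x y z. x \<in> carrier Q \<and> y \<in> carrier Q \<and> z \<in> carrier Q \<longrightarrow> P x y z) \<longleftrightarrow>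
      (\<forall>u\<in>carrier F. \<forall>v\<in>carrier F. \<forall>w\<in>carrier F. P (p u) (p v) (p w))" for P
    unfolding img[symmetric] by blast
  have all_s: "(\<forall>a b x. a \<in> A \<and> b \<in> B \<and> x \<in> carrier Q \<longrightarrow> P a b x) \<longleftrightarrow> (\<forall>v\<in>carrier F. \<forall>a\<in>A. \<forall>b\<in>B. P a b (p v))"
    for P and A B :: "'k set" unfolding img[symmetric] by blast
  have all_t: "(\<forall>a x. a \<in> A \<and> x \<in> carrier Q \<longrightarrow> P a x) \<longleftrightarrow> (\<forall>v\<in>carrier F. \<forall>a\<in>A. P a (p v))"
    for P and A :: "'k set" unfolding img[symmetric] by blast
  have all_u: "(\<forall>a x y. a \<in> A \<and> x \<in> carrier Q \<and> y \<in> carrier Q \<longrightarrow> P a x y) \<longleftrightarrow> (\<forall>v\<in>carrier F. \<forall>w\<in>carrier F. \<forall>a\<in>A. P a (p v) (p w))"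
    for P and A :: "'k set" unfolding img[symmetric] by blast
  have Q: "vectorspace class_ring Q"
  proof (rule vs_criteria)
    show "\<forall>v\<in>carrier Q. \<exists>w\<in>carrier Q. v \<oplus>\<^bsub>Q\<^esub> w = \<zero>\<^bsub>Q\<^esub>"
      unfolding all
    proof
      fix v assume v: "v \<in> carrier F"
      then show "\<exists>w\<in>carrier Q. p v \<oplus>\<^bsub>Q\<^esub> w = \<zero>\<^bsub>Q\<^esub>"
        by (intro bexI[of _ "p (\<ominus>\<^bsub>F\<^esub> v)"]) (simp_all add: add zero F.r_neg pQ)
    qed
    show "\<zero>\<^bsub>Q\<^esub> \<in> carrier Q" unfolding zero[symmetric] by (simp add: pQ)
    show "\<forall>v w. v \<in> carrier Q \<and> w \<in> carrier Q \<longrightarrow> v \<oplus>\<^bsub>Q\<^esub> w \<in> carrier Q"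
      unfolding all2 by (simp add: add pQ)
    show "\<forall>v w. v \<in> carrier Q \<and> w \<in> carrier Q \<longrightarrow> v \<oplus>\<^bsub>Q\<^esub> w = w \<oplus>\<^bsub>Q\<^esub> v"
      unfolding all2 by (simp add: add F.a_comm)
    show "\<forall>v w x. v \<in> carrier Q \<and> w \<in> carrier Q \<and> x \<in> carrier Q \<longrightarrow> v \<oplus>\<^bsub>Q\<^esub> w \<oplus>\<^bsub>Q\<^esub> x = v \<oplus>\<^bsub>Q\<^esub> (w \<oplus>\<^bsub>Q\<^esub> x)"
      unfolding all3 by (simp add: add F.a_assoc)
    show "\<forall>v\<in>carrier Q. v \<oplus>\<^bsub>Q\<^esub> \<zero>\<^bsub>Q\<^esub> = v"
      unfolding all zero[symmetric] by (simp add: add)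
    show "\<forall>c v. c \<in> carrier class_ring \<and> v \<in> carrier Q \<longrightarrow> c \<odot>\<^bsub>Q\<^esub> v \<in> carrier Q"
      unfolding all_t by (simp add: smult pQ)
    show "\<forall>a b v. a \<in> carrier class_ring \<and> b \<in> carrier class_ring \<and> v \<in> carrier Q \<longrightarrow>
        (a \<otimes>\<^bsub>class_ring\<^esub> b) \<odot>\<^bsub>Q\<^esub> v = a \<odot>\<^bsub>Q\<^esub> (b \<odot>\<^bsub>Q\<^esub> v)"
      unfolding all_s using F.smult_assoc1 by (simp add: smult)
    show "\<forall>v\<in>carrier Q. \<one>\<^bsub>class_ring\<^esub> \<odot>\<^bsub>Q\<^esub> v = v"
      unfolding all using F.smult_one by (simp add: smult)
    show "\<forall>a b v. a \<in> carrier class_ring \<and> b \<in> carrier class_ring \<and> v \<in> carrier Q \<longrightarrow>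
        (a \<oplus>\<^bsub>class_ring\<^esub> b) \<odot>\<^bsub>Q\<^esub> v = a \<odot>\<^bsub>Q\<^esub> v \<oplus>\<^bsub>Q\<^esub> b \<odot>\<^bsub>Q\<^esub> v"
      unfolding all_s using F.smult_l_distr by (simp add: smult add)
    show "\<forall>a v w. a \<in> carrier class_ring \<and> v \<in> carrier Q \<and> w \<in> carrier Q \<longrightarrow>
        a \<odot>\<^bsub>Q\<^esub> (v \<oplus>\<^bsub>Q\<^esub> w) = a \<odot>\<^bsub>Q\<^esub> v \<oplus>\<^bsub>Q\<^esub> a \<odot>\<^bsub>Q\<^esub> w"
      unfolding all_u using F.smult_r_distr by (simp add: smult add)
  qed (rule class_field)
  have Fv: "vectorspace class_ring F" by unfold_locales
  show p: "linear_map class_ring F Q p"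
    unfolding linear_map_iff using Fv Q by (simp add: add smult pQ)
  have lin: "linear_map class_ring Q Q T'"
    if T: "linear_map class_ring F F T" and T': "\<And>v. v \<in> carrier F \<Longrightarrow> T' (p v) = p (T v)" for T T'
  proof -
    have cl: "\<And>v. v \<in> carrier F \<Longrightarrow> T v \<in> carrier F" "\<And>v w. v \<in> carrier F \<Longrightarrow> w \<in> carrier F \<Longrightarrow> T (v \<oplus>\<^bsub>F\<^esub> w) = T v \<oplus>\<^bsub>F\<^esub> T w"
      "\<And>c v. v \<in> carrier F \<Longrightarrow> T (c \<odot>\<^bsub>F\<^esub> v) = c \<odot>\<^bsub>F\<^esub> T v"
      using T by (simp_all add: linear_map_iff)
    show ?thesis unfolding linear_map_iff all using Q by (simp add: add smult T' cl pQ)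
  qed
  show "yd_module G Q"
    unfolding yd_module_def yd_module_axioms_def kG_module_def kG_module_axioms_def
  proof (intro conjI allI impI)
    show "group G" by (rule F.is_group)
    show "vectorspace class_ring Q" by (rule Q)
    show "finite (carrier G)" by (rule F.finite_group)
    show "linear_map class_ring Q Q (act Q g)" if "g \<in> carrier G" for g
      by (rule lin[OF F.act_linear[OF that]]) (rule act[OF that])
    show "linear_map class_ring Q Q (\<lambda>v. coact Q v g)" if "g \<in> carrier G" for g
      by (rule lin[OF F.coact_linear[OF that]]) (rule coact[OF that])
    fix x assume "x \<in> carrier Q"
    then obtain v where v: "x = p v" "v \<in> carrier F" using img by blast
    show "act Q \<one>\<^bsub>G\<^esub> x = x" using v by (simp add: act F.act_one)
    have "(\<Oplus>\<^bsub>Q\<^esub>h\<in>carrier G. p (coact F v h)) = p (\<Oplus>\<^bsub>F\<^esub>h\<in>carrier G. coact F v h)"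
      by (rule linear_map_finsum[OF p, symmetric]) (use F.coact_closed v in blast)
    moreover have "(\<Oplus>\<^bsub>Q\<^esub>h\<in>carrier G. coact Q x h) = (\<Oplus>\<^bsub>Q\<^esub>h\<in>carrier G. p (coact F v h))"
    proof -
      interpret Q: vectorspace class_ring Q by (rule Q)
      show ?thesis using v coact F.coact_closed pQ by (intro Q.finsum_cong') auto
    qed
    ultimately show "(\<Oplus>\<^bsub>Q\<^esub>h\<in>carrier G. coact Q x h) = x" using F.counit v by simp
    fix g h assume gh: "g \<in> carrier G" "h \<in> carrier G"
    show "act Q (g \<otimes>\<^bsub>G\<^esub> h) x = act Q g (act Q h x)"
      using v gh by (simp add: act F.act_closed F.act_mult)
    show "coact Q (coact Q x g) h = (if h = g then coact Q x g else \<zero>\<^bsub>Q\<^esub>)"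
      using v gh by (simp add: coact F.coact_closed F.coassoc zero)
    show "coact Q (act Q g x) (g \<otimes>\<^bsub>G\<^esub> h \<otimes>\<^bsub>G\<^esub> inv\<^bsub>G\<^esub> g) = act Q g (coact Q x h)"
      using v gh by (simp add: act coact F.act_closed F.coact_closed F.compat)
  qed
qed

lemma yd_quotient_simps [simp]:
  "carrier (yd_quotient F R) = a_rcosets\<^bsub>F\<^esub> R" "zero (yd_quotient F R) = R"
  "add (yd_quotient F R) X Y = X <+>\<^bsub>F\<^esub> Y"
  "smult (yd_quotient F R) a X = R <+>\<^bsub>F\<^esub> (\<lambda>w. a \<odot>\<^bsub>F\<^esub> w) ` X"
  "act (yd_quotient F R) g X = R <+>\<^bsub>F\<^esub> act F g ` X"
  "coact (yd_quotient F R) X y = R <+>\<^bsub>F\<^esub> (\<lambda>w. coact F w y) ` X"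
  by (simp_all add: yd_quotient_def)

text \<open>
  The operations on cosets are given by sets of representatives; as \<open>R\<close> is stable, they are the
  operations on single representatives.
\<close>
lemma yd_quotient_yd:
  fixes F :: "('k :: field, 'g, 'v) yd_module"
  assumes F: "yd_module G F" and R: "yd_submodule G F R"
  defines "p \<equiv> \<lambda>f. R +>\<^bsub>F\<^esub> f" and "Q \<equiv> yd_quotient F R"
  shows "yd_module G Q" "linear_map class_ring F Q p" "p ` carrier F = carrier Q"
    "\<And>g v. g \<in> carrier G \<Longrightarrow> v \<in> carrier F \<Longrightarrow> act Q g (p v) = p (act F g v)"
    "\<And>g v. g \<in> carrier G \<Longrightarrow> v \<in> carrier F \<Longrightarrow> coact Q (p v) g = p (coact F v g)"
    "\<And>v. v \<in> carrier F \<Longrightarrow> p v = \<zero>\<^bsub>Q\<^esub> \<longleftrightarrow> v \<in> R"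
proof -
  interpret F: yd_module G F by (fact F)
  have R': "R \<subseteq> carrier F" "\<zero>\<^bsub>F\<^esub> \<in> R" "\<And>v w. v \<in> R \<Longrightarrow> w \<in> R \<Longrightarrow> v \<oplus>\<^bsub>F\<^esub> w \<in> R" "\<And>c v. v \<in> R \<Longrightarrow> c \<odot>\<^bsub>F\<^esub> v \<in> R"
    "\<And>g v. g \<in> carrier G \<Longrightarrow> v \<in> R \<Longrightarrow> act F g v \<in> R" "\<And>g v. g \<in> carrier G \<Longrightarrow> v \<in> R \<Longrightarrow> coact F v g \<in> R"
    using R unfolding yd_submodule_def subspace_iff by blast+
  have "submodule class_ring R F" using R unfolding yd_submodule_def VectorSpace.subspace_def by blast
  have neg: "\<ominus>\<^bsub>F\<^esub> v \<in> R" if "v \<in> R" for v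
  proof -
    have "(- 1) \<odot>\<^bsub>F\<^esub> v = \<ominus>\<^bsub>F\<^esub> v" using F.smult_minus_1[of v] R'(1) that by (auto simp: class_ring_simps)
    then show ?thesis using R'(4)[OF that, of "- 1"] by simp
  qed
  interpret R: abelian_subgroup R F
  proof (rule abelian_subgroupI3)
    show "additive_subgroup R F"
      by (rule additive_subgroup.intro, rule subgroup.intro) (use R' neg in \<open>auto simp: a_inv_def[symmetric]\<close>)
    show "abelian_group F" by unfold_locales
  qed
  have lift: "R <+>\<^bsub>F\<^esub> T ` p v = p (T v)"
    if T: "linear_map class_ring F F T" and TR: "\<And>r. r \<in> R \<Longrightarrow> T r \<in> R" and v: "v \<in> carrier F" for T v
  proof -
    have cl: "\<And>v. v \<in> carrier F \<Longrightarrow> T v \<in> carrier F" "\<And>v w. v \<in> carrier F \<Longrightarrow> w \<in> carrier F \<Longrightarrow> T (v \<oplus>\<^bsub>F\<^esub> w) = T v \<oplus>\<^bsub>F\<^esub> T w"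
      using T by (simp_all add: linear_map_iff)
    show ?thesis
    proof
      show "R <+>\<^bsub>F\<^esub> T ` p v \<subseteq> p (T v)"
      proof
        fix x assume "x \<in> R <+>\<^bsub>F\<^esub> T ` p v"
        then obtain r r' where r: "r \<in> R" "r' \<in> R" "x = r \<oplus>\<^bsub>F\<^esub> T (r' \<oplus>\<^bsub>F\<^esub> v)"
          unfolding set_add_def' p_def a_r_coset_def' by blast
        then have "x = (r \<oplus>\<^bsub>F\<^esub> T r') \<oplus>\<^bsub>F\<^esub> T v"
          using R'(1) v cl F.a_assoc by (simp add: subset_iff)
        moreover have "r \<oplus>\<^bsub>F\<^esub> T r' \<in> R" using r R'(3) TR by blast
        ultimately show "x \<in> p (T v)" unfolding p_def a_r_coset_def' by blast
      qed
      show "p (T v) \<subseteq> R <+>\<^bsub>F\<^esub> T ` p v"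
      proof
        fix x assume "x \<in> p (T v)"
        then obtain r where r: "r \<in> R" "x = r \<oplus>\<^bsub>F\<^esub> T v" unfolding p_def a_r_coset_def' by blast
        have "v = \<zero>\<^bsub>F\<^esub> \<oplus>\<^bsub>F\<^esub> v" using v by simp
        then have "v \<in> p v" unfolding p_def a_r_coset_def' using R'(2) by blast
        then show "x \<in> R <+>\<^bsub>F\<^esub> T ` p v" unfolding set_add_def' using r by blast
      qed
    qed
  qed
  have Fv: "vectorspace class_ring F" by unfold_locales
  have scal: "linear_map class_ring F F (\<lambda>w. c \<odot>\<^bsub>F\<^esub> w)" for c
  proof -
    have "c \<odot>\<^bsub>F\<^esub> (a \<odot>\<^bsub>F\<^esub> v) = a \<odot>\<^bsub>F\<^esub> (c \<odot>\<^bsub>F\<^esub> v)" if "v \<in> carrier F" for a v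
      using F.smult_assoc1[of c a v] F.smult_assoc1[of a c v] that by (simp add: mult.commute)
    then show ?thesis unfolding linear_map_iff using Fv F.smult_r_distr[of c] by simp
  qed
  show img: "p ` carrier F = carrier Q"
    unfolding p_def Q_def yd_quotient_simps A_RCOSETS_def' by blast
  have zero: "p \<zero>\<^bsub>F\<^esub> = \<zero>\<^bsub>Q\<^esub>"
    unfolding p_def Q_def yd_quotient_simps by (rule F.a_coset_add_zero[OF R'(1)])
  have add: "p v \<oplus>\<^bsub>Q\<^esub> p w = p (v \<oplus>\<^bsub>F\<^esub> w)" if "v \<in> carrier F" "w \<in> carrier F" for v w
    unfolding p_def Q_def yd_quotient_simps using R.a_rcos_sum that by simp
  have smult: "c \<odot>\<^bsub>Q\<^esub> p v = p (c \<odot>\<^bsub>F\<^esub> v)" if "v \<in> carrier F" for c v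
    unfolding Q_def yd_quotient_simps by (rule lift[OF scal R'(4) that])
  show act: "act Q g (p v) = p (act F g v)" if "g \<in> carrier G" "v \<in> carrier F" for g v
    unfolding Q_def yd_quotient_simps by (rule lift[OF F.act_linear[OF that(1)] R'(5)[OF that(1)] that(2)])
  show coact: "coact Q (p v) g = p (coact F v g)" if "g \<in> carrier G" "v \<in> carrier F" for g v
    unfolding Q_def yd_quotient_simps by (rule lift[OF F.coact_linear[OF that(1)] R'(6)[OF that(1)] that(2)])
  show "yd_module G Q" "linear_map class_ring F Q p"
    by (rule yd_module_image[OF F img zero add smult act coact]; assumption)+
  show "p v = \<zero>\<^bsub>Q\<^esub> \<longleftrightarrow> v \<in> R" if v: "v \<in> carrier F" for v
  proof
    assume "p v = \<zero>\<^bsub>Q\<^esub>"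
    moreover have "\<zero>\<^bsub>F\<^esub> \<oplus>\<^bsub>F\<^esub> v \<in> p v" unfolding p_def a_r_coset_def' using R'(2) by blast
    ultimately show "v \<in> R" using v unfolding Q_def by simp
  next
    assume "v \<in> R"
    then show "p v = \<zero>\<^bsub>Q\<^esub>" unfolding p_def Q_def yd_quotient_simps by (rule R.a_rcos_const)
  qed
qed

section \<open>Induced Yetter-Drinfeld modules\<close>

lemma group_tensor_simps [simp]:
  "carrier (group_tensor G V c) = carrier G \<rightarrow>\<^sub>E carrier V"
  "zero (group_tensor G V c) = (\<lambda>x\<in>carrier G. \<zero>\<^bsub>V\<^esub>)"
  "add (group_tensor G V c) f f' = (\<lambda>x\<in>carrier G. f x \<oplus>\<^bsub>V\<^esub> f' x)"
  "smult (group_tensor G V c) a f = (\<lambda>x\<in>carrier G. a \<odot>\<^bsub>V\<^esub> f x)"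
  "act (group_tensor G V c) g f = (\<lambda>x\<in>carrier G. f (inv\<^bsub>G\<^esub> g \<otimes>\<^bsub>G\<^esub> x))"
  "coact (group_tensor G V c) f y = (\<lambda>x\<in>carrier G. if x \<otimes>\<^bsub>G\<^esub> c \<otimes>\<^bsub>G\<^esub> inv\<^bsub>G\<^esub> x = y then f x else \<zero>\<^bsub>V\<^esub>)"
  by (simp_all add: group_tensor_def)

lemma (in abelian_group) minus_zero_eq: "x \<in> carrier G \<Longrightarrow> y \<in> carrier G \<Longrightarrow> x \<ominus> y = \<zero> \<Longrightarrow> x = y"
  using minus_equality[of x "\<ominus> y"] by (simp add: minus_eq)

text \<open>A module \<open>V\<close> over a subgroup \<open>H\<close> of the centralizer of \<open>c\<close>.\<close>
locale induction_data = group G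
  for G :: "('g, 'm) monoid_scheme" (structure) +
  fixes H :: "'g set" and c :: 'g and V :: "('k :: field, 'g, 'v) kG_module"
  assumes finite_G: "finite (carrier G)" and H: "subgroup H G" and c: "c \<in> carrier G"
    and cent: "\<And>h. h \<in> H \<Longrightarrow> h \<otimes> c \<otimes> inv h = c"
    and V: "vectorspace class_ring V"
    and V_linear: "\<And>h. h \<in> H \<Longrightarrow> linear_map class_ring V V (act V h)"
    and V_one: "\<And>v. v \<in> carrier V \<Longrightarrow> act V \<one> v = v"
    and V_mult: "\<And>g h v. g \<in> H \<Longrightarrow> h \<in> H \<Longrightarrow> v \<in> carrier V \<Longrightarrow> act V (g \<otimes> h) v = act V g (act V h v)"
begin

abbreviation "F \<equiv> group_tensor G V c"
abbreviation "rels \<equiv> {pure_tensor G V (g \<otimes> h) v \<ominus>\<^bsub>F\<^esub> pure_tensor G V g (act V h v)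
       | g h v. g \<in> carrier G \<and> h \<in> H \<and> v \<in> carrier V}"
abbreviation "Rel \<equiv> balancing_relations G H V c"
abbreviation "Q \<equiv> induced G H V c"
abbreviation "pure \<equiv> pure_tensor G V"

sublocale V: vectorspace class_ring V by (fact V)

lemma act_V_closed: "h \<in> H \<Longrightarrow> v \<in> carrier V \<Longrightarrow> act V h v \<in> carrier V"
  using V_linear[of h] by (simp add: linear_map_iff)

lemma H_sub: "h \<in> H \<Longrightarrow> h \<in> carrier G"
  using subgroup.mem_carrier[OF H] .

lemma F_vectorspace: "vectorspace class_ring F"
proof (rule vs_criteria)
  show "\<forall>v\<in>carrier F. \<exists>w\<in>carrier F. v \<oplus>\<^bsub>F\<^esub> w = \<zero>\<^bsub>F\<^esub>"
  proof
    fix f assume f: "f \<in> carrier F"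
    then show "\<exists>w\<in>carrier F. f \<oplus>\<^bsub>F\<^esub> w = \<zero>\<^bsub>F\<^esub>"
      by (intro bexI[of _ "\<lambda>x\<in>carrier G. \<ominus>\<^bsub>V\<^esub> f x"]) (auto simp: fun_eq_iff PiE_iff V.r_neg)
  qed
qed (auto simp: class_field fun_eq_iff PiE_iff extensional_def restrict_def V.a_ac V.smult_r_distr
    intro: V.smult_l_distr[simplified] V.smult_assoc1[simplified] V.smult_one[simplified])

sublocale F: vectorspace class_ring F by (rule F_vectorspace)

lemma finsum_F:
  assumes "\<phi> \<in> A \<rightarrow> carrier F" "x \<in> carrier G"
  shows "(\<Oplus>\<^bsub>F\<^esub>y\<in>A. \<phi> y) x = (\<Oplus>\<^bsub>V\<^esub>y\<in>A. \<phi> y x)"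
  using assms(1)
proof (induction A rule: infinite_finite_induct)
  case (insert y A)
  then have 1: "\<phi> \<in> A \<rightarrow> carrier F" "\<phi> y \<in> carrier F" by auto
  have 2: "(\<lambda>y. \<phi> y x) \<in> A \<rightarrow> carrier V" "\<phi> y x \<in> carrier V"
    using 1 assms(2) by (auto simp: PiE_iff Pi_iff)
  have "(\<Oplus>\<^bsub>F\<^esub>y\<in>insert y A. \<phi> y) x = (\<phi> y \<oplus>\<^bsub>F\<^esub> (\<Oplus>\<^bsub>F\<^esub>y\<in>A. \<phi> y)) x"
    using insert 1 by (subst F.finsum_insert) auto
  also have "\<dots> = \<phi> y x \<oplus>\<^bsub>V\<^esub> (\<Oplus>\<^bsub>V\<^esub>y\<in>A. \<phi> y x)" using assms(2) insert.IH[OF 1(1)] by simp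
  also have "\<dots> = (\<Oplus>\<^bsub>V\<^esub>y\<in>insert y A. \<phi> y x)" using insert 2 by (subst V.finsum_insert) auto
  finally show ?case .
qed (use assms(2) in simp_all)

lemma F_ext: "f \<in> carrier F \<Longrightarrow> f' \<in> carrier F \<Longrightarrow> (\<And>x. x \<in> carrier G \<Longrightarrow> f x = f' x) \<Longrightarrow> f = f'"
  by (auto simp: PiE_iff intro: extensionalityI)

lemma F_yd: "yd_module G F"
proof -
  have V0: "\<zero>\<^bsub>V\<^esub> \<in> carrier V" by simp
  have act_lin: "linear_map class_ring F F (act F g)" if g: "g \<in> carrier G" for g
    unfolding linear_map_iff using g F_vectorspace
    by (auto simp: PiE_iff fun_eq_iff restrict_def extensional_def)
  have coact_lin: "linear_map class_ring F F (\<lambda>f. coact F f g)" if g: "g \<in> carrier G" for g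
    unfolding linear_map_iff using g F_vectorspace V.smult_r_null
    by (auto simp: PiE_iff fun_eq_iff restrict_def extensional_def)
  have conj: "x \<otimes> c \<otimes> inv x = g \<otimes> h \<otimes> inv g \<longleftrightarrow> (inv g \<otimes> x) \<otimes> c \<otimes> inv (inv g \<otimes> x) = h"
    if "x \<in> carrier G" "g \<in> carrier G" "h \<in> carrier G" for x g h
  proof -
    have "(inv g \<otimes> x) \<otimes> c \<otimes> inv (inv g \<otimes> x) = inv g \<otimes> (x \<otimes> c \<otimes> inv x) \<otimes> g"
      using that c by (simp add: inv_mult_group m_assoc)
    moreover have "inv g \<otimes> y \<otimes> g = h \<longleftrightarrow> y = g \<otimes> h \<otimes> inv g" if y: "y \<in> carrier G" for y
    proof
      assume "inv g \<otimes> y \<otimes> g = h"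
      then have "g \<otimes> h \<otimes> inv g = g \<otimes> (inv g \<otimes> y \<otimes> g) \<otimes> inv g" by simp
      also have "\<dots> = (g \<otimes> inv g) \<otimes> y \<otimes> (g \<otimes> inv g)" using y \<open>g \<in> carrier G\<close> by (simp only: m_assoc m_closed inv_closed)
      finally show "y = g \<otimes> h \<otimes> inv g" using y \<open>g \<in> carrier G\<close> by simp
    next
      assume "y = g \<otimes> h \<otimes> inv g"
      then have "inv g \<otimes> y \<otimes> g = (inv g \<otimes> g) \<otimes> h \<otimes> (inv g \<otimes> g)"
        using \<open>g \<in> carrier G\<close> \<open>h \<in> carrier G\<close> by (simp only: m_assoc m_closed inv_closed)
      then show "inv g \<otimes> y \<otimes> g = h" using \<open>g \<in> carrier G\<close> \<open>h \<in> carrier G\<close> by simp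
    qed
    ultimately show ?thesis using that c by auto
  qed
  show ?thesis
    unfolding yd_module_def yd_module_axioms_def kG_module_def kG_module_axioms_def
  proof (intro conjI allI impI)
    fix f assume f: "f \<in> carrier F"
    show "act F \<one> f = f" using f by (intro F_ext) (auto simp: PiE_iff)
    have co: "coact F f h \<in> carrier F" if "h \<in> carrier G" for h
      using coact_lin[OF that] f by (simp add: linear_map_iff)
    show "(\<Oplus>\<^bsub>F\<^esub>h\<in>carrier G. coact F f h) = f"
    proof (rule F_ext[OF _ f])
      show "(\<Oplus>\<^bsub>F\<^esub>h\<in>carrier G. coact F f h) \<in> carrier F" using co by (intro F.finsum_closed) blast
      fix x assume x: "x \<in> carrier G"
      have "(\<Oplus>\<^bsub>F\<^esub>h\<in>carrier G. coact F f h) x = (\<Oplus>\<^bsub>V\<^esub>h\<in>carrier G. coact F f h x)"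
        by (rule finsum_F) (use co x in blast)+
      also have "\<dots> = (\<Oplus>\<^bsub>V\<^esub>h\<in>carrier G. if x \<otimes> c \<otimes> inv x = h then f x else \<zero>\<^bsub>V\<^esub>)"
        using x by simp
      also have "\<dots> = f x"
        by (rule V.add.finprod_singleton[where f="\<lambda>_. f x"]) (use x c f finite_G in \<open>auto simp: PiE_iff\<close>)
      finally show "(\<Oplus>\<^bsub>F\<^esub>h\<in>carrier G. coact F f h) x = f x" .
    qed
    fix g h assume gh: "g \<in> carrier G" "h \<in> carrier G"
    show "act F (g \<otimes> h) f = act F g (act F h f)"
      using gh by (auto simp: fun_eq_iff inv_mult_group m_assoc)
    show "coact F (coact F f g) h = (if h = g then coact F f g else \<zero>\<^bsub>F\<^esub>)"
      by (auto simp: fun_eq_iff)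
    show "coact F (act F g f) (g \<otimes> h \<otimes> inv g) = act F g (coact F f h)"
      using conj gh by (auto simp: fun_eq_iff)
  qed (use act_lin coact_lin finite_G F_vectorspace is_group in auto)
qed

lemma pure_carrier [simp]: "v \<in> carrier V \<Longrightarrow> pure g v \<in> carrier F"
  unfolding pure_tensor_def by auto

lemma pure_add: "v \<in> carrier V \<Longrightarrow> w \<in> carrier V \<Longrightarrow> pure g (v \<oplus>\<^bsub>V\<^esub> w) = pure g v \<oplus>\<^bsub>F\<^esub> pure g w"
  unfolding pure_tensor_def by (auto simp: fun_eq_iff)

lemma pure_smult: "v \<in> carrier V \<Longrightarrow> pure g (a \<odot>\<^bsub>V\<^esub> v) = a \<odot>\<^bsub>F\<^esub> pure g v"
  unfolding pure_tensor_def using V.smult_r_null by (auto simp: fun_eq_iff)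

lemma act_pure: "y \<in> carrier G \<Longrightarrow> g \<in> carrier G \<Longrightarrow> act F y (pure g v) = pure (y \<otimes> g) v"
  unfolding pure_tensor_def by (auto simp: fun_eq_iff inv_solve_left')

lemma coact_pure:
  "y \<in> carrier G \<Longrightarrow> g \<in> carrier G \<Longrightarrow> coact F (pure g v) y = (if g \<otimes> c \<otimes> inv g = y then pure g v else \<zero>\<^bsub>F\<^esub>)"
  unfolding pure_tensor_def by (auto simp: fun_eq_iff)

lemma rels_sub: "rels \<subseteq> carrier F"
  using act_V_closed by (auto simp del: group_tensor_simps intro!: F.minus_closed)

lemma Rel_span: "Rel = F.span rels"
  unfolding balancing_relations_def ..

text \<open>Both terms of a relation have the same degree, because \<open>H\<close> centralizes \<open>c\<close>.\<close>
lemma Rel_yd: "yd_submodule G F Rel"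
  unfolding Rel_span
proof (rule span_yd_submodule[OF F_yd rels_sub])
  interpret FY: yd_module G F by (rule F_yd)
  have rel_in: "pure (g \<otimes> h) v \<ominus>\<^bsub>F\<^esub> pure g (act V h v) \<in> F.span rels"
    if "g \<in> carrier G" "h \<in> H" "v \<in> carrier V" for g h v
    by (rule subsetD[OF F.in_own_span[OF rels_sub]]) (use that in blast)
  have lin_minus: "T (x \<ominus>\<^bsub>F\<^esub> y) = T x \<ominus>\<^bsub>F\<^esub> T y"
    if "linear_map class_ring F F T" "x \<in> carrier F" "y \<in> carrier F" for T x y
  proof -
    interpret T: linear_map class_ring F F T by (fact that(1))
    show ?thesis using T.T_minus that(2,3) by simp
  qed
  fix y x assume y: "y \<in> carrier G" and "x \<in> rels"
  then obtain g h v where x: "x = pure (g \<otimes> h) v \<ominus>\<^bsub>F\<^esub> pure g (act V h v)"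
    and g: "g \<in> carrier G" and h: "h \<in> H" and v: "v \<in> carrier V" by blast
  have hG: "h \<in> carrier G" using H_sub[OF h] .
  have hv: "act V h v \<in> carrier V" by (rule act_V_closed[OF h v])
  have "act F y x = act F y (pure (g \<otimes> h) v) \<ominus>\<^bsub>F\<^esub> act F y (pure g (act V h v))"
    unfolding x by (rule lin_minus[OF FY.act_linear[OF y] pure_carrier[OF v] pure_carrier[OF hv]])
  also have "\<dots> = pure ((y \<otimes> g) \<otimes> h) v \<ominus>\<^bsub>F\<^esub> pure (y \<otimes> g) (act V h v)"
    using act_pure[OF y, of "g \<otimes> h" v] act_pure[OF y g] g hG y by (simp only: m_closed m_assoc)
  finally show "act F y x \<in> F.span rels" using rel_in[of "y \<otimes> g" h v] g h v y by simp
  let ?d = "g \<otimes> c \<otimes> inv g"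
  have "(g \<otimes> h) \<otimes> c \<otimes> inv (g \<otimes> h) = g \<otimes> (h \<otimes> c \<otimes> inv h) \<otimes> inv g"
    using g hG c by (simp add: inv_mult_group m_assoc)
  then have d: "(g \<otimes> h) \<otimes> c \<otimes> inv (g \<otimes> h) = ?d" using cent[OF h] by simp
  have "coact F x y = coact F (pure (g \<otimes> h) v) y \<ominus>\<^bsub>F\<^esub> coact F (pure g (act V h v)) y"
    unfolding x by (rule lin_minus[OF FY.coact_linear[OF y] pure_carrier[OF v] pure_carrier[OF hv]])
  also have "\<dots> = (if ?d = y then pure (g \<otimes> h) v else \<zero>\<^bsub>F\<^esub>) \<ominus>\<^bsub>F\<^esub> (if ?d = y then pure g (act V h v) else \<zero>\<^bsub>F\<^esub>)"
    using coact_pure[OF y, of "g \<otimes> h" v] coact_pure[OF y g] g hG unfolding d by (simp only: m_closed)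
  also have "\<dots> = (if ?d = y then x else \<zero>\<^bsub>F\<^esub>)"
  proof (cases "?d = y")
    case False
    have "\<zero>\<^bsub>F\<^esub> \<ominus>\<^bsub>F\<^esub> \<zero>\<^bsub>F\<^esub> = \<zero>\<^bsub>F\<^esub>" unfolding F.minus_eq by (rule F.r_neg[OF F.zero_closed])
    then show ?thesis using False by (simp only: if_False)
  qed (simp only: x if_True simp_thms)
  finally show "coact F x y \<in> F.span rels" using rel_in[OF g h v] F.span_zero[of rels] x by (simp only: split: if_split) blast
qed

lemmas Q_yd = yd_quotient_yd[OF F_yd Rel_yd, folded induced_def]

abbreviation "proj \<equiv> \<lambda>f. Rel +>\<^bsub>F\<^esub> f"

text \<open>The class of \<open>1 \<otimes> v\<close>.\<close>
definition \<iota> :: "'v \<Rightarrow> ('g \<Rightarrow> 'v) set" where "\<iota> v = proj (pure \<one> v)"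

lemma iota_closed: "v \<in> carrier V \<Longrightarrow> \<iota> v \<in> carrier Q"
  unfolding \<iota>_def Q_yd(3)[symmetric] by (intro imageI pure_carrier)

lemma iota_linear: "linear_map class_ring V Q \<iota>"
proof -
  have "vectorspace class_ring Q" using Q_yd(2) by (simp add: linear_map_iff)
  moreover have "\<And>f f'. f \<in> carrier F \<Longrightarrow> f' \<in> carrier F \<Longrightarrow> proj (f \<oplus>\<^bsub>F\<^esub> f') = proj f \<oplus>\<^bsub>Q\<^esub> proj f'"
    "\<And>f a. f \<in> carrier F \<Longrightarrow> proj (a \<odot>\<^bsub>F\<^esub> f) = a \<odot>\<^bsub>Q\<^esub> proj f"
    using Q_yd(2) unfolding linear_map_iff by blast+
  ultimately show ?thesis
    unfolding linear_map_iff using V iota_closed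
    by (simp add: \<iota>_def pure_add pure_smult del: group_tensor_simps)
qed

lemma act_iota: "g \<in> carrier G \<Longrightarrow> v \<in> carrier V \<Longrightarrow> act Q g (\<iota> v) = proj (pure g v)"
  unfolding \<iota>_def by (subst Q_yd(4)) (simp_all add: act_pure del: group_tensor_simps)

lemma act_iota_H: "h \<in> H \<Longrightarrow> v \<in> carrier V \<Longrightarrow> act Q h (\<iota> v) = \<iota> (act V h v)"
proof -
  assume h: "h \<in> H" and v: "v \<in> carrier V"
  interpret P: linear_map class_ring F Q proj by (rule Q_yd(2))
  have hG: "h \<in> carrier G" by (rule H_sub[OF h])
  have pv: "pure h v \<in> carrier F" and phv: "pure \<one> (act V h v) \<in> carrier F"
    using v act_V_closed[OF h v] by (simp_all del: group_tensor_simps)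
  have "pure (\<one> \<otimes> h) v \<ominus>\<^bsub>F\<^esub> pure \<one> (act V h v) \<in> rels" using h v by blast
  then have "pure h v \<ominus>\<^bsub>F\<^esub> pure \<one> (act V h v) \<in> Rel"
    unfolding Rel_span using F.in_own_span[OF rels_sub] hG by auto
  then have "proj (pure h v \<ominus>\<^bsub>F\<^esub> pure \<one> (act V h v)) = \<zero>\<^bsub>Q\<^esub>"
    using Q_yd(6)[OF F.minus_closed[OF pv phv]] by blast
  moreover have "proj (pure h v \<ominus>\<^bsub>F\<^esub> pure \<one> (act V h v)) = proj (pure h v) \<ominus>\<^bsub>Q\<^esub> proj (pure \<one> (act V h v))"
    by (rule P.T_minus[OF pv phv])
  moreover have "proj (pure h v) \<in> carrier Q" "proj (pure \<one> (act V h v)) \<in> carrier Q"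
    unfolding Q_yd(3)[symmetric] by (rule imageI[OF pv], rule imageI[OF phv])
  moreover have "abelian_group Q" using Q_yd(2) by (simp add: linear_map_iff vectorspace_def Module.module_def del: group_tensor_simps)
  ultimately have "proj (pure h v) = proj (pure \<one> (act V h v))"
    using abelian_group.minus_zero_eq by metis
  then show ?thesis using act_iota[OF hG v] by (simp only: \<iota>_def)
qed

lemma coact_iota: "v \<in> carrier V \<Longrightarrow> coact Q (\<iota> v) c = \<iota> v"
  unfolding \<iota>_def using c by (subst Q_yd(5)) (simp_all add: coact_pure del: group_tensor_simps)

text \<open>The map \<open>f \<mapsto> \<Sum>\<^bsub>h\<in>H\<^esub> h f(h)\<close> kills the relations and maps \<open>1 \<otimes> v\<close> to \<open>v\<close>.\<close>
lemma iota_zero: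
  assumes v: "v \<in> carrier V" and 0: "\<iota> v = \<zero>\<^bsub>Q\<^esub>"
  shows "v = \<zero>\<^bsub>V\<^esub>"
proof -
  define \<theta> where "\<theta> f = (\<Oplus>\<^bsub>V\<^esub>h\<in>H. act V h (f h))" for f
  have finH: "finite H" using finite_subset[OF _ finite_G] H_sub by blast
  have lin: "act V h (x \<oplus>\<^bsub>V\<^esub> y) = act V h x \<oplus>\<^bsub>V\<^esub> act V h y" "act V h (a \<odot>\<^bsub>V\<^esub> x) = a \<odot>\<^bsub>V\<^esub> act V h x"
    if "h \<in> H" "x \<in> carrier V" "y \<in> carrier V" for h x y a
    using V_linear[OF that(1)] that(2,3) by (simp_all add: linear_map_iff)
  have act0: "act V h \<zero>\<^bsub>V\<^esub> = \<zero>\<^bsub>V\<^esub>" if "h \<in> H" for h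
    by (rule linear_map_zero[OF V_linear[OF that]])
  have fV: "f h \<in> carrier V" if "f \<in> carrier F" "h \<in> H" for f h
    using that H_sub by (auto simp: PiE_iff)
  have summands: "(\<lambda>h. act V h (f h)) \<in> H \<rightarrow> carrier V" if "f \<in> carrier F" for f
    using act_V_closed fV[OF that] by blast
  have \<theta>_lin: "linear_map class_ring F V \<theta>"
    unfolding linear_map_iff
  proof (intro conjI ballI allI)
    show "vectorspace class_ring F" by (rule F_vectorspace)
    show "vectorspace class_ring V" by (rule V)
    fix f assume f: "f \<in> carrier F"
    show "\<theta> f \<in> carrier V" unfolding \<theta>_def by (rule V.finsum_closed[OF summands[OF f]])
    show "\<theta> (f \<oplus>\<^bsub>F\<^esub> f') = \<theta> f \<oplus>\<^bsub>V\<^esub> \<theta> f'" if f': "f' \<in> carrier F" for f'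
    proof -
      have "\<theta> (f \<oplus>\<^bsub>F\<^esub> f') = (\<Oplus>\<^bsub>V\<^esub>h\<in>H. act V h (f h) \<oplus>\<^bsub>V\<^esub> act V h (f' h))"
        unfolding \<theta>_def
        using summands[OF f] summands[OF f'] fV[OF f] fV[OF f'] H_sub lin by (intro V.finsum_cong') (auto simp: Pi_iff)
      then show ?thesis unfolding \<theta>_def using V.finsum_addf[OF summands[OF f] summands[OF f']] by simp
    qed
    show "\<theta> (a \<odot>\<^bsub>F\<^esub> f) = a \<odot>\<^bsub>V\<^esub> \<theta> f" for a
    proof -
      have "\<theta> (a \<odot>\<^bsub>F\<^esub> f) = (\<Oplus>\<^bsub>V\<^esub>h\<in>H. a \<odot>\<^bsub>V\<^esub> act V h (f h))"
        unfolding \<theta>_def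
        using summands[OF f] fV[OF f] H_sub lin(2) by (intro V.finsum_cong') (auto simp: Pi_iff)
      then show ?thesis unfolding \<theta>_def using V.finsum_smult[of a "\<lambda>h. act V h (f h)" H] summands[OF f] by simp
    qed
  qed
  have \<theta>_pure: "\<theta> (pure x w) = (if x \<in> H then act V x w else \<zero>\<^bsub>V\<^esub>)" if w: "w \<in> carrier V" for x w
  proof (cases "x \<in> H")
    case True
    have "\<theta> (pure x w) = (\<Oplus>\<^bsub>V\<^esub>h\<in>H. if x = h then act V h w else \<zero>\<^bsub>V\<^esub>)"
      unfolding \<theta>_def
      using H_sub act0 act_V_closed w by (intro V.finsum_cong') (auto simp: pure_tensor_def)
    also have "\<dots> = act V x w"
      by (rule V.add.finprod_singleton[OF True finH]) (use act_V_closed w in blast)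
    finally show ?thesis using True by simp
  next
    case False
    have "\<theta> (pure x w) = (\<Oplus>\<^bsub>V\<^esub>h\<in>H. \<zero>\<^bsub>V\<^esub>)"
      unfolding \<theta>_def using H_sub act0 False by (intro V.finsum_cong') (auto simp: pure_tensor_def)
    then show ?thesis using False by simp
  qed
  interpret T: linear_map class_ring F V \<theta> by (rule \<theta>_lin)
  have rel0: "\<theta> x \<in> {\<zero>\<^bsub>V\<^esub>}" if "x \<in> rels" for x
  proof -
    obtain g h w where x: "x = pure (g \<otimes> h) w \<ominus>\<^bsub>F\<^esub> pure g (act V h w)"
      and g: "g \<in> carrier G" and h: "h \<in> H" and w: "w \<in> carrier V" using \<open>x \<in> rels\<close> by blast
    have hw: "act V h w \<in> carrier V" by (rule act_V_closed[OF h w])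
    have gH: "g \<otimes> h \<in> H \<longleftrightarrow> g \<in> H"
    proof
      assume "g \<otimes> h \<in> H"
      then have "g \<otimes> h \<otimes> inv h \<in> H" using subgroup.m_closed[OF H] subgroup.m_inv_closed[OF H h] by blast
      then show "g \<in> H" using g H_sub[OF h] by (simp add: m_assoc)
    qed (use subgroup.m_closed[OF H] h in blast)
    have "\<theta> x = \<theta> (pure (g \<otimes> h) w) \<ominus>\<^bsub>V\<^esub> \<theta> (pure g (act V h w))"
      unfolding x by (rule T.T_minus) (simp_all add: w hw del: group_tensor_simps)
    also have "\<theta> (pure (g \<otimes> h) w) = \<theta> (pure g (act V h w))"
      using V_mult[OF _ h w, of g] by (simp add: \<theta>_pure w hw gH)
    also have "\<theta> (pure g (act V h w)) \<ominus>\<^bsub>V\<^esub> \<theta> (pure g (act V h w)) = \<zero>\<^bsub>V\<^esub>"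
      using hw act_V_closed by (simp add: \<theta>_pure V.minus_eq V.r_neg)
    finally show ?thesis by simp
  qed
  have S0: "subspace class_ring {\<zero>\<^bsub>V\<^esub>} V" unfolding subspace_iff using V V.smult_r_null by simp
  have p: "pure \<one> v \<in> carrier F" by (rule pure_carrier[OF v])
  then have "pure \<one> v \<in> Rel" using Q_yd(6)[OF p] 0 unfolding \<iota>_def by simp
  then have "\<theta> (pure \<one> v) \<in> {\<zero>\<^bsub>V\<^esub>}"
    unfolding Rel_span using linear_map_span[OF \<theta>_lin rels_sub S0 rel0] by blast
  then show ?thesis using subgroup.one_closed[OF H] by (simp add: \<theta>_pure v V_one)
qed

text \<open>The translates of the image of \<open>V\<close> span the induced module.\<close>
lemma iota_generates:
  assumes w: "w \<in> carrier V"
    and gen: "\<And>W. subspace class_ring W V \<Longrightarrow> (\<And>h x. h \<in> H \<Longrightarrow> x \<in> W \<Longrightarrow> act V h x \<in> W) \<Longrightarrow> w \<in> W \<Longrightarrow> carrier V \<subseteq> W"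
  shows "generated G Q (\<iota> w)"
  unfolding generated_def
proof (intro allI impI)
  fix S assume S: "yd_submodule G Q S" "\<iota> w \<in> S"
  have S': "subspace class_ring S Q" "\<And>g x. g \<in> carrier G \<Longrightarrow> x \<in> S \<Longrightarrow> act Q g x \<in> S"
    using S(1) unfolding yd_submodule_def by blast+
  have S'': "\<zero>\<^bsub>Q\<^esub> \<in> S" "\<And>x y. x \<in> S \<Longrightarrow> y \<in> S \<Longrightarrow> x \<oplus>\<^bsub>Q\<^esub> y \<in> S" "\<And>a x. x \<in> S \<Longrightarrow> a \<odot>\<^bsub>Q\<^esub> x \<in> S"
    using S'(1) unfolding subspace_iff by blast+
  have lin: "\<And>x y. x \<in> carrier V \<Longrightarrow> y \<in> carrier V \<Longrightarrow> \<iota> (x \<oplus>\<^bsub>V\<^esub> y) = \<iota> x \<oplus>\<^bsub>Q\<^esub> \<iota> y"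
    "\<And>x a. x \<in> carrier V \<Longrightarrow> \<iota> (a \<odot>\<^bsub>V\<^esub> x) = a \<odot>\<^bsub>Q\<^esub> \<iota> x"
    using iota_linear unfolding linear_map_iff by blast+
  have "carrier V \<subseteq> {x \<in> carrier V. \<iota> x \<in> S}"
  proof (rule gen)
    show "subspace class_ring {x \<in> carrier V. \<iota> x \<in> S} V"
      unfolding subspace_iff using V S'' lin linear_map_zero[OF iota_linear] by simp
    show "act V h x \<in> {x \<in> carrier V. \<iota> x \<in> S}" if "h \<in> H" "x \<in> {x \<in> carrier V. \<iota> x \<in> S}" for h x
      using that act_V_closed S'(2)[OF H_sub[OF that(1)], of "\<iota> x"] act_iota_H by simp
    show "w \<in> {x \<in> carrier V. \<iota> x \<in> S}" using w S(2) by simp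
  qed
  then have pure_S: "proj (pure g x) \<in> S" if "g \<in> carrier G" "x \<in> carrier V" for g x
    using S'(2)[OF that(1), of "\<iota> x"] act_iota[OF that] that by auto
  interpret QY: yd_module G Q by (rule Q_yd(1))
  have "proj f \<in> S" if f: "f \<in> carrier F" for f
  proof -
    have fV: "f x \<in> carrier V" if "x \<in> carrier G" for x using f that by (auto simp: PiE_iff)
    have pc: "(\<lambda>y. pure y (f y)) \<in> carrier G \<rightarrow> carrier F" using fV pure_carrier by blast
    have "f = (\<Oplus>\<^bsub>F\<^esub>y\<in>carrier G. pure y (f y))"
    proof (rule F_ext[OF f F.finsum_closed[OF pc]])
      fix x assume x: "x \<in> carrier G"
      have "(\<Oplus>\<^bsub>F\<^esub>y\<in>carrier G. pure y (f y)) x = (\<Oplus>\<^bsub>V\<^esub>y\<in>carrier G. pure y (f y) x)"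
        by (rule finsum_F[OF pc x])
      also have "\<dots> = (\<Oplus>\<^bsub>V\<^esub>y\<in>carrier G. if x = y then f y else \<zero>\<^bsub>V\<^esub>)"
        using x fV by (intro V.finsum_cong') (auto simp: pure_tensor_def)
      also have "\<dots> = f x"
        by (rule V.add.finprod_singleton[OF x finite_G]) (use fV in blast)
      finally show "f x = (\<Oplus>\<^bsub>F\<^esub>y\<in>carrier G. pure y (f y)) x" by simp
    qed
    then have "proj f = proj (\<Oplus>\<^bsub>F\<^esub>y\<in>carrier G. pure y (f y))" by (rule arg_cong)
    also have "\<dots> = (\<Oplus>\<^bsub>Q\<^esub>y\<in>carrier G. proj (pure y (f y)))"
      by (rule linear_map_finsum[OF Q_yd(2) pc])
    also have "\<dots> \<in> S" by (rule QY.finsum_subspace_closed[OF S'(1)]) (use pure_S fV in blast)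
    finally show ?thesis .
  qed
  then show "carrier Q \<subseteq> S" unfolding Q_yd(3)[symmetric] by blast
qed

lemma Q_fin_dim: "w \<in> carrier V \<Longrightarrow> generated G Q (\<iota> w) \<Longrightarrow> vectorspace.fin_dim class_ring Q"
  by (rule generated_fin_dim[OF Q_yd(1) iota_closed c coact_iota])

end

section \<open>Labels of the induced modules\<close>

lemma klein_module_simps:
  "carrier (klein_module z c m :: ('k :: field, dih, 'k vec) kG_module) = carrier_vec 1"
  "add (klein_module z c m :: ('k, dih, 'k vec) kG_module) = (+)"
  "zero (klein_module z c m :: ('k, dih, 'k vec) kG_module) = 0\<^sub>v 1"
  "smult (klein_module z c m :: ('k, dih, 'k vec) kG_module) = (\<cdot>\<^sub>v)"
  by (simp_all add: klein_module_def Let_def module_vec_simps)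

lemma cyclic_module_simps:
  "carrier (cyclic_module l r j :: ('k :: field, dih, 'k vec) kG_module) = carrier_vec r"
  "add (cyclic_module l r j :: ('k, dih, 'k vec) kG_module) = (+)"
  "zero (cyclic_module l r j :: ('k, dih, 'k vec) kG_module) = 0\<^sub>v r"
  "smult (cyclic_module l r j :: ('k, dih, 'k vec) kG_module) = (\<cdot>\<^sub>v)"
  "act (cyclic_module l r j :: ('k, dih, 'k vec) kG_module) (i, e) v = (jordan_block r (l ^ j) ^\<^sub>m i) *\<^sub>v v"
  by (simp_all add: cyclic_module_def module_vec_simps)

lemma unit_vec_nonzero: "i < r \<Longrightarrow> unit_vec r i \<noteq> (0\<^sub>v r :: 'k :: zero_neq_one vec)"
proof
  assume "i < r" "unit_vec r i = (0\<^sub>v r :: 'k vec)"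
  then have "unit_vec r i $ i = (0\<^sub>v r :: 'k vec) $ i" by simp
  then show False using \<open>i < r\<close> by simp
qed

context dih_setup
begin

text \<open>
  The scalars by which the two generators of the Klein four group act on its \<open>m\<close>-th
  one-dimensional module.
\<close>
definition sgn1 :: "nat \<Rightarrow> 'k" where "sgn1 m = (if m = 1 \<or> m = 2 then 1 else - 1)"
definition sgn2 :: "nat \<Rightarrow> 'k" where "sgn2 m = (if m = 1 \<or> m = 3 then 1 else - 1)"

lemma klein_act:
  "act (klein_module (n div 2, False) (k, True) m) h v =
     (if h = (0, False) then 1 else if h = (n div 2, False) then sgn1 m
      else if h = (k, True) then sgn2 m else sgn1 m * sgn2 m :: 'k) \<cdot>\<^sub>v v"
  by (simp add: klein_module_def Let_def sgn1_def sgn2_def)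

lemma klein_group:
  assumes k: "k \<le> 1"
  shows "generate (dihedral n) {(k, True), (n div 2, False)} =
    {(0, False), (n div 2, False), (k, True), (k + n div 2, True)}" (is "?H = ?K")
proof
  have n2: "n = 2 * (n div 2)" and n1: "1 < n div 2" using half by simp_all
  define m where "m = n div 2"
  have n: "n = 2 * m" and m: "1 < m" using n2 n1 unfolding m_def by simp_all
  show "?H \<subseteq> ?K"
  proof
    fix x assume "x \<in> ?H"
    then show "x \<in> ?K"
    proof induction
      case (inv h)
      then show ?case using k m n dih_inverse[of k n True] dih_inverse[of m n False] by (auto simp: m_def[symmetric])
    next
      case (eng g h)
      have kk: "k = 0 \<or> k = 1" using k by auto
      show ?case using eng(3,4) kk m unfolding m_def[symmetric] unfolding n by (elim insertE emptyE disjE) (simp_all add: mod_if)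
    qed (use m_def in auto)
  qed
  have "(k, True) \<in> ?H" "(n div 2, False) \<in> ?H" "\<one>\<^bsub>dihedral n\<^esub> \<in> ?H"
    by (auto simp del: dih_one intro: generate.intros)
  moreover from generate.eng[OF this(2,1)] have "(k + n div 2, True) \<in> ?H"
    using k m n by (simp add: m_def[symmetric] add.commute)
  ultimately show "?K \<subseteq> ?H" by simp
qed

lemma cyclic_group: "generate (dihedral n) {(1, False)} = {(i, False) | i. i < n}" (is "?H = ?K")
proof
  show "?H \<subseteq> ?K"
  proof
    fix x assume "x \<in> ?H"
    then show "x \<in> ?K"
    proof induction
      case (inv h)
      then show ?case using n_pos dih_inverse[of 1 n False] by auto
    next
      case (eng g h)
      then show ?case using n_pos by auto
    qed (use n_pos in auto)
  qed
  interpret group "dihedral n" using dihedral_group n_pos by simp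
  have pow: "(1, False) [^]\<^bsub>dihedral n\<^esub> (k :: nat) \<in> ?H" for k
    by (induction k) (auto simp del: dih_one intro: generate.intros)
  show "?K \<subseteq> ?H"
  proof
    fix x assume "x \<in> ?K"
    then obtain i where i: "i < n" "x = (i, False)" by auto
    then have "x = (1, False) [^]\<^bsub>dihedral n\<^esub> i" using dihedral_pow_a[OF n_pos(2), of i] by simp
    then show "x \<in> ?H" using pow by simp
  qed
qed

lemma finite_dihedral: "finite (carrier (dihedral n))"
  by (simp add: dihedral_def)

lemma klein_induction:
  assumes k: "k \<le> 1"
  shows "induction_data (dihedral n) (generate (dihedral n) {(k, True), (n div 2, False)}) (k, True)
    (klein_module (n div 2, False) (k, True) m :: ('k, dih, 'k vec) kG_module)"
proof -
  let ?V = "klein_module (n div 2, False) (k, True) m :: ('k, dih, 'k vec) kG_module"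
  let ?H = "generate (dihedral n) {(k, True), (n div 2, False)}"
  interpret group "dihedral n" using dihedral_group n_pos by simp
  define j where "j = n div 2"
  have n: "n = 2 * j" and j: "1 < j" using half unfolding j_def by simp_all
  have kk: "k = 0 \<or> k = 1" using k by auto
  have V: "vectorspace class_ring ?V"
    by (rule vectorspace_cong[OF vec_vs[where n=1]]) (simp_all add: klein_module_simps module_vec_simps)
  show ?thesis
  proof (intro induction_data.intro induction_data_axioms.intro)
    show "group (dihedral n)" by (rule is_group)
    show "finite (carrier (dihedral n))" by (rule finite_dihedral)
    show "subgroup ?H (dihedral n)"
      by (rule generate_is_subgroup) (use kk half n_pos in auto)
    show kG: "(k, True) \<in> carrier (dihedral n)" using kk n_pos by auto
    have HG: "h \<in> carrier (dihedral n)" if "h \<in> ?H" for h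
      using generate_in_carrier[OF _ that] kG half by auto
    show "h \<otimes>\<^bsub>dihedral n\<^esub> (k, True) \<otimes>\<^bsub>dihedral n\<^esub> inv\<^bsub>dihedral n\<^esub> h = (k, True)" if "h \<in> ?H" for h
    proof -
      have "(k, True) \<otimes>\<^bsub>dihedral n\<^esub> h = h \<otimes>\<^bsub>dihedral n\<^esub> (k, True)"
        using that kk j unfolding klein_group[OF k] unfolding j_def[symmetric] unfolding n
        by (elim insertE emptyE disjE) (simp_all add: mod_if)
      then show ?thesis using inv_solve_right' HG[OF that] kG by (metis m_closed)
    qed
    show "vectorspace class_ring ?V" by (rule V)
    show "linear_map class_ring ?V ?V (act ?V h)" if "h \<in> ?H" for h
      unfolding linear_map_iff klein_act using V
      by (simp add: klein_module_simps smult_add_distrib_vec[of _ 1] smult_smult_assoc mult.commute)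
    show "act ?V \<one>\<^bsub>dihedral n\<^esub> v = v" if "v \<in> carrier ?V" for v by (simp add: klein_act)
    show "act ?V (g \<otimes>\<^bsub>dihedral n\<^esub> h) v = act ?V g (act ?V h v)" if "g \<in> ?H" "h \<in> ?H" "v \<in> carrier ?V" for g h v
      using that(1,2) kk j unfolding klein_group[OF k] klein_act smult_smult_assoc unfolding j_def[symmetric]
      unfolding n by (elim insertE emptyE disjE) (simp_all add: mod_if sgn1_def sgn2_def)
  qed
qed

lemma jordan_block_pow_mod:
  assumes "r \<le> q" "l ^ t = (1 :: 'k)"
  shows "jordan_block r l ^\<^sub>m (i mod n) = jordan_block r l ^\<^sub>m i"
proof -
  have J: "jordan_block r l \<in> carrier_mat r r" by simp
  have "jordan_block r l ^\<^sub>m (n * (i div n) + i mod n) = 1\<^sub>m r * jordan_block r l ^\<^sub>m (i mod n)"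
    unfolding pow_mat_add[OF J] pow_mat_mult[OF J, symmetric] jordan_block_pow_n[OF assms] one_mat_pow ..
  also have "\<dots> = jordan_block r l ^\<^sub>m (i mod n)" by (rule left_mult_one_mat[of _ r r]) simp
  finally show ?thesis by simp
qed

lemma cyclic_induction:
  assumes r: "r \<le> q" and l: "l < n"
  shows "induction_data (dihedral n) (generate (dihedral n) {(1, False)}) (l, False) (cyclic_module \<xi> r j)"
proof -
  let ?V = "cyclic_module \<xi> r j" and ?J = "jordan_block r (\<xi> ^ j)"
  let ?H = "generate (dihedral n) {(1, False)}"
  interpret group "dihedral n" using dihedral_group n_pos by simp
  have V: "vectorspace class_ring ?V"
    by (rule vectorspace_cong[OF vec_vs[where n=r]]) (simp_all add: cyclic_module_simps module_vec_simps)
  have J: "?J ^\<^sub>m i \<in> carrier_mat r r" for i by simp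
  show ?thesis
  proof (intro induction_data.intro induction_data_axioms.intro)
    show "group (dihedral n)" by (rule is_group)
    show "finite (carrier (dihedral n))" by (rule finite_dihedral)
    show "subgroup ?H (dihedral n)"
      by (rule generate_is_subgroup) (use n_pos in auto)
    show "(l, False) \<in> carrier (dihedral n)" using l by simp
    show "h \<otimes>\<^bsub>dihedral n\<^esub> (l, False) \<otimes>\<^bsub>dihedral n\<^esub> inv\<^bsub>dihedral n\<^esub> h = (l, False)" if h: "h \<in> ?H" for h
    proof -
      obtain i where "i < n" "h = (i, False)" using h unfolding cyclic_group by blast
      then show ?thesis using dih_conj_rotation[of i n l False] l by (simp del: dih_mult)
    qed
    show "vectorspace class_ring ?V" by (rule V)
    show "linear_map class_ring ?V ?V (act ?V h)" if "h \<in> ?H" for h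
      using V mult_add_distrib_mat_vec[OF J] mult_mat_vec[OF J] mult_mat_vec_carrier[OF J]
      unfolding linear_map_iff by (cases h) (simp add: cyclic_module_simps)
    show "act ?V \<one>\<^bsub>dihedral n\<^esub> v = v" if "v \<in> carrier ?V" for v using that by (simp add: cyclic_module_simps)
    show "act ?V (g \<otimes>\<^bsub>dihedral n\<^esub> h) v = act ?V g (act ?V h v)"
      if gh: "g \<in> ?H" "h \<in> ?H" and v: "v \<in> carrier ?V" for g h v
    proof -
      obtain a b where ab: "g = (a, False)" "h = (b, False)" using gh unfolding cyclic_group by auto
      have v': "v \<in> carrier_vec r" using v by (simp add: cyclic_module_simps)
      show ?thesis
        using assoc_mult_mat_vec[OF J J v', of a b]
        by (simp add: ab cyclic_module_simps jordan_block_pow_mod[OF r xi_pow_t] pow_mat_add[of ?J r])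
    qed
  qed
qed

fun induced_label :: "induced_index \<Rightarrow> 'k label" where
  "induced_label (DV m) = Klein (0, True) (sgn1 m) (sgn2 m)"
| "induced_label (DU m) = Klein (1, True) (sgn1 m) (sgn2 m)"
| "induced_label (DQ r j l) = Cyclic (l, False) (\<xi> ^ j) r"

lemma klein_label:
  fixes k m :: nat
  assumes k: "k \<le> 1"
  defines "M \<equiv> induced (dihedral n) (generate (dihedral n) {(k, True), (n div 2, False)})
       (klein_module (n div 2, False) (k, True) m) (k, True)"
  shows "yd_module (dihedral n) M" "vectorspace.fin_dim class_ring M"
    "has_label n M (Klein (k, True) (sgn1 m) (sgn2 m))"
proof -
  let ?H = "generate (dihedral n) {(k, True), (n div 2, False)}"
  let ?V = "klein_module (n div 2, False) (k, True) m :: ('k, dih, 'k vec) kG_module"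
  let ?e = "unit_vec 1 0 :: 'k vec"
  interpret I: induction_data "dihedral n" ?H "(k, True)" ?V by (rule klein_induction[OF k])
  have e: "?e \<in> carrier ?V" by (simp add: klein_module_simps)
  have gen: "generated (dihedral n) M (I.\<iota> ?e)"
    unfolding M_def
  proof (rule I.iota_generates[OF e])
    fix W assume W: "subspace class_ring W ?V" "?e \<in> W"
    have "subspace class_ring W (module_vec TYPE('k) 1)"
      using W(1) vec_vs[of 1] unfolding subspace_iff by (simp add: klein_module_simps module_vec_simps)
    from subspace_vec_UNIV[OF this] W(2) show "carrier ?V \<subseteq> W" by (simp add: klein_module_simps)
  qed
  show "yd_module (dihedral n) M" unfolding M_def by (rule I.Q_yd(1))
  show "vectorspace.fin_dim class_ring M" unfolding M_def by (rule I.Q_fin_dim[OF e gen[unfolded M_def]])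
  have sc: "I.\<iota> (c \<cdot>\<^sub>v ?e) = c \<odot>\<^bsub>M\<^esub> I.\<iota> ?e" for c
    using I.iota_linear e unfolding linear_map_iff M_def by (simp add: klein_module_simps)
  have H: "(n div 2, False) \<in> ?H" "(k, True) \<in> ?H" by (auto intro: generate.intros)
  have eig: "act ?V (n div 2, False) ?e = sgn1 m \<cdot>\<^sub>v ?e" "act ?V (k, True) ?e = sgn2 m \<cdot>\<^sub>v ?e"
    using half(3) by (simp_all add: klein_act)
  have "I.\<iota> ?e \<noteq> \<zero>\<^bsub>M\<^esub>"
    using I.iota_zero[OF e] unit_vec_nonzero[of 0 1] unfolding M_def by (auto simp: klein_module_simps)
  moreover have "act M (n div 2, False) (I.\<iota> ?e) = sgn1 m \<odot>\<^bsub>M\<^esub> I.\<iota> ?e"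
    using I.act_iota_H[OF H(1) e, folded M_def] by (simp only: eig sc)
  moreover have "act M (k, True) (I.\<iota> ?e) = sgn2 m \<odot>\<^bsub>M\<^esub> I.\<iota> ?e"
    using I.act_iota_H[OF H(2) e, folded M_def] by (simp only: eig sc)
  ultimately have "is_gen n M (Klein (k, True) (sgn1 m) (sgn2 m)) (I.\<iota> ?e)"
    using I.iota_closed[OF e, folded M_def] I.coact_iota[OF e, folded M_def] by (simp only: is_gen.simps simp_thms)
  then show "has_label n M (Klein (k, True) (sgn1 m) (sgn2 m))"
    using gen unfolding has_label_def by blast
qed

lemma cyclic_label:
  fixes r j l :: nat
  assumes r: "1 \<le> r" "r \<le> q" and l: "l < n"
  defines "M \<equiv> induced (dihedral n) (generate (dihedral n) {(1, False)}) (cyclic_module \<xi> r j) (l, False)"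
  shows "yd_module (dihedral n) M" "vectorspace.fin_dim class_ring M"
    "has_label n M (Cyclic (l, False) (\<xi> ^ j) r)"
proof -
  let ?H = "generate (dihedral n) {(1, False)}"
  let ?V = "cyclic_module \<xi> r j" and ?J = "jordan_block r (\<xi> ^ j)"
  let ?e = "unit_vec r (r - 1) :: 'k vec"
  interpret I: induction_data "dihedral n" ?H "(l, False)" ?V by (rule cyclic_induction[OF r(2) l])
  have e: "?e \<in> carrier ?V" by (simp add: cyclic_module_simps)
  have H: "(1, False) \<in> ?H" by (auto intro: generate.intros)
  have act: "act ?V (1, False) v = ?J *\<^sub>v v" if "v \<in> carrier_vec r" for v
    using that by (simp add: cyclic_module_simps)
  have gen: "generated (dihedral n) M (I.\<iota> ?e)"
    unfolding M_def
  proof (rule I.iota_generates[OF e])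
    fix W assume W: "subspace class_ring W ?V" "\<And>h x. h \<in> ?H \<Longrightarrow> x \<in> W \<Longrightarrow> act ?V h x \<in> W" "?e \<in> W"
    have W': "subspace class_ring W (module_vec TYPE('k) r)"
      using W(1) vec_vs[of r] unfolding subspace_iff by (simp add: cyclic_module_simps module_vec_simps)
    have Wc: "W \<subseteq> carrier_vec r" using W' unfolding subspace_iff by (simp add: module_vec_simps)
    have "?J *\<^sub>v x \<in> W" if "x \<in> W" for x
      using W(2)[OF H that] act[of x] Wc that by auto
    from jordan_block_cyclic[OF W' this W(3) r(1)] show "carrier ?V \<subseteq> W" by (simp add: cyclic_module_simps)
  qed
  show "yd_module (dihedral n) M" unfolding M_def by (rule I.Q_yd(1))
  show "vectorspace.fin_dim class_ring M" unfolding M_def by (rule I.Q_fin_dim[OF e gen[unfolded M_def]])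
  let ?u = "\<lambda>k. if k < r then unit_vec r (r - 1 - k) else 0\<^sub>v r :: 'k vec"
  have u: "?u k \<in> carrier_vec r" for k by simp
  have step: "?J *\<^sub>v ?u k = \<xi> ^ j \<cdot>\<^sub>v ?u k + ?u (Suc k)" if "k < r" for k
    using jordan_block_unit_vec[of "r - 1 - k" r "\<xi> ^ j"] that by (cases "Suc k = r") auto
  have lin: "I.\<iota> (x + y) = I.\<iota> x \<oplus>\<^bsub>M\<^esub> I.\<iota> y" "I.\<iota> (c \<cdot>\<^sub>v x) = c \<odot>\<^bsub>M\<^esub> I.\<iota> x"
    if "x \<in> carrier_vec r" "y \<in> carrier_vec r" for x y c
    using I.iota_linear that unfolding linear_map_iff M_def by (simp_all add: cyclic_module_simps)
  have uc: "?u k \<in> carrier ?V" for k by (simp add: cyclic_module_simps)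
  define w where "w k = I.\<iota> (?u k)" for k
  have w_step: "act M (1, False) (w k) = \<xi> ^ j \<odot>\<^bsub>M\<^esub> w k \<oplus>\<^bsub>M\<^esub> w (Suc k)" if "k < r" for k
  proof -
    have "act M (1, False) (w k) = I.\<iota> (?J *\<^sub>v ?u k)"
      using I.act_iota_H[OF H uc[of k], folded M_def] unfolding w_def act[OF u] .
    also have "\<dots> = I.\<iota> (\<xi> ^ j \<cdot>\<^sub>v ?u k) \<oplus>\<^bsub>M\<^esub> w (Suc k)"
      unfolding step[OF that] w_def by (rule lin(1)) (simp_all add: u)
    finally show ?thesis unfolding lin(2)[OF u u] w_def .
  qed
  have w_closed: "w k \<in> carrier M" for k unfolding w_def using I.iota_closed[OF uc[of k], folded M_def] .
  have w_end: "w r = \<zero>\<^bsub>M\<^esub>"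
    using linear_map_zero[OF I.iota_linear, folded M_def] by (simp add: w_def cyclic_module_simps)
  have w_last: "w (r - 1) \<noteq> \<zero>\<^bsub>M\<^esub>"
    using I.iota_zero[OF uc[of "r - 1"], folded M_def] unit_vec_nonzero[of 0 r] r
    unfolding w_def by (auto simp: cyclic_module_simps)
  have w_start: "w 0 = I.\<iota> ?e" using r by (simp add: w_def)
  have "jordan_chain M (\<xi> ^ j) r (I.\<iota> ?e)"
    unfolding jordan_chain_def using r(1) w_step w_closed w_end w_last w_start
    by (intro conjI exI[of _ w]) blast+
  then have "is_gen n M (Cyclic (l, False) (\<xi> ^ j) r) (I.\<iota> ?e)"
    using I.iota_closed[OF e, folded M_def] I.coact_iota[OF e, folded M_def] by (simp only: is_gen.simps simp_thms)
  then show "has_label n M (Cyclic (l, False) (\<xi> ^ j) r)"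
    using gen unfolding has_label_def by blast
qed

lemma induced_module_label:
  assumes y: "y \<in> induced_indices p s t n"
  defines "M \<equiv> induced_module n \<xi> y"
  shows "yd_module (dihedral n) M" "vectorspace.fin_dim class_ring M"
    "has_label n M (induced_label y)" "valid (induced_label y)"
proof -
  have "yd_module (dihedral n) M \<and> vectorspace.fin_dim class_ring M \<and> has_label n M (induced_label y) \<and>
    valid (induced_label y)"
  proof (cases y)
    case (DV m)
    then show ?thesis using klein_label[of 0 m] by (simp add: M_def sgn1_def sgn2_def)
  next
    case (DU m)
    then show ?thesis using klein_label[of 1 m] by (simp add: M_def sgn1_def sgn2_def)
  next
    case (DQ r j l)
    then have r: "1 \<le> r" "r \<le> q" and l: "1 \<le> l" "l \<le> n div 2 - 1"
      using y by (auto simp: induced_indices_def q_def)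
    have l': "l < n" "l < n div 2" using l half by linarith+
    show ?thesis using cyclic_label[OF r l'(1), of j] r l l' by (simp add: M_def DQ xi_pow_t)
  qed
  then show "yd_module (dihedral n) M" "vectorspace.fin_dim class_ring M"
    "has_label n M (induced_label y)" "valid (induced_label y)" by blast+
qed

end

section \<open>The list of indecomposable modules\<close>

context dih_setup
begin

lemma minus_one_neq: "(1 :: 'k) \<noteq> - 1" "(- 1 :: 'k) \<noteq> 1"
  using two_nonzero by (metis add.right_inverse one_add_one)+

lemma inverse_xi: "i \<le> t \<Longrightarrow> inverse (\<xi> ^ i) = \<xi> ^ (t - i)"
proof (rule inverse_unique)
  assume "i \<le> t"
  then show "\<xi> ^ i * \<xi> ^ (t - i) = 1" using xi_t by (simp add: power_add[symmetric])
qed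

lemma inverse_xi_neq:
  assumes "1 \<le> i" "i \<le> t div 2 - 1" "1 \<le> j" "j \<le> t div 2 - 1"
  shows "\<xi> ^ i \<noteq> inverse (\<xi> ^ j)"
proof
  assume "\<xi> ^ i = inverse (\<xi> ^ j)"
  moreover have "j \<le> t" "i < t" "t - j < t" "i \<noteq> t - j" using assms by linarith+
  ultimately show False using inverse_xi[of j] xi_pow_inj[of i "t - j"] by simp
qed

lemma matrix_label_inj:
  assumes z: "z \<in> central" "z' \<in> central" and x: "x \<in> dih_indices p s t" "x' \<in> dih_indices p s t"
    and eq: "matrix_label z' x' = matrix_label z x \<or> matrix_label z' x' = inverse_label n (matrix_label z x)"
  shows "z = z' \<and> x = x'"
proof (cases "\<exists>r i r' i'. x = W r i \<and> x' = W r' i'")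
  case True
  then obtain r i r' i' where W: "x = W r i" "x' = W r' i'" by blast
  have i: "1 \<le> i" "i \<le> t div 2 - 1" "1 \<le> i'" "i' \<le> t div 2 - 1" using x W by (auto simp: dih_indices_def)
  then have "i < t" "i' < t" by linarith+
  then show ?thesis using eq inverse_xi_neq[OF i(3,4,1,2)] xi_pow_inj[of i' i] by (auto simp: W)
next
  case False
  then show ?thesis using eq minus_one_neq by (cases x; cases x') auto
qed

lemma sgn_inj:
  assumes "1 \<le> m" "m \<le> 4" "1 \<le> m'" "m' \<le> 4" "sgn1 m = sgn1 m'" "sgn2 m = sgn2 m'"
  shows "m = m'"
proof -
  have "m = 1 \<or> m = 2 \<or> m = 3 \<or> m = 4" "m' = 1 \<or> m' = 2 \<or> m' = 3 \<or> m' = 4" using assms(1-4) by linarith+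
  then show ?thesis using assms(5,6) minus_one_neq unfolding sgn1_def sgn2_def by (elim disjE) simp_all
qed

lemma induced_label_inj:
  assumes y: "y \<in> induced_indices p s t n" "y' \<in> induced_indices p s t n"
    and eq: "induced_label y' = induced_label y \<or> induced_label y' = inverse_label n (induced_label y)"
  shows "y = y'"
proof (cases "\<exists>r j l r' j' l'. y = DQ r j l \<and> y' = DQ r' j' l'")
  case True
  then obtain r j l r' j' l' where D: "y = DQ r j l" "y' = DQ r' j' l'" by blast
  have b: "j < t" "j' < t" "1 \<le> l" "l \<le> n div 2 - 1" "1 \<le> l'" "l' \<le> n div 2 - 1"
    using y t_pos by (auto simp: D induced_indices_def)
  then have "l' \<noteq> n - l" "n - l < n" using half by linarith+
  then show ?thesis using eq xi_pow_inj[OF b(2,1)] by (auto simp: D)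
next
  case False
  then show ?thesis
    using eq y sgn_inj by (cases y; cases y') (auto simp: induced_indices_def simp del: One_nat_def)
qed

lemma matrix_label_neq_induced_label:
  assumes "z \<in> central" "y \<in> induced_indices p s t n"
  shows "induced_label y \<noteq> matrix_label z x" "induced_label y \<noteq> inverse_label n (matrix_label z x)"
proof -
  have l: "l \<noteq> 0 \<and> l \<noteq> n div 2 \<and> l \<noteq> n - n div 2" if "y = DQ r j l" for r j l
  proof -
    have "1 \<le> l" "l \<le> n div 2 - 1" using assms(2) that by (auto simp: induced_indices_def)
    then show ?thesis using half by linarith
  qed
  have "induced_label y \<noteq> matrix_label z x \<and> induced_label y \<noteq> inverse_label n (matrix_label z x)"
  proof (cases y)
    case (DQ r j l)
    then show ?thesis using l[OF DQ] assms(1) half by (cases x) auto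
  qed (cases x; simp)+
  then show "induced_label y \<noteq> matrix_label z x" "induced_label y \<noteq> inverse_label n (matrix_label z x)"
    by blast+
qed

text \<open>
  The exponent of \<open>\<xi>\<close> in \<open>l\<close> is neither \<open>0\<close> nor \<open>t/2\<close>; if it exceeds \<open>t/2\<close>, the exponent in the
  inverse label is smaller than \<open>t/2\<close>.
\<close>
lemma matrix_label_surj:
  assumes X: "valid (Cyclic z l r)" and z: "z \<in> central"
  shows "\<exists>x\<in>dih_indices p s t. matrix_label z x = Cyclic z l r \<or> matrix_label z x = inverse_label n (Cyclic z l r)"
proof -
  have r: "1 \<le> r" "r \<le> p ^ s" using X by (simp_all add: q_def)
  have l2: "l\<^sup>2 \<noteq> 1" and "l ^ t = 1" using X z by auto
  then obtain j where j: "j < t" "l = \<xi> ^ j" using roots_of_unity by blast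
  have "j \<noteq> 0" using l2 j(2) by (cases j) auto
  moreover have "j \<noteq> t div 2" using l2 xi_half unfolding j(2) by auto
  ultimately consider "1 \<le> j" "j \<le> t div 2 - 1" | "1 \<le> t - j" "t - j \<le> t div 2 - 1"
    using j(1) even_t by fastforce
  then show ?thesis
  proof cases
    case 1
    then show ?thesis using r j by (intro bexI[of _ "W r j"]) (auto simp: dih_indices_def)
  next
    case 2
    have "((n - fst z) mod n, snd z) = z" using z half by auto
    then show ?thesis using 2 r j inverse_xi[of j] by (intro bexI[of _ "W r (t - j)"]) (auto simp: dih_indices_def)
  qed
qed

text \<open>
  If the exponent of \<open>a\<close> in the degree exceeds \<open>n/2\<close>, the one in the inverse label is smaller than
  \<open>n/2\<close>.
\<close>
lemma induced_label_surj:
  assumes X: "valid (Cyclic z l r)" and z: "z \<notin> central"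
  shows "\<exists>y\<in>induced_indices p s t n. induced_label y = Cyclic z l r \<or> induced_label y = inverse_label n (Cyclic z l r)"
proof -
  have r: "1 \<le> r" "r \<le> p ^ s" using X by (simp_all add: q_def)
  obtain m where m: "m < n" "z = (m, False)" using X by auto
  have lt: "l ^ t = 1" using X by auto
  then have "inverse l ^ t = 1" by (simp add: power_inverse)
  then obtain j j' where j: "j < t" "l = \<xi> ^ j" "j' < t" "inverse l = \<xi> ^ j'" using roots_of_unity lt by metis
  have "m \<noteq> 0" "m \<noteq> n div 2" using z m by auto
  then consider "1 \<le> m" "m \<le> n div 2 - 1" | "1 \<le> n - m" "n - m \<le> n div 2 - 1" "(n - m) mod n = n - m"
    using m(1) half by fastforce
  then show ?thesis
  proof cases
    case 1
    then show ?thesis using r j by (intro bexI[of _ "DQ r j m"]) (auto simp: induced_indices_def m(2))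
  next
    case 2
    then show ?thesis using r j(3) by (intro bexI[of _ "DQ r j' (n - m)"]) (auto simp: induced_indices_def m(2) j(4))
  qed
qed

lemma label_listed:
  assumes X: "valid X"
  shows "(\<exists>z\<in>central. \<exists>x\<in>dih_indices p s t. matrix_label z x = X \<or> matrix_label z x = inverse_label n X) \<or>
    (\<exists>y\<in>induced_indices p s t n. induced_label y = X \<or> induced_label y = inverse_label n X)"
proof (cases X)
  case (Central g l \<epsilon> r)
  have r: "1 \<le> r" "r \<le> p ^ s" using X by (simp_all add: q_def Central)
  have g: "g \<in> central" and "l = 1 \<or> l = - 1" "\<epsilon> = 1 \<or> \<epsilon> = - 1"
    using X by (simp_all add: Central power2_eq_1_iff)
  moreover have "matrix_label g (V0 r) = Central g 1 1 r" "matrix_label g (V0' r) = Central g 1 (- 1) r"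
    "matrix_label g (Vh r) = Central g (- 1) (- 1) r" "matrix_label g (Vh' r) = Central g (- 1) 1 r"
    by simp_all
  moreover have "{V0 r, V0' r, Vh r, Vh' r} \<subseteq> dih_indices p s t" using r by (auto simp: dih_indices_def)
  ultimately have "\<exists>x\<in>dih_indices p s t. matrix_label g x = X" unfolding Central by (metis insert_subset)
  then show ?thesis using g by blast
next
  case (Cyclic z l r)
  then show ?thesis using matrix_label_surj[of z l r] induced_label_surj[of z l r] X by blast
next
  case (Klein g \<alpha> \<beta>)
  have "g = (0, True) \<or> g = (1, True)" "\<alpha> = 1 \<or> \<alpha> = - 1" "\<beta> = 1 \<or> \<beta> = - 1"
    using X by (simp_all add: Klein power2_eq_1_iff)
  moreover have "\<exists>m. 1 \<le> m \<and> m \<le> 4 \<and> sgn1 m = \<alpha> \<and> sgn2 m = \<beta>"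
    using calculation(2,3)
  proof (elim disjE)
    show ?thesis if "\<alpha> = 1" "\<beta> = 1" by (rule exI[of _ 1]) (simp add: that sgn1_def sgn2_def)
    show ?thesis if "\<alpha> = 1" "\<beta> = - 1" by (rule exI[of _ 2]) (simp add: that sgn1_def sgn2_def)
    show ?thesis if "\<alpha> = - 1" "\<beta> = 1" by (rule exI[of _ 3]) (simp add: that sgn1_def sgn2_def)
    show ?thesis if "\<alpha> = - 1" "\<beta> = - 1" by (rule exI[of _ 4]) (simp add: that sgn1_def sgn2_def)
  qed
  then obtain m where m: "1 \<le> m" "m \<le> 4" "sgn1 m = \<alpha>" "sgn2 m = \<beta>" by blast
  have "DV m \<in> induced_indices p s t n" "DU m \<in> induced_indices p s t n"
    using m(1,2) by (auto simp: induced_indices_def)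
  moreover have "induced_label (DV m) = Klein (0, True) \<alpha> \<beta>" "induced_label (DU m) = Klein (1, True) \<alpha> \<beta>"
    by (simp_all only: induced_label.simps m(3,4))
  ultimately have "\<exists>y\<in>induced_indices p s t n. induced_label y = X" unfolding Klein by metis
  then show ?thesis by blast
qed

lemma isomorphic_labels:
  fixes M :: "('k, dih, 'v, 'd) yd_module_scheme" and N :: "('k, dih, 'w, 'e) yd_module_scheme"
  assumes M: "yd_module (dihedral n) M" "has_label n M X" "valid X"
    and N: "yd_module (dihedral n) N" "vectorspace.fin_dim class_ring N" "has_label n N Y" "valid Y"
    and iso: "yd_isomorphic (dihedral n) M N"
  shows "Y = X \<or> Y = inverse_label n X"
  by (rule label_unique[OF N(1,2) M(3) has_label_iso[OF n_pos(2) M(1) N(1) iso M(2) degree_carrier[OF M(3)]] N(4,3)])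

lemma inverse_label_holds:
  fixes M :: "('k, dih, 'v, 'd) yd_module_scheme"
  assumes "yd_module (dihedral n) M" "vectorspace.fin_dim class_ring M" "valid X" "has_label n M X"
  shows "has_label n M (inverse_label n X)" "valid (inverse_label n X)"
proof -
  have "has_label n M (inverse_label n X) \<and> valid (inverse_label n X)"
  proof (cases X)
    case (Cyclic g l r)
    then obtain m where "g = (m, False)" using assms(3) by auto
    then show ?thesis using label_inverse[OF assms(1,2), of m l r] assms(3,4) by (simp add: Cyclic)
  qed (use assms in simp_all)
  then show "has_label n M (inverse_label n X)" "valid (inverse_label n X)" by blast+
qed

end

theorem theorem4p2:
  fixes \<xi> :: "'k :: alg_closed_field" and p s t n :: nat
  assumes "CHAR('k) = p" and "odd p"
    and "s \<ge> 1" and "\<not> p dvd t" and "n = p ^ s * t" and "even n"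
    and "primitive_root_of_unity t \<xi>"
  shows
    "(\<comment> \<open>the listed Yetter-Drinfeld modules are indecomposable\<close>
      (\<forall>z \<in> {(0, False), (n div 2, False)}. \<forall>x \<in> dih_indices p s t.
        fd_indecomposable_yd (dihedral n) (with_degree (dih_module t \<xi> x) z)) \<and>
      (\<forall>y \<in> induced_indices p s t n.
        fd_indecomposable_yd (dihedral n) (induced_module n \<xi> y))) \<and>
     (\<comment> \<open>they are pairwise non-isomorphic\<close>
      (\<forall>z \<in> {(0, False), (n div 2, False)}. \<forall>z' \<in> {(0, False), (n div 2, False)}.
        \<forall>x \<in> dih_indices p s t. \<forall>x' \<in> dih_indices p s t. (z, x) \<noteq> (z', x') \<longrightarrow>
        \<not> yd_isomorphic (dihedral n) (with_degree (dih_module t \<xi> x) z)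
             (with_degree (dih_module t \<xi> x') z')) \<and>
      (\<forall>y \<in> induced_indices p s t n. \<forall>y' \<in> induced_indices p s t n. y \<noteq> y' \<longrightarrow>
        \<not> yd_isomorphic (dihedral n) (induced_module n \<xi> y) (induced_module n \<xi> y')) \<and>
      (\<forall>z \<in> {(0, False), (n div 2, False)}. \<forall>x \<in> dih_indices p s t.
        \<forall>y \<in> induced_indices p s t n.
        \<not> yd_isomorphic (dihedral n) (with_degree (dih_module t \<xi> x) z) (induced_module n \<xi> y))) \<and>
     (\<comment> \<open>every finite dimensional indecomposable Yetter-Drinfeld module is isomorphic to one of them\<close>
      \<forall>M :: ('k, dih, 'v) yd_module. fd_indecomposable_yd (dihedral n) M \<longrightarrow>
       (\<exists>z \<in> {(0, False), (n div 2, False)}. \<exists>x \<in> dih_indices p s t.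
          yd_isomorphic (dihedral n) M (with_degree (dih_module t \<xi> x) z)) \<or>
       (\<exists>y \<in> induced_indices p s t n.
          yd_isomorphic (dihedral n) M (induced_module n \<xi> y)))"
proof -
  interpret dih_setup p s t n \<xi> by (rule dih_setup.intro) (fact assms)+
  note mat = dih_module_label and ind = induced_module_label
  show ?thesis
  proof (intro conjI ballI allI impI)
    fix z x assume z: "z \<in> central" and x: "x \<in> dih_indices p s t"
    note zx = mat[OF z x]
    show "fd_indecomposable_yd (dihedral n) (with_degree (dih_module t \<xi> x) z)"
      by (rule label_indecomposable[OF zx(1,2,4,3)])
    show "\<not> yd_isomorphic (dihedral n) (with_degree (dih_module t \<xi> x) z) (with_degree (dih_module t \<xi> x') z')"
      if z': "z' \<in> central" and x': "x' \<in> dih_indices p s t" and ne: "(z, x) \<noteq> (z', x')" for z' x'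
    proof
      assume "yd_isomorphic (dihedral n) (with_degree (dih_module t \<xi> x) z) (with_degree (dih_module t \<xi> x') z')"
      from isomorphic_labels[OF zx(1,3,4) mat[OF z' x'] this] matrix_label_inj[OF z z' x x'] ne
      show False by blast
    qed
    show "\<not> yd_isomorphic (dihedral n) (with_degree (dih_module t \<xi> x) z) (induced_module n \<xi> y)"
      if y: "y \<in> induced_indices p s t n" for y
    proof
      assume "yd_isomorphic (dihedral n) (with_degree (dih_module t \<xi> x) z) (induced_module n \<xi> y)"
      from isomorphic_labels[OF zx(1,3,4) ind[OF y] this] matrix_label_neq_induced_label[OF z y, of x]
      show False by blast
    qed
  next
    fix y assume y: "y \<in> induced_indices p s t n"
    note yy = ind[OF y]
    show "fd_indecomposable_yd (dihedral n) (induced_module n \<xi> y)"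
      by (rule label_indecomposable[OF yy(1,2,4,3)])
    show "\<not> yd_isomorphic (dihedral n) (induced_module n \<xi> y) (induced_module n \<xi> y')"
      if y': "y' \<in> induced_indices p s t n" and ne: "y \<noteq> y'" for y'
    proof
      assume "yd_isomorphic (dihedral n) (induced_module n \<xi> y) (induced_module n \<xi> y')"
      from isomorphic_labels[OF yy(1,3,4) ind[OF y'] this] induced_label_inj[OF y y'] ne
      show False by blast
    qed
  next
    fix M :: "('k, dih, 'v) yd_module"
    assume M: "fd_indecomposable_yd (dihedral n) M"
    have M': "yd_module (dihedral n) M" "vectorspace.fin_dim class_ring M"
      using M unfolding fd_indecomposable_yd_def by auto
    obtain X where X: "valid X" "has_label n M X" using label_exists[OF M] .
    note X' = inverse_label_holds[OF M' X]
    have holds: "valid Y \<and> has_label n M Y" if "Y = X \<or> Y = inverse_label n X" for Y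
      using that X X' by blast
    from label_listed[OF X(1)] consider
        (matrix) z x where "z \<in> central" "x \<in> dih_indices p s t"
          "matrix_label z x = X \<or> matrix_label z x = inverse_label n X"
      | (induced) y where "y \<in> induced_indices p s t n"
          "induced_label y = X \<or> induced_label y = inverse_label n X"
      by blast
    then show "(\<exists>z\<in>central. \<exists>x\<in>dih_indices p s t. yd_isomorphic (dihedral n) M (with_degree (dih_module t \<xi> x) z)) \<or>
      (\<exists>y\<in>induced_indices p s t n. yd_isomorphic (dihedral n) M (induced_module n \<xi> y))"
    proof cases
      case (matrix z x)
      then have "yd_isomorphic (dihedral n) M (with_degree (dih_module t \<xi> x) z)"
        using label_isomorphic[OF M' mat(1,2)[OF matrix(1,2)] _ _ mat(3)[OF matrix(1,2)]] holds by blast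
      then show ?thesis using matrix by blast
    next
      case (induced y)
      then have "yd_isomorphic (dihedral n) M (induced_module n \<xi> y)"
        using label_isomorphic[OF M' ind(1,2)[OF induced(1)] _ _ ind(3)[OF induced(1)]] holds by blast
      then show ?thesis using induced by blast
    qed
  qed
qed

end
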